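(* Let $G(u)=e^{-A}u=v(1,\cdot)$, where $v$ solves $\frac{d}{dt}v+Av=0$, $v(0)=u$, with $A=-\Delta$ on $\mathbb{T}^{n}$ with periodic boundary conditions, and let $\ell(G(u))=(G(u)(x_{1}),\dots,G(u)(x_{K}))^{T}$ for fixed points $x_{1},\dots,x_{K}\in\mathbb{T}^{n}$. Consider the inverse problem of finding $u$ from noisy observations $$y=\ell(G(u))+\eta,$$ where $\eta\in\mathbb{R}^{K}$ is mean zero Gaussian with covariance $\Gamma$. Let $\mu_{0}$ be a variable index Besov prior, i.e. a $(\delta,B^{s(\cdot)}_{q(\cdot)})$ measure, with $s\in C^{\log}_{loc}(\mathbb{T}^{n})\cap L^{\infty}(\mathbb{T}^{n})$, $q\in\mathcal{P}^{\log}(\mathbb{T}^{n})$, $\inf_{x\in\mathbb{T}^{n}}s(x)>\frac{n}{q^{+}}$ and $\delta>4$. Then the measure $\mu^{y}(du)$ is absolutely continuous with respect to $\mu_{0}$ with Radon–Nikodym derivative $$\frac{d\mu^{y}}{d\mu_{0}}(u)=\frac{1}{Z(y)}\exp(-\Phi(u;y)),$$ where $$\Phi(u;y)=\frac12|\Gamma^{-1/2}(y-\ell(G(u)))|^{2}-\frac12|\Gamma^{-1/2}y|^{2}$$ and $$Z(y)=\int_{B^{t(\cdot)}_{q(\cdot)}}\exp\left(-\frac12|\Gamma^{-1/2}(y-\ell(G(u)))|^{2}+\frac12|\Gamma^{-1/2}y|^{2}\right)\mu_{0}(du)$$ with $t\in C^{\log}_{loc}(\mathbb{T}^{n})\cap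 L^{\infty}(\mathbb{T}^{n})$ satisfying $\sup_{x\in\mathbb{T}^{n}}\left(t(x)-s(x)+\frac{n}{q^{+}}\right)<0$. Furthermore, the posterior measure is continuous in the Hellinger metric with respect to the data: $$d_{Hell}(\mu^{y},\mu^{y'})\le C|y-y'|,$$ where $C=C(r)$ with $\max\{|y|,|y'|\}\le r$.
   Context: $\mathbb{T}^{n}$ is the $n$-dimensional torus, $n\le3$; $A=-\Delta$ on $H=L^{2}(\mathbb{T}^{n})$ with domain $H^{2}(\mathbb{T}^{n})$. The noise $\eta$ is independent of $u\sim\mu_{0}$, and $\mu^{y}$ is the posterior measure, i.e. the conditional distribution of $u$ given $y$. The Hellinger metric is $d_{Hell}(\mu,\mu')=\sqrt{\frac12\int\left(\sqrt{\frac{d\mu}{d\nu}}-\sqrt{\frac{d\mu'}{d\nu}}\right)^{2}d\nu}$ for any reference measure $\nu$ with respect to which both are absolutely continuous. $\mathcal{P}$ is the set of measurable $q:\mathbb{T}^{n}\to[1,\infty)$; $q^{\pm}$ are the essential sup/inf. $g\in C^{\log}_{loc}(\mathbb{T}^{n})$ means $|g(x)-g(y)|\le c/\log(e+1/|x-y|)$ for all $x,y$ and some $c>0$; $g\in C^{\log}$ if moreover $|g(x)-g_\infty|\le c/\log(e+|x|)$ for some $g_\infty$. $\mathcal{P}^{\log}$: those $q\in\mathcal{P}$ with $1/q\in C^{\log}$ and $1\le q^{-}\le q^{+}<\infty$. The space $B^{t(\cdot)}_{q(\cdot)}$ consists of $u$ on $\mathbb{T}^{n}$ with finite norm $\left\|\left(\sum_{k\ge0}|2^{kt(x)}(\varphi_{k}\hat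 u)^{\vee}(x)|^{q(x)}\right)^{1/q(x)}\right\|_{L^{q(\cdot)}(\mathbb{T}^{n})}$, where $\{\varphi_{k}\}$ is a smooth dyadic resolution of unity and $\|f\|_{L^{q(\cdot)}}=\inf\{\lambda>0:\int|f(x)/\lambda|^{q(x)}dx\le1\}$. Wavelets: $\psi^{F},\psi^{M}$ are the scaling function and wavelet of an orthonormal Meyer system on $\mathbb{R}$, or of a Daubechies system of sufficiently high regularity for the wavelet characterization of the spaces involved. $G^{0}=\{F,M\}^{n}$; for $j\ge1$, $G^{j}$ is the set of $G\in\{F,M\}^{n}$ with at least one entry $M$; $\mathbb{M}_{j}=\{0,\dots,2^{j}-1\}^{n}$; $\tilde\Psi^{j}_{Gm}(x)=\prod_{r=1}^{n}\sum_{\ell\in\mathbb{Z}}2^{j/2}\psi^{G_{r}}(2^{j}(x_{r}+\ell)-m_{r})$. A $(\delta,B^{s(\cdot)}_{q(\cdot)})$ measure is the law of $u=\sum_{j\ge0}\sum_{G\in G^{j}}\sum_{m\in\mathbb{M}_{j}}\gamma^{j}_{Gm}\xi^{j}_{Gm}\tilde\Psi^{j}_{Gm}$ with $\gamma^{j}_{Gm}=2^{-j(s(2^{-j}m)+n/2-n/q^{+})}(1/\delta)^{1/q^{+}}$ and $\xi^{j}_{Gm}$ i.i.d. on $\mathbb{R}$ with density proportional to $x\mapsto\exp\left(-\frac12\int_{\mathbb{T}^{n}}|x|^{q(y)}dy\right)$. *)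

theory Defs
  imports "HOL-Probability.Probability"
begin

section \<open>Functions on the torus\<close>

text \<open>The torus is the quotient of real n-space by the integer lattice, n being the cardinality
  of the index type. A function on it is a function on real n-space of period 1 in every
  coordinate, and integrals are taken over the half-open unit cube.\<close>

definition periodic :: "(real ^ 'n::finite \<Rightarrow> 'b) \<Rightarrow> bool" where
  "periodic f \<longleftrightarrow> (\<forall>x i. f (x + axis i 1) = f x)"

definition unit_cube :: "(real ^ 'n::finite) set" where
  "unit_cube = {x. \<forall>i. 0 \<le> x $ i \<and> x $ i < 1}"

definition torus :: "(real ^ 'n::finite) measure" where
  "torus = restrict_space lborel unit_cube"

definition partial_deriv ::
  "'a::euclidean_space \<Rightarrow> ('a \<Rightarrow> 'b::real_normed_vector) \<Rightarrow> 'a \<Rightarrow> 'b" where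
  "partial_deriv b f x = frechet_derivative f (at x) b"

text \<open>The list is used as a multi-index of elements of the standard basis.\<close>

primrec iterated_deriv ::
  "'a::euclidean_space list \<Rightarrow> ('a \<Rightarrow> 'b::real_normed_vector) \<Rightarrow> 'a \<Rightarrow> 'b" where
  "iterated_deriv [] f = f"
| "iterated_deriv (b # bs) f = partial_deriv b (iterated_deriv bs f)"

primrec Ck :: "nat \<Rightarrow> ('a::euclidean_space \<Rightarrow> 'b::real_normed_vector) \<Rightarrow> bool" where
  "Ck 0 f \<longleftrightarrow> continuous_on UNIV f"
| "Ck (Suc k) f \<longleftrightarrow> (\<forall>x. f differentiable (at x)) \<and> (\<forall>b\<in>Basis. Ck k (partial_deriv b f))"

definition smooth :: "('a::euclidean_space \<Rightarrow> 'b::real_normed_vector) \<Rightarrow> bool" where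
  "smooth f \<longleftrightarrow> (\<forall>k. Ck k f)"

definition laplacian :: "('a::euclidean_space \<Rightarrow> real) \<Rightarrow> 'a \<Rightarrow> real" where
  "laplacian f x = (\<Sum>b\<in>Basis. partial_deriv b (partial_deriv b f) x)"


section \<open>Real distributions on the torus\<close>

definition test_functions :: "(real ^ 'n::finite \<Rightarrow> real) set" where
  "test_functions = {f. periodic f \<and> smooth f}"

text \<open>Distributions are the continuous linear functionals on the test functions. The continuity
  estimate says that the value at \<open>f\<close> is at most \<open>C\<close> times the maximum of the sup norms of the
  derivatives of \<open>f\<close> up to order \<open>N\<close>. The functionals are extensional, so that they are equal as
  soon as they agree on test functions.\<close>

definition distributions :: "((real ^ 'n::finite \<Rightarrow> real) \<Rightarrow> real) set" where
  "distributions = {T \<in> extensional test_functions.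
     (\<forall>f\<in>test_functions. \<forall>g\<in>test_functions. \<forall>a b.
        T (\<lambda>x. a * f x + b * g x) = a * T f + b * T g) \<and>
     (\<exists>C N. \<forall>f\<in>test_functions. \<forall>B.
        (\<forall>bs x. set bs \<subseteq> Basis \<longrightarrow> length bs \<le> N \<longrightarrow> \<bar>iterated_deriv bs f x\<bar> \<le> B) \<longrightarrow>
        \<bar>T f\<bar> \<le> C * B)}"

text \<open>The sigma-algebra generated by the evaluations. On the separable Besov spaces below it
  induces the Borel sigma-algebra of the norm.\<close>

definition distribution_space :: "((real ^ 'n::finite \<Rightarrow> real) \<Rightarrow> real) measure" where
  "distribution_space =
     sigma distributions {{T \<in> distributions. T f \<in> A} | f A. f \<in> test_functions \<and> A \<in> sets borel}"

definition pairing :: "(real ^ 'n::finite \<Rightarrow> real) \<Rightarrow> (real ^ 'n \<Rightarrow> real) \<Rightarrow> real" where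
  "pairing g f = (\<integral>x. g x * f x \<partial>torus)"

definition regular_distribution ::
  "(real ^ 'n::finite \<Rightarrow> real) \<Rightarrow> (real ^ 'n \<Rightarrow> real) \<Rightarrow> real" where
  "regular_distribution g = restrict (pairing g) test_functions"

definition frequency :: "int ^ 'n::finite \<Rightarrow> real ^ 'n" where
  "frequency p = (\<chi> i. 2 * pi * of_int (p $ i))"

text \<open>The value of a real distribution at the character with frequency \<open>- p\<close>, by its real and
  imaginary parts.\<close>

definition fourier_coeff ::
  "((real ^ 'n::finite \<Rightarrow> real) \<Rightarrow> real) \<Rightarrow> int ^ 'n \<Rightarrow> complex" where
  "fourier_coeff T p =
     Complex (T (\<lambda>x. cos (frequency p \<bullet> x))) (- T (\<lambda>x. sin (frequency p \<bullet> x)))"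


section \<open>The heat semigroup at time 1\<close>

text \<open>The equation is understood in the sense of distributions, because the Besov spaces need not
  be contained in \<open>L\<^sup>2\<close>; for square integrable initial values this is the semigroup generated by
  the Laplacian on \<open>L\<^sup>2\<close> with domain \<open>H\<^sup>2\<close>.\<close>

definition heat_solution ::
  "((real ^ 'n::finite \<Rightarrow> real) \<Rightarrow> real) \<Rightarrow> (real \<Rightarrow> (real ^ 'n \<Rightarrow> real) \<Rightarrow> real) \<Rightarrow> bool" where
  "heat_solution u v \<longleftrightarrow> v 0 = u \<and> (\<forall>\<tau>\<ge>0. v \<tau> \<in> distributions) \<and>
     (\<forall>f\<in>test_functions. \<forall>\<tau>\<ge>0.
        ((\<lambda>\<tau>'. v \<tau>' f) has_real_derivative v \<tau> (laplacian f)) (at \<tau> within {0..}))"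

text \<open>The time-1 value of the solution is a regular distribution with a unique continuous
  representative, which is what point evaluation refers to.\<close>

definition heat_map :: "((real ^ 'n::finite \<Rightarrow> real) \<Rightarrow> real) \<Rightarrow> real ^ 'n \<Rightarrow> real" where
  "heat_map u = (THE g. continuous_on UNIV g \<and> periodic g \<and>
     (\<exists>v. heat_solution u v \<and> v 1 = regular_distribution g))"

definition observation ::
  "('k::finite \<Rightarrow> real ^ 'n::finite) \<Rightarrow> (real ^ 'n \<Rightarrow> real) \<Rightarrow> real ^ 'k" where
  "observation x g = (\<chi> k. g (x k))"


section \<open>Variable exponents\<close>

text \<open>Since \<open>g\<close> is periodic, letting \<open>x\<close> and \<open>y\<close> range over all representatives amounts to using
  the distance of the torus. In the decay condition \<open>x\<close> must be restricted to one fundamental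
  domain, as only constants satisfy it on all representatives.\<close>

definition C_log_loc :: "(real ^ 'n::finite \<Rightarrow> real) set" where
  "C_log_loc = {g. periodic g \<and>
     (\<exists>c>0. \<forall>x y. \<bar>g x - g y\<bar> \<le> c / ln (exp 1 + 1 / norm (x - y)))}"

definition C_log :: "(real ^ 'n::finite \<Rightarrow> real) set" where
  "C_log = {g \<in> C_log_loc.
     \<exists>g_inf. \<exists>c>0. \<forall>x\<in>unit_cube. \<bar>g x - g_inf\<bar> \<le> c / ln (exp 1 + norm x)}"

definition L_infinity :: "(real ^ 'n::finite \<Rightarrow> real) set" where
  "L_infinity = {g \<in> borel_measurable borel. periodic g \<and> (\<exists>B. AE x in torus. \<bar>g x\<bar> \<le> B)}"

definition exponents :: "(real ^ 'n::finite \<Rightarrow> real) set" where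
  "exponents = {q \<in> borel_measurable borel. periodic q \<and> (\<forall>x. 1 \<le> q x)}"

definition ess_sup :: "(real ^ 'n::finite \<Rightarrow> real) \<Rightarrow> ereal" where
  "ess_sup q = esssup torus (\<lambda>x. ereal (q x))"

definition ess_inf :: "(real ^ 'n::finite \<Rightarrow> real) \<Rightarrow> ereal" where
  "ess_inf q = - esssup torus (\<lambda>x. - ereal (q x))"

definition exponents_log :: "(real ^ 'n::finite \<Rightarrow> real) set" where
  "exponents_log = {q \<in> exponents. (\<lambda>x. 1 / q x) \<in> C_log \<and>
     1 \<le> ess_inf q \<and> ess_inf q \<le> ess_sup q \<and> ess_sup q < \<infinity>}"

abbreviation q_plus :: "(real ^ 'n::finite \<Rightarrow> real) \<Rightarrow> real" where
  "q_plus q \<equiv> real_of_ereal (ess_sup q)"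


section \<open>Variable index Besov spaces\<close>

definition dyadic_resolution :: "(nat \<Rightarrow> real ^ 'n::finite \<Rightarrow> real) \<Rightarrow> bool" where
  "dyadic_resolution \<theta> \<longleftrightarrow>
     (\<forall>k. smooth (\<theta> k)) \<and>
     (\<forall>z. 2 < norm z \<longrightarrow> \<theta> 0 z = 0) \<and>
     (\<forall>k\<ge>1. \<forall>z. norm z < 2 ^ (k - 1) \<or> 2 ^ (k + 1) < norm z \<longrightarrow> \<theta> k z = 0) \<and>
     (\<forall>bs. set bs \<subseteq> Basis \<longrightarrow>
        (\<exists>c. \<forall>k z. 2 ^ (k * length bs) * \<bar>iterated_deriv bs (\<theta> k) z\<bar> \<le> c)) \<and>
     (\<forall>z. (\<lambda>k. \<theta> k z) sums 1)"

text \<open>The inverse Fourier transform of \<open>\<theta> k\<close> times the Fourier transform of the distribution; for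
  a periodic distribution it is a (finite) Fourier series.\<close>

definition dyadic_block :: "(nat \<Rightarrow> real ^ 'n::finite \<Rightarrow> real) \<Rightarrow> nat \<Rightarrow>
    ((real ^ 'n \<Rightarrow> real) \<Rightarrow> real) \<Rightarrow> real ^ 'n \<Rightarrow> complex" where
  "dyadic_block \<theta> k T x = (\<Sum>\<^sub>\<infinity>p\<in>UNIV.
     complex_of_real (\<theta> k (frequency p)) * fourier_coeff T p * cis (frequency p \<bullet> x))"

definition ennreal_powr :: "ennreal \<Rightarrow> real \<Rightarrow> ennreal" where
  "ennreal_powr a r = (if a = \<infinity> then \<infinity> else ennreal (enn2real a powr r))"

text \<open>The value is \<open>\<infinity>\<close> if no \<open>c\<close> is admissible.\<close>

definition variable_Lq_norm ::
  "(real ^ 'n::finite \<Rightarrow> real) \<Rightarrow> (real ^ 'n \<Rightarrow> ennreal) \<Rightarrow> ennreal" where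
  "variable_Lq_norm q f =
     Inf {ennreal c | c. 0 < c \<and> (\<integral>\<^sup>+ x. ennreal_powr (f x / ennreal c) (q x) \<partial>torus) \<le> 1}"

definition besov_norm :: "(nat \<Rightarrow> real ^ 'n::finite \<Rightarrow> real) \<Rightarrow> (real ^ 'n \<Rightarrow> real) \<Rightarrow>
    (real ^ 'n \<Rightarrow> real) \<Rightarrow> ((real ^ 'n \<Rightarrow> real) \<Rightarrow> real) \<Rightarrow> ennreal" where
  "besov_norm \<theta> t q T = variable_Lq_norm q (\<lambda>x. ennreal_powr
     (\<Sum>k. ennreal ((2 powr (real k * t x) * cmod (dyadic_block \<theta> k T x)) powr q x)) (1 / q x))"

definition besov_space :: "(nat \<Rightarrow> real ^ 'n::finite \<Rightarrow> real) \<Rightarrow> (real ^ 'n \<Rightarrow> real) \<Rightarrow>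
    (real ^ 'n \<Rightarrow> real) \<Rightarrow> ((real ^ 'n \<Rightarrow> real) \<Rightarrow> real) set" where
  "besov_space \<theta> t q = {T \<in> distributions. besov_norm \<theta> t q T < \<infinity>}"


section \<open>Wavelet systems\<close>

text \<open>The Fourier transforms of the Meyer functions (for the kernel \<open>exp (- i x z)\<close> without
  prefactor) are \<open>cos (pi / 2 * \<nu> (3 \<bar>z\<bar> / (2 * pi) - 1))\<close> for the scaling function and, up to the
  phase \<open>exp (i z (p + 1 / 2))\<close>, the product below for the wavelet; the two factors of the latter
  are the usual pieces for \<open>\<bar>z\<bar> \<le> 4 * pi / 3\<close> and \<open>\<bar>z\<bar> \<ge> 4 * pi / 3\<close>, the other factor being 1
  there. The integer \<open>p\<close> covers the different conventions for the position of the wavelet.\<close>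

definition meyer_system :: "(real \<Rightarrow> real) \<Rightarrow> (real \<Rightarrow> real) \<Rightarrow> bool" where
  "meyer_system \<psi>F \<psi>M \<longleftrightarrow> (\<exists>\<nu> :: real \<Rightarrow> real. \<exists>p :: int.
     smooth \<nu> \<and> (\<forall>z\<le>0. \<nu> z = 0) \<and> (\<forall>z\<ge>1. \<nu> z = 1) \<and> (\<forall>z. \<nu> z + \<nu> (1 - z) = 1) \<and>
     (\<forall>x. \<psi>F x = 1 / (2 * pi) *
        (\<integral>z. cos (x * z) * cos (pi / 2 * \<nu> (3 * \<bar>z\<bar> / (2 * pi) - 1)) \<partial>lborel)) \<and>
     (\<forall>x. \<psi>M x = 1 / (2 * pi) *
        (\<integral>z. cos ((x + of_int p + 1 / 2) * z) *
          (sin (pi / 2 * \<nu> (3 * \<bar>z\<bar> / (2 * pi) - 1)) *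
           cos (pi / 2 * \<nu> (3 * \<bar>z\<bar> / (4 * pi) - 1))) \<partial>lborel)))"

text \<open>Compactly supported orthonormal systems with a filter of length \<open>2 * N\<close> and \<open>N\<close> vanishing
  moments, for every choice of the spectral factor. The integers \<open>a\<close>, \<open>p\<close> and the sign \<open>\<sigma>\<close> cover
  the different conventions for the positions and the sign; the indexing of the mirror filter is
  that of \<open>(-1) ^ k * h (1 - k)\<close> up to these.\<close>

definition daubechies_system :: "nat \<Rightarrow> (real \<Rightarrow> real) \<Rightarrow> (real \<Rightarrow> real) \<Rightarrow> bool" where
  "daubechies_system N \<psi>F \<psi>M \<longleftrightarrow> 1 \<le> N \<and>
     \<psi>F \<in> borel_measurable borel \<and> integrable lborel (\<lambda>x. (\<psi>F x)\<^sup>2) \<and>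
     (\<integral>x. \<psi>F x \<partial>lborel) = 1 \<and>
     (\<forall>m :: int. (\<integral>x. \<psi>F x * \<psi>F (x - of_int m) \<partial>lborel) = (if m = 0 then 1 else 0)) \<and>
     (\<exists>(h :: int \<Rightarrow> real) (a :: int) (p :: int) (\<sigma> :: real).
        (\<forall>x. x < of_int a \<or> of_int a + 2 * real N - 1 < x \<longrightarrow> \<psi>F x = 0) \<and>
        (\<forall>x. \<psi>F x = sqrt 2 * (\<Sum>k\<in>{a..<a + 2 * int N}. h k * \<psi>F (2 * x - of_int k))) \<and>
        odd p \<and> \<sigma> \<in> {- 1, 1} \<and>
        (\<forall>x. \<psi>M x = \<sigma> * sqrt 2 * (\<Sum>k\<in>{a..<a + 2 * int N}.
           (- 1) powi k * h k * \<psi>F (2 * x + of_int k - of_int p)))) \<and>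
     (\<forall>l<N. (\<integral>x. x ^ l * \<psi>M x \<partial>lborel) = 0)"

datatype wavelet_kind = Scaling | Wavelet

instance wavelet_kind :: finite
proof
  have "UNIV = {Scaling, Wavelet}"
    using wavelet_kind.exhaust by auto
  then show "finite (UNIV :: wavelet_kind set)"
    by (metis finite.emptyI finite.insertI)
qed

definition wavelet_types :: "nat \<Rightarrow> (wavelet_kind ^ 'n::finite) set" where
  "wavelet_types j = (if j = 0 then UNIV else {G. \<exists>r. G $ r = Wavelet})"

definition wavelet_positions :: "nat \<Rightarrow> (nat ^ 'n::finite) set" where
  "wavelet_positions j = {m. \<forall>r. m $ r < 2 ^ j}"

definition periodic_wavelet :: "(real \<Rightarrow> real) \<Rightarrow> (real \<Rightarrow> real) \<Rightarrow> nat \<Rightarrow>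
    wavelet_kind ^ 'n::finite \<Rightarrow> nat ^ 'n \<Rightarrow> real ^ 'n \<Rightarrow> real" where
  "periodic_wavelet \<psi>F \<psi>M j G m x = (\<Prod>r\<in>UNIV. \<Sum>\<^sub>\<infinity>l\<in>(UNIV :: int set).
     2 powr (real j / 2) * (case G $ r of Scaling \<Rightarrow> \<psi>F | Wavelet \<Rightarrow> \<psi>M)
       (2 ^ j * (x $ r + of_int l) - real (m $ r)))"


section \<open>Variable index Besov priors\<close>

definition besov_weight :: "real \<Rightarrow> (real ^ 'n::finite \<Rightarrow> real) \<Rightarrow> (real ^ 'n \<Rightarrow> real) \<Rightarrow> nat \<Rightarrow>
    nat ^ 'n \<Rightarrow> real" where
  "besov_weight \<delta> s q j m =
     2 powr (- real j * (s (\<chi> r. real (m $ r) / 2 ^ j) + real CARD('n) / 2 - real CARD('n) / q_plus q)) *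
     (1 / \<delta>) powr (1 / q_plus q)"

definition coefficient_density :: "(real ^ 'n::finite \<Rightarrow> real) \<Rightarrow> real \<Rightarrow> real" where
  "coefficient_density q x =
     exp (- 1 / 2 * (\<integral>y. \<bar>x\<bar> powr q y \<partial>torus)) /
     (\<integral>z. exp (- 1 / 2 * (\<integral>y. \<bar>z\<bar> powr q y \<partial>torus)) \<partial>lborel)"

text \<open>The canonical model of the i.i.d. random coefficients: they are the coordinates.\<close>

definition coefficient_space ::
  "(real ^ 'n::finite \<Rightarrow> real) \<Rightarrow> (nat \<times> (wavelet_kind ^ 'n) \<times> (nat ^ 'n) \<Rightarrow> real) measure" where
  "coefficient_space q =
     PiM (SIGMA j:UNIV. wavelet_types j \<times> wavelet_positions j)
       (\<lambda>_. density lborel (\<lambda>x. ennreal (coefficient_density q x)))"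

text \<open>The law of a random distribution to which the wavelet series converges almost surely.\<close>

definition besov_measure :: "real \<Rightarrow> (real ^ 'n::finite \<Rightarrow> real) \<Rightarrow> (real ^ 'n \<Rightarrow> real) \<Rightarrow>
    (real \<Rightarrow> real) \<Rightarrow> (real \<Rightarrow> real) \<Rightarrow> ((real ^ 'n \<Rightarrow> real) \<Rightarrow> real) measure \<Rightarrow> bool" where
  "besov_measure \<delta> s q \<psi>F \<psi>M \<mu> \<longleftrightarrow>
     (\<exists>u \<in> measurable (coefficient_space q) distribution_space.
        (AE \<xi> in coefficient_space q. \<forall>f\<in>test_functions.
           (\<lambda>j. \<Sum>G\<in>wavelet_types j. \<Sum>m\<in>wavelet_positions j.
              besov_weight \<delta> s q j m * \<xi> (j, G, m) * pairing (periodic_wavelet \<psi>F \<psi>M j G m) f)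
           sums u \<xi> f) \<and>
        \<mu> = distr (coefficient_space q) distribution_space u)"


section \<open>Gaussian noise, conditional distributions and the Hellinger metric\<close>

definition positive_definite :: "real ^ 'k::finite ^ 'k \<Rightarrow> bool" where
  "positive_definite A \<longleftrightarrow> transpose A = A \<and> (\<forall>x. x \<noteq> 0 \<longrightarrow> 0 < x \<bullet> (A *v x))"

definition inverse_sqrt_matrix :: "real ^ 'k::finite ^ 'k \<Rightarrow> real ^ 'k ^ 'k" where
  "inverse_sqrt_matrix A = (THE S. positive_definite S \<and> S ** S = matrix_inv A)"

definition centered_gaussian_density :: "real ^ 'k::finite ^ 'k \<Rightarrow> real ^ 'k \<Rightarrow> real" where
  "centered_gaussian_density A x =
     exp (- 1 / 2 * (x \<bullet> (matrix_inv A *v x))) / sqrt ((2 * pi) ^ CARD('k) * det A)"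

text \<open>The library's \<^const>\<open>prob_space.indep_var\<close> requires both random variables to have values in the
  same type.\<close>

definition independent_vars :: "'w measure \<Rightarrow> 'a measure \<Rightarrow> ('w \<Rightarrow> 'a) \<Rightarrow>
    'b measure \<Rightarrow> ('w \<Rightarrow> 'b) \<Rightarrow> bool" where
  "independent_vars P MX X MY Y \<longleftrightarrow>
     X \<in> measurable P MX \<and> Y \<in> measurable P MY \<and>
     prob_space.indep_set P
       {X -` A \<inter> space P | A. A \<in> sets MX} {Y -` B \<inter> space P | B. B \<in> sets MY}"

text \<open>\<open>\<kappa>\<close> is a regular conditional distribution under \<open>P\<close> of \<open>X\<close> given \<open>Y\<close>.\<close>

definition conditional_distribution :: "'w measure \<Rightarrow> 'a measure \<Rightarrow> ('w \<Rightarrow> 'a) \<Rightarrow>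
    'b measure \<Rightarrow> ('w \<Rightarrow> 'b) \<Rightarrow> ('b \<Rightarrow> 'a measure) \<Rightarrow> bool" where
  "conditional_distribution P MX X MY Y \<kappa> \<longleftrightarrow>
     X \<in> measurable P MX \<and> Y \<in> measurable P MY \<and> \<kappa> \<in> measurable MY (prob_algebra MX) \<and>
     (\<forall>A\<in>sets MX. \<forall>B\<in>sets MY.
        emeasure P {\<omega> \<in> space P. X \<omega> \<in> A \<and> Y \<omega> \<in> B} =
        (\<integral>\<^sup>+ y\<in>B. emeasure (\<kappa> y) A \<partial>distr P MY Y))"

definition reference_measure :: "'a measure \<Rightarrow> 'a measure \<Rightarrow> 'a measure \<Rightarrow> bool" where
  "reference_measure N M M' \<longleftrightarrow> sigma_finite_measure N \<and>
     sets M = sets N \<and> sets M' = sets N \<and> absolutely_continuous N M \<and> absolutely_continuous N M'"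

text \<open>The value does not depend on the choice of the reference measure \<open>N\<close>.\<close>

definition hellinger_dist :: "'a measure \<Rightarrow> 'a measure \<Rightarrow> 'a measure \<Rightarrow> real" where
  "hellinger_dist N M M' = sqrt (1 / 2 *
     (\<integral>u. (sqrt (enn2real (RN_deriv N M u)) - sqrt (enn2real (RN_deriv N M' u)))\<^sup>2 \<partial>N))"


section \<open>The potential and the normalizing constant\<close>

definition potential :: "real ^ 'k::finite ^ 'k \<Rightarrow> ('u \<Rightarrow> real ^ 'k) \<Rightarrow> 'u \<Rightarrow> real ^ 'k \<Rightarrow> real" where
  "potential \<Gamma> obs u y =
     1 / 2 * (norm (inverse_sqrt_matrix \<Gamma> *v (y - obs u)))\<^sup>2 -
     1 / 2 * (norm (inverse_sqrt_matrix \<Gamma> *v y))\<^sup>2"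

definition normalizer :: "real ^ 'k::finite ^ 'k \<Rightarrow> ('u \<Rightarrow> real ^ 'k) \<Rightarrow> 'u measure \<Rightarrow> 'u set \<Rightarrow>
    real ^ 'k \<Rightarrow> real" where
  "normalizer \<Gamma> obs \<mu> B y = (LINT u:B|\<mu>.
     exp (- 1 / 2 * (norm (inverse_sqrt_matrix \<Gamma> *v (y - obs u)))\<^sup>2 +
          1 / 2 * (norm (inverse_sqrt_matrix \<Gamma> *v y))\<^sup>2))"

end

theory Submission
  imports Defs
begin

text \<open>The heat flow multiplies the Fourier coefficients of a distribution by
  \<open>exp (- |2 \<pi> p|\<^sup>2)\<close>, so the observation map is defined and measurable on all distributions,
  and the posterior is obtained by disintegrating the product of the prior and the Gaussian noise.
  As a function of the data, the likelihood is a Gaussian times a factor that does not depend on the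
  unknown; so it and its square root are bounded and Lipschitz on bounded sets of data, uniformly in
  the unknown, which gives the Hellinger estimate.

  It remains to see that the prior is carried by the Besov space, so that the normalizing constant
  may be computed there. Almost surely the coefficients grow at most linearly in the level \<open>j\<close>.
  Because of the decay of the wavelets and the uniform continuity of \<open>s\<close>, level \<open>j\<close> of the series
  is then \<open>O (2 powr (- j (s y - n / q\<^sup>+ - \<epsilon>)))\<close> near every point \<open>y\<close>. In the block of frequency
  \<open>2 ^ k\<close>, the levels \<open>j \<ge> (1 - \<kappa>) k\<close> are estimated by this bound and the decay of the
  Littlewood--Paley kernel at distances beyond \<open>2 powr (- (1 - \<kappa>) k)\<close>, whereas the levels
  \<open>j < (1 - \<kappa>) k\<close> are negligible, since the Fourier coefficients of smooth wavelets decay rapidly.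
  Hence \<open>2 powr (k t x)\<close> times the block decays geometrically in \<open>k\<close>, uniformly in \<open>x\<close>.\<close>

section \<open>Square roots of positive definite matrices\<close>

text \<open>Two objects of the statement are definite descriptions, the inverse square root of the
  covariance and the heat map. Giving them values takes the spectral theorem and a Fourier theory of
  periodic distributions. A conditional distribution is determined only almost everywhere, and the
  null set must not depend on the event; hence the countable generator of the sigma-algebra of
  distributions. Smoothness is measured by finite differences: a translation by half a period
  changes the sign of a character, and differences suit wavelets of limited regularity. The same
  device with space and frequency exchanged gives the decay of Fourier integrals. The obstacle in
  the Besov part is that \<open>s\<close> can be compared only at nearby points. Localizing a block
  at a scale slightly coarser than \<open>2 powr (- k)\<close> gains arbitrary powers in the tails
  and costs a factor \<open>2 powr (\<kappa> * n * k)\<close>. A loss \<open>e\<close> in the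
  exponent is allotted to each imprecision; \<open>\<kappa>\<close> is chosen from \<open>e\<close>
  and the number of differences from \<open>\<kappa>\<close>, which fixes the regularity asked of
  the wavelets.\<close>

lemma self_adjoint_eigenvector:
  fixes f :: "'a::euclidean_space \<Rightarrow> 'a"
  assumes lin: "linear f" and sym: "\<And>x y. f x \<bullet> y = x \<bullet> f y"
    and V: "subspace V" "V \<noteq> {0}" and inv: "\<And>x. x \<in> V \<Longrightarrow> f x \<in> V"
  obtains v c where "v \<in> V" "norm v = 1" "f v = c *\<^sub>R v"
proof -
  let ?K = "sphere 0 1 \<inter> V"
  have "0 \<in> V" using V(1) by (rule subspace_0)
  then obtain w where w: "w \<in> V" "w \<noteq> 0" using V(2) by blast
  have "w /\<^sub>R norm w \<in> ?K" using w V(1) by (simp add: subspace_scale)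
  then have ne: "?K \<noteq> {}" by blast
  have comp: "compact ?K"
    by (intro compact_Int_closed compact_sphere closed_subspace V(1))
  have cont: "continuous_on ?K (\<lambda>x. x \<bullet> f x)"
    by (intro continuous_intros linear_continuous_on linear_conv_bounded_linear[THEN iffD1] lin)
  obtain v where v: "v \<in> ?K" and max: "\<And>x. x \<in> ?K \<Longrightarrow> x \<bullet> f x \<le> v \<bullet> f v"
    using continuous_attains_sup[OF comp ne cont] by blast
  have nv: "norm v = 1" and vV: "v \<in> V" using v by auto
  define c where "c = v \<bullet> f v"
  have gen: "x \<bullet> f x \<le> c * (norm x)\<^sup>2" if "x \<in> V" for x
  proof (cases "x = 0")
    case True then show ?thesis using lin by (simp add: linear_0)
  next
    case False
    have "x /\<^sub>R norm x \<in> ?K" using that False V(1) by (simp add: subspace_scale)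
    from max[OF this] have "(x \<bullet> f x) / (norm x)\<^sup>2 \<le> c"
      by (simp add: linear_scale[OF lin] c_def power2_eq_square divide_simps)
    then show ?thesis using False by (simp add: divide_simps mult.commute)
  qed
  \<comment> \<open>The residual of \<open>v\<close>, orthogonal to \<open>v\<close>. Were it
    nonzero, moving from \<open>v\<close> towards it would raise the Rayleigh quotient to first
    order.\<close>
  define g where "g = f v - c *\<^sub>R v"
  have gV: "g \<in> V" unfolding g_def using vV inv V(1) by (simp add: subspace_diff subspace_scale)
  have vv: "v \<bullet> v = 1" using nv by (simp add: norm_eq_1)
  have gv: "g \<bullet> v = 0" unfolding g_def by (simp add: inner_diff_left vv) (simp add: c_def inner_commute)
  have fvg: "v \<bullet> f g = g \<bullet> g"
  proof -
    have "v \<bullet> f g = f v \<bullet> g" using sym by simp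
    also have "f v = g + c *\<^sub>R v" by (simp add: g_def)
    finally show ?thesis using gv by (simp add: inner_add_left inner_add_right inner_commute)
  qed
  have quad: "2 * e * (g \<bullet> g) + e\<^sup>2 * (g \<bullet> f g - c * (g \<bullet> g)) \<le> 0" for e :: real
  proof -
    have "v + e *\<^sub>R g \<in> V" using vV gV V(1) by (simp add: subspace_add subspace_scale)
    moreover have "(norm (v + e *\<^sub>R g))\<^sup>2 = 1 + e\<^sup>2 * (g \<bullet> g)"
      unfolding power2_norm_eq_inner using gv
      by (simp add: inner_add_left inner_add_right vv inner_commute power2_eq_square)
    ultimately show ?thesis
      using gen[of "v + e *\<^sub>R g"] gv fvg sym[of g v]
      by (simp add: linear_add[OF lin] linear_scale[OF lin] inner_add_left inner_add_right
          vv c_def[symmetric] inner_commute power2_eq_square algebra_simps)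
  qed
  have "g \<bullet> g = 0"
  proof (rule ccontr)
    assume "g \<bullet> g \<noteq> 0"
    then have gp: "g \<bullet> g > 0" by simp
    define d where "d = \<bar>g \<bullet> f g - c * (g \<bullet> g)\<bar> + 1"
    have dp: "d > 0" by (simp add: d_def)
    \<comment> \<open>This size makes \<open>e^2 * d\<close>, a bound for the second-order loss,
      half of the first-order gain \<open>2 * e * (g \<bullet> g)\<close>.\<close>
    define e where "e = (g \<bullet> g) / d"
    have ep: "e > 0" using gp dp by (simp add: e_def)
    have "- d \<le> g \<bullet> f g - c * (g \<bullet> g)" by (simp add: d_def)
    then have "e\<^sup>2 * (- d) \<le> e\<^sup>2 * (g \<bullet> f g - c * (g \<bullet> g))" by (intro mult_left_mono) auto
    then have "2 * e * (g \<bullet> g) - e\<^sup>2 * d \<le> 0" using quad[of e] by simp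
    moreover have "e\<^sup>2 * d = e * (g \<bullet> g)" using dp by (simp add: e_def power2_eq_square)
    ultimately have "e * (g \<bullet> g) \<le> 0" by simp
    then show False using ep gp by (simp add: mult_le_0_iff)
  qed
  then have "f v = c *\<^sub>R v" by (simp add: g_def)
  then show ?thesis using that nv vV by blast
qed

text \<open>Split off a unit eigenvector and pass to its orthogonal complement in \<open>V\<close>,
  which is invariant because \<open>f\<close> is symmetric. Orthogonality of \<open>B\<close> is not
  recorded; the square root is built from the expansion and the eigenvalue equations.\<close>

lemma self_adjoint_eigenbasis:
  fixes f :: "'a::euclidean_space \<Rightarrow> 'a"
  assumes lin: "linear f" and sym: "\<And>x y. f x \<bullet> y = x \<bullet> f y"
    and V: "subspace V" and inv: "\<And>x. x \<in> V \<Longrightarrow> f x \<in> V"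
  shows "\<exists>B c. finite B \<and> B \<subseteq> V \<and> (\<forall>b\<in>B. norm b = 1 \<and> f b = c b *\<^sub>R b) \<and>
    (\<forall>x\<in>V. x = (\<Sum>b\<in>B. (x \<bullet> b) *\<^sub>R b))"
  using V inv
proof (induction "dim V" arbitrary: V rule: less_induct)
  case less
  show ?case
  proof (cases "V = {0}")
    case True
    show ?thesis by (rule exI[of _ "{}"]) (simp add: True)
  next
    case False
    obtain v k where v: "v \<in> V" "norm v = 1" "f v = k *\<^sub>R v"
      using self_adjoint_eigenvector[OF lin sym less.prems(1) False less.prems(2)] by blast
    define W where "W = V \<inter> {x. v \<bullet> x = 0}"
    have sW: "subspace W" unfolding W_def
      by (intro subspace_inter less.prems(1) subspace_hyperplane)
    have iW: "f x \<in> W" if "x \<in> W" for x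
    proof -
      have "v \<bullet> f x = f v \<bullet> x" by (simp add: sym)
      also have "\<dots> = 0" using that v by (simp add: W_def)
      finally show ?thesis using that less.prems(2) by (simp add: W_def)
    qed
    have vv: "v \<bullet> v = 1" using v by (simp add: norm_eq_1)
    have "v \<notin> W" using vv by (simp add: W_def)
    then have "W \<subset> V" using v(1) by (metis W_def inf_le1 psubsetI)
    then have "dim W < dim V"
      using sW less.prems(1) by (metis dim_psubset span_eq_iff)
    from less.hyps[OF this sW iW] obtain B c where B: "finite B" "B \<subseteq> W"
      "\<And>b. b \<in> B \<Longrightarrow> norm b = 1 \<and> f b = c b *\<^sub>R b"
      "\<And>x. x \<in> W \<Longrightarrow> x = (\<Sum>b\<in>B. (x \<bullet> b) *\<^sub>R b)" by metis
    have vB: "v \<notin> B" using B(2) \<open>v \<notin> W\<close> by blast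
    have orth: "v \<bullet> b = 0" if "b \<in> B" for b using that B(2) by (auto simp: W_def)
    have ex: "x = (\<Sum>b\<in>insert v B. (x \<bullet> b) *\<^sub>R b)" if "x \<in> V" for x
    proof -
      have "x - (x \<bullet> v) *\<^sub>R v \<in> W" using that v less.prems(1)
        by (auto simp: W_def subspace_diff subspace_scale inner_diff_right vv inner_commute)
      from B(4)[OF this]
      have "x - (x \<bullet> v) *\<^sub>R v = (\<Sum>b\<in>B. (x \<bullet> b) *\<^sub>R b)"
        by (auto simp: inner_diff_left orth cong: sum.cong)
      then show ?thesis using B(1) vB by (simp add: algebra_simps)
    qed
    show ?thesis
      by (rule exI[of _ "insert v B"], rule exI[of _ "\<lambda>b. if b = v then k else c b"])
        (use B v ex vB in \<open>auto simp: W_def\<close>)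
  qed
qed

lemma positive_definite_sqrt_exists:
  fixes A :: "real ^ 'k::finite ^ 'k"
  assumes "positive_definite A"
  shows "\<exists>S. positive_definite S \<and> S ** S = A"
proof -
  have tr: "transpose A = A" and pos: "\<And>x. x \<noteq> 0 \<Longrightarrow> 0 < x \<bullet> (A *v x)"
    using assms by (auto simp: positive_definite_def)
  have sym: "(A *v x) \<bullet> y = x \<bullet> (A *v y)" for x y
    by (metis dot_lmul_matrix tr transpose_matrix_vector)
  obtain B c where B: "finite B" "\<And>b. b \<in> B \<Longrightarrow> norm b = 1" "\<And>b. b \<in> B \<Longrightarrow> A *v b = c b *\<^sub>R b"
    and ex: "\<And>x. x = (\<Sum>b\<in>B. (x \<bullet> b) *\<^sub>R b)"
    using self_adjoint_eigenbasis[of "(*v) A" UNIV, OF matrix_vector_mul_linear sym subspace_UNIV] by auto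
  have cpos: "c b > 0" if "b \<in> B" for b
  proof -
    have "b \<noteq> 0" using B(2)[OF that] by auto
    from pos[OF this] show ?thesis using B(2,3)[OF that] by (simp add: norm_eq_1)
  qed
  define g where "g x = (\<Sum>b\<in>B. (sqrt (c b) * (x \<bullet> b)) *\<^sub>R b)" for x :: "real ^ 'k"
  have lin: "linear g" unfolding g_def
    by (rule linearI) (simp_all add: inner_add_left algebra_simps sum.distrib scaleR_sum_right)
  have gb: "g b = sqrt (c b) *\<^sub>R b" if b: "b \<in> B" for b
  proof -
    have "A *v b = (\<Sum>d\<in>B. (b \<bullet> d) *\<^sub>R (A *v d))"
      by (subst ex[of b]) (simp add: matrix_vector_mul_linear[THEN linear_sum] linear_scale[OF matrix_vector_mul_linear])
    \<comment> \<open>Symmetry of \<open>A\<close> gives \<open>c b = c d\<close> or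
      \<open>b \<bullet> d = 0\<close>. Either way the roots of the eigenvalues may be exchanged,
      which replaces orthogonality of \<open>B\<close>.\<close>
    have *: "sqrt (c d) * (b \<bullet> d) = sqrt (c b) * (b \<bullet> d)" if d: "d \<in> B" for d
    proof -
      have "c b * (b \<bullet> d) = c d * (b \<bullet> d)"
        using sym[of b d] B(3)[OF b] B(3)[OF d] by simp
      then show ?thesis by auto
    qed
    have "g b = (\<Sum>d\<in>B. (sqrt (c b) * (b \<bullet> d)) *\<^sub>R d)"
      unfolding g_def by (intro sum.cong refl) (simp add: *)
    also have "\<dots> = sqrt (c b) *\<^sub>R (\<Sum>d\<in>B. (b \<bullet> d) *\<^sub>R d)"
      by (simp add: scaleR_sum_right)
    finally show ?thesis using ex[of b] by simp
  qed
  have gsym: "g x \<bullet> y = x \<bullet> g y" for x y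
    by (simp add: g_def inner_sum_left inner_sum_right) (simp add: algebra_simps inner_commute)
  have gg: "g (g x) = A *v x" for x
  proof -
    have "g (g x) = (\<Sum>b\<in>B. (sqrt (c b) * (x \<bullet> b)) *\<^sub>R g b)"
      by (subst (2) g_def) (simp add: linear_sum[OF lin] linear_scale[OF lin])
    also have "\<dots> = (\<Sum>b\<in>B. (x \<bullet> b) *\<^sub>R (A *v b))"
      using B cpos by (intro sum.cong refl) (simp add: gb less_imp_le)
    also have "\<dots> = A *v (\<Sum>b\<in>B. (x \<bullet> b) *\<^sub>R b)"
      by (simp add: linear_sum[OF matrix_vector_mul_linear] linear_scale[OF matrix_vector_mul_linear])
    finally show ?thesis using ex[of x] by simp
  qed
  define S where "S = matrix g"
  have Sg: "S *v x = g x" for x by (simp add: S_def matrix_works lin)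
  have "S ** S = A"
    by (simp add: matrix_eq matrix_vector_mul_assoc[symmetric] Sg gg)
  moreover have "transpose S = S"
  proof -
    have "(transpose S *v x) \<bullet> y = (S *v x) \<bullet> y" for x y
      by (metis Sg dot_lmul_matrix gsym transpose_matrix_vector)
    then show ?thesis by (metis matrix_eq vector_eq_rdot)
  qed
  moreover have "0 < x \<bullet> (S *v x)" if "x \<noteq> 0" for x
  proof -
    have eq: "x \<bullet> (S *v x) = (\<Sum>b\<in>B. sqrt (c b) * (x \<bullet> b)\<^sup>2)"
      by (simp add: Sg g_def inner_sum_right power2_eq_square algebra_simps)
    have "\<exists>b\<in>B. x \<bullet> b \<noteq> 0"
      using ex[of x] that by (metis (no_types, lifting) scale_zero_left sum.neutral)
    then obtain b where "b \<in> B" "x \<bullet> b \<noteq> 0" by blast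
    then show ?thesis unfolding eq using cpos B(1)
      by (intro sum_pos2[of _ b]) (auto simp: less_imp_le)
  qed
  ultimately show ?thesis unfolding positive_definite_def by blast
qed

text \<open>For symmetric \<open>D\<close> the diagonal entries of \<open>D ** S ** D\<close> are
  the values of the quadratic form of \<open>S\<close> at the columns of \<open>D\<close>, so
  definiteness of \<open>S\<close> gives the trace a sign.\<close>

lemma trace_sandwich_eq_sum:
  fixes D S :: "real ^ 'k::finite ^ 'k"
  assumes "transpose D = D"
  shows "trace (D ** S ** D) = (\<Sum>i\<in>UNIV. (D *v axis i 1) \<bullet> (S *v (D *v axis i 1)))"
proof -
  have "(D ** S ** D) $ i $ i = (D *v axis i 1) \<bullet> (S *v (D *v axis i 1))" for i
  proof -
    have "(D *v axis i 1) \<bullet> (S *v (D *v axis i 1)) = axis i 1 \<bullet> (D *v (S *v (D *v axis i 1)))"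
      by (metis assms dot_lmul_matrix transpose_matrix_vector)
    also have "\<dots> = axis i 1 \<bullet> ((D ** S ** D) *v axis i 1)"
      by (simp add: matrix_vector_mul_assoc matrix_mul_assoc)
    also have "\<dots> = (D ** S ** D) $ i $ i"
      by (simp add: matrix_vector_mult_basis column_def inner_axis')
    finally show ?thesis by simp
  qed
  then show ?thesis by (simp add: trace_def)
qed

text \<open>If \<open>D = S - T\<close> then \<open>S D + D T = 0\<close>, hence \<open>tr (D S D) + tr (D T D) = 0\<close>; both traces are
  sums of nonnegative terms.\<close>

lemma positive_definite_sqrt_unique:
  fixes S T :: "real ^ 'k::finite ^ 'k"
  assumes "positive_definite S" "positive_definite T" "S ** S = T ** T"
  shows "S = T"
proof -
  define D where "D = S - T"
  have trD: "transpose D = D"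
    using assms(1,2) by (simp add: D_def positive_definite_def transpose_def vec_eq_iff)
  have z: "S ** D + D ** T = 0"
    using assms(3) unfolding D_def matrix_eq
    by (simp add: matrix_vector_mult_add_rdistrib matrix_vector_mul_assoc[symmetric]
        matrix_vector_mult_diff_rdistrib matrix_vector_mult_diff_distrib)
  have "D ** S ** D + D ** D ** T = D ** (S ** D + D ** T)"
    by (simp add: matrix_add_ldistrib matrix_mul_assoc)
  then have "D ** S ** D + D ** D ** T = 0" by (simp add: z)
  then have "trace (D ** S ** D) + trace (D ** D ** T) = 0"
    by (metis trace_add trace_0 mat_0)
  moreover have "trace (D ** D ** T) = trace (D ** T ** D)"
    by (metis matrix_mul_assoc trace_mul_sym)
  ultimately have sum0: "(\<Sum>i\<in>UNIV. (D *v axis i 1) \<bullet> (S *v (D *v axis i 1)) +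
      (D *v axis i 1) \<bullet> (T *v (D *v axis i 1))) = 0"
    by (simp add: trace_sandwich_eq_sum[OF trD] sum.distrib)
  have pos: "0 < x \<bullet> (S *v x) + x \<bullet> (T *v x)" if "x \<noteq> 0" for x
    using assms(1,2) that by (simp add: positive_definite_def add_pos_pos)
  have nn: "0 \<le> x \<bullet> (S *v x) + x \<bullet> (T *v x)" for x
    using pos[of x] by (cases "x = 0") (auto simp: less_imp_le)
  have "D *v axis i 1 = 0" for i
  proof -
    have "(D *v axis i 1) \<bullet> (S *v (D *v axis i 1)) + (D *v axis i 1) \<bullet> (T *v (D *v axis i 1)) = 0"
      using sum0 nn by (subst (asm) sum_nonneg_eq_0_iff) auto
    then show ?thesis using pos by force
  qed
  then have "D = 0"
    by (simp add: matrix_vector_mult_basis column_def vec_eq_iff)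
  then show ?thesis by (simp add: D_def)
qed

lemma positive_definite_matrix_inv:
  fixes A :: "real ^ 'k::finite ^ 'k"
  assumes "positive_definite A"
  shows "positive_definite (matrix_inv A)"
proof -
  have pos: "\<And>x. x \<noteq> 0 \<Longrightarrow> 0 < x \<bullet> (A *v x)" and tr: "transpose A = A"
    using assms by (auto simp: positive_definite_def)
  have ker: "A *v x = 0 \<Longrightarrow> x = 0" for x using pos[of x] by force
  have "inj ((*v) A)"
    using ker by (simp add: linear_injective_0[OF matrix_vector_mul_linear])
  then have inv: "invertible A"
    using matrix_left_invertible_injective invertible_left_inverse by blast
  have r: "A ** matrix_inv A = mat 1" and l: "matrix_inv A ** A = mat 1"
    using someI_ex[OF inv[unfolded invertible_def]] by (auto simp: matrix_inv_def)
  have "transpose (matrix_inv A) ** A = mat 1"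
    by (metis matrix_transpose_mul r tr transpose_mat)
  then have "transpose (matrix_inv A) = matrix_inv A"
    by (metis matrix_mul_assoc matrix_mul_lid matrix_mul_rid r)
  moreover have "0 < x \<bullet> (matrix_inv A *v x)" if "x \<noteq> 0" for x
  proof -
    define y where "y = matrix_inv A *v x"
    have Ay: "A *v y = x" by (simp add: y_def matrix_vector_mul_assoc r)
    then have "y \<noteq> 0" using that by auto
    from pos[OF this, unfolded Ay] show ?thesis by (simp add: y_def inner_commute)
  qed
  ultimately show ?thesis by (simp add: positive_definite_def)
qed

text \<open>Existence and uniqueness of the root give the definite description a value.\<close>

lemma inverse_sqrt_matrix:
  fixes A :: "real ^ 'k::finite ^ 'k"
  assumes "positive_definite A"
  shows "positive_definite (inverse_sqrt_matrix A)"
    "inverse_sqrt_matrix A ** inverse_sqrt_matrix A = matrix_inv A"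
proof -
  have "\<exists>!S. positive_definite S \<and> S ** S = matrix_inv A"
    using positive_definite_sqrt_exists[OF positive_definite_matrix_inv[OF assms]]
      positive_definite_sqrt_unique by metis
  from theI'[OF this] show "positive_definite (inverse_sqrt_matrix A)"
    "inverse_sqrt_matrix A ** inverse_sqrt_matrix A = matrix_inv A"
    by (simp_all add: inverse_sqrt_matrix_def)
qed

text \<open>Reconciles the two ways in which the covariance enters: by its inverse in the Gaussian
  density, by the root of the inverse in the potential.\<close>

lemma norm_inverse_sqrt_matrix:
  fixes A :: "real ^ 'k::finite ^ 'k"
  assumes "positive_definite A"
  shows "(norm (inverse_sqrt_matrix A *v z))\<^sup>2 = z \<bullet> (matrix_inv A *v z)"
proof -
  let ?S = "inverse_sqrt_matrix A"
  have "transpose ?S = ?S" using inverse_sqrt_matrix[OF assms] by (simp add: positive_definite_def)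
  then have "(?S *v z) \<bullet> (?S *v z) = z \<bullet> (?S *v (?S *v z))"
    by (metis dot_lmul_matrix transpose_matrix_vector)
  then show ?thesis
    by (simp add: power2_norm_eq_inner matrix_vector_mul_assoc inverse_sqrt_matrix[OF assms])
qed

section \<open>Bayes' formula for Gaussian noise\<close>

text \<open>For a fixed event both kernels are densities of the same measure with respect to the law
  of \<open>Y\<close>, so they agree almost everywhere. Countability of \<open>C\<close> makes one
  null set serve all of \<open>C\<close>, and probability measures that agree on an
  intersection-stable generator coincide.\<close>

lemma conditional_distribution_AE_unique:
  assumes P: "prob_space P"
    and C: "countable C" "Int_stable C" "C \<subseteq> Pow (space M)" "space M \<in> C"
      "sets M = sigma_sets (space M) C"
    and k: "conditional_distribution P M X N Y \<kappa>"
    and m: "conditional_distribution P M X N Y \<mu>"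
  shows "AE y in distr P N Y. \<kappa> y = \<mu> y"
proof -
  have Y: "Y \<in> measurable P N" using k by (simp add: conditional_distribution_def)
  interpret P: prob_space P by fact
  interpret L: prob_space "distr P N Y" by (rule P.prob_space_distr) fact
  have meas: "(\<lambda>y. emeasure (\<nu> y) A) \<in> borel_measurable N"
    if "conditional_distribution P M X N Y \<nu>" "A \<in> sets M" for \<nu> A
    using that by (auto simp: conditional_distribution_def
        intro: measurable_emeasure_kernel measurable_prob_algebraD)
  have eq: "AE y in distr P N Y. emeasure (\<kappa> y) A = emeasure (\<mu> y) A" if A: "A \<in> sets M" for A
  proof (rule L.density_unique)
    show "(\<lambda>y. emeasure (\<kappa> y) A) \<in> borel_measurable (distr P N Y)"
      "(\<lambda>y. emeasure (\<mu> y) A) \<in> borel_measurable (distr P N Y)"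
      using meas[OF k A] meas[OF m A] by simp_all
    show "density (distr P N Y) (\<lambda>y. emeasure (\<kappa> y) A) = density (distr P N Y) (\<lambda>y. emeasure (\<mu> y) A)"
    proof (rule measure_eqI)
      fix B assume "B \<in> sets (density (distr P N Y) (\<lambda>y. emeasure (\<kappa> y) A))"
      then have B: "B \<in> sets N" by simp
      show "emeasure (density (distr P N Y) (\<lambda>y. emeasure (\<kappa> y) A)) B =
          emeasure (density (distr P N Y) (\<lambda>y. emeasure (\<mu> y) A)) B"
        using k m A B meas[OF k A] meas[OF m A]
        by (simp add: emeasure_density conditional_distribution_def)
    qed simp
  qed
  have "AE y in distr P N Y. \<forall>A\<in>C. emeasure (\<kappa> y) A = emeasure (\<mu> y) A"
    using C by (subst AE_ball_countable) (auto intro!: eq sigma_sets.Basic)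
  moreover have "AE y in distr P N Y. y \<in> space N" by (rule AE_I2) simp
  ultimately show ?thesis
  proof eventually_elim
    case (elim y)
    have "\<kappa> y \<in> space (prob_algebra M)" "\<mu> y \<in> space (prob_algebra M)"
      using elim(2) k m by (auto simp: conditional_distribution_def dest: measurable_space)
    then have s: "sets (\<kappa> y) = sets M" "sets (\<mu> y) = sets M" "prob_space (\<kappa> y)"
      by (auto simp: space_prob_algebra)
    interpret K: prob_space "\<kappa> y" by fact
    show ?case
    proof (rule measure_eqI_generator_eq[OF C(2,3)])
      show "range (\<lambda>_::nat. space M) \<subseteq> C" using C(4) by auto
    qed (use elim(1) s C in auto)
  qed
qed

section \<open>Likelihood, evidence and posterior for Gaussian noise\<close>

locale gaussian_inverse_problem = prob_space \<mu>0 for \<mu>0 :: "'a measure" +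
  fixes obs :: "'a \<Rightarrow> real ^ 'k::finite" and \<Gamma> :: "real ^ 'k ^ 'k"
  assumes obs[measurable]: "obs \<in> borel_measurable \<mu>0"
    and positive_definite: "positive_definite \<Gamma>"
begin

text \<open>Ratio of the noise densities at \<open>y - obs w\<close> and at
  \<open>y\<close>.\<close>

definition likelihood :: "real ^ 'k \<Rightarrow> 'a \<Rightarrow> real" where
  "likelihood y w = exp (- potential \<Gamma> obs w y)"

definition evidence :: "real ^ 'k \<Rightarrow> real" where
  "evidence y = (\<integral>w. likelihood y w \<partial>\<mu>0)"

definition posterior :: "real ^ 'k \<Rightarrow> 'a measure" where
  "posterior y = density \<mu>0 (\<lambda>w. ennreal (1 / evidence y * likelihood y w))"

text \<open>Turns the noise into a standard normal vector.\<close>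

definition whiten :: "real ^ 'k \<Rightarrow> real ^ 'k" where
  "whiten v = inverse_sqrt_matrix \<Gamma> *v v"

lemma bounded_linear_whiten: "bounded_linear whiten"
  unfolding whiten_def[abs_def] by (rule matrix_vector_mul_bounded_linear)

lemmas whiten_diff = bounded_linear.linear[OF bounded_linear_whiten, THEN linear_diff]
  and whiten_neg = bounded_linear.linear[OF bounded_linear_whiten, THEN linear_neg]

text \<open>The terms quadratic in \<open>y\<close> cancel. The exponent is affine in the data, and
  its negative quadratic term in \<open>obs w\<close> tames the unbounded observation; all bounds
  uniform in \<open>w\<close> rest on this form.\<close>

lemma likelihood_eq:
  "likelihood y w = exp (whiten y \<bullet> whiten (obs w) - 1 / 2 * (norm (whiten (obs w)))\<^sup>2)"
  by (simp add: likelihood_def potential_def whiten_def[symmetric] whiten_diff power2_norm_eq_inner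
      inner_diff_left inner_diff_right inner_commute algebra_simps)

lemma measurable_whiten[measurable]: "whiten \<in> borel_measurable borel"
  by (intro borel_measurable_continuous_onI linear_continuous_on bounded_linear_whiten)

lemma measurable_gaussian_density[measurable]: "centered_gaussian_density \<Gamma> \<in> borel_measurable borel"
  unfolding centered_gaussian_density_def norm_inverse_sqrt_matrix[OF positive_definite, symmetric]
    whiten_def[symmetric]
  by measurable

lemma likelihood_measurable[measurable (raw)]:
  assumes [measurable]: "f \<in> borel_measurable N" "g \<in> measurable N \<mu>0"
  shows "(\<lambda>x. likelihood (f x) (g x)) \<in> borel_measurable N"
  unfolding likelihood_eq by measurable

lemma likelihood_measurable1: "likelihood y \<in> borel_measurable \<mu>0"
  by measurable

lemma likelihood_pos: "likelihood y w > 0"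
  by (simp add: likelihood_def)

lemma gaussian_completion:
  fixes a b :: real
  shows "b * a - 1 / 2 * a\<^sup>2 \<le> 1 / 2 * b\<^sup>2"
  using zero_le_power2[of "a - b"] by (simp add: power2_diff field_simps)

text \<open>Cauchy-Schwarz and completing the square in \<open>norm (whiten (obs w))\<close> remove
  \<open>w\<close> from the bound.\<close>

lemma likelihood_le: "likelihood y w \<le> exp (1 / 2 * (norm (whiten y))\<^sup>2)"
  unfolding likelihood_eq
  using gaussian_completion[of "norm (whiten y)" "norm (whiten (obs w))"]
    norm_cauchy_schwarz[of "whiten y" "whiten (obs w)"] by simp

lemma likelihood_integrable: "integrable \<mu>0 (likelihood y)"
  by (rule integrable_const_bound[where B="exp (1 / 2 * (norm (whiten y))\<^sup>2)"])
    (use likelihood_le likelihood_pos in \<open>auto simp: less_imp_le abs_of_pos\<close>)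

lemma evidence_pos: "evidence y > 0"
  unfolding evidence_def
  using integral_less_AE_space[of "\<lambda>_. 0" "likelihood y"]
  by (simp add: likelihood_integrable likelihood_pos emeasure_space_1)

lemma nn_integral_likelihood: "(\<integral>\<^sup>+w. ennreal (likelihood y w) \<partial>\<mu>0) = ennreal (evidence y)"
  unfolding evidence_def
  by (rule nn_integral_eq_integral) (auto simp: likelihood_integrable likelihood_pos less_imp_le)

lemma evidence_measurable[measurable]: "evidence \<in> borel_measurable borel"
proof -
  have "(\<lambda>y. evidence y) \<in> borel_measurable borel"
    unfolding evidence_def by (rule borel_measurable_lebesgue_integral) measurable
  then show ?thesis .
qed

lemma sets_posterior[simp]: "sets (posterior y) = sets \<mu>0"
  by (simp add: posterior_def)

lemma emeasure_posterior:
  assumes "A \<in> sets \<mu>0"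
  shows "emeasure (posterior y) A = (\<integral>\<^sup>+w. ennreal (1 / evidence y * likelihood y w) * indicator A w \<partial>\<mu>0)"
  unfolding posterior_def by (rule emeasure_density) (use assms in measurable)

text \<open>Clears the division in the posterior density; the right-hand side is the inner integral
  that Fubini produces in the disintegration.\<close>

lemma evidence_emeasure_posterior:
  assumes A[measurable]: "A \<in> sets \<mu>0"
  shows "ennreal (evidence y) * emeasure (posterior y) A = (\<integral>\<^sup>+w. ennreal (likelihood y w) * indicator A w \<partial>\<mu>0)"
proof -
  have "ennreal (evidence y) * emeasure (posterior y) A =
      (\<integral>\<^sup>+w. ennreal (evidence y) * (ennreal (1 / evidence y * likelihood y w) * indicator A w) \<partial>\<mu>0)"
    unfolding emeasure_posterior[OF A] by (rule nn_integral_cmult[symmetric]) measurable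
  also have "\<dots> = (\<integral>\<^sup>+w. ennreal (likelihood y w) * indicator A w \<partial>\<mu>0)"
    using evidence_pos[of y]
    by (intro nn_integral_cong) (simp add: mult.assoc[symmetric] ennreal_mult'[symmetric])
  finally show ?thesis .
qed

lemma prob_space_posterior: "prob_space (posterior y)"
proof
  have "ennreal (evidence y) * emeasure (posterior y) (space \<mu>0) = ennreal (evidence y) * 1"
    unfolding evidence_emeasure_posterior[OF sets.top]
    by (simp add: nn_integral_likelihood[symmetric] cong: nn_integral_cong)
  then have "emeasure (posterior y) (space \<mu>0) = 1"
    using evidence_pos[of y] by (subst (asm) ennreal_mult_cancel_left) auto
  then show "emeasure (posterior y) (space (posterior y)) = 1"
    by (simp add: posterior_def)
qed

text \<open>The target \<open>M\<close> is separate from the prior because the kernel has to map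
  into \<open>distribution_space\<close>, which shares only its measurable sets with the
  prior.\<close>

lemma measurable_posterior:
  assumes "sets M = sets \<mu>0"
  shows "posterior \<in> measurable borel (prob_algebra M)"
proof (rule measurable_prob_algebraI)
  show "prob_space (posterior y)" for y by (rule prob_space_posterior)
  show "posterior \<in> measurable borel (subprob_algebra M)"
  proof (rule measurable_subprob_algebra)
    show "subprob_space (posterior y)" for y
      using prob_space_posterior by (rule prob_space_imp_subprob_space)
    show "sets (posterior y) = sets M" for y using assms by simp
    fix A assume "A \<in> sets M"
    then have A[measurable]: "A \<in> sets \<mu>0" using assms by simp
    show "(\<lambda>y. emeasure (posterior y) A) \<in> borel_measurable borel"
      unfolding emeasure_posterior[OF A] by measurable
  qed
qed

lemma RN_deriv_posterior:
  "AE w in \<mu>0. RN_deriv \<mu>0 (posterior y) w = ennreal (1 / evidence y * likelihood y w)"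
  using RN_deriv_unique[of "\<lambda>w. ennreal (1 / evidence y * likelihood y w)" "posterior y"]
  by (auto simp: posterior_def elim: AE_mp)

lemma absolutely_continuous_posterior: "absolutely_continuous \<mu>0 (posterior y)"
  unfolding posterior_def by (rule absolutely_continuousI_density) measurable

text \<open>The posterior density is strictly positive. Hence whatever dominates a posterior
  dominates the prior, which allows an arbitrary reference measure in the Hellinger
  estimate.\<close>

lemma absolutely_continuous_prior: "absolutely_continuous (posterior y) \<mu>0"
  unfolding absolutely_continuous_def
proof
  fix A assume "A \<in> null_sets (posterior y)"
  then have "A \<in> sets \<mu>0" "AE w in \<mu>0. w \<in> A \<longrightarrow> ennreal (1 / evidence y * likelihood y w) = 0"
    unfolding posterior_def by (auto simp: null_sets_density_iff)
  moreover have "1 / evidence y * likelihood y w > 0" for w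
    using evidence_pos[of y] likelihood_pos[of y w] by simp
  then have "ennreal (1 / evidence y * likelihood y w) \<noteq> 0" for w
    by (simp only: ennreal_eq_0_iff not_le)
  ultimately have "AE w in \<mu>0. w \<notin> A" by simp
  then show "A \<in> null_sets \<mu>0" using \<open>A \<in> sets \<mu>0\<close> by (simp add: AE_iff_null_sets)
qed

text \<open>Shows the origin of the term in \<open>y\<close> alone that the potential subtracts: up
  to sign it is the exponent of the noise density at \<open>y\<close>.\<close>

lemma gaussian_density_shift:
  "centered_gaussian_density \<Gamma> (y - obs w) = centered_gaussian_density \<Gamma> y * likelihood y w"
  by (simp add: centered_gaussian_density_def likelihood_def potential_def
      norm_inverse_sqrt_matrix[OF positive_definite] exp_add[symmetric] exp_minus exp_diff field_simps)

text \<open>By independence the joint law of \<open>X\<close> and the noise is a product. The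
  substitution \<open>y = obs w + z\<close> and Fubini give the pair of unknown and data the density
  noise density at \<open>y\<close> times \<open>likelihood y w\<close>, which factors into the law
  of the data and the posterior.\<close>

lemma conditional_distribution_posterior:
  assumes P: "prob_space P" and M: "sets M = sets \<mu>0"
    and X: "X \<in> measurable P M" "distr P M X = \<mu>0"
    and noise: "distributed P lborel \<eta> (\<lambda>z. ennreal (centered_gaussian_density \<Gamma> z))"
    and ind: "independent_vars P M X borel \<eta>"
  shows "conditional_distribution P M X borel (\<lambda>\<omega>. obs (X \<omega>) + \<eta> \<omega>) posterior"
proof -
  interpret P: prob_space P by fact
  let ?g = "\<lambda>z. ennreal (centered_gaussian_density \<Gamma> z)"
  let ?N = "distr P borel \<eta>"
  let ?Y = "\<lambda>\<omega>. obs (X \<omega>) + \<eta> \<omega>"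
  have \<eta>[measurable]: "\<eta> \<in> borel_measurable P" using ind by (simp add: independent_vars_def)
  have Xm[measurable]: "X \<in> measurable P \<mu>0" using X(1) M by (simp cong: measurable_cong_sets)
  have N: "?N = density lborel ?g"
    using noise by (metis distributed_def distr_cong sets_lborel)
  have g: "?g \<in> borel_measurable borel"
    using noise by (simp add: distributed_def)
  interpret N: prob_space ?N by (rule P.prob_space_distr) measurable
  have dX: "distr P \<mu>0 X = \<mu>0" using X(2) M by (metis distr_cong)
  have joint: "\<mu>0 \<Otimes>\<^sub>M ?N = distr P (\<mu>0 \<Otimes>\<^sub>M borel) (\<lambda>\<omega>. (X \<omega>, \<eta> \<omega>))"
  proof (rule pair_measure_eqI)
    show "sigma_finite_measure \<mu>0" "sigma_finite_measure ?N"
      by (rule sigma_finite_measure_axioms N.sigma_finite_measure_axioms)+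
    show "sets (\<mu>0 \<Otimes>\<^sub>M ?N) = sets (distr P (\<mu>0 \<Otimes>\<^sub>M borel) (\<lambda>\<omega>. (X \<omega>, \<eta> \<omega>)))"
      by (simp cong: sets_pair_measure_cong)
    fix A B assume A: "A \<in> sets \<mu>0" and B: "B \<in> sets ?N"
    have A': "A \<in> sets M" and B': "B \<in> sets borel" using A B M by auto
    have "P.prob ((X -` A \<inter> space P) \<inter> (\<eta> -` B \<inter> space P)) =
        P.prob (X -` A \<inter> space P) * P.prob (\<eta> -` B \<inter> space P)"
      using ind A' B' unfolding independent_vars_def by (intro P.indep_setD) auto
    moreover have "(\<lambda>\<omega>. (X \<omega>, \<eta> \<omega>)) -` (A \<times> B) \<inter> space P = (X -` A \<inter> space P) \<inter> (\<eta> -` B \<inter> space P)"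
      by auto
    ultimately have "emeasure (distr P (\<mu>0 \<Otimes>\<^sub>M borel) (\<lambda>\<omega>. (X \<omega>, \<eta> \<omega>))) (A \<times> B) =
        emeasure (distr P \<mu>0 X) A * emeasure ?N B"
      using A B' by (simp add: emeasure_distr P.emeasure_eq_measure ennreal_mult)
    then show "emeasure \<mu>0 A * emeasure ?N B =
        emeasure (distr P (\<mu>0 \<Otimes>\<^sub>M borel) (\<lambda>\<omega>. (X \<omega>, \<eta> \<omega>))) (A \<times> B)"
      by (simp add: dX)
  qed
  have split: "emeasure P {\<omega> \<in> space P. X \<omega> \<in> A \<and> ?Y \<omega> \<in> B} =
      (\<integral>\<^sup>+y. ?g y * ennreal (evidence y) * emeasure (posterior y) A * indicator B y \<partial>lborel)"
    if A[measurable]: "A \<in> sets \<mu>0" and B[measurable]: "B \<in> sets borel" for A B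
  proof -
    have [measurable]: "{p \<in> space (\<mu>0 \<Otimes>\<^sub>M borel). fst p \<in> A \<and> obs (fst p) + snd p \<in> B} \<in> sets (\<mu>0 \<Otimes>\<^sub>M borel)"
      by measurable
    have "{\<omega> \<in> space P. X \<omega> \<in> A \<and> ?Y \<omega> \<in> B} =
        (\<lambda>\<omega>. (X \<omega>, \<eta> \<omega>)) -` {p \<in> space (\<mu>0 \<Otimes>\<^sub>M borel). fst p \<in> A \<and> obs (fst p) + snd p \<in> B} \<inter> space P"
      using measurable_space[OF Xm] by (auto simp: space_pair_measure)
    then have "emeasure P {\<omega> \<in> space P. X \<omega> \<in> A \<and> ?Y \<omega> \<in> B} =
        emeasure (\<mu>0 \<Otimes>\<^sub>M ?N) {p \<in> space (\<mu>0 \<Otimes>\<^sub>M borel). fst p \<in> A \<and> obs (fst p) + snd p \<in> B}"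
      unfolding joint by (simp add: emeasure_distr)
    also have "\<dots> = (\<integral>\<^sup>+w. \<integral>\<^sup>+z. indicator {p \<in> space (\<mu>0 \<Otimes>\<^sub>M borel). fst p \<in> A \<and> obs (fst p) + snd p \<in> B} (w, z) \<partial>?N \<partial>\<mu>0)"
      by (rule N.emeasure_pair_measure) (simp cong: sets_pair_measure_cong)
    also have "\<dots> = (\<integral>\<^sup>+w. \<integral>\<^sup>+z. ?g z * (indicator A w * indicator B (obs w + z)) \<partial>lborel \<partial>\<mu>0)"
      unfolding N by (intro nn_integral_cong, subst nn_integral_density)
        (auto intro!: nn_integral_cong simp: indicator_def space_pair_measure)
    \<comment> \<open>For fixed \<open>w\<close>, translation invariance of Lebesgue measure
      replaces the noise by the data as the variable of integration.\<close>
    also have "\<dots> = (\<integral>\<^sup>+w. \<integral>\<^sup>+y. ?g (y - obs w) * (indicator A w * indicator B y) \<partial>lborel \<partial>\<mu>0)"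
    proof (rule nn_integral_cong)
      fix w
      have "(\<integral>\<^sup>+y. ?g (y - obs w) * (indicator A w * indicator B y) \<partial>lborel) =
          (\<integral>\<^sup>+y. ?g (y - obs w) * (indicator A w * indicator B y) \<partial>(distr lborel borel ((+) (obs w))))"
        by (simp add: lborel_distr_plus)
      also have "\<dots> = (\<integral>\<^sup>+z. ?g z * (indicator A w * indicator B (obs w + z)) \<partial>lborel)"
        by (subst nn_integral_distr) auto
      finally show "(\<integral>\<^sup>+z. ?g z * (indicator A w * indicator B (obs w + z)) \<partial>lborel) =
        (\<integral>\<^sup>+y. ?g (y - obs w) * (indicator A w * indicator B y) \<partial>lborel)" by simp
    qed
    also have "\<dots> = (\<integral>\<^sup>+w. \<integral>\<^sup>+y. ?g y * indicator B y * (ennreal (likelihood y w) * indicator A w) \<partial>lborel \<partial>\<mu>0)"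
      by (intro nn_integral_cong) (simp add: gaussian_density_shift ennreal_mult'' likelihood_pos less_imp_le mult_ac)
    also have "\<dots> = (\<integral>\<^sup>+y. \<integral>\<^sup>+w. ?g y * indicator B y * (ennreal (likelihood y w) * indicator A w) \<partial>\<mu>0 \<partial>lborel)"
    proof -
      interpret pair_sigma_finite \<mu>0 lborel ..
      have [measurable]: "centered_gaussian_density \<Gamma> \<in> borel_measurable lborel" "B \<in> sets lborel"
        using measurable_gaussian_density B by simp_all
      show ?thesis by (rule Fubini'[symmetric]) (unfold split_beta', measurable)
    qed
    also have "\<dots> = (\<integral>\<^sup>+y. ?g y * indicator B y * (ennreal (evidence y) * emeasure (posterior y) A) \<partial>lborel)"
      by (simp add: nn_integral_cmult evidence_emeasure_posterior)
    finally show ?thesis by (simp add: mult_ac)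
  qed
  have pm[measurable]: "(\<lambda>y. emeasure (posterior y) A) \<in> borel_measurable borel" if "A \<in> sets \<mu>0" for A
    using measurable_posterior[OF refl] that
    by (auto intro: measurable_emeasure_kernel measurable_prob_algebraD)
  \<comment> \<open>The case \<open>A = space \<mu>0\<close> of \<open>split\<close>; the posterior
    has mass 1.\<close>
  have law: "distr P borel ?Y = density lborel (\<lambda>y. ?g y * ennreal (evidence y))"
  proof (rule measure_eqI)
    fix B assume "B \<in> sets (distr P borel ?Y)"
    then have B[measurable]: "B \<in> sets borel" by simp
    have "emeasure (distr P borel ?Y) B = emeasure P {\<omega> \<in> space P. X \<omega> \<in> space \<mu>0 \<and> ?Y \<omega> \<in> B}"
      using measurable_space[OF Xm] by (subst emeasure_distr) (auto intro!: arg_cong[where f="emeasure P"])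
    also have "\<dots> = (\<integral>\<^sup>+y. ?g y * ennreal (evidence y) * emeasure (posterior y) (space \<mu>0) * indicator B y \<partial>lborel)"
      by (rule split) auto
    also have "\<dots> = (\<integral>\<^sup>+y. ?g y * ennreal (evidence y) * indicator B y \<partial>lborel)"
      using prob_space.emeasure_space_1[OF prob_space_posterior]
      by (simp add: posterior_def)
    finally show "emeasure (distr P borel ?Y) B = emeasure (density lborel (\<lambda>y. ?g y * ennreal (evidence y))) B"
      by (simp add: emeasure_density)
  qed simp
  show ?thesis
    unfolding conditional_distribution_def
  proof (intro conjI ballI X measurable_posterior M)
    show "?Y \<in> borel_measurable P" by measurable
    fix A :: "'a set" and B :: "(real ^ 'k) set" assume "A \<in> sets M" "B \<in> sets borel"
    then have A[measurable]: "A \<in> sets \<mu>0" and B[measurable]: "B \<in> sets borel" using M by auto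
    show "emeasure P {\<omega> \<in> space P. X \<omega> \<in> A \<and> ?Y \<omega> \<in> B} =
        (\<integral>\<^sup>+y\<in>B. emeasure (posterior y) A \<partial>distr P borel ?Y)"
      unfolding law split[OF A B] by (subst nn_integral_density) (auto simp: mult_ac)
  qed
qed

text \<open>The root of the posterior density is Lipschitz in the data with a constant
  \<open>D\<close> independent of the unknown, and integration against the prior, of mass 1,
  preserves \<open>D\<close>. The reference measure is reduced to the prior by the chain rule for
  densities.\<close>

lemma posterior_hellinger_Lipschitz:
  "\<exists>C. \<forall>y y'. max (norm y) (norm y') \<le> r \<longrightarrow>
     (\<forall>N. reference_measure N (posterior y) (posterior y') \<longrightarrow>
        hellinger_dist N (posterior y) (posterior y') \<le> C * norm (y - y'))"
proof -
  define K where "K = onorm whiten"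
  have K: "norm (whiten v) \<le> K * norm v" for v
    unfolding K_def by (rule onorm[OF bounded_linear_whiten])
  have K0: "K \<ge> 0" unfolding K_def by (rule onorm_pos_le[OF bounded_linear_whiten])
  \<comment> \<open>With \<open>a = norm (whiten (obs w))\<close>, the summand 1 pays for a factor
    \<open>a \<le> exp a\<close>, and \<open>K * r / 2\<close> is the rate of the linear exponent of
    \<open>g\<close>. The maximum of \<open>exp (c * a - a^2 / 4)\<close> over \<open>a\<close> is
    \<open>G\<close>.\<close>
  define c where "c = 1 + 1 / 2 * (K * r)"
  define G where "G = exp (c\<^sup>2)"
  \<comment> \<open>The gradient of \<open>g\<close> in the data is at most \<open>K / 2\<close>
    times \<open>a * g\<close>, and \<open>G\<close> bounds \<open>a * g\<close>.\<close>
  define L where "L = 1 / 2 * K * G"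
  \<comment> \<open>A lower bound for the evidence on the ball of radius \<open>r\<close>: the
    linear term of the exponent is replaced by its lower bound there.\<close>
  define z where "z = (\<integral>w. exp (- (K * r * norm (whiten (obs w))) - 1 / 2 * (norm (whiten (obs w)))\<^sup>2) \<partial>\<mu>0)"
  \<comment> \<open>Product rule for \<open>g\<close> divided by the root of the evidence. The
    evidence has Lipschitz constant \<open>2 * G * L\<close>, since the likelihood is the square of
    \<open>g\<close>.\<close>
  define D where "D = L / sqrt z + G * (2 * G * L / (z * sqrt z))"
  have L0: "L \<ge> 0" and G0: "G > 0" using K0 by (auto simp: L_def G_def)
  define g where "g y w = exp (1 / 2 * (whiten y \<bullet> whiten (obs w)) - 1 / 4 * (norm (whiten (obs w)))\<^sup>2)" for y w
  have g_sq: "likelihood y w = (g y w)\<^sup>2" for y w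
    by (simp add: likelihood_eq g_def power2_eq_square exp_add[symmetric] field_simps)
  have g_pos: "g y w > 0" for y w by (simp add: g_def)
  have lin_quad: "d * a - 1 / 4 * a\<^sup>2 \<le> d\<^sup>2" for a d :: real
    using zero_le_power2[of "a / 2 - d"] by (simp add: power2_diff field_simps)
  have exponent: "1 / 2 * (whiten y \<bullet> whiten (obs w)) \<le> 1 / 2 * (K * r) * norm (whiten (obs w))"
    if "norm y \<le> r" for y w
  proof -
    have "norm (whiten y) \<le> K * r" using K[of y] that K0 by (meson mult_left_mono order_trans)
    then have "norm (whiten y) * norm (whiten (obs w)) \<le> K * r * norm (whiten (obs w))"
      by (rule mult_right_mono) simp
    then show ?thesis using norm_cauchy_schwarz[of "whiten y" "whiten (obs w)"] by simp
  qed
  have g_le: "norm (whiten (obs w)) * g y w \<le> G" "g y w \<le> G" if r: "norm y \<le> r" for y w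
  proof -
    let ?a = "norm (whiten (obs w))"
    have "1 / 2 * (whiten y \<bullet> whiten (obs w)) - 1 / 4 * ?a\<^sup>2 \<le> 1 / 2 * (K * r) * ?a - 1 / 4 * ?a\<^sup>2"
      using exponent[OF r, of w] by simp
    then have g1: "g y w \<le> exp (1 / 2 * (K * r) * ?a - 1 / 4 * ?a\<^sup>2)"
      unfolding g_def by (subst exp_le_cancel_iff)
    have ca: "exp (c * ?a - 1 / 4 * ?a\<^sup>2) \<le> G" unfolding G_def using lin_quad[of c ?a] by simp
    have "?a * g y w \<le> exp ?a * exp (1 / 2 * (K * r) * ?a - 1 / 4 * ?a\<^sup>2)"
      using g1 g_pos[of y w] order_trans[OF _ exp_ge_add_one_self[of ?a], of ?a]
      by (intro mult_mono) auto
    also have "\<dots> = exp (c * ?a - 1 / 4 * ?a\<^sup>2)"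
      by (simp add: c_def exp_add[symmetric] algebra_simps)
    finally show "?a * g y w \<le> G" using ca by simp
    have "1 / 2 * (K * r) * ?a - 1 / 4 * ?a\<^sup>2 \<le> c * ?a - 1 / 4 * ?a\<^sup>2"
      by (simp add: c_def algebra_simps)
    then have "g y w \<le> exp (c * ?a - 1 / 4 * ?a\<^sup>2)" using g1 by (meson exp_le_cancel_iff order_trans)
    then show "g y w \<le> G" using ca by simp
  qed
  have g_Lip: "\<bar>g y w - g y' w\<bar> \<le> L * norm (y - y')" if r: "norm y \<le> r" "norm y' \<le> r" for y y' w
  proof -
    \<comment> \<open>The inequality \<open>1 - exp (- x) \<le> x\<close> bounds the decrease of
      \<open>g\<close> by its value at \<open>y\<close> alone; exchanging \<open>y\<close> and
      \<open>y'\<close> then gives the absolute value.\<close>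
    have one_sided: "g y w - g y' w \<le> L * norm (y - y')" if r: "norm y \<le> r" for y y'
    proof -
      have "1 - exp (- (1 / 2 * (whiten (y - y') \<bullet> whiten (obs w)))) \<le> 1 / 2 * (whiten (y - y') \<bullet> whiten (obs w))"
        using exp_ge_add_one_self[of "- (1 / 2 * (whiten (y - y') \<bullet> whiten (obs w)))"] by linarith
      also have "\<dots> \<le> 1 / 2 * (norm (whiten (y - y')) * norm (whiten (obs w)))"
        using norm_cauchy_schwarz[of "whiten (y - y')" "whiten (obs w)"] by simp
      also have "\<dots> \<le> 1 / 2 * (K * norm (y - y') * norm (whiten (obs w)))"
        using K[of "y - y'"] by (simp add: mult_right_mono)
      finally have "g y w * (1 - exp (- (1 / 2 * (whiten (y - y') \<bullet> whiten (obs w)))))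
          \<le> g y w * (1 / 2 * (K * norm (y - y') * norm (whiten (obs w))))"
        using g_pos[of y w] by (intro mult_left_mono) auto
      also have "\<dots> = 1 / 2 * K * norm (y - y') * (norm (whiten (obs w)) * g y w)" by simp
      also have "\<dots> \<le> 1 / 2 * K * norm (y - y') * G"
        using g_le(1)[OF r, of w] K0 by (intro mult_left_mono) auto
      also have "\<dots> = L * norm (y - y')" by (simp add: L_def)
      also have "g y w * (1 - exp (- (1 / 2 * (whiten (y - y') \<bullet> whiten (obs w))))) = g y w - g y' w"
        by (simp add: g_def right_diff_distrib exp_add[symmetric] whiten_diff inner_diff_left algebra_simps)
      finally show ?thesis .
    qed
    show ?thesis using one_sided[OF r(1), of y'] one_sided[OF r(2), of y] by (simp add: norm_minus_commute abs_le_iff)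
  qed
  have g_meas[measurable]: "g y \<in> borel_measurable \<mu>0" for y unfolding g_def by measurable
  have z_pos: "z > 0" and z_le: "z \<le> evidence y" if r: "norm y \<le> r" for y
  proof -
    have r0: "r \<ge> 0" using r norm_ge_zero order_trans by blast
    have int: "integrable \<mu>0 (\<lambda>w. exp (- (K * r * norm (whiten (obs w))) - 1 / 2 * (norm (whiten (obs w)))\<^sup>2))"
    proof (rule integrable_const_bound[where B=1])
      have "- (K * r * norm (whiten (obs w))) - 1 / 2 * (norm (whiten (obs w)))\<^sup>2 \<le> 0" for w
        using mult_nonneg_nonneg[OF mult_nonneg_nonneg[OF K0 r0] norm_ge_zero[of "whiten (obs w)"]]
          zero_le_power2[of "norm (whiten (obs w))"] by linarith
      then show "AE w in \<mu>0. norm (exp (- (K * r * norm (whiten (obs w))) - 1 / 2 * (norm (whiten (obs w)))\<^sup>2)) \<le> 1"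
        by simp
    qed measurable
    show "z > 0" unfolding z_def
      using integral_less_AE_space[OF _ int, of "\<lambda>_. 0"] by (simp add: emeasure_space_1)
    have "- (K * r * norm (whiten (obs w))) \<le> whiten y \<bullet> whiten (obs w)" for w
      using exponent[of "- y" w] r by (simp add: mult_minus_right whiten_neg)
    then show "z \<le> evidence y" unfolding z_def evidence_def
      by (intro integral_mono[OF int likelihood_integrable]) (simp add: likelihood_eq)
  qed
  have Z_Lip: "\<bar>evidence y - evidence y'\<bar> \<le> 2 * G * L * norm (y - y')" if r: "norm y \<le> r" "norm y' \<le> r" for y y'
  proof -
    have "\<bar>likelihood y w - likelihood y' w\<bar> \<le> 2 * G * L * norm (y - y')" for w
    proof -
      have "\<bar>likelihood y w - likelihood y' w\<bar> = \<bar>g y w + g y' w\<bar> * \<bar>g y w - g y' w\<bar>"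
        by (simp add: g_sq abs_mult[symmetric] power2_eq_square algebra_simps)
      also have "\<dots> \<le> (2 * G) * (L * norm (y - y'))"
        using g_le(2)[OF r(1), of w] g_le(2)[OF r(2), of w] g_Lip[OF r, of w] g_pos[of y w] g_pos[of y' w] G0
        by (intro mult_mono) auto
      finally show ?thesis by simp
    qed
    then have "\<bar>\<integral>w. likelihood y w - likelihood y' w \<partial>\<mu>0\<bar> \<le> (\<integral>w. 2 * G * L * norm (y - y') \<partial>\<mu>0)"
      using likelihood_integrable
      by (intro order_trans[OF integral_abs_bound] integral_mono) auto
    then show ?thesis using likelihood_integrable by (simp add: evidence_def prob_space)
  qed
  have h_Lip: "\<bar>sqrt (1 / evidence y * likelihood y w) - sqrt (1 / evidence y' * likelihood y' w)\<bar> \<le> D * norm (y - y')"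
    if r: "norm y \<le> r" "norm y' \<le> r" for y y' w
  proof -
    let ?Z = "evidence y" and ?Z' = "evidence y'"
    note zs = z_pos[OF r(1)] z_le[OF r(1)] z_le[OF r(2)]
    have sq: "sqrt (1 / evidence y * likelihood y w) = g y w / sqrt (evidence y)" for y
      using g_pos[of y w] by (simp add: g_sq real_sqrt_mult real_sqrt_divide)
    have s: "sqrt z \<le> sqrt ?Z" "sqrt z \<le> sqrt ?Z'" "sqrt z > 0" using zs by auto
    have sp: "sqrt ?Z > 0" "sqrt ?Z' > 0" using s by linarith+
    have diff: "\<bar>1 / sqrt ?Z - 1 / sqrt ?Z'\<bar> \<le> 2 * G * L / (z * sqrt z) * norm (y - y')"
    proof -
      have le: "sqrt z \<le> sqrt ?Z' + sqrt ?Z" using s sp by linarith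
      have "?Z' - ?Z = (sqrt ?Z' - sqrt ?Z) * (sqrt ?Z' + sqrt ?Z)"
        using zs by (simp add: algebra_simps)
      then have "\<bar>?Z' - ?Z\<bar> = \<bar>sqrt ?Z' - sqrt ?Z\<bar> * (sqrt ?Z' + sqrt ?Z)"
        using sp by (simp add: abs_mult)
      moreover have "\<bar>sqrt ?Z' - sqrt ?Z\<bar> * sqrt z \<le> \<bar>sqrt ?Z' - sqrt ?Z\<bar> * (sqrt ?Z' + sqrt ?Z)"
        by (rule mult_left_mono[OF le]) simp
      ultimately have "\<bar>sqrt ?Z' - sqrt ?Z\<bar> * sqrt z \<le> 2 * G * L * norm (y - y')"
        using Z_Lip[OF r] by (simp add: abs_minus_commute)
      then have a: "\<bar>sqrt ?Z' - sqrt ?Z\<bar> \<le> 2 * G * L * norm (y - y') / sqrt z"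
        using s(3) by (simp add: pos_le_divide_eq)
      have "z = sqrt z * sqrt z" using zs by simp
      also have "\<dots> \<le> sqrt ?Z * sqrt ?Z'" using s by (intro mult_mono) auto
      finally have b: "z \<le> sqrt ?Z * sqrt ?Z'" .
      have "1 / sqrt ?Z - 1 / sqrt ?Z' = (sqrt ?Z' - sqrt ?Z) / (sqrt ?Z * sqrt ?Z')"
        using sp by (simp add: diff_frac_eq)
      then have "\<bar>1 / sqrt ?Z - 1 / sqrt ?Z'\<bar> = \<bar>sqrt ?Z' - sqrt ?Z\<bar> / (sqrt ?Z * sqrt ?Z')"
        using sp by (simp add: abs_mult)
      also have "\<dots> \<le> (2 * G * L * norm (y - y') / sqrt z) / z"
        using a b zs L0 G0 by (intro frac_le) auto
      finally show ?thesis by (simp add: mult_ac)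
    qed
    have "\<bar>g y w / sqrt ?Z - g y' w / sqrt ?Z'\<bar> =
        \<bar>(g y w - g y' w) / sqrt ?Z + g y' w * (1 / sqrt ?Z - 1 / sqrt ?Z')\<bar>"
      by (simp add: diff_divide_distrib right_diff_distrib)
    also have "\<dots> \<le> \<bar>g y w - g y' w\<bar> / sqrt ?Z + g y' w * \<bar>1 / sqrt ?Z - 1 / sqrt ?Z'\<bar>"
      using sp g_pos[of y' w] by (intro order_trans[OF abs_triangle_ineq]) (simp add: abs_mult)
    also have "\<dots> \<le> L * norm (y - y') / sqrt z + G * (2 * G * L / (z * sqrt z) * norm (y - y'))"
      using g_Lip[OF r, of w] g_le(2)[OF r(2), of w] diff s g_pos[of y' w] L0 G0
      by (intro add_mono frac_le mult_mono) auto
    also have "\<dots> = D * norm (y - y')" by (simp add: D_def algebra_simps)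
    finally show ?thesis unfolding sq .
  qed
  show ?thesis
  proof (intro exI[of _ D] allI impI)
    fix y y' and N :: "'a measure"
    assume "max (norm y) (norm y') \<le> r" and N: "reference_measure N (posterior y) (posterior y')"
    then have r: "norm y \<le> r" "norm y' \<le> r" by auto
    interpret N: sigma_finite_measure N using N by (simp add: reference_measure_def)
    have sN: "sets \<mu>0 = sets N" using N by (simp add: reference_measure_def)
    have ac: "absolutely_continuous N \<mu>0"
      using N absolutely_continuous_prior[of y] unfolding reference_measure_def absolutely_continuous_def
      by (meson order_trans)
    define R where "R = RN_deriv N \<mu>0"
    have R[measurable]: "R \<in> borel_measurable N" by (simp add: R_def)
    have dR: "density N R = \<mu>0" unfolding R_def by (rule N.density_RN_deriv[OF ac sN])
    have Rfin: "AE w in N. R w \<noteq> \<infinity>"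
      unfolding R_def by (rule N.RN_deriv_finite) (use sigma_finite_measure_axioms ac sN in auto)
    have lm: "likelihood v \<in> borel_measurable N" for v
      using likelihood_measurable1[of v] sN by (simp cong: measurable_cong_sets)
    note [measurable] = lm
    \<comment> \<open>Chain rule through the prior, with \<open>R\<close> the density of the prior
      in \<open>N\<close>. The common factor \<open>R\<close> comes out of the squared difference of
      roots and turns the integral over \<open>N\<close> into one over the prior.\<close>
    have RNp: "AE w in N. RN_deriv N (posterior v) w = R w * ennreal (1 / evidence v * likelihood v w)" for v
    proof -
      have "density N (\<lambda>w. R w * ennreal (1 / evidence v * likelihood v w)) =
          density (density N R) (\<lambda>w. ennreal (1 / evidence v * likelihood v w))"
        by (subst density_density_eq) measurable
      then have "density N (\<lambda>w. R w * ennreal (1 / evidence v * likelihood v w)) = posterior v"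
        by (simp add: dR posterior_def)
      from N.RN_deriv_unique[OF _ this] show ?thesis by (auto elim!: AE_mp)
    qed
    let ?d = "\<lambda>w. (sqrt (1 / evidence y * likelihood y w) - sqrt (1 / evidence y' * likelihood y' w))\<^sup>2"
    have nn: "0 \<le> 1 / evidence v * likelihood v w" for v w
      using evidence_pos[of v] likelihood_pos[of v w] by simp
    have "(\<integral>w. (sqrt (enn2real (RN_deriv N (posterior y) w)) - sqrt (enn2real (RN_deriv N (posterior y') w)))\<^sup>2 \<partial>N)
        = (\<integral>w. enn2real (R w) * ?d w \<partial>N)"
    proof (rule integral_cong_AE)
      show "AE w in N. (sqrt (enn2real (RN_deriv N (posterior y) w)) - sqrt (enn2real (RN_deriv N (posterior y') w)))\<^sup>2
          = enn2real (R w) * ?d w"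
        using RNp[of y] RNp[of y'] Rfin
      proof eventually_elim
        case (elim w)
        have *: "(sqrt a * b - sqrt a * c)\<^sup>2 = a * (b - c)\<^sup>2" if "a \<ge> 0" for a b c :: real
          using that by (simp add: right_diff_distrib[symmetric] power_mult_distrib)
        have "sqrt (enn2real (RN_deriv N (posterior y) w)) = sqrt (enn2real (R w)) * sqrt (1 / evidence y * likelihood y w)"
          by (subst real_sqrt_mult[symmetric]) (simp only: elim(1) enn2real_mult enn2real_ennreal[OF nn])
        moreover have "sqrt (enn2real (RN_deriv N (posterior y') w)) = sqrt (enn2real (R w)) * sqrt (1 / evidence y' * likelihood y' w)"
          by (subst real_sqrt_mult[symmetric]) (simp only: elim(2) enn2real_mult enn2real_ennreal[OF nn])
        ultimately show ?case using *[OF enn2real_nonneg] by simp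
      qed
    qed measurable
    also have "\<dots> = (\<integral>w. ?d w \<partial>\<mu>0)"
      unfolding R_def by (rule N.RN_deriv_integral[symmetric]) (use sigma_finite_measure_axioms ac sN in auto)
    also have "\<dots> \<le> (\<integral>w. (D * norm (y - y'))\<^sup>2 \<partial>\<mu>0)"
    proof (rule integral_mono_AE)
      have *: "?d w \<le> (D * norm (y - y'))\<^sup>2" for w
        using h_Lip[OF r, of w] by (metis abs_ge_zero power2_abs power_mono)
      show "integrable \<mu>0 ?d"
        by (rule integrable_const_bound[where B="(D * norm (y - y'))\<^sup>2"]) (use * in auto)
      show "AE w in \<mu>0. ?d w \<le> (D * norm (y - y'))\<^sup>2" using * by simp
    qed simp
    also have "\<dots> = (D * norm (y - y'))\<^sup>2" by (simp add: prob_space)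
    finally have H: "(\<integral>w. (sqrt (enn2real (RN_deriv N (posterior y) w)) - sqrt (enn2real (RN_deriv N (posterior y') w)))\<^sup>2 \<partial>N)
        \<le> (D * norm (y - y'))\<^sup>2" .
    have D0: "D \<ge> 0" using L0 G0 z_pos[OF r(1)] by (simp add: D_def)
    have half: "1 / 2 * I \<le> b\<^sup>2" if "I \<le> b\<^sup>2" for I b :: real
      using that zero_le_power2[of b] by linarith
    have "hellinger_dist N (posterior y) (posterior y') \<le> sqrt ((D * norm (y - y'))\<^sup>2)"
      unfolding hellinger_dist_def by (rule real_sqrt_le_mono[OF half[OF H]])
    then show "hellinger_dist N (posterior y) (posterior y') \<le> D * norm (y - y')"
      using D0 by simp
  qed
qed

end

section \<open>Test functions and finite differences\<close>

lemma partial_deriv_eq: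
  assumes "(f has_derivative f') (at x)"
  shows "partial_deriv b f x = f' b"
  using frechet_derivative_at[OF assms] by (simp add: partial_deriv_def)

lemma partial_deriv_directional:
  fixes f :: "'a::euclidean_space \<Rightarrow> real"
  assumes "f differentiable (at x)"
  shows "((\<lambda>h. f (x + h *\<^sub>R b)) has_real_derivative partial_deriv b f x) (at 0)"
proof -
  obtain D where D: "(f has_derivative D) (at x)" using assms by (auto simp: differentiable_def)
  have g: "((\<lambda>h::real. x + h *\<^sub>R b) has_derivative (\<lambda>h. h *\<^sub>R b)) (at 0)"
    by (auto intro!: derivative_eq_intros)
  have "((f \<circ> (\<lambda>h. x + h *\<^sub>R b)) has_derivative D \<circ> (\<lambda>h. h *\<^sub>R b)) (at 0)"
    using D by (intro diff_chain_at[OF g]) simp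
  moreover have "D \<circ> (\<lambda>h. h *\<^sub>R b) = (*) (D b)"
    using linear_scale[OF has_derivative_linear[OF D]] by (auto simp: o_def mult.commute)
  ultimately show ?thesis
    by (simp add: has_field_derivative_def o_def partial_deriv_eq[OF D])
qed

lemma Ck_imp_continuous: "Ck k f \<Longrightarrow> continuous_on UNIV f"
  by (cases k) (auto intro!: continuous_at_imp_continuous_on differentiable_imp_continuous_within)

lemma Ck_Suc_D: "Ck (Suc k) f \<Longrightarrow> Ck k f"
proof (induction k arbitrary: f)
  case 0 then show ?case using Ck_imp_continuous[OF 0] by simp
next
  case (Suc k) then show ?case unfolding Ck.simps(2)[of "Suc k" f] Ck.simps(2)[of k f] by blast
qed

lemma Ck_const: "Ck k (\<lambda>_. c)"
proof (induction k arbitrary: c)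
  case (Suc k)
  have "partial_deriv b (\<lambda>_. c) = (\<lambda>_. 0)" for b :: 'a
    using partial_deriv_eq[OF has_derivative_const] by blast
  then show ?case using Suc by simp
qed simp

lemma partial_deriv_linear_combination:
  fixes f g :: "'a::euclidean_space \<Rightarrow> real"
  assumes "\<And>x. f differentiable (at x)" "\<And>x. g differentiable (at x)"
  shows "partial_deriv b (\<lambda>x. c * f x + d * g x) = (\<lambda>x. c * partial_deriv b f x + d * partial_deriv b g x)"
proof
  fix x
  obtain F G where FG: "(f has_derivative F) (at x)" "(g has_derivative G) (at x)"
    using assms by (meson differentiable_def)
  then have "((\<lambda>x. c * f x + d * g x) has_derivative (\<lambda>h. c * F h + d * G h)) (at x)"
    by (auto intro!: derivative_eq_intros)
  then show "partial_deriv b (\<lambda>x. c * f x + d * g x) x = c * partial_deriv b f x + d * partial_deriv b g x"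
    using FG by (simp add: partial_deriv_eq)
qed

lemma Ck_linear_combination:
  fixes f g :: "'a::euclidean_space \<Rightarrow> real"
  shows "Ck k f \<Longrightarrow> Ck k g \<Longrightarrow> Ck k (\<lambda>x. c * f x + d * g x)"
proof (induction k arbitrary: f g)
  case 0 then show ?case by (auto intro!: continuous_intros)
next
  case (Suc k)
  then show ?case
    by (auto simp: partial_deriv_linear_combination intro!: derivative_intros)
qed

lemma smooth_partial_deriv: "smooth f \<Longrightarrow> b \<in> Basis \<Longrightarrow> smooth (partial_deriv b f)"
  unfolding smooth_def using Ck.simps(2) by blast

lemma smooth_iterated_deriv: "smooth f \<Longrightarrow> set bs \<subseteq> Basis \<Longrightarrow> smooth (iterated_deriv bs f)"
  by (induction bs) (auto intro: smooth_partial_deriv)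

lemma smooth_differentiable: "smooth f \<Longrightarrow> f differentiable (at x)"
  unfolding smooth_def using Ck.simps(2) by blast

lemma smooth_continuous: "smooth f \<Longrightarrow> continuous_on UNIV f"
  unfolding smooth_def using Ck_imp_continuous by blast

lemma smooth_linear_combination:
  fixes f g :: "'a::euclidean_space \<Rightarrow> real"
  shows "smooth f \<Longrightarrow> smooth g \<Longrightarrow> smooth (\<lambda>x. c * f x + d * g x)"
  by (simp add: smooth_def Ck_linear_combination)

lemma iterated_deriv_append: "iterated_deriv (as @ bs) f = iterated_deriv as (iterated_deriv bs f)"
  by (induction as) auto

lemma iterated_deriv_linear_combination:
  fixes f g :: "'a::euclidean_space \<Rightarrow> real"
  assumes "smooth f" "smooth g" "set bs \<subseteq> Basis"
  shows "iterated_deriv bs (\<lambda>x. c * f x + d * g x) =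
    (\<lambda>x. c * iterated_deriv bs f x + d * iterated_deriv bs g x)"
  using assms(3)
proof (induction bs)
  case (Cons b bs)
  then show ?case
    by (simp add: partial_deriv_linear_combination smooth_differentiable smooth_iterated_deriv assms)
qed simp


lemma periodic_partial_deriv:
  assumes "periodic f" "\<And>x. f differentiable (at x)"
  shows "periodic (partial_deriv b f :: real ^ 'n::finite \<Rightarrow> real)"
  unfolding periodic_def
proof (intro allI)
  fix x i
  have "((\<lambda>h. f (x + axis i 1 + h *\<^sub>R b)) has_real_derivative partial_deriv b f (x + axis i 1)) (at 0)"
    by (rule partial_deriv_directional) (rule assms)
  moreover have "f (x + axis i 1 + h *\<^sub>R b) = f (x + h *\<^sub>R b)" for h
    using assms(1) by (metis periodic_def add.assoc add.commute)
  ultimately have "((\<lambda>h. f (x + h *\<^sub>R b)) has_real_derivative partial_deriv b f (x + axis i 1)) (at 0)"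
    by simp
  then show "partial_deriv b f (x + axis i 1) = partial_deriv b f x"
    using partial_deriv_directional[OF assms(2)] DERIV_unique by blast
qed

lemma test_functions_partial_deriv:
  "f \<in> test_functions \<Longrightarrow> b \<in> Basis \<Longrightarrow> partial_deriv b f \<in> test_functions"
  by (auto simp: test_functions_def smooth_partial_deriv periodic_partial_deriv smooth_differentiable)

lemma test_functions_iterated_deriv:
  "f \<in> test_functions \<Longrightarrow> set bs \<subseteq> Basis \<Longrightarrow> iterated_deriv bs f \<in> test_functions"
  by (induction bs) (auto intro: test_functions_partial_deriv)

lemma test_functions_linear_combination:
  "f \<in> test_functions \<Longrightarrow> g \<in> test_functions \<Longrightarrow> (\<lambda>x. c * f x + d * g x) \<in> test_functions"
  by (auto simp: test_functions_def periodic_def smooth_linear_combination)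

lemma test_functions_zero: "(\<lambda>x. 0) \<in> test_functions"
  by (auto simp: test_functions_def periodic_def smooth_def Ck_const)

lemma test_functions_sum:
  "(\<And>i. i \<in> I \<Longrightarrow> f i \<in> test_functions) \<Longrightarrow> (\<lambda>x. \<Sum>i\<in>I. c i * f i x) \<in> test_functions"
proof (induction I rule: infinite_finite_induct)
  case (insert i I)
  then have "(\<lambda>x. c i * f i x + 1 * (\<Sum>i\<in>I. c i * f i x)) \<in> test_functions"
    by (intro test_functions_linear_combination) auto
  then show ?case using insert by simp
qed (auto simp: test_functions_zero)

lemma laplacian_test_functions: "f \<in> test_functions \<Longrightarrow> laplacian f \<in> test_functions"
  using test_functions_sum[of Basis "\<lambda>b. partial_deriv b (partial_deriv b f)" "\<lambda>_. 1"]
  unfolding laplacian_def[abs_def] by (simp add: test_functions_partial_deriv)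


section \<open>Real characters of the torus\<close>

text \<open>The phase unites cosine (\<open>a = 0\<close>) and sine (\<open>a = - pi / 2\<close>). A
  partial derivative advances it by \<open>pi / 2\<close> and multiplies by a constant; a
  translation along an axis only changes it.\<close>

definition trig :: "int ^ 'n::finite \<Rightarrow> real \<Rightarrow> real ^ 'n \<Rightarrow> real" where
  "trig p a x = cos (frequency p \<bullet> x + a)"

lemma continuous_trig[continuous_intros]: "continuous_on S (trig p a)"
  unfolding trig_def[abs_def] by (intro continuous_intros)

lemma abs_trig_le: "\<bar>trig p a x\<bar> \<le> 1"
  by (simp add: trig_def)

lemma frequency_axis[simp]: "frequency p \<bullet> axis i h = 2 * pi * of_int (p $ i) * h"
  by (simp add: inner_axis frequency_def)

lemma trig_shift: "trig p a (x + h *\<^sub>R axis i 1) = trig p (a + 2 * pi * of_int (p $ i) * h) x"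
  by (simp add: trig_def inner_add_right algebra_simps)

lemma trig_has_derivative:
  "(trig p a has_derivative (\<lambda>h. (frequency p \<bullet> h) * trig p (a + pi / 2) x)) (at x)"
proof -
  have "(trig p a has_derivative (\<lambda>h. - sin (frequency p \<bullet> x + a) * (frequency p \<bullet> h))) (at x)"
    unfolding trig_def[abs_def] by (auto intro!: derivative_eq_intros)
  moreover have "- sin (frequency p \<bullet> x + a) = trig p (a + pi / 2) x"
    by (simp add: trig_def add.assoc[symmetric] cos_add)
  ultimately show ?thesis by (simp add: mult.commute)
qed

lemma partial_deriv_trig:
  "partial_deriv b (trig p a) = (\<lambda>x. (frequency p \<bullet> b) * trig p (a + pi / 2) x)"
  by (rule ext) (rule partial_deriv_eq[OF trig_has_derivative])

lemma trig_differentiable: "trig p a differentiable (at x)"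
  using trig_has_derivative by (auto simp: differentiable_def)

lemma Ck_cmult: "Ck k f \<Longrightarrow> Ck k (\<lambda>x. c * f x :: real)"
  using Ck_linear_combination[of k f "\<lambda>_. 0" c 0] by (simp add: Ck_const)

lemma Ck_trig: "Ck k (trig p a)"
  by (induction k arbitrary: a)
    (auto simp: partial_deriv_trig trig_differentiable continuous_trig intro!: Ck_cmult)

lemma trig_periodic: "periodic (trig p a)"
  unfolding periodic_def
proof (intro allI)
  fix x i
  have "trig p a (x + axis i 1) = cos ((frequency p \<bullet> x + a) + 2 * pi * of_int (p $ i))"
    by (simp add: trig_def inner_add_right algebra_simps)
  also have "\<dots> = cos (frequency p \<bullet> x + a)" by (simp only: cos_add cos_int_2pin sin_int_2pin) simp
  finally show "trig p a (x + axis i 1) = trig p a x" by (simp add: trig_def)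
qed

lemma trig_test: "trig p a \<in> test_functions"
  by (auto simp: test_functions_def trig_periodic smooth_def Ck_trig)

lemma iterated_deriv_trig:
  "iterated_deriv bs (trig p a) =
    (\<lambda>x. (\<Prod>b\<leftarrow>bs. frequency p \<bullet> b) * trig p (a + real (length bs) * (pi / 2)) x)"
proof (induction bs)
  case (Cons b bs)
  have "partial_deriv b (\<lambda>x. c * trig p d x + 0 * trig p d x) = (\<lambda>x. c * partial_deriv b (trig p d) x + 0 * partial_deriv b (trig p d) x)" for c d
    by (intro partial_deriv_linear_combination trig_differentiable)
  then show ?case using Cons by (simp add: partial_deriv_trig algebra_simps add_divide_distrib)
qed simp

lemma laplacian_trig: "laplacian (trig p a) = (\<lambda>x. - (norm (frequency p))\<^sup>2 * trig p a x)"
proof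
  fix x
  have "partial_deriv b (partial_deriv b (trig p a)) x = - (frequency p \<bullet> b)\<^sup>2 * trig p a x" for b
    using fun_cong[OF iterated_deriv_trig[of "[b, b]" p a], of x]
    by (simp add: power2_eq_square trig_def add.assoc[symmetric])
  then have "laplacian (trig p a) x = - (\<Sum>b\<in>Basis. (frequency p \<bullet> b)\<^sup>2) * trig p a x"
    by (simp add: laplacian_def sum_distrib_right sum_negf)
  also have "(\<Sum>b\<in>Basis. (frequency p \<bullet> b)\<^sup>2) = (norm (frequency p))\<^sup>2"
    unfolding power2_norm_eq_inner by (simp add: power2_eq_square flip: euclidean_inner)
  finally show "laplacian (trig p a) x = - (norm (frequency p))\<^sup>2 * trig p a x" by simp
qed

lemma trig_expand: "trig p a x = cos a * trig p 0 x - sin a * trig p (- pi / 2) x"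
  by (simp add: trig_def cos_add cos_diff mult.commute)


section \<open>Finite differences\<close>

text \<open>Forward differences over any additive type: they serve for functions on the line and in
  space and for coefficients indexed by the lattice.\<close>

primrec fd :: "'a::plus \<Rightarrow> nat \<Rightarrow> ('a \<Rightarrow> 'b::ab_group_add) \<Rightarrow> 'a \<Rightarrow> 'b" where
  "fd h 0 f = f"
| "fd h (Suc M) f = (\<lambda>x. fd h M f (x + h) - fd h M f x)"

lemma continuous_fd:
  fixes f :: "'a::real_normed_vector \<Rightarrow> real"
  assumes "continuous_on UNIV f"
  shows "continuous_on UNIV (fd h M f)"
proof (induction M)
  case (Suc M)
  have "continuous_on UNIV (\<lambda>x. fd h M f (x + h))"
    by (rule continuous_on_compose2[OF Suc]) (auto intro!: continuous_intros)
  then show ?case using Suc by (auto intro!: continuous_intros)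
qed (simp add: assms)

lemma periodic_fd: "periodic f \<Longrightarrow> periodic (fd h M f)"
proof (induction M)
  case (Suc M)
  have eq: "x + axis i 1 + h = x + h + axis i 1" for x i by simp
  show ?case using Suc unfolding periodic_def fd.simps eq by simp
qed simp

lemma has_derivative_fd:
  fixes F G :: "'a::real_normed_vector \<Rightarrow> real"
  assumes "\<And>x. ((\<lambda>s. F (x + s *\<^sub>R b)) has_real_derivative G x) (at 0)"
  shows "((\<lambda>s. fd h M F (x + s *\<^sub>R b)) has_real_derivative fd h M G x) (at 0)"
proof (induction M arbitrary: x)
  case (Suc M)
  have eq: "x + s *\<^sub>R b + h = x + h + s *\<^sub>R b" for s by simp
  show ?case unfolding fd.simps eq by (rule DERIV_diff[OF Suc Suc])
qed (simp add: assms)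

lemma directional_derivative_shift:
  fixes F :: "'a::real_normed_vector \<Rightarrow> real"
  assumes "\<And>x. ((\<lambda>s. F (x + s *\<^sub>R b)) has_real_derivative G x) (at 0)"
  shows "((\<lambda>s. F (x + s *\<^sub>R b)) has_real_derivative G (x + s *\<^sub>R b)) (at s)"
  using assms[of "x + s *\<^sub>R b"]
    DERIV_shift[of "\<lambda>s. F (x + s *\<^sub>R b)" "G (x + s *\<^sub>R b)" 0 s]
  by (simp add: algebra_simps)

lemma directional_mvt:
  fixes F :: "'a::real_normed_vector \<Rightarrow> real"
  assumes d: "\<And>x. ((\<lambda>s. F (x + s *\<^sub>R b)) has_real_derivative G x) (at 0)"
    and B: "\<And>x. \<bar>G x\<bar> \<le> B"
  shows "\<bar>F (x + h *\<^sub>R b) - F x\<bar> \<le> B * \<bar>h\<bar>"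
proof -
  have "norm (F (x + h *\<^sub>R b) - F (x + 0 *\<^sub>R b)) \<le> B * norm (h - 0)"
    by (rule field_differentiable_bound[of UNIV "\<lambda>s. F (x + s *\<^sub>R b)" "\<lambda>s. G (x + s *\<^sub>R b)"])
      (use directional_derivative_shift[of F b G, OF d] B in auto)
  then show ?thesis by simp
qed

text \<open>One application of the mean value theorem per difference. The successive derivatives are
  supplied as a family \<open>F\<close>, so explicit families such as phase-shifted cosines fit as
  well as iterated derivatives.\<close>

lemma abs_fd_le_derivative:
  fixes F :: "nat \<Rightarrow> 'a::real_normed_vector \<Rightarrow> real"
  assumes "\<And>a x. a < M \<Longrightarrow> ((\<lambda>s. F a (x + s *\<^sub>R b)) has_real_derivative F (Suc a) x) (at 0)"
    and "\<And>x. \<bar>F M x\<bar> \<le> B"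
  shows "\<bar>fd (h *\<^sub>R b) M (F 0) x\<bar> \<le> \<bar>h\<bar> ^ M * B"
  using assms
proof (induction M arbitrary: F x)
  case (Suc M)
  have IH: "\<bar>fd (h *\<^sub>R b) M (F (Suc 0)) x\<bar> \<le> \<bar>h\<bar> ^ M * B" for x
    using Suc.IH[of "\<lambda>a. F (Suc a)"] Suc.prems by simp
  have "\<bar>fd (h *\<^sub>R b) M (F 0) (x + h *\<^sub>R b) - fd (h *\<^sub>R b) M (F 0) x\<bar> \<le> (\<bar>h\<bar> ^ M * B) * \<bar>h\<bar>"
    by (rule directional_mvt[OF has_derivative_fd IH]) (use Suc.prems(1)[of 0] in auto)
  then show ?case by (simp add: mult_ac)
qed simp

lemma abs_fd_le_iterated_deriv:
  fixes f :: "'a::euclidean_space \<Rightarrow> real"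
  assumes f: "Ck M f" and b: "b \<in> Basis" and B: "\<And>x. \<bar>iterated_deriv (replicate M b) f x\<bar> \<le> B"
  shows "\<bar>fd (h *\<^sub>R b) M f x\<bar> \<le> \<bar>h\<bar> ^ M * B"
proof -
  have C: "Ck (M - a) (iterated_deriv (replicate a b) f)" if "a \<le> M" for a
    using that
  proof (induction a)
    case (Suc a)
    then have "Ck (Suc (M - Suc a)) (iterated_deriv (replicate a b) f)"
      by (metis Suc_diff_Suc Suc_leD Suc_le_lessD)
    then show ?case using b by simp
  qed (simp add: f)
  have "\<bar>fd (h *\<^sub>R b) M (iterated_deriv (replicate 0 b) f) x\<bar> \<le> \<bar>h\<bar> ^ M * B"
  proof (rule abs_fd_le_derivative[where F="\<lambda>a. iterated_deriv (replicate a b) f"])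
    fix a x assume "a < M"
    then have "Ck (Suc (M - Suc a)) (iterated_deriv (replicate a b) f)"
      using C[of a] by (simp add: Suc_diff_Suc)
    then show "((\<lambda>s. iterated_deriv (replicate a b) f (x + s *\<^sub>R b)) has_real_derivative
        iterated_deriv (replicate (Suc a) b) f x) (at 0)"
      by (auto intro!: partial_deriv_directional)
  qed (rule B)
  then show ?thesis by simp
qed

section \<open>Integration on the torus\<close>

definition lattice_point :: "int ^ 'n::finite \<Rightarrow> real ^ 'n" where
  "lattice_point p = (\<chi> i. of_int (p $ i))"

lemma periodic_axis_int:
  assumes "periodic f"
  shows "f (x + of_int m *\<^sub>R axis i 1) = f x"
proof (induction m rule: int_induct[where k=0])
  case (step1 m)
  have "f (x + of_int m *\<^sub>R axis i 1 + axis i 1) = f x"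
    using assms step1 by (simp add: periodic_def)
  then show ?case by (simp add: algebra_simps)
next
  case (step2 m)
  have "f (x + of_int (m - 1) *\<^sub>R axis i 1) = f (x + of_int (m - 1) *\<^sub>R axis i 1 + axis i 1)"
    using assms by (simp add: periodic_def)
  also have "x + of_int (m - 1) *\<^sub>R axis i 1 + axis i 1 = x + of_int m *\<^sub>R axis i 1"
    by (simp add: algebra_simps)
  finally show ?case using step2 by simp
qed simp

lemma periodic_lattice_point:
  fixes f :: "real ^ 'n::finite \<Rightarrow> 'b"
  assumes "periodic f"
  shows "f (x + lattice_point p) = f x"
proof -
  have "f (x + (\<Sum>i\<in>I. of_int (p $ i) *\<^sub>R axis i 1)) = f x" if "finite I" for I :: "'n set"
    using that
  proof (induction I)
    case (insert i I)
    have "x + (\<Sum>i\<in>insert i I. of_int (p $ i) *\<^sub>R axis i 1) =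
        (x + (\<Sum>i\<in>I. of_int (p $ i) *\<^sub>R axis i 1)) + of_int (p $ i) *\<^sub>R axis i 1"
      using insert by (simp add: algebra_simps)
    then show ?case by (simp only: periodic_axis_int[OF assms] insert.IH)
  qed simp
  moreover have "lattice_point p = (\<Sum>i\<in>UNIV. of_int (p $ i) *\<^sub>R axis i 1)"
    by (simp add: lattice_point_def vec_eq_iff axis_def if_distrib cong: if_cong)
  ultimately show ?thesis by simp
qed

definition wrap :: "real ^ 'n::finite \<Rightarrow> real ^ 'n" where
  "wrap x = (\<chi> i. frac (x $ i))"

lemma wrap_eq: "wrap x = x + lattice_point (\<chi> i. - floor (x $ i))"
  by (simp add: wrap_def lattice_point_def vec_eq_iff frac_def)

lemma wrap_in_cube: "wrap x \<in> unit_cube"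
  by (simp add: wrap_def unit_cube_def frac_lt_1)

lemma wrap_id: "x \<in> unit_cube \<Longrightarrow> wrap x = x"
  by (simp add: wrap_def unit_cube_def vec_eq_iff frac_eq)

lemma periodic_wrap: "periodic f \<Longrightarrow> f (wrap x) = f x"
  unfolding wrap_eq by (rule periodic_lattice_point)

lemma wrap_add_axis[simp]: "wrap (x + axis i 1) = wrap x"
  by (auto simp: wrap_def vec_eq_iff axis_def frac_def)

lemma borel_measurable_vecI:
  fixes f :: "'a \<Rightarrow> real ^ 'n::finite"
  assumes "\<And>i. (\<lambda>x. f x $ i) \<in> borel_measurable M"
  shows "f \<in> borel_measurable M"
  unfolding borel_measurable_euclidean_space[of f]
  using assms by (auto simp: Basis_vec_def inner_axis)

lemma measurable_wrap[measurable]: "wrap \<in> borel_measurable borel"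
  by (rule borel_measurable_vecI) (simp add: wrap_def frac_def)

lemma unit_cube_borel[measurable]: "unit_cube \<in> sets (borel :: (real ^ 'n::finite) measure)"
proof -
  have "unit_cube = (\<Inter>i\<in>UNIV. {x::real ^ 'n. 0 \<le> x $ i \<and> x $ i < 1})"
    by (auto simp: unit_cube_def)
  also have "\<dots> \<in> sets borel"
    by (rule sets.countable_INT'') auto
  finally show ?thesis .
qed

lemma space_torus[simp]: "space torus = unit_cube"
  by (simp add: torus_def space_restrict_space)

lemma sets_torus: "A \<in> sets torus \<longleftrightarrow> A \<in> sets borel \<and> A \<subseteq> unit_cube"
  by (auto simp: torus_def sets_restrict_space)

lemma measurable_torus[measurable_dest]: "f \<in> measurable borel M \<Longrightarrow> f \<in> measurable torus M"
  unfolding torus_def by (rule measurable_restrict_space1) simp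

lemma nn_integral_torus:
  "(\<integral>\<^sup>+x. f x \<partial>torus) = (\<integral>\<^sup>+x. f x * indicator unit_cube x \<partial>lborel)"
  unfolding torus_def by (rule nn_integral_restrict_space) simp

lemma emeasure_torus: "A \<in> sets torus \<Longrightarrow> emeasure torus A = emeasure lborel A"
  unfolding torus_def by (rule emeasure_restrict_space) (auto simp: sets_restrict_space)

lemma unit_cube_subset: "unit_cube \<subseteq> cbox 0 (\<chi> i. 1)" "box 0 (\<chi> i. 1) \<subseteq> unit_cube"
  by (auto simp: unit_cube_def mem_box_cart less_imp_le)

lemma prob_space_torus: "prob_space (torus :: (real ^ 'n::finite) measure)"
proof
  let ?one = "(\<chi> i. 1) :: real ^ 'n"
  have one: "?one \<bullet> b = 1" if "b \<in> Basis" for b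
    using that by (auto simp: Basis_vec_def inner_axis)
  have "emeasure lborel (box 0 ?one) \<le> emeasure lborel (unit_cube :: (real ^ 'n) set)"
    by (rule emeasure_mono[OF unit_cube_subset(2)]) simp
  moreover have "emeasure lborel (unit_cube :: (real ^ 'n) set) \<le> emeasure lborel (cbox 0 ?one)"
    by (rule emeasure_mono[OF unit_cube_subset(1)]) simp
  ultimately have "emeasure lborel (unit_cube :: (real ^ 'n) set) = 1"
    by (simp add: emeasure_lborel_box_eq emeasure_lborel_cbox_eq one)
  then show "emeasure (torus :: (real ^ 'n) measure) (space torus) = 1"
    by (simp add: emeasure_torus sets_torus)
qed

interpretation torus: prob_space "torus :: (real ^ 'n::finite) measure"
  by (rule prob_space_torus)

lemma measure_torus_cube[simp]: "measure torus unit_cube = 1" "emeasure torus unit_cube = 1"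
  using torus.prob_space torus.emeasure_space_1 by simp_all

lemma lattice_enumeration: "\<exists>e :: nat \<Rightarrow> int ^ 'n::finite. bij e"
proof -
  have "inj (\<lambda>m::int. \<chi> i::'n. m)" by (auto simp: inj_def vec_eq_iff)
  then have "infinite (UNIV :: (int ^ 'n) set)"
    by (metis finite_imageD finite_subset infinite_UNIV_int subset_UNIV)
  from bij_betw_from_nat_into[OF countableI_type this] show ?thesis by blast
qed

text \<open>Half-openness of the cube makes the tiling of space exact, without a null set of
  overlaps.\<close>

lemma translate_in_cube_iff: "y + lattice_point p \<in> unit_cube \<longleftrightarrow> p = (\<chi> i. - floor (y $ i))"
proof -
  have "0 \<le> z + of_int k \<and> z + of_int k < 1 \<longleftrightarrow> k = - floor z" for z :: real and k
    using floor_eq_iff[of z "- k"] by auto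
  then show ?thesis by (simp add: unit_cube_def lattice_point_def vec_eq_iff)
qed

text \<open>Both sides equal the integral over all of space of \<open>F y\<close> times the indicators of
  \<open>unit_cube + a\<close> and of all lattice translates of \<open>unit_cube\<close>.\<close>

lemma nn_integral_torus_shift:
  fixes F :: "real ^ 'n::finite \<Rightarrow> ennreal"
  assumes [measurable]: "F \<in> borel_measurable borel" and per: "periodic F"
  shows "(\<integral>\<^sup>+x. F (x + a) \<partial>torus) = (\<integral>\<^sup>+x. F x \<partial>torus)"
proof -
  let ?c = "indicator unit_cube :: real ^ 'n \<Rightarrow> ennreal"
  obtain e :: "nat \<Rightarrow> int ^ 'n" where e: "bij e" using lattice_enumeration by blast
  have shift: "(\<integral>\<^sup>+x. H (x + b) \<partial>lborel) = (\<integral>\<^sup>+x. H x \<partial>lborel)"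
    if [measurable]: "H \<in> borel_measurable borel" for H :: "real ^ 'n \<Rightarrow> ennreal" and b
  proof -
    have "(\<integral>\<^sup>+x. H x \<partial>lborel) = (\<integral>\<^sup>+x. H x \<partial>(distr lborel borel ((+) b)))" by (simp add: lborel_distr_plus)
    then show ?thesis by (simp add: nn_integral_distr add.commute)
  qed
  have tile: "(\<Sum>k. ?c (y + lattice_point (e k))) = 1" for y
  proof -
    obtain k where k: "e k = (\<chi> i. - floor (y $ i))" using e by (metis bij_pointE)
    have "?c (y + lattice_point (e j)) = (if j = k then 1 else 0)" for j
      using e k by (auto simp: indicator_def translate_in_cube_iff bij_def inj_def)
    then show ?thesis using sums_single[of k "\<lambda>_. 1::ennreal"] by (simp add: sums_iff)
  qed
  have "(\<integral>\<^sup>+x. F (x + a) \<partial>torus) = (\<integral>\<^sup>+x. F (x + a) * ?c (x + a - a) \<partial>lborel)"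
    by (simp add: nn_integral_torus)
  also have "\<dots> = (\<integral>\<^sup>+y. F y * ?c (y - a) \<partial>lborel)"
    using shift[of "\<lambda>y. F y * ?c (y - a)" a] by simp
  also have "\<dots> = (\<integral>\<^sup>+y. (\<Sum>k. F y * ?c (y - a) * ?c (y + lattice_point (e k))) \<partial>lborel)"
    by (simp add: tile)
  also have "\<dots> = (\<Sum>k. \<integral>\<^sup>+y. F y * ?c (y - a) * ?c (y + lattice_point (e k)) \<partial>lborel)"
    by (rule nn_integral_suminf) measurable
  also have "\<dots> = (\<Sum>k. \<integral>\<^sup>+x. F x * ?c (x - lattice_point (e k) - a) * ?c x \<partial>lborel)"
  proof (rule suminf_cong)
    fix k
    have "(\<integral>\<^sup>+y. F y * ?c (y - a) * ?c (y + lattice_point (e k)) \<partial>lborel) =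
        (\<integral>\<^sup>+y. F (y + lattice_point (e k)) * ?c (y + lattice_point (e k) - lattice_point (e k) - a) *
          ?c (y + lattice_point (e k)) \<partial>lborel)"
      by (simp add: periodic_lattice_point[OF per])
    also have "\<dots> = (\<integral>\<^sup>+x. F x * ?c (x - lattice_point (e k) - a) * ?c x \<partial>lborel)"
      using shift[of "\<lambda>x. F x * ?c (x - lattice_point (e k) - a) * ?c x" "lattice_point (e k)"] by simp
    finally show "(\<integral>\<^sup>+y. F y * ?c (y - a) * ?c (y + lattice_point (e k)) \<partial>lborel) =
        (\<integral>\<^sup>+x. F x * ?c (x - lattice_point (e k) - a) * ?c x \<partial>lborel)" .
  qed
  also have "\<dots> = (\<integral>\<^sup>+x. (\<Sum>k. F x * ?c (x - lattice_point (e k) - a) * ?c x) \<partial>lborel)"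
    by (rule nn_integral_suminf[symmetric]) measurable
  also have "\<dots> = (\<integral>\<^sup>+x. F x * ?c x \<partial>lborel)"
  proof (rule nn_integral_cong)
    fix x
    have "bij (uminus :: int ^ 'n \<Rightarrow> _)" by (rule bij_uminus)
    then have e': "bij (\<lambda>k. - e k)" using e bij_comp[of e uminus] by (simp add: o_def)
    have lm: "lattice_point (- q) = - lattice_point q" for q :: "int ^ 'n"
      by (simp add: lattice_point_def vec_eq_iff)
    obtain k where k: "- e k = (\<chi> i. - floor ((x - a) $ i))" using e' by (metis bij_pointE)
    have "?c (x - lattice_point (e j) - a) = (if j = k then 1 else 0)" for j
    proof -
      have "x - lattice_point (e j) - a \<in> unit_cube \<longleftrightarrow> - e j = - e k"
        using translate_in_cube_iff[of "x - a" "- e j"] unfolding k lm by (simp add: algebra_simps)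
      also have "\<dots> \<longleftrightarrow> j = k" using e' by (auto simp: bij_def inj_def)
      finally show ?thesis by (simp add: indicator_def)
    qed
    then have one: "(\<Sum>k. ?c (x - lattice_point (e k) - a)) = 1"
      using sums_single[of k "\<lambda>_. 1::ennreal"] by (simp add: sums_iff)
    have "(\<Sum>k. F x * ?c (x - lattice_point (e k) - a) * ?c x) = (\<Sum>k. (F x * ?c x) * ?c (x - lattice_point (e k) - a))"
      by (simp add: mult_ac)
    then show "(\<Sum>k. F x * ?c (x - lattice_point (e k) - a) * ?c x) = F x * ?c x"
      by (simp add: one)
  qed
  finally show ?thesis by (simp add: nn_integral_torus)
qed

text \<open>Translation invariance as a pushforward identity passes to Bochner integrals at once,
  with no integrability condition and no splitting into positive and negative parts.\<close>

lemma distr_torus_wrap_shift: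
  "distr torus torus (\<lambda>x. wrap (x + a)) = (torus :: (real ^ 'n::finite) measure)"
proof (rule measure_eqI)
  have m: "(\<lambda>x. wrap (x + a)) \<in> measurable torus torus"
    unfolding torus_def by (intro measurable_restrict_space2 measurable_restrict_space1) (auto simp: wrap_in_cube)
  fix A :: "(real ^ 'n) set" assume "A \<in> sets (distr torus torus (\<lambda>x. wrap (x + a)))"
  then have A: "A \<in> sets torus" by simp
  then have [measurable]: "A \<in> sets borel" by (simp add: sets_torus)
  have "emeasure (distr torus torus (\<lambda>x. wrap (x + a))) A =
      (\<integral>\<^sup>+x. indicator A (wrap (x + a)) \<partial>torus)"
    using A m by (subst nn_integral_distr[OF m, symmetric]) auto
  also have "\<dots> = (\<integral>\<^sup>+x. indicator A (wrap x) \<partial>torus)"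
    by (rule nn_integral_torus_shift[where F="\<lambda>x. indicator A (wrap x)"])
      (measurable, simp add: periodic_def)
  also have "\<dots> = (\<integral>\<^sup>+x. indicator A x \<partial>torus)"
    by (rule nn_integral_cong) (simp add: wrap_id)
  finally show "emeasure (distr torus torus (\<lambda>x. wrap (x + a))) A = emeasure torus A" using A by simp
qed simp

lemma integral_torus_shift:
  fixes f :: "real ^ 'n::finite \<Rightarrow> real"
  assumes f: "f \<in> borel_measurable borel" and per: "periodic f"
  shows "(\<integral>x. f (x + a) \<partial>torus) = (\<integral>x. f x \<partial>torus)"
proof -
  have m: "(\<lambda>x. wrap (x + a)) \<in> measurable torus torus"
    unfolding torus_def by (intro measurable_restrict_space2 measurable_restrict_space1) (auto simp: wrap_in_cube)
  have "(\<integral>x. f x \<partial>torus) = (\<integral>x. f x \<partial>distr torus torus (\<lambda>x. wrap (x + a)))"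
    by (simp only: distr_torus_wrap_shift)
  also have "\<dots> = (\<integral>x. f (wrap (x + a)) \<partial>torus)"
    using measurable_torus[OF f] m by (intro integral_distr) auto
  finally show ?thesis by (simp add: periodic_wrap[OF per])
qed

lemma continuous_bounded_on_cube:
  fixes f :: "real ^ 'n::finite \<Rightarrow> real"
  assumes "continuous_on UNIV f"
  obtains B where "\<And>x. x \<in> unit_cube \<Longrightarrow> \<bar>f x\<bar> \<le> B"
proof -
  have "bounded (f ` cbox 0 (\<chi> i. 1))"
    by (intro compact_imp_bounded compact_continuous_image compact_cbox) (rule continuous_on_subset[OF assms], simp)
  then obtain B where "\<And>x. x \<in> cbox 0 (\<chi> i. 1) \<Longrightarrow> \<bar>f x\<bar> \<le> B"
    by (auto simp: bounded_iff)
  then show ?thesis using that unit_cube_subset(1) by blast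
qed

lemma periodic_continuous_bounded:
  fixes f :: "real ^ 'n::finite \<Rightarrow> real"
  assumes "continuous_on UNIV f" "periodic f"
  obtains B where "\<And>x. \<bar>f x\<bar> \<le> B"
proof -
  obtain B where "\<And>x. x \<in> unit_cube \<Longrightarrow> \<bar>f x\<bar> \<le> B" using continuous_bounded_on_cube[OF assms(1)] by blast
  from this[OF wrap_in_cube] show ?thesis
    by (intro that[of B]) (simp add: periodic_wrap[OF assms(2)])
qed

lemma integrable_torus_continuous:
  fixes f :: "real ^ 'n::finite \<Rightarrow> real"
  assumes "continuous_on UNIV f"
  shows "integrable torus f"
proof -
  obtain B where B: "\<And>x. x \<in> unit_cube \<Longrightarrow> \<bar>f x\<bar> \<le> B" using continuous_bounded_on_cube[OF assms] by blast
  have "f \<in> borel_measurable torus"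
    by (intro measurable_torus borel_measurable_continuous_onI assms)
  then show ?thesis by (rule torus.integrable_const_bound[rotated, where B=B]) (auto intro!: AE_I2 B)
qed

lemma abs_integral_torus_le:
  fixes f :: "real ^ 'n::finite \<Rightarrow> real"
  assumes "\<And>x. x \<in> unit_cube \<Longrightarrow> \<bar>f x\<bar> \<le> B"
  shows "\<bar>\<integral>x. f x \<partial>torus\<bar> \<le> B"
proof (cases "integrable torus f")
  case True
  have "\<bar>\<integral>x. f x \<partial>torus\<bar> \<le> (\<integral>x. \<bar>f x\<bar> \<partial>torus)" by (rule integral_abs_bound)
  also have "\<dots> \<le> (\<integral>x. B \<partial>(torus :: (real ^ 'n) measure))"
    using True assms by (intro integral_mono) auto
  finally show ?thesis by (simp add: torus.prob_space)
next
  case False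
  \<comment> \<open>A nonintegrable function has integral 0 by convention, so it suffices that
    \<open>B\<close> is nonnegative, as seen at one point of the cube.\<close>
  have "B \<ge> 0" using assms[OF wrap_in_cube[of 0]] by linarith
  then show ?thesis using False by (simp add: not_integrable_integral_eq)
qed

lemma pairing_linear_left:
  assumes "continuous_on UNIV f" "continuous_on UNIV g" "continuous_on UNIV h"
  shows "pairing (\<lambda>x. a * f x + b * g x) h = a * pairing f h + b * pairing g h"
proof -
  have "integrable torus (\<lambda>x. f x * h x)" "integrable torus (\<lambda>x. g x * h x)"
    by (intro integrable_torus_continuous continuous_intros assms)+
  then show ?thesis by (simp add: pairing_def distrib_right mult.assoc)
qed

lemma pairing_commute: "pairing f g = pairing g f"
  by (simp add: pairing_def mult.commute)

text \<open>The step is half a period of the character along coordinate \<open>i\<close> and changes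
  its sign. By translation invariance the shifted function pairs to the opposite value, so the first
  difference pairs to \<open>- 2\<close> times the original.\<close>

lemma pairing_half_shift:
  assumes f: "continuous_on UNIV f" "periodic f" and p: "p $ i \<noteq> 0"
  shows "pairing f (trig p a) = - (1 / 2) * pairing (fd ((1 / (2 * of_int (p $ i))) *\<^sub>R axis i 1) 1 f) (trig p a)"
proof -
  let ?h = "(1 / (2 * of_int (p $ i))) *\<^sub>R axis i 1 :: real ^ 'a"
  have shift: "trig p a (x + ?h) = - trig p a x" for x
    unfolding trig_shift using p by (simp add: trig_def add.assoc[symmetric])
  have c: "continuous_on UNIV (\<lambda>x. f (x + ?h))"
    by (rule continuous_on_compose2[OF f(1)]) (auto intro!: continuous_intros)
  have int: "integrable torus (\<lambda>x. f x * trig p a x)" "integrable torus (\<lambda>x. f (x + ?h) * trig p a x)"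
    by (intro integrable_torus_continuous continuous_intros f c)+
  have "pairing f (trig p a) = (\<integral>x. f (x + ?h) * trig p a (x + ?h) \<partial>torus)"
    unfolding pairing_def
    by (rule integral_torus_shift[where f="\<lambda>x. f x * trig p a x", symmetric])
      (use f trig_periodic[of p a] in \<open>auto simp: periodic_def intro!: borel_measurable_continuous_onI continuous_intros\<close>)
  also have "\<dots> = - (\<integral>x. f (x + ?h) * trig p a x \<partial>torus)" by (simp add: shift)
  finally have "(\<integral>x. f (x + ?h) * trig p a x \<partial>torus) = - pairing f (trig p a)" by simp
  then have "pairing (fd ?h 1 f) (trig p a) = - 2 * pairing f (trig p a)"
    using int by (simp add: pairing_def left_diff_distrib)
  then show ?thesis by simp
qed

lemma pairing_fd:
  assumes f: "continuous_on UNIV f" "periodic f" and p: "p $ i \<noteq> 0"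
  shows "pairing f (trig p a) =
    (- (1 / 2)) ^ M * pairing (fd ((1 / (2 * of_int (p $ i))) *\<^sub>R axis i 1) M f) (trig p a)"
proof (induction M)
  case (Suc M)
  show ?case unfolding Suc
    by (subst pairing_half_shift[OF continuous_fd[OF f(1)] periodic_fd[OF f(2)] p]) simp
qed simp

text \<open>Bounds a Fourier coefficient by differences instead of derivatives, the form that suits
  periodized wavelets of finite smoothness.\<close>

lemma abs_pairing_trig_le:
  assumes f: "continuous_on UNIV f" "periodic f" and p: "p $ i \<noteq> 0"
    and B: "\<And>x. \<bar>fd ((1 / (2 * of_int (p $ i))) *\<^sub>R axis i 1) M f x\<bar> \<le> B"
  shows "\<bar>pairing f (trig p a)\<bar> \<le> B / 2 ^ M"
proof -
  have "\<bar>pairing (fd ((1 / (2 * of_int (p $ i))) *\<^sub>R axis i 1) M f) (trig p a)\<bar> \<le> B"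
    unfolding pairing_def
  proof (rule abs_integral_torus_le)
    fix x show "\<bar>fd ((1 / (2 * of_int (p $ i))) *\<^sub>R axis i 1) M f x * trig p a x\<bar> \<le> B"
      using B[of x] abs_trig_le[of p a x] mult_mono[of "\<bar>fd ((1 / (2 * of_int (p $ i))) *\<^sub>R axis i 1) M f x\<bar>" B "\<bar>trig p a x\<bar>" 1]
      by (simp add: abs_mult)
  qed
  then show ?thesis unfolding pairing_fd[OF f p, of a M]
    by (simp add: abs_mult power_abs power_divide divide_right_mono)
qed

section \<open>Orthogonality and completeness of the characters\<close>

text \<open>For \<open>p \<noteq> 0\<close> this is the Fourier coefficient of a constant, all of
  whose first differences vanish.\<close>

lemma integral_trig: "(\<integral>x. trig p a x \<partial>torus) = (if p = 0 then cos a else 0)"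
proof (cases "p = 0")
  case True
  then have "trig p a = (\<lambda>_. cos a)" by (auto simp: trig_def frequency_def vec_eq_iff inner_vec_def)
  then show ?thesis using True by (simp add: torus.prob_space)
next
  case False
  then obtain i where i: "p $ i \<noteq> 0" by (auto simp: vec_eq_iff)
  have "\<bar>pairing (\<lambda>_. 1) (trig p a)\<bar> \<le> 0 / 2 ^ 1"
    by (rule abs_pairing_trig_le[OF _ _ i]) (auto simp: periodic_def)
  then show ?thesis using False by (simp add: pairing_def)
qed

lemma frequency_diff: "frequency (p - p') = frequency p - frequency p'"
  and frequency_add: "frequency (p + p') = frequency p + frequency p'"
  and frequency_minus: "frequency (- p) = - frequency p"
  by (simp_all add: frequency_def vec_eq_iff algebra_simps)

lemma trig_mult: "trig p a x * trig p' b x = 1 / 2 * trig (p + p') (a + b) x + 1 / 2 * trig (p - p') (a - b) x"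
  unfolding trig_def frequency_add frequency_diff inner_add_left inner_diff_left cos_times_cos
  by (simp add: algebra_simps add_divide_distrib)

text \<open>\<open>p\<close> and \<open>- p\<close> give the same real characters up to the sign of
  the phase, hence two contributions; both occur only if \<open>p\<close> and \<open>p'\<close>
  vanish.\<close>

lemma pairing_trig_trig:
  "pairing (trig p a) (trig p' b) =
    1 / 2 * (if p = - p' then cos (a + b) else 0) + 1 / 2 * (if p = p' then cos (a - b) else 0)"
proof -
  have int: "integrable torus (trig q c)" for q c by (intro integrable_torus_continuous continuous_trig)
  have "pairing (trig p a) (trig p' b) =
      1 / 2 * (\<integral>x. trig (p + p') (a + b) x \<partial>torus) + 1 / 2 * (\<integral>x. trig (p - p') (a - b) x \<partial>torus)"
    unfolding pairing_def trig_mult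
    by (subst Bochner_Integration.integral_add) (simp_all only: integral_mult_right_zero integrable_mult_right int)
  then show ?thesis by (simp add: integral_trig add_eq_0_iff2)
qed

text \<open>The argument for the completeness of the trigonometric system in Rudin's Real and Complex
  Analysis: powers of the trigonometric polynomial \<open>Q\<close> concentrate at \<open>x0\<close>.\<close>

lemma fourier_uniqueness:
  fixes f :: "real ^ 'n::finite \<Rightarrow> real"
  assumes f: "continuous_on UNIV f" "periodic f"
    and zero: "\<And>p a. pairing f (trig p a) = 0"
  shows "f = (\<lambda>_. 0)"
proof (rule ccontr)
  assume "f \<noteq> (\<lambda>_. 0)"
  then obtain x1 where "f x1 \<noteq> 0" by auto
  \<comment> \<open>After a change of sign and wrapping into the cube, the function is positive at a
    point of the cube.\<close>
  then obtain x0 :: "real ^ 'n" and g :: "real ^ 'n \<Rightarrow> real" where x0: "x0 \<in> unit_cube" "g x0 > 0" and g: "continuous_on UNIV g" "periodic g"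
      "\<And>p a. pairing g (trig p a) = 0"
  proof (cases "f x1 > 0")
    case True
    then show ?thesis
      using that[of "wrap x1" f] f zero by (simp add: wrap_in_cube periodic_wrap)
  next
    case False
    have "pairing (\<lambda>x. - f x) h = - pairing f h" for h by (simp add: pairing_def)
    then show ?thesis using False \<open>f x1 \<noteq> 0\<close>
      using that[of "wrap x1" "\<lambda>x. - f x"] f zero periodic_wrap[OF f(2), of x1]
      by (auto simp: wrap_in_cube periodic_def intro!: continuous_intros)
  qed
  define n where "n = real CARD('n)"
  have n: "n > 0" by (simp add: n_def)
  \<comment> \<open>The mean over the coordinates of \<open>(1 + cos) / 2\<close>: nonnegative, and
    1 exactly at the lattice translates of \<open>x0\<close>. Multiplication by \<open>Q\<close>
    preserves orthogonality to all characters.\<close>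
  define Q where "Q x = (\<Sum>i\<in>(UNIV::'n set). (1 + trig (axis i 1) (- 2 * pi * x0 $ i) x) / (2 * n))" for x
  have trig_eq: "trig (axis i 1) (- 2 * pi * x0 $ i) x = cos (2 * pi * (x $ i - x0 $ i))" for i x
  proof -
    have "frequency (axis i 1 :: int ^ 'n) \<bullet> x = 2 * pi * x $ i"
      by (simp add: frequency_def inner_vec_def axis_def if_distrib if_distribR cong: if_cong)
    then show ?thesis by (simp add: trig_def algebra_simps)
  qed
  have Qc: "continuous_on UNIV Q" unfolding Q_def by (intro continuous_intros) (use n in auto)
  have Q0: "0 \<le> Q x" for x unfolding Q_def using n abs_trig_le
    by (intro sum_nonneg divide_nonneg_pos) (auto simp: abs_le_iff, smt (verit) abs_trig_le abs_le_iff)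
  have Q1: "Q x \<le> 1" for x
  proof -
    have "Q x \<le> (\<Sum>i\<in>(UNIV::'n set). 1 / n)" unfolding Q_def
      using n abs_trig_le[of _ _ x] by (intro sum_mono) (auto simp: field_simps abs_le_iff)
    then show ?thesis using n by (simp add: n_def)
  qed
  have Qx0: "Q x0 = 1" unfolding Q_def trig_eq using n by (simp add: n_def)
  have gQ: "(\<forall>p a. pairing (\<lambda>x. g x * Q x ^ m) (trig p a) = 0)" for m
  proof (induction m)
    case 0 then show ?case using g by simp
  next
    case (Suc m)
    show ?case
    proof (intro allI)
      fix p a
      have cm: "continuous_on UNIV (\<lambda>x. g x * Q x ^ m)" by (intro continuous_intros g Qc)
      have int: "integrable torus (\<lambda>x. g x * Q x ^ m * trig q b x)" for q b
        by (intro integrable_torus_continuous continuous_intros cm)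
      have z: "(\<integral>x. g x * Q x ^ m * trig q b x \<partial>torus) = 0" for q b
        using Suc by (simp add: pairing_def)
      let ?e = "\<lambda>i. axis i 1 :: int ^ 'n" and ?d = "\<lambda>i. - 2 * pi * x0 $ i"
      have "g x * Q x ^ Suc m * trig p a x = (\<Sum>i\<in>UNIV. (g x * Q x ^ m * trig p a x +
          (1 / 2 * (g x * Q x ^ m * trig (?e i + p) (?d i + a) x) + 1 / 2 * (g x * Q x ^ m * trig (?e i - p) (?d i - a) x))) / (2 * n))" for x
      proof -
        have "g x * Q x ^ Suc m * trig p a x = (\<Sum>i\<in>UNIV. (g x * Q x ^ m * trig p a x + g x * Q x ^ m * (trig (?e i) (?d i) x * trig p a x)) / (2 * n))"
          by (simp add: Q_def[of x] sum_distrib_left sum_distrib_right algebra_simps add_divide_distrib)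
        then show ?thesis unfolding trig_mult by (simp add: algebra_simps)
      qed
      then show "pairing (\<lambda>x. g x * Q x ^ Suc m) (trig p a) = 0"
        by (simp add: pairing_def int z)
    qed
  qed
  have I0: "(\<integral>x. g x * Q x ^ m \<partial>torus) = 0" for m
  proof -
    have "trig 0 0 x = 1" for x :: "real ^ 'n" by (simp add: trig_def frequency_def inner_vec_def)
    then show ?thesis using gQ[of m] by (simp add: pairing_def) (metis (no_types, lifting) Bochner_Integration.integral_cong mult.right_neutral)
  qed
  obtain B where B: "\<And>x. \<bar>g x\<bar> \<le> B" using periodic_continuous_bounded[OF g(1,2)] by blast
  define c where "c = g x0 / 2"
  have c: "c > 0" using x0 by (simp add: c_def)
  have "isCont g x0" using g(1) by (simp add: continuous_on_eq_continuous_at)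
  then have "eventually (\<lambda>x. c < g x) (nhds x0)"
    using x0 unfolding isCont_def tendsto_at_iff_tendsto_nhds
    by (elim order_tendstoD(1)) (simp add: c_def)
  then obtain d where d: "d > 0" "\<And>x. dist x x0 < d \<Longrightarrow> c < g x"
    by (auto simp: eventually_nhds_metric)
  \<comment> \<open>Closeness up to \<open>\<rho>\<close> in every coordinate modulo integers gives
    a distance of at most \<open>\<rho> * n < d\<close>; \<open>\<rho> \<le> 1 / 2\<close> keeps the
    arguments of the cosine within its range of monotonicity.\<close>
  define \<rho> where "\<rho> = min (1 / 2) (d / (2 * n))"
  have \<rho>: "0 < \<rho>" "\<rho> \<le> 1 / 2" "\<rho> * n < d" using d n by (auto simp: \<rho>_def min_def field_simps)
  have near: "c < g x" if "\<And>i. \<exists>l::int. \<bar>x $ i - x0 $ i + of_int l\<bar> \<le> \<rho>" for x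
  proof -
    have "\<exists>l :: 'n \<Rightarrow> int. \<forall>i. \<bar>x $ i - x0 $ i + of_int (l i)\<bar> \<le> \<rho>"
      using that by (intro choice) blast
    then obtain l :: "'n \<Rightarrow> int" where l: "\<And>i. \<bar>x $ i - x0 $ i + of_int (l i)\<bar> \<le> \<rho>" by blast
    let ?y = "x + lattice_point (\<chi> i. l i)"
    have "dist ?y x0 \<le> (\<Sum>i\<in>UNIV. \<bar>(?y - x0) $ i\<bar>)" unfolding dist_norm by (rule norm_le_l1_cart)
    also have "\<dots> \<le> (\<Sum>i\<in>(UNIV::'n set). \<rho>)" using l
      by (intro sum_mono) (simp add: lattice_point_def algebra_simps)
    also have "\<dots> < d" using \<rho> by (simp add: n_def mult.commute)
    finally show ?thesis using d(2)[of ?y] periodic_lattice_point[OF g(2)] by simp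
  qed
  \<comment> \<open>How far below 1 the value of \<open>Q\<close> is forced by a single coordinate
    farther than \<open>\<rho>\<close> from that of \<open>x0\<close> modulo integers.\<close>
  define \<beta> where "\<beta> = (1 - cos (2 * pi * \<rho>)) / (2 * n)"
  have "cos (2 * pi * \<rho>) < cos 0"
    using \<rho> by (intro cos_monotone_0_pi) auto
  then have \<beta>: "\<beta> > 0" using n by (simp add: \<beta>_def)
  have far: "Q x \<le> 1 - \<beta>" if "\<not> (\<forall>i. \<exists>l::int. \<bar>x $ i - x0 $ i + of_int l\<bar> \<le> \<rho>)" for x
  proof -
    have "\<exists>i. \<forall>l::int. \<rho> < \<bar>x $ i - x0 $ i + of_int l\<bar>" using that by (simp add: not_le)
    then obtain i where i: "\<And>l::int. \<rho> < \<bar>x $ i - x0 $ i + of_int l\<bar>" by blast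
    define y where "y = x $ i - x0 $ i - of_int (round (x $ i - x0 $ i))"
    have y: "\<rho> < \<bar>y\<bar>" "\<bar>y\<bar> \<le> 1 / 2"
      using i[of "- round (x $ i - x0 $ i)"] of_int_round_abs_le[of "x $ i - x0 $ i"]
      by (auto simp: y_def abs_minus_commute)
    have "cos (2 * pi * (x $ i - x0 $ i)) = cos (2 * pi * y + 2 * pi * of_int (round (x $ i - x0 $ i)))"
      by (simp add: y_def algebra_simps)
    also have "\<dots> = cos (2 * pi * y)" by (simp only: cos_add cos_int_2pin sin_int_2pin mult_1_right mult_zero_right diff_zero)
    also have "\<dots> = cos (2 * pi * \<bar>y\<bar>)" using cos_abs_real[of "2 * pi * y"] by (simp add: abs_mult)
    also have "\<dots> \<le> cos (2 * pi * \<rho>)"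
      using y \<rho> by (intro cos_monotone_0_pi_le) auto
    finally have cosi: "cos (2 * pi * (x $ i - x0 $ i)) \<le> cos (2 * pi * \<rho>)" .
    have "Q x = (1 + cos (2 * pi * (x $ i - x0 $ i))) / (2 * n) + (\<Sum>j\<in>UNIV - {i}. (1 + cos (2 * pi * (x $ j - x0 $ j))) / (2 * n))"
      unfolding Q_def trig_eq by (subst sum.remove[of _ i]) auto
    also have "\<dots> \<le> (1 + cos (2 * pi * \<rho>)) / (2 * n) + (\<Sum>j\<in>UNIV - {i}. 1 / n)"
      using cosi n by (intro add_mono sum_mono divide_right_mono) (auto simp: field_simps)
    also have "\<dots> = 1 - \<beta>" using n by (simp add: \<beta>_def card_Diff_singleton field_simps n_def of_nat_diff)
    finally show ?thesis .
  qed
  let ?N = "{x. Q x > 1 - \<beta> / 2}"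
  have "open ?N" using Qc by (intro open_Collect_less continuous_intros)
  moreover have "x0 \<in> ?N" using Qx0 \<beta> by simp
  ultimately obtain e where e: "e > 0" "ball x0 e \<subseteq> ?N" by (meson open_contains_ball)
  \<comment> \<open>\<open>x0\<close> may lie on a face of the cube. A small move inwards reaches
    the open cube while \<open>Q\<close> stays above \<open>1 - \<beta> / 2\<close>, so that a ball
    of positive measure is available.\<close>
  define x2 where "x2 = x0 + (\<chi> i. min (e / (2 * n)) ((1 - x0 $ i) / 2))"
  have x2: "x2 \<in> box 0 (\<chi> i. 1)"
    using x0 e n by (auto simp: mem_box_cart x2_def unit_cube_def min_def field_simps add_nonneg_pos)
  have "dist x2 x0 \<le> (\<Sum>i\<in>UNIV. \<bar>(x2 - x0) $ i\<bar>)" unfolding dist_norm by (rule norm_le_l1_cart)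
  also have "\<dots> \<le> (\<Sum>i\<in>(UNIV::'n set). e / (2 * n))"
  proof (intro sum_mono)
    fix i
    have "0 \<le> (1 - x0 $ i) / 2" "0 \<le> e / (2 * n)" using x0 e n by (auto simp: unit_cube_def less_imp_le)
    then show "\<bar>(x2 - x0) $ i\<bar> \<le> e / (2 * n)" by (simp add: x2_def)
  qed
  also have "\<dots> < e" using e n by (simp add: n_def)
  finally have "x2 \<in> ?N" using e by (auto simp: dist_commute)
  let ?U = "?N \<inter> box 0 (\<chi> i. 1)"
  have "open ?U" using \<open>open ?N\<close> by (intro open_Int open_box)
  then obtain r where r: "r > 0" "ball x2 r \<subseteq> ?U" using \<open>x2 \<in> ?N\<close> x2 by (meson IntI open_contains_ball)
  define v where "v = measure torus ?U"
  have Ut: "?U \<in> sets torus" using \<open>open ?U\<close> unit_cube_subset(2) by (auto simp: sets_torus)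
  have "emeasure lborel (ball x2 r) \<le> emeasure torus ?U"
    unfolding emeasure_torus[OF Ut] by (intro emeasure_mono r) (use \<open>open ?U\<close> in auto)
  moreover have "emeasure lborel (ball x2 r) > 0"
    using r by (simp add: emeasure_ball unit_ball_vol_pos)
  ultimately have "0 < emeasure torus ?U" by (rule order_less_le_trans[rotated])
  then have v: "v > 0" unfolding v_def torus.emeasure_eq_measure by (simp only: ennreal_less_zero_iff)
  have lower: "c * (1 - \<beta> / 2) ^ m * v - B * (1 - \<beta>) ^ m \<le> 0" if "\<beta> \<le> 1" for m
  proof -
    have B0: "B \<ge> 0" using B[of 0] by linarith
    have pt: "c * (1 - \<beta> / 2) ^ m * indicator ?U x - B * (1 - \<beta>) ^ m \<le> g x * Q x ^ m" for x
    proof (cases "\<forall>i. \<exists>l::int. \<bar>x $ i - x0 $ i + of_int l\<bar> \<le> \<rho>")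
      case True
      then have gx: "c < g x" using near by blast
      have "c * (1 - \<beta> / 2) ^ m * indicator ?U x \<le> g x * Q x ^ m"
      proof (cases "x \<in> ?U")
        case True
        then have "(1 - \<beta> / 2) ^ m \<le> Q x ^ m" using that by (intro power_mono) auto
        then show ?thesis using gx c True that by (simp add: mult_mono)
      next
        case False
        then show ?thesis using gx c Q0[of x] by simp
      qed
      moreover have "0 \<le> B * (1 - \<beta>) ^ m" using B0 that by simp
      ultimately show ?thesis by linarith
    next
      case False
      then have Qb: "Q x \<le> 1 - \<beta>" by (rule far)
      then have "indicator ?U x = (0::real)" using \<beta> by auto
      moreover have "\<bar>g x * Q x ^ m\<bar> \<le> B * (1 - \<beta>) ^ m"
        unfolding abs_mult using B Q0[of x] Qb B0 by (intro mult_mono) (auto simp: power_abs power_mono)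
      ultimately show ?thesis by (simp only: mult_zero_right diff_0 abs_le_iff) linarith
    qed
    have iU: "integrable torus (\<lambda>x. c * (1 - \<beta> / 2) ^ m * indicator ?U x)"
      using Ut by (intro integrable_mult_right integrable_real_indicator) (auto simp: torus.emeasure_eq_measure)
    have i1: "integrable torus (\<lambda>x. c * (1 - \<beta> / 2) ^ m * indicator ?U x - B * (1 - \<beta>) ^ m)"
      by (intro Bochner_Integration.integrable_diff iU) simp
    have i2: "integrable torus (\<lambda>x. g x * Q x ^ m)"
      by (intro integrable_torus_continuous continuous_intros g Qc)
    have "(\<integral>x. c * (1 - \<beta> / 2) ^ m * indicator ?U x - B * (1 - \<beta>) ^ m \<partial>torus) =
        c * (1 - \<beta> / 2) ^ m * v - B * (1 - \<beta>) ^ m"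
    proof -
      have "?U \<inter> unit_cube = ?U" using unit_cube_subset(2) by blast
      then show ?thesis using Ut by (subst Bochner_Integration.integral_diff[OF iU]) (simp_all add: v_def)
    qed
    moreover have "(\<integral>x. c * (1 - \<beta> / 2) ^ m * indicator ?U x - B * (1 - \<beta>) ^ m \<partial>torus) \<le> (\<integral>x. g x * Q x ^ m \<partial>torus)"
      by (rule integral_mono[OF i1 i2 pt])
    ultimately show ?thesis by (simp only: I0)
  qed
  have "0 \<le> 1 - \<beta>"
  proof -
    have "\<beta> \<le> 2 / (2 * n)" unfolding \<beta>_def using n by (intro divide_right_mono) auto
    also have "\<dots> \<le> 1" by (simp add: n_def)
    finally show ?thesis by simp
  qed
  then have b1: "\<beta> \<le> 1" by simp
  \<comment> \<open>The positive part of the integral is at least of order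
    \<open>(1 - \<beta> / 2) ^ m\<close>, the remainder at most of order
    \<open>(1 - \<beta>) ^ m\<close>. Their ratio is \<open>\<gamma> ^ m\<close> up to constants, so
    a zero integral is impossible for large \<open>m\<close>.\<close>
  define \<gamma> where "\<gamma> = (1 - \<beta>) / (1 - \<beta> / 2)"
  have \<gamma>: "0 \<le> \<gamma>" "\<gamma> < 1" using \<beta> b1 by (auto simp: \<gamma>_def field_simps)
  have "(\<lambda>m. B * \<gamma> ^ m) \<longlonglongrightarrow> B * 0" by (intro tendsto_intros LIMSEQ_power_zero) (use \<gamma> in auto)
  then have "eventually (\<lambda>m. B * \<gamma> ^ m < c * v) sequentially"
    using c v by (intro order_tendstoD(2)) auto
  then obtain m where "B * \<gamma> ^ m < c * v" by (auto simp: eventually_sequentially)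
  moreover have pos: "(1 - \<beta> / 2) ^ m > 0" using b1 by simp
  ultimately have "B * \<gamma> ^ m * (1 - \<beta> / 2) ^ m < c * v * (1 - \<beta> / 2) ^ m" by (rule mult_strict_right_mono)
  moreover have "\<gamma> ^ m * (1 - \<beta> / 2) ^ m = (1 - \<beta>) ^ m"
    unfolding \<gamma>_def using b1 by (simp add: power_mult_distrib[symmetric])
  ultimately show False using lower[OF b1, of m] by (simp add: mult_ac)
qed

section \<open>Fourier series of test functions\<close>

lemma trig_add_axis[simp]: "trig p a (x + axis i 1) = trig p a x"
  using trig_periodic[of p a] unfolding periodic_def by blast

text \<open>Distributivity, with vectors in place of functions. Factors 1 count the points of a box;
  one-dimensional profiles give sums of tensor products over positions.\<close>

lemma sum_vec_prod:
  fixes f :: "'n::finite \<Rightarrow> 'a \<Rightarrow> 'c::comm_semiring_1"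
  assumes "finite A"
  shows "(\<Sum>m\<in>{m. \<forall>r. m $ r \<in> A}. \<Prod>r\<in>UNIV. f r (m $ r)) = (\<Prod>r\<in>UNIV. \<Sum>a\<in>A. f r a)"
proof -
  have "(\<Sum>m\<in>{m. \<forall>r. m $ r \<in> A}. \<Prod>r\<in>UNIV. f r (m $ r)) = (\<Sum>g\<in>PiE UNIV (\<lambda>_. A). \<Prod>r\<in>UNIV. f r (g r))"
    by (rule sum.reindex_bij_witness[of _ "\<lambda>g. \<chi> r. g r" "\<lambda>m r. m $ r"]) (auto simp: PiE_def)
  also have "\<dots> = (\<Prod>r\<in>UNIV. \<Sum>a\<in>A. f r a)"
    using assms by (intro prod_sum_PiE[symmetric]) auto
  finally show ?thesis .
qed

lemma finite_vec_set: "finite A \<Longrightarrow> finite {m :: 'a ^ 'n::finite. \<forall>r. m $ r \<in> A}"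
proof -
  assume A: "finite A"
  have "{m :: 'a ^ 'n. \<forall>r. m $ r \<in> A} \<subseteq> (\<lambda>g. \<chi> r. g r) ` (PiE UNIV (\<lambda>_. A))"
  proof
    fix m :: "'a ^ 'n" assume "m \<in> {m. \<forall>r. m $ r \<in> A}"
    then show "m \<in> (\<lambda>g. \<chi> r. g r) ` (PiE UNIV (\<lambda>_. A))"
      by (intro image_eqI[of _ _ "\<lambda>r. m $ r"]) (auto simp: vec_eq_iff PiE_def)
  qed
  moreover have "finite ((\<lambda>g. \<chi> r. g r) ` (PiE (UNIV :: 'n set) (\<lambda>_. A)))"
    by (intro finite_imageI finite_PiE A) simp
  ultimately show ?thesis by (rule finite_subset)
qed

lemma int_range_eq: "range int = {0..}"
proof (intro equalityI subsetI)
  fix i :: int assume "i \<in> {0..}"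
  then have "i = int (nat i)" by simp
  then show "i \<in> range int" by blast
qed auto

lemma summable_inverse_square_int: "(\<lambda>i::int. 1 / (1 + \<bar>real_of_int i\<bar>)\<^sup>2) summable_on UNIV"
proof -
  have "summable (\<lambda>n. 1 / (real (Suc n))\<^sup>2)"
    using inverse_power_summable[of 2, where 'a=real] by (subst summable_Suc_iff) (simp add: inverse_eq_divide)
  then have s: "(\<lambda>n::nat. 1 / (1 + real n)\<^sup>2) summable_on UNIV"
    by (subst summable_on_UNIV_nonneg_real_iff) (simp_all add: add.commute)
  have a: "(\<lambda>i::int. 1 / (1 + \<bar>real_of_int i\<bar>)\<^sup>2) summable_on {0..}"
    using s summable_on_reindex_bij_betw[of int UNIV "{0..}" "\<lambda>i. 1 / (1 + \<bar>real_of_int i\<bar>)\<^sup>2"]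
    by (simp add: bij_betw_def inj_on_def int_range_eq)
  have b: "(\<lambda>i::int. 1 / (1 + \<bar>real_of_int i\<bar>)\<^sup>2) summable_on {..0}"
    using a summable_on_reindex_bij_betw[of uminus "{0..}" "{..0}" "\<lambda>i::int. 1 / (1 + \<bar>real_of_int i\<bar>)\<^sup>2"]
    by (simp add: bij_betw_def)
  have "UNIV = {0::int..} \<union> {..0}" by auto
  then show ?thesis using summable_on_union[OF a b] by simp
qed

definition decay :: "nat \<Rightarrow> int ^ 'n::finite \<Rightarrow> real" where
  "decay M p = 1 / (1 + norm (frequency p)) ^ M"

lemma decay_nonneg: "decay M p \<ge> 0"
  by (auto simp: decay_def)

lemma abs_frequency_nth_le: "\<bar>of_int (p $ i)\<bar> \<le> norm (frequency p)"
proof -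
  have "\<bar>frequency p $ i\<bar> \<le> norm (frequency p)" by (rule component_le_norm_cart)
  moreover have "\<bar>real_of_int (p $ i)\<bar> * 1 \<le> \<bar>real_of_int (p $ i)\<bar> * (2 * pi)"
    using pi_ge_two by (intro mult_left_mono) auto
  ultimately show ?thesis by (simp add: frequency_def abs_mult mult_ac)
qed

text \<open>The exponent \<open>2 * CARD('n)\<close> allots a square to every coordinate, so the
  comparison series is a product of convergent one-dimensional series.\<close>

lemma decay_summable: "decay (2 * CARD('n) + N) summable_on (UNIV :: (int ^ 'n::finite) set)"
proof (rule summable_on_comparison_test)
  let ?g = "\<lambda>i::int. 1 / (1 + \<bar>real_of_int i\<bar>)\<^sup>2"
  define S where "S = (\<Sum>\<^sub>\<infinity>i. ?g i)"
  show "(\<lambda>p :: int ^ 'n. \<Prod>r\<in>UNIV. ?g (p $ r)) summable_on UNIV"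
  proof (rule nonneg_bdd_above_summable_on)
    show "bdd_above (sum (\<lambda>p :: int ^ 'n. \<Prod>r\<in>UNIV. ?g (p $ r)) ` {F. F \<subseteq> UNIV \<and> finite F})"
    proof (rule bdd_aboveI2)
      fix F :: "(int ^ 'n) set" assume "F \<in> {F. F \<subseteq> UNIV \<and> finite F}"
      then have F: "finite F" by simp
      define A where "A = (\<Union>p\<in>F. range (\<lambda>r. p $ r))"
      have A: "finite A" using F by (auto simp: A_def)
      have "(\<Sum>p\<in>F. \<Prod>r\<in>UNIV. ?g (p $ r)) \<le> (\<Sum>p\<in>{p :: int ^ 'n. \<forall>r. p $ r \<in> A}. \<Prod>r\<in>UNIV. ?g (p $ r))"
        by (rule sum_mono2[OF finite_vec_set[OF A]]) (auto simp: A_def intro!: prod_nonneg)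
      also have "\<dots> = (\<Prod>r\<in>(UNIV::'n set). \<Sum>a\<in>A. ?g a)" by (rule sum_vec_prod[OF A])
      also have "\<dots> \<le> (\<Prod>r\<in>(UNIV::'n set). S)"
        unfolding S_def using A
        by (intro prod_mono conjI sum_nonneg finite_sum_le_infsum summable_inverse_square_int) auto
      finally show "(\<Sum>p\<in>F. \<Prod>r\<in>UNIV. ?g (p $ r)) \<le> (\<Prod>r\<in>(UNIV::'n set). S)" .
    qed
  qed (auto intro!: prod_nonneg)
  fix p :: "int ^ 'n"
  show "0 \<le> decay (2 * CARD('n) + N) p" by (rule decay_nonneg)
  have "(\<Prod>r\<in>(UNIV::'n set). (1 + \<bar>real_of_int (p $ r)\<bar>)\<^sup>2) \<le> (\<Prod>r\<in>(UNIV::'n set). (1 + norm (frequency p))\<^sup>2)"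
    using abs_frequency_nth_le by (intro prod_mono conjI power_mono) auto
  also have "\<dots> = (1 + norm (frequency p)) ^ (2 * CARD('n))" by (simp add: power_mult)
  also have "\<dots> \<le> (1 + norm (frequency p)) ^ (2 * CARD('n) + N)" by (rule power_increasing) auto
  finally have "decay (2 * CARD('n) + N) p \<le> 1 / (\<Prod>r\<in>(UNIV::'n set). (1 + \<bar>real_of_int (p $ r)\<bar>)\<^sup>2)"
    unfolding decay_def by (intro divide_left_mono mult_pos_pos prod_pos) (auto simp: add_pos_nonneg)
  then show "decay (2 * CARD('n) + N) p \<le> (\<Prod>r\<in>UNIV. ?g (p $ r))" by (simp add: prod_dividef)
qed

lemma max_coordinate:
  fixes p :: "int ^ 'n::finite"
  obtains i where "norm (frequency p) \<le> 2 * pi * real CARD('n) * \<bar>of_int (p $ i)\<bar>" "\<And>j. \<bar>p $ j\<bar> \<le> \<bar>p $ i\<bar>"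
proof -
  obtain i where i: "\<And>j. \<bar>p $ j\<bar> \<le> \<bar>p $ i\<bar>"
  proof -
    have "Max (range (\<lambda>j. \<bar>p $ j\<bar>)) \<in> range (\<lambda>j. \<bar>p $ j\<bar>)" by (rule Max_in) auto
    then obtain i where i: "Max (range (\<lambda>j. \<bar>p $ j\<bar>)) = \<bar>p $ i\<bar>" by (rule rangeE)
    show ?thesis
      by (rule that[of i]) (simp add: i[symmetric])
  qed
  have "norm (frequency p) \<le> (\<Sum>j\<in>UNIV. \<bar>frequency p $ j\<bar>)" by (rule norm_le_l1_cart)
  also have "\<dots> \<le> (\<Sum>j\<in>(UNIV::'n set). 2 * pi * \<bar>of_int (p $ i)\<bar>)"
    using i by (intro sum_mono) (auto simp: frequency_def abs_mult simp flip: of_int_abs)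
  finally show ?thesis using that[of i] i by (simp add: mult_ac)
qed

text \<open>The factor by which the largest coordinate of \<open>p\<close>, when nonzero, dominates
  \<open>1 + norm (frequency p)\<close>.\<close>

definition frequency_const :: "'n::finite itself \<Rightarrow> real" where
  "frequency_const _ = 1 + 2 * pi * real CARD('n)"

lemma frequency_const_ge1: "frequency_const TYPE('n::finite) \<ge> 1"
  by (simp add: frequency_const_def)

text \<open>\<open>fd\<close> with step \<open>1 / (2 p\<^sub>i)\<close> in the direction of the largest component of \<open>p\<close> takes the
  place of integration by parts.\<close>

lemma pairing_decay:
  fixes f :: "real ^ 'n::finite \<Rightarrow> real"
  assumes f: "f \<in> test_functions"
    and B: "\<And>bs x. set bs \<subseteq> Basis \<Longrightarrow> length bs \<le> M \<Longrightarrow> \<bar>iterated_deriv bs f x\<bar> \<le> B"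
  shows "\<bar>pairing f (trig p a)\<bar> \<le> frequency_const TYPE('n) ^ M * B * decay M p"
proof -
  have fc: "continuous_on UNIV f" "periodic f" using f by (auto simp: test_functions_def smooth_continuous)
  have B0: "B \<ge> 0" using B[of "[]" 0] by simp
  show ?thesis
  proof (cases "p = 0")
    case True
    have "\<bar>pairing f (trig p a)\<bar> \<le> B"
      unfolding pairing_def
    proof (rule abs_integral_torus_le)
      fix x show "\<bar>f x * trig p a x\<bar> \<le> B"
        using B[of "[]" x] abs_trig_le[of p a x] mult_mono[of "\<bar>f x\<bar>" B "\<bar>trig p a x\<bar>" 1] by (simp add: abs_mult)
    qed
    also have "B = 1 ^ M * B * 1" by simp
    also have "\<dots> \<le> frequency_const TYPE('n) ^ M * B * 1"
      using frequency_const_ge1[where 'n='n] B0 by (intro mult_right_mono power_mono) auto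
    also have "1 = decay M p" using True by (simp add: decay_def frequency_def norm_vec_def L2_set_def)
    finally show ?thesis .
  next
    case False
    obtain i where i: "norm (frequency p) \<le> 2 * pi * real CARD('n) * \<bar>of_int (p $ i)\<bar>" "\<And>j. \<bar>p $ j\<bar> \<le> \<bar>p $ i\<bar>"
      using max_coordinate[of p] by blast
    have pi: "p $ i \<noteq> 0" using False i(2) by (auto simp: vec_eq_iff)
    then have p1: "1 \<le> \<bar>real_of_int (p $ i)\<bar>" by linarith
    let ?h = "1 / (2 * real_of_int (p $ i))"
    have "\<bar>fd (?h *\<^sub>R axis i 1) M f x\<bar> \<le> \<bar>?h\<bar> ^ M * B" for x
      by (rule abs_fd_le_iterated_deriv) (use f B in \<open>auto simp: test_functions_def smooth_def axis_in_Basis_iff intro: B\<close>)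
    from abs_pairing_trig_le[OF fc pi this]
    have "\<bar>pairing f (trig p a)\<bar> \<le> (\<bar>?h\<bar> / 2) ^ M * B" by (simp add: power_divide mult_ac)
    also have "\<dots> \<le> (frequency_const TYPE('n) * (1 / (1 + norm (frequency p)))) ^ M * B"
    proof (intro mult_right_mono power_mono B0)
      have "1 + norm (frequency p) \<le> frequency_const TYPE('n) * \<bar>of_int (p $ i)\<bar>"
        using i p1 by (simp add: frequency_const_def algebra_simps)
      then have "1 / \<bar>of_int (p $ i)\<bar> \<le> frequency_const TYPE('n) * (1 / (1 + norm (frequency p)))"
        using p1 by (simp add: field_simps add_pos_nonneg)
      moreover have "\<bar>?h\<bar> / 2 \<le> 1 / \<bar>of_int (p $ i)\<bar>" using p1 by (simp add: abs_mult field_simps)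
      ultimately show "\<bar>?h\<bar> / 2 \<le> frequency_const TYPE('n) * (1 / (1 + norm (frequency p)))"
        by (meson order_trans)
    qed simp
    also have "\<dots> = frequency_const TYPE('n) ^ M * B * decay M p"
      by (simp add: decay_def power_mult_distrib power_divide)
    finally show ?thesis .
  qed
qed

lemma test_functions_deriv_bound:
  fixes f :: "real ^ 'n::finite \<Rightarrow> real"
  assumes f: "f \<in> test_functions"
  obtains B where "\<And>bs x. set bs \<subseteq> Basis \<Longrightarrow> length bs \<le> M \<Longrightarrow> \<bar>iterated_deriv bs f x\<bar> \<le> B"
proof -
  let ?L = "{bs. set bs \<subseteq> (Basis :: (real ^ 'n) set) \<and> length bs \<le> M}"
  have "\<exists>B. \<forall>x. \<bar>iterated_deriv bs f x\<bar> \<le> B" if "bs \<in> ?L" for bs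
  proof -
    have "iterated_deriv bs f \<in> test_functions" using that f by (auto intro: test_functions_iterated_deriv)
    then obtain B where "\<And>x. \<bar>iterated_deriv bs f x\<bar> \<le> B"
      using periodic_continuous_bounded[of "iterated_deriv bs f"] by (auto simp: test_functions_def smooth_continuous)
    then show ?thesis by blast
  qed
  then have "\<exists>B. \<forall>bs\<in>?L. \<forall>x. \<bar>iterated_deriv bs f x\<bar> \<le> B bs" by (intro bchoice) blast
  then obtain B where B: "\<And>bs x. bs \<in> ?L \<Longrightarrow> \<bar>iterated_deriv bs f x\<bar> \<le> B bs" by blast
  have fin: "finite ?L" by (rule finite_lists_length_le) simp
  show ?thesis
  proof (rule that[of "\<Sum>bs\<in>?L. \<bar>B bs\<bar>"])
    fix bs :: "(real ^ 'n) list" and x assume bs: "set bs \<subseteq> Basis" "length bs \<le> M"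
    then have "\<bar>iterated_deriv bs f x\<bar> \<le> \<bar>B bs\<bar>" using B[of bs x] by force
    also have "\<dots> \<le> (\<Sum>bs\<in>?L. \<bar>B bs\<bar>)" using bs by (intro member_le_sum fin) auto
    finally show "\<bar>iterated_deriv bs f x\<bar> \<le> (\<Sum>bs\<in>?L. \<bar>B bs\<bar>)" .
  qed
qed

section \<open>Real Fourier terms and the inversion formula\<close>

text \<open>The real part of the term with index \<open>p\<close> of the complex Fourier series of
  \<open>f\<close> at \<open>x\<close>. Since \<open>p\<close> and \<open>- p\<close> contribute
  equally, the sum over the whole lattice restores a real \<open>f\<close> with no factor 2.\<close>

definition fterm :: "(real ^ 'n::finite \<Rightarrow> real) \<Rightarrow> int ^ 'n \<Rightarrow> real ^ 'n \<Rightarrow> real" where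
  "fterm f p x = pairing f (trig p (- (frequency p \<bullet> x)))"

lemma pairing_trig_expand:
  assumes "continuous_on UNIV f"
  shows "pairing f (trig p a) = cos a * pairing f (trig p 0) - sin a * pairing f (trig p (- pi / 2))"
  using pairing_linear_left[OF continuous_trig continuous_trig assms, of "cos a" p 0 "- sin a" p "- pi / 2"]
  by (simp add: pairing_commute[of f] trig_expand[of p a, abs_def])

lemma fterm_eq:
  assumes "continuous_on UNIV f"
  shows "fterm f p = (\<lambda>x. pairing f (trig p 0) * trig p 0 x + pairing f (trig p (- pi / 2)) * trig p (- pi / 2) x)"
  by (rule ext) (simp add: fterm_def pairing_trig_expand[OF assms, of p "- (frequency p \<bullet> _)"] trig_def cos_diff mult.commute)

lemma fterm_test:
  assumes "continuous_on UNIV f"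
  shows "fterm f p \<in> test_functions"
  unfolding fterm_eq[OF assms] by (intro test_functions_linear_combination trig_test)

text \<open>Difference quotients have integral zero by translation invariance; the mean value bound
  dominates them, so the limit has integral zero too.\<close>

lemma integral_directional_derivative_torus:
  fixes F G :: "real ^ 'n::finite \<Rightarrow> real"
  assumes F: "continuous_on UNIV F" "periodic F" and G: "continuous_on UNIV G" "periodic G"
    and d: "\<And>x. ((\<lambda>s. F (x + s *\<^sub>R b)) has_real_derivative G x) (at 0)"
  shows "(\<integral>x. G x \<partial>torus) = 0"
proof -
  obtain B where B: "\<And>x. \<bar>G x\<bar> \<le> B" using periodic_continuous_bounded[OF G] by blast
  define h where "h n = 1 / real (Suc n)" for n
  have h: "h n \<noteq> 0" for n by (simp add: h_def)
  have h0: "h \<longlonglongrightarrow> 0" unfolding h_def by (rule LIMSEQ_Suc[OF lim_1_over_n])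
  have Fc: "continuous_on UNIV (\<lambda>x. F (x + h n *\<^sub>R b))" for n
    by (rule continuous_on_compose2[OF F(1)]) (auto intro!: continuous_intros)
  have lim: "(\<lambda>n. \<integral>x. (F (x + h n *\<^sub>R b) - F x) / h n \<partial>torus) \<longlonglongrightarrow> (\<integral>x. G x \<partial>torus)"
  proof (rule integral_dominated_convergence[where w="\<lambda>_. B"])
    show "G \<in> borel_measurable torus" "(\<lambda>x. (F (x + h n *\<^sub>R b) - F x) / h n) \<in> borel_measurable torus" for n
      using h by (auto intro!: measurable_torus borel_measurable_continuous_onI continuous_intros G Fc F)
    show "AE x in torus. (\<lambda>n. (F (x + h n *\<^sub>R b) - F x) / h n) \<longlonglongrightarrow> G x"
    proof (rule AE_I2)
      fix x
      have "((\<lambda>s. (F (x + s *\<^sub>R b) - F x) / s) \<longlongrightarrow> G x) (at 0)"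
        using d[of x] by (simp add: DERIV_def)
      moreover have "filterlim h (at 0) sequentially" using h0 h by (auto simp: filterlim_at)
      ultimately show "(\<lambda>n. (F (x + h n *\<^sub>R b) - F x) / h n) \<longlonglongrightarrow> G x" by (rule filterlim_compose)
    qed
    show "AE x in torus. norm ((F (x + h n *\<^sub>R b) - F x) / h n) \<le> B" for n
      using directional_mvt[of F b G, OF d B, of _ "h n"] h[of n]
      by (auto intro!: AE_I2 simp: abs_mult pos_divide_le_eq)
  qed simp
  have zero: "(\<integral>x. (F (x + h n *\<^sub>R b) - F x) / h n \<partial>torus) = 0" for n
  proof -
    have "(\<integral>x. F (x + h n *\<^sub>R b) - F x \<partial>torus) = 0"
      using integral_torus_shift[OF borel_measurable_continuous_onI[OF F(1)] F(2), of "h n *\<^sub>R b"]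
      by (simp add: integrable_torus_continuous F Fc)
    then show ?thesis by simp
  qed
  show ?thesis using lim unfolding zero by (simp only: LIMSEQ_const_iff)
qed

text \<open>Integration by parts without boundary terms: the derivative of the product with the
  character has integral zero.\<close>

lemma pairing_partial_deriv:
  assumes f: "f \<in> test_functions" and b: "b \<in> Basis"
  shows "pairing (partial_deriv b f) (trig p a) = - (frequency p \<bullet> b) * pairing f (trig p (a + pi / 2))"
proof -
  have s: "smooth f" and per: "periodic f" using f by (auto simp: test_functions_def)
  have pb: "partial_deriv b f \<in> test_functions" by (rule test_functions_partial_deriv[OF f b])
  have c: "continuous_on UNIV f" "continuous_on UNIV (partial_deriv b f)"
    using s pb by (auto simp: test_functions_def smooth_continuous)
  have pper: "periodic (partial_deriv b f)" using pb by (auto simp: test_functions_def)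
  let ?G = "\<lambda>x. partial_deriv b f x * trig p a x + f x * ((frequency p \<bullet> b) * trig p (a + pi / 2) x)"
  have "(\<integral>x. ?G x \<partial>torus) = 0"
  proof (rule integral_directional_derivative_torus[where F="\<lambda>x. f x * trig p a x" and b=b])
    fix x
    have "((\<lambda>s. f (x + s *\<^sub>R b)) has_real_derivative partial_deriv b f x) (at 0)"
      by (rule partial_deriv_directional) (rule smooth_differentiable[OF s])
    moreover have "((\<lambda>s. trig p a (x + s *\<^sub>R b)) has_real_derivative (frequency p \<bullet> b) * trig p (a + pi / 2) x) (at 0)"
      using partial_deriv_directional[OF trig_differentiable, of p a x b] by (simp add: partial_deriv_trig)
    ultimately show "((\<lambda>s. f (x + s *\<^sub>R b) * trig p a (x + s *\<^sub>R b)) has_real_derivative ?G x) (at 0)"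
      by (auto intro!: derivative_eq_intros)
  qed (use per pper in \<open>auto simp: periodic_def intro!: continuous_intros c\<close>)
  moreover have "?G = (\<lambda>x. partial_deriv b f x * trig p a x + (frequency p \<bullet> b) * (f x * trig p (a + pi / 2) x))"
    by (simp add: mult.left_commute)
  moreover have "integrable torus (\<lambda>x. partial_deriv b f x * trig p a x)" "integrable torus (\<lambda>x. f x * trig p (a + pi / 2) x)"
    by (intro integrable_torus_continuous continuous_intros c)+
  ultimately have "pairing (partial_deriv b f) (trig p a) + (frequency p \<bullet> b) * pairing f (trig p (a + pi / 2)) = 0"
    by (simp add: pairing_def)
  then show ?thesis by simp
qed

lemma partial_deriv_fterm:
  assumes f: "f \<in> test_functions" and b: "b \<in> Basis"
  shows "partial_deriv b (fterm f p) = fterm (partial_deriv b f) p"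
proof
  fix x
  have c: "continuous_on UNIV f" using f by (auto simp: test_functions_def smooth_continuous)
  have "partial_deriv b (fterm f p) x = (frequency p \<bullet> b) *
      (pairing f (trig p 0) * trig p (pi / 2) x + pairing f (trig p (- pi / 2)) * trig p 0 x)"
    unfolding fterm_eq[OF c]
    by (subst partial_deriv_linear_combination) (auto simp: trig_differentiable partial_deriv_trig algebra_simps)
  also have "\<dots> = - (frequency p \<bullet> b) * pairing f (trig p (- (frequency p \<bullet> x) + pi / 2))"
    unfolding pairing_trig_expand[OF c, of p "- (frequency p \<bullet> x) + pi / 2"]
    by (simp add: trig_def cos_add sin_add cos_diff sin_diff algebra_simps)
  also have "\<dots> = fterm (partial_deriv b f) p x"
    by (simp add: fterm_def pairing_partial_deriv[OF f b])
  finally show "partial_deriv b (fterm f p) x = fterm (partial_deriv b f) p x" .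
qed

text \<open>Allows the inversion formula and its tail bounds to be applied to every derivative of
  \<open>f\<close>, so Fourier series of test functions converge in the topology for which
  distributions are continuous.\<close>

lemma iterated_deriv_fterm:
  assumes f: "f \<in> test_functions" and bs: "set bs \<subseteq> Basis"
  shows "iterated_deriv bs (fterm f p) = fterm (iterated_deriv bs f) p"
  using bs by (induction bs) (auto simp: partial_deriv_fterm test_functions_iterated_deriv[OF f])

lemma fterm_bound:
  fixes f :: "real ^ 'n::finite \<Rightarrow> real"
  assumes f: "f \<in> test_functions"
    and B: "\<And>bs x. set bs \<subseteq> Basis \<Longrightarrow> length bs \<le> M \<Longrightarrow> \<bar>iterated_deriv bs f x\<bar> \<le> B"
  shows "\<bar>fterm f p x\<bar> \<le> frequency_const TYPE('n) ^ M * B * decay M p"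
  unfolding fterm_def by (rule pairing_decay[OF f B])

lemma uniform_limit_infsum:
  fixes f :: "'i \<Rightarrow> 'a \<Rightarrow> real"
  assumes "\<And>i x. \<bar>f i x\<bar> \<le> M i" "M summable_on UNIV"
  shows "uniform_limit UNIV (\<lambda>P x. \<Sum>i\<in>P. f i x) (\<lambda>x. \<Sum>\<^sub>\<infinity>i. f i x) (finite_subsets_at_top UNIV)"
  by (rule Weierstrass_m_test_general[where M=M]) (use assms in auto)

lemma continuous_on_infsum:
  fixes f :: "'i \<Rightarrow> 'a::topological_space \<Rightarrow> real"
  assumes "\<And>i. continuous_on UNIV (f i)" "\<And>i x. \<bar>f i x\<bar> \<le> M i" "M summable_on UNIV"
  shows "continuous_on UNIV (\<lambda>x. \<Sum>\<^sub>\<infinity>i. f i x)"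
  by (rule uniform_limit_theorem[OF _ uniform_limit_infsum[OF assms(2,3)]])
    (auto intro!: always_eventually continuous_on_sum assms)

lemma abs_summable_bounded:
  fixes f :: "'i \<Rightarrow> real"
  assumes "\<And>i. \<bar>f i\<bar> \<le> M i" "M summable_on UNIV"
  shows "f summable_on UNIV"
proof (rule abs_summable_summable, rule summable_on_comparison_test[OF assms(2)])
qed (use assms in auto)

text \<open>The majorant makes the series converge uniformly, and the torus has mass 1, so sum and
  integral may be exchanged.\<close>

lemma has_sum_pairing:
  fixes f :: "'i \<Rightarrow> real ^ 'n::finite \<Rightarrow> real"
  assumes f: "\<And>i. continuous_on UNIV (f i)" "\<And>i x. \<bar>f i x\<bar> \<le> M i" "M summable_on UNIV"
    and g: "continuous_on UNIV g"
  shows "((\<lambda>i. pairing (f i) g) has_sum pairing (\<lambda>x. \<Sum>\<^sub>\<infinity>i. f i x) g) UNIV"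
proof -
  let ?S = "\<lambda>x. \<Sum>\<^sub>\<infinity>i. f i x"
  have Sc: "continuous_on UNIV ?S" by (rule continuous_on_infsum[OF f])
  obtain B where B: "\<And>x. x \<in> unit_cube \<Longrightarrow> \<bar>g x\<bar> \<le> B" using continuous_bounded_on_cube[OF g] by blast
  have B0: "B \<ge> 0" using B[OF wrap_in_cube[of 0]] by linarith
  have sum_eq: "(\<Sum>i\<in>P. pairing (f i) g) = pairing (\<lambda>x. \<Sum>i\<in>P. f i x) g" for P
    unfolding pairing_def sum_distrib_right
    by (rule Bochner_Integration.integral_sum[symmetric]) (intro integrable_torus_continuous continuous_intros f g)
  show ?thesis unfolding has_sum_def sum_eq
  proof (rule tendstoI)
    fix e :: real assume e: "e > 0"
    have "eventually (\<lambda>P. \<forall>x\<in>UNIV. dist (\<Sum>i\<in>P. f i x) (?S x) < e / (B + 1)) (finite_subsets_at_top UNIV)"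
      by (rule uniform_limitD[OF uniform_limit_infsum[OF f(2,3)]]) (use e B0 in simp)
    then show "eventually (\<lambda>P. dist (pairing (\<lambda>x. \<Sum>i\<in>P. f i x) g) (pairing ?S g) < e) (finite_subsets_at_top UNIV)"
    proof eventually_elim
      case (elim P)
      have "pairing (\<lambda>x. \<Sum>i\<in>P. f i x) g - pairing ?S g = (\<integral>x. ((\<Sum>i\<in>P. f i x) - ?S x) * g x \<partial>torus)"
        unfolding pairing_def left_diff_distrib
        by (rule Bochner_Integration.integral_diff[symmetric]) (intro integrable_torus_continuous continuous_intros f g Sc)+
      moreover have "\<bar>\<integral>x. ((\<Sum>i\<in>P. f i x) - ?S x) * g x \<partial>torus\<bar> \<le> e / (B + 1) * B"
      proof (rule abs_integral_torus_le)
        fix x :: "real ^ 'n" assume "x \<in> unit_cube"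
        then show "\<bar>((\<Sum>i\<in>P. f i x) - ?S x) * g x\<bar> \<le> e / (B + 1) * B"
          using elim e B0 B unfolding abs_mult by (intro mult_mono) (auto simp: dist_real_def less_imp_le)
      qed
      moreover have "e / (B + 1) * B < e" using e B0 by (simp add: field_simps)
      ultimately show ?case by (simp add: dist_real_def)
    qed
  qed
qed

lemma has_sum_two_points:
  fixes c :: "'i \<Rightarrow> real"
  shows "((\<lambda>p. c p * (if p = a then 1 else 0)) has_sum c a) UNIV"
  by (rule has_sum_finite_neutralI[of "{a}"]) auto

text \<open>Decay of the coefficients makes the series converge uniformly to a continuous periodic
  function. It has the Fourier coefficients of \<open>f\<close>, so uniqueness identifies it with
  \<open>f\<close>.\<close>

theorem fourier_inversion:
  fixes f :: "real ^ 'n::finite \<Rightarrow> real"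
  assumes f: "f \<in> test_functions"
  shows "((\<lambda>p. fterm f p x) has_sum f x) UNIV"
proof -
  have fc: "continuous_on UNIV f" "periodic f" using f by (auto simp: test_functions_def smooth_continuous)
  let ?M = "2 * CARD('n) + 0"
  obtain B where B: "\<And>bs x. set bs \<subseteq> Basis \<Longrightarrow> length bs \<le> ?M \<Longrightarrow> \<bar>iterated_deriv bs f x\<bar> \<le> B"
    using test_functions_deriv_bound[OF f, of ?M] by blast
  define W :: "int ^ 'n \<Rightarrow> real" where "W p = frequency_const TYPE('n) ^ ?M * B * decay ?M p" for p
  have W: "W summable_on UNIV" unfolding W_def by (intro summable_on_cmult_right decay_summable)
  have bd: "\<bar>fterm f p x\<bar> \<le> W p" for p x unfolding W_def by (rule fterm_bound[OF f B])
  have ftc: "continuous_on UNIV (fterm f p)" for p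
    using fterm_test[OF fc(1)] by (auto simp: test_functions_def smooth_continuous)
  let ?S = "\<lambda>x. \<Sum>\<^sub>\<infinity>p. fterm f p x"
  have Sc: "continuous_on UNIV ?S" by (rule continuous_on_infsum[OF ftc bd W])
  have Sp: "periodic ?S"
    using fterm_test[OF fc(1)] by (auto simp: periodic_def test_functions_def)
  have "(\<lambda>x. f x - ?S x) = (\<lambda>_. 0)"
  proof (rule fourier_uniqueness)
    show "continuous_on UNIV (\<lambda>x. f x - ?S x)" by (intro continuous_intros fc Sc)
    show "periodic (\<lambda>x. f x - ?S x)" using fc Sp by (auto simp: periodic_def)
    fix p' a
    \<comment> \<open>The coefficient at \<open>p'\<close> comes half from the term
      \<open>p'\<close> and half from the term \<open>- p'\<close>. These coincide only for
      \<open>p' = 0\<close>, where the sine coefficient vanishes.\<close>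
    have eq: "pairing (fterm f p) (trig p' a) =
        1 / 2 * (pairing f (trig p' a) * (if p = p' then 1 else 0)) +
        1 / 2 * (pairing f (trig p' a) * (if p = - p' then 1 else 0))" for p
    proof -
      have e: "pairing (fterm f p) (trig p' a) = pairing f (trig p 0) * pairing (trig p 0) (trig p' a) +
          pairing f (trig p (- pi / 2)) * pairing (trig p (- pi / 2)) (trig p' a)"
        unfolding fterm_eq[OF fc(1)] by (rule pairing_linear_left) (intro continuous_trig)+
      have m: "trig (- p') c = trig p' (- c)" for c
      proof
        fix x show "trig (- p') c x = trig p' (- c) x"
          using cos_minus[of "frequency p' \<bullet> x - c"] by (simp add: trig_def frequency_minus)
      qed
      have s: "pairing f (trig p' (pi / 2)) = - pairing f (trig p' (- pi / 2))"
        by (subst pairing_trig_expand[OF fc(1)]) simp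
      show ?thesis
      proof (cases "p' = - p'")
        case True
        then have z: "pairing f (trig p' (- (pi / 2))) = 0"
          using m[of "pi / 2"] s by (simp only: mult_minus_left minus_divide_left)
        have "p = - p' \<longleftrightarrow> p = p'" by (simp only: True[symmetric])
        then show ?thesis unfolding e pairing_trig_trig pairing_trig_expand[OF fc(1), of p' a]
          by (cases "p = p'") (simp_all add: z cos_add cos_diff)
      next
        case False
        then show ?thesis unfolding e pairing_trig_trig pairing_trig_expand[OF fc(1), of p' a]
          by (cases "p = p'"; cases "p = - p'") (simp_all add: m s cos_add cos_diff algebra_simps)
      qed
    qed
    have "((\<lambda>p. pairing (fterm f p) (trig p' a)) has_sum
        (1 / 2 * pairing f (trig p' a) + 1 / 2 * pairing f (trig p' a))) UNIV"
      unfolding eq by (intro has_sum_add has_sum_cmult_right has_sum_two_points)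
    moreover have "((\<lambda>p. pairing (fterm f p) (trig p' a)) has_sum pairing ?S (trig p' a)) UNIV"
      by (rule has_sum_pairing[OF ftc bd W continuous_trig])
    ultimately have "1 / 2 * pairing f (trig p' a) + 1 / 2 * pairing f (trig p' a) = pairing ?S (trig p' a)"
      by (rule has_sum_unique)
    then have "pairing ?S (trig p' a) = pairing f (trig p' a)" by simp
    then show "pairing (\<lambda>x. f x - ?S x) (trig p' a) = 0"
      using pairing_linear_left[OF fc(1) Sc continuous_trig, of 1 "- 1" p' a] by simp
  qed
  then have "f x = ?S x" by (metis eq_iff_diff_eq_0)
  moreover have "(\<lambda>p. fterm f p x) summable_on UNIV"
    by (rule abs_summable_bounded[OF bd W])
  ultimately show ?thesis by (simp add: has_sum_infsum)
qed

section \<open>The heat flow of a distribution\<close>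

lemma distributions_linear:
  "T \<in> distributions \<Longrightarrow> f \<in> test_functions \<Longrightarrow> g \<in> test_functions \<Longrightarrow>
    T (\<lambda>x. a * f x + b * g x) = a * T f + b * T g"
  unfolding distributions_def by blast

lemma distributions_cmult:
  assumes "T \<in> distributions" "f \<in> test_functions"
  shows "T (\<lambda>x. a * f x) = a * T f"
  using distributions_linear[OF assms assms(2), of a 0] by simp

lemma distributions_zero: "T \<in> distributions \<Longrightarrow> T (\<lambda>x. 0) = 0"
  using distributions_cmult[of T "\<lambda>_. 0" 0] test_functions_zero by simp

lemma distributions_sum:
  assumes T: "T \<in> distributions" and f: "\<And>i. i \<in> I \<Longrightarrow> f i \<in> test_functions"
  shows "T (\<lambda>x. \<Sum>i\<in>I. c i * f i x) = (\<Sum>i\<in>I. c i * T (f i))"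
  using f
proof (induction I rule: infinite_finite_induct)
  case (insert i I)
  have "T (\<lambda>x. c i * f i x + 1 * (\<Sum>i\<in>I. c i * f i x)) = c i * T (f i) + 1 * T (\<lambda>x. \<Sum>i\<in>I. c i * f i x)"
    using insert by (intro distributions_linear[OF T] test_functions_sum) auto
  then show ?case using insert by simp
qed (auto simp: distributions_zero[OF T])

lemma distributions_bound:
  fixes T :: "(real ^ 'n::finite \<Rightarrow> real) \<Rightarrow> real"
  assumes "T \<in> distributions"
  obtains C N where "C \<ge> 0" "\<And>f B. f \<in> test_functions \<Longrightarrow>
    (\<And>bs x. set bs \<subseteq> Basis \<Longrightarrow> length bs \<le> N \<Longrightarrow> \<bar>iterated_deriv bs f x\<bar> \<le> B) \<Longrightarrow> \<bar>T f\<bar> \<le> C * B"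
proof -
  obtain C N where CN: "\<And>f B. f \<in> test_functions \<Longrightarrow>
      (\<forall>bs x. set bs \<subseteq> Basis \<longrightarrow> length bs \<le> N \<longrightarrow> \<bar>iterated_deriv bs f x\<bar> \<le> B) \<Longrightarrow> \<bar>T f\<bar> \<le> C * B"
    using assms unfolding distributions_def by blast
  show ?thesis
  proof (rule that[of "\<bar>C\<bar>" N])
    fix f :: "real ^ 'n \<Rightarrow> real" and B assume f: "f \<in> test_functions"
      and B: "\<And>bs x. set bs \<subseteq> Basis \<Longrightarrow> length bs \<le> N \<Longrightarrow> \<bar>iterated_deriv bs f x\<bar> \<le> B"
    have "B \<ge> 0" using B[of "[]" 0] by simp
    then have "C * B \<le> \<bar>C\<bar> * B" by (intro mult_right_mono) auto
    moreover have "\<bar>T f\<bar> \<le> C * B" by (rule CN[OF f]) (use B in blast)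
    ultimately show "\<bar>T f\<bar> \<le> \<bar>C\<bar> * B" by linarith
  qed simp
qed

text \<open>A derivative of order at most \<open>N\<close> of a character produces at most
  \<open>N\<close> components of its frequency; the continuity estimate turns this into polynomial
  growth of the Fourier coefficients.\<close>

lemma distributions_trig_bound:
  assumes "T \<in> distributions"
  obtains C N where "C \<ge> 0" "\<And>p a. \<bar>T (trig p a)\<bar> \<le> C * (1 + norm (frequency p)) ^ N"
proof -
  obtain C N where C: "C \<ge> 0" "\<And>f B. f \<in> test_functions \<Longrightarrow>
    (\<And>bs x. set bs \<subseteq> Basis \<Longrightarrow> length bs \<le> N \<Longrightarrow> \<bar>iterated_deriv bs f x\<bar> \<le> B) \<Longrightarrow> \<bar>T f\<bar> \<le> C * B"
    using distributions_bound[OF assms] by blast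
  show ?thesis
  proof (rule that[OF C(1)])
    fix p :: "int ^ 'a" and a
    show "\<bar>T (trig p a)\<bar> \<le> C * (1 + norm (frequency p)) ^ N"
    proof (rule C(2)[OF trig_test])
      fix bs :: "(real ^ 'a) list" and x assume bs: "set bs \<subseteq> Basis" "length bs \<le> N"
      have "\<bar>\<Prod>b\<leftarrow>bs. frequency p \<bullet> b\<bar> \<le> (1 + norm (frequency p)) ^ length bs"
        using bs(1)
      proof (induction bs)
        case (Cons b bs)
        have "\<bar>frequency p \<bullet> b\<bar> \<le> norm (frequency p)"
          using Cons.prems by (auto intro: Basis_le_norm)
        then show ?case using Cons by (auto simp: abs_mult intro!: mult_mono)
      qed simp
      also have "\<dots> \<le> (1 + norm (frequency p)) ^ N" using bs(2) by (intro power_increasing) auto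
      finally have "\<bar>\<Prod>b\<leftarrow>bs. frequency p \<bullet> b\<bar> * \<bar>trig p (a + real (length bs) * (pi / 2)) x\<bar> \<le> (1 + norm (frequency p)) ^ N * 1"
        by (intro mult_mono abs_trig_le) auto
      then show "\<bar>iterated_deriv bs (trig p a) x\<bar> \<le> (1 + norm (frequency p)) ^ N"
        by (simp add: iterated_deriv_trig abs_mult)
    qed
  qed
qed

lemma test_continuous: "f \<in> test_functions \<Longrightarrow> continuous_on UNIV f"
  by (auto simp: test_functions_def smooth_continuous)

lemma distributions_fterm:
  assumes T: "T \<in> distributions" and f: "f \<in> test_functions"
  shows "T (fterm f p) = pairing f (trig p 0) * T (trig p 0) + pairing f (trig p (- pi / 2)) * T (trig p (- pi / 2))"
  unfolding fterm_eq[OF test_continuous[OF f]] by (rule distributions_linear[OF T trig_test trig_test])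

lemma decay_mult: "decay (M + N) p * (1 + norm (frequency p)) ^ N = decay M p"
proof -
  have "1 + norm (frequency p) \<noteq> 0" using norm_ge_zero[of "frequency p"] by linarith
  then show ?thesis by (simp add: decay_def power_add)
qed

text \<open>The growth of order \<open>N\<close> of the distribution is paid by \<open>N\<close>
  extra derivatives of the test function, leaving decay of order \<open>M\<close>.\<close>

lemma distributions_fterm_bound:
  fixes T :: "(real ^ 'n::finite \<Rightarrow> real) \<Rightarrow> real"
  assumes T: "T \<in> distributions"
  obtains K N where "K \<ge> 0" "\<And>f B p. f \<in> test_functions \<Longrightarrow>
    (\<And>bs x. set bs \<subseteq> Basis \<Longrightarrow> length bs \<le> M + N \<Longrightarrow> \<bar>iterated_deriv bs f x\<bar> \<le> B) \<Longrightarrow>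
    \<bar>T (fterm f p)\<bar> \<le> K * B * decay M p"
proof -
  obtain C N where C: "C \<ge> 0" "\<And>p a. \<bar>T (trig p a)\<bar> \<le> C * (1 + norm (frequency p)) ^ N"
    using distributions_trig_bound[OF T] by blast
  let ?F = "frequency_const TYPE('n) ^ (M + N)"
  have F: "?F \<ge> 0" using frequency_const_ge1[where 'n='n] by simp
  show ?thesis
  proof (rule that[of "2 * C * ?F" N])
    show "2 * C * ?F \<ge> 0" using C(1) F by simp
    fix f :: "real ^ 'n \<Rightarrow> real" and B p
    assume f: "f \<in> test_functions"
      and B: "\<And>bs x. set bs \<subseteq> Basis \<Longrightarrow> length bs \<le> M + N \<Longrightarrow> \<bar>iterated_deriv bs f x\<bar> \<le> B"
    have "B \<ge> 0" using B[of "[]" 0] by simp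
    have *: "\<bar>pairing f (trig p a) * T (trig p a)\<bar> \<le> C * ?F * B * decay M p" for a
    proof -
      have "\<bar>pairing f (trig p a) * T (trig p a)\<bar> \<le> (?F * B * decay (M + N) p) * (C * (1 + norm (frequency p)) ^ N)"
        unfolding abs_mult using F \<open>B \<ge> 0\<close> decay_nonneg
        by (intro mult_mono pairing_decay[OF f B] C mult_nonneg_nonneg) auto
      also have "\<dots> = C * ?F * B * (decay (M + N) p * (1 + norm (frequency p)) ^ N)" by simp
      finally show ?thesis unfolding decay_mult .
    qed
    show "\<bar>T (fterm f p)\<bar> \<le> 2 * C * ?F * B * decay M p"
      unfolding distributions_fterm[OF T f] using *[of 0] *[of "- pi / 2"] by linarith
  qed
qed

lemma has_sum_diff:
  fixes f g :: "'i \<Rightarrow> real"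
  assumes "(f has_sum a) A" "(g has_sum b) A"
  shows "((\<lambda>i. f i - g i) has_sum (a - b)) A"
  using has_sum_add[OF assms(1) has_sum_uminusI[OF assms(2)]] by simp

text \<open>Comparison with the majorant outside \<open>P\<close>. With \<open>P\<close> empty it is
  the plain bound of a sum by the sum of a majorant.\<close>

lemma infsum_tail_le:
  fixes f :: "'i \<Rightarrow> real"
  assumes b: "\<And>i. \<bar>f i\<bar> \<le> W i" and W: "W summable_on UNIV" and P: "finite P" and f: "(f has_sum S) UNIV"
  shows "\<bar>S - sum f P\<bar> \<le> infsum W UNIV - sum W P"
proof -
  have Wp: "W summable_on (UNIV - P)" using W summable_on_subset_banach by blast
  have d: "(f has_sum (S - sum f P)) (UNIV - P)"
    by (rule has_sum_Diff[OF f has_sum_finite[OF P]]) simp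
  have w: "(W has_sum (infsum W UNIV - sum W P)) (UNIV - P)"
    by (rule has_sum_Diff[OF has_sum_infsum[OF W] has_sum_finite[OF P]]) simp
  have "S - sum f P \<le> infsum W UNIV - sum W P"
    by (rule has_sum_mono[OF d w]) (use b in \<open>simp add: abs_le_iff\<close>)
  moreover have "- (S - sum f P) \<le> infsum W UNIV - sum W P"
    by (rule has_sum_mono[OF has_sum_uminusI[OF d] w]) (use b in \<open>simp add: abs_le_iff\<close>)
  ultimately show ?thesis by linarith
qed

text \<open>If \<open>N\<close> is the order in the continuity estimate of \<open>T\<close>, the
  remainder of the Fourier series of \<open>f\<close> and its derivatives up to order
  \<open>N\<close> are bounded by one summable tail, which continuity carries over to
  \<open>T\<close>.\<close>

theorem distributions_expansion:
  fixes T :: "(real ^ 'n::finite \<Rightarrow> real) \<Rightarrow> real"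
  assumes T: "T \<in> distributions" and f: "f \<in> test_functions"
  shows "((\<lambda>p. T (fterm f p)) has_sum T f) UNIV"
proof -
  obtain C N where C: "C \<ge> 0" "\<And>f B. f \<in> test_functions \<Longrightarrow>
    (\<And>bs x. set bs \<subseteq> Basis \<Longrightarrow> length bs \<le> N \<Longrightarrow> \<bar>iterated_deriv bs f x\<bar> \<le> B) \<Longrightarrow> \<bar>T f\<bar> \<le> C * B"
    using distributions_bound[OF T] by blast
  let ?M = "2 * CARD('n) + 0"
  obtain B where B: "\<And>bs x. set bs \<subseteq> Basis \<Longrightarrow> length bs \<le> ?M + N \<Longrightarrow> \<bar>iterated_deriv bs f x\<bar> \<le> B"
    using test_functions_deriv_bound[OF f, of "?M + N"] by blast
  define W :: "int ^ 'n \<Rightarrow> real" where "W p = frequency_const TYPE('n) ^ ?M * B * decay ?M p" for p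
  have W: "W summable_on UNIV" unfolding W_def by (intro summable_on_cmult_right decay_summable)
  have est: "\<bar>T f - (\<Sum>p\<in>P. T (fterm f p))\<bar> \<le> C * (infsum W UNIV - sum W P)" if P: "finite P" for P
  proof -
    let ?g = "\<lambda>x. 1 * f x + (- 1) * (\<Sum>p\<in>P. 1 * fterm f p x)"
    have ft: "fterm f p \<in> test_functions" for p by (rule fterm_test[OF test_continuous[OF f]])
    have g: "?g \<in> test_functions" by (intro test_functions_linear_combination f test_functions_sum ft)
    have "\<bar>T ?g\<bar> \<le> C * (infsum W UNIV - sum W P)"
    proof (rule C(2)[OF g])
      fix bs :: "(real ^ 'n) list" and x assume bs: "set bs \<subseteq> Basis" "length bs \<le> N"
      let ?h = "iterated_deriv bs f"
      have h: "?h \<in> test_functions" by (rule test_functions_iterated_deriv[OF f bs(1)])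
      have sum: "iterated_deriv bs (\<lambda>x. \<Sum>p\<in>P. 1 * fterm f p x) = (\<lambda>x. \<Sum>p\<in>P. fterm ?h p x)"
        using P
      proof (induction P)
        case empty
        have "iterated_deriv bs (\<lambda>x. 0 * f x + 0 * f x) = (\<lambda>x. 0 * ?h x + 0 * ?h x)"
          using f bs by (intro iterated_deriv_linear_combination) (auto simp: test_functions_def)
        then show ?case by simp
      next
        case (insert p P)
        have "iterated_deriv bs (\<lambda>x. 1 * fterm f p x + 1 * (\<Sum>p\<in>P. 1 * fterm f p x)) =
            (\<lambda>x. 1 * iterated_deriv bs (fterm f p) x + 1 * iterated_deriv bs (\<lambda>x. \<Sum>p\<in>P. 1 * fterm f p x) x)"
          using ft[of p] test_functions_sum[of P "fterm f" "\<lambda>_. 1"] ft bs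
          by (intro iterated_deriv_linear_combination) (auto simp: test_functions_def)
        then show ?case using insert iterated_deriv_fterm[OF f bs(1)] by simp
      qed
      have "iterated_deriv bs ?g x = ?h x - (\<Sum>p\<in>P. fterm ?h p x)"
      proof -
        have "smooth f" "smooth (\<lambda>x. \<Sum>p\<in>P. 1 * fterm f p x)"
          using f test_functions_sum[of P "fterm f" "\<lambda>_. 1"] ft by (auto simp: test_functions_def)
        from iterated_deriv_linear_combination[OF this bs(1), of 1 "- 1"] show ?thesis
          unfolding sum by (metis (no_types, lifting) mult_1 mult_minus1 uminus_add_conv_diff add.commute)
      qed
      also have "\<bar>\<dots>\<bar> \<le> infsum W UNIV - sum W P"
      proof (rule infsum_tail_le[OF _ W P fourier_inversion[OF h]])
        fix p
        show "\<bar>fterm ?h p x\<bar> \<le> W p" unfolding W_def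
        proof (rule fterm_bound[OF h])
          fix bs' :: "(real ^ 'n) list" and x assume "set bs' \<subseteq> Basis" "length bs' \<le> ?M"
          then show "\<bar>iterated_deriv bs' ?h x\<bar> \<le> B"
            using B[of "bs' @ bs" x] bs by (simp add: iterated_deriv_append)
        qed
      qed
      finally show "\<bar>iterated_deriv bs ?g x\<bar> \<le> infsum W UNIV - sum W P" .
    qed
    also have "T ?g = 1 * T f + (- 1) * (\<Sum>p\<in>P. 1 * T (fterm f p))"
      using distributions_linear[OF T f, of "\<lambda>x. \<Sum>p\<in>P. 1 * fterm f p x" 1 "- 1"]
        distributions_sum[OF T, of P "fterm f" "\<lambda>_. 1"] test_functions_sum[of P "fterm f" "\<lambda>_. 1"] ft by simp
    finally show ?thesis by simp
  qed
  have lim: "((\<lambda>P. C * (infsum W UNIV - sum W P)) \<longlongrightarrow> C * (infsum W UNIV - infsum W UNIV)) (finite_subsets_at_top UNIV)"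
    using has_sum_infsum[OF W] unfolding has_sum_def by (intro tendsto_intros)
  show ?thesis unfolding has_sum_def
  proof (rule Lim_transform2[OF tendsto_const])
    show "((\<lambda>P. T f - (\<Sum>p\<in>P. T (fterm f p))) \<longlongrightarrow> 0) (finite_subsets_at_top UNIV)"
    proof (rule Lim_null_comparison)
      show "eventually (\<lambda>P. norm (T f - (\<Sum>p\<in>P. T (fterm f p))) \<le> C * (infsum W UNIV - sum W P)) (finite_subsets_at_top UNIV)"
        using est by (intro eventually_finite_subsets_at_top_weakI) simp
    qed (use lim in simp)
  qed
qed


section \<open>Existence, uniqueness and regularity of the heat flow\<close>

definition heat_flow :: "((real ^ 'n::finite \<Rightarrow> real) \<Rightarrow> real) \<Rightarrow> real \<Rightarrow> (real ^ 'n \<Rightarrow> real) \<Rightarrow> real" where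
  "heat_flow u \<tau> = (\<lambda>f\<in>test_functions. \<Sum>\<^sub>\<infinity>p. exp (- ((norm (frequency p))\<^sup>2 * \<tau>)) * u (fterm f p))"

lemma fterm_linear:
  assumes "f \<in> test_functions" "g \<in> test_functions"
  shows "fterm (\<lambda>x. a * f x + b * g x) p = (\<lambda>x. a * fterm f p x + b * fterm g p x)"
  unfolding fterm_def by (rule ext) (intro pairing_linear_left test_continuous assms continuous_trig)

lemma pairing_laplacian:
  assumes f: "f \<in> test_functions"
  shows "pairing (laplacian f) (trig p a) = - (norm (frequency p))\<^sup>2 * pairing f (trig p a)"
proof -
  have "pairing (partial_deriv b (partial_deriv b f)) (trig p a) = - (frequency p \<bullet> b)\<^sup>2 * pairing f (trig p a)"
    if b: "b \<in> Basis" for b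
  proof -
    have "trig p (a + pi / 2 + pi / 2) = (\<lambda>x. - trig p a x)"
    proof
      fix x show "trig p (a + pi / 2 + pi / 2) x = - trig p a x"
        using cos_periodic_pi[of "frequency p \<bullet> x + a"] by (simp add: trig_def algebra_simps)
    qed
    then have "pairing f (trig p (a + pi / 2 + pi / 2)) = - pairing f (trig p a)"
      by (simp add: pairing_def)
    then show ?thesis
      using pairing_partial_deriv[OF f b] pairing_partial_deriv[OF test_functions_partial_deriv[OF f b] b]
      by (simp add: power2_eq_square)
  qed
  then have "(\<Sum>b\<in>Basis. pairing (partial_deriv b (partial_deriv b f)) (trig p a)) =
      - (\<Sum>b\<in>Basis. (frequency p \<bullet> b)\<^sup>2) * pairing f (trig p a)"
    by (simp add: sum_distrib_right sum_negf)
  also have "(\<Sum>b\<in>Basis. (frequency p \<bullet> b)\<^sup>2) = (norm (frequency p))\<^sup>2"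
    unfolding power2_norm_eq_inner by (simp add: power2_eq_square flip: euclidean_inner)
  also have "(\<Sum>b\<in>Basis. pairing (partial_deriv b (partial_deriv b f)) (trig p a)) = pairing (laplacian f) (trig p a)"
    unfolding pairing_def laplacian_def sum_distrib_right
    by (rule Bochner_Integration.integral_sum[symmetric])
      (intro integrable_torus_continuous continuous_intros test_continuous test_functions_partial_deriv f)
  finally show ?thesis .
qed

lemma fterm_laplacian:
  "f \<in> test_functions \<Longrightarrow> fterm (laplacian f) p = (\<lambda>x. - (norm (frequency p))\<^sup>2 * fterm f p x)"
  unfolding fterm_def by (simp add: pairing_laplacian)

text \<open>The mean value theorem, used twice. At nonnegative times the exponentials are at most 1,
  so the constant \<open>l^2\<close> does not depend on time and the remainders can be
  summed.\<close>

lemma exp_second_order: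
  fixes l s t :: real
  assumes l: "l \<ge> 0" and st: "s \<ge> 0" "t \<ge> 0"
  shows "\<bar>exp (- (l * s)) - exp (- (l * t)) - (- l * exp (- (l * t))) * (s - t)\<bar> \<le> l\<^sup>2 * (s - t)\<^sup>2"
proof -
  have lip: "\<bar>exp (- (l * r)) - exp (- (l * t))\<bar> \<le> l * \<bar>r - t\<bar>" if "r \<ge> 0" for r
  proof -
    have "norm (exp (- (l * r)) - exp (- (l * t))) \<le> l * norm (r - t)"
    proof (rule field_differentiable_bound[of "{0..}" "\<lambda>r. exp (- (l * r))" "\<lambda>r. - l * exp (- (l * r))"])
      fix z :: real assume "z \<in> {0..}"
      then show "norm (- l * exp (- (l * z))) \<le> l" using l by (simp add: abs_mult mult_left_le)
      show "((\<lambda>r. exp (- (l * r))) has_field_derivative - l * exp (- (l * z))) (at z within {0..})"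
        by (auto intro!: derivative_eq_intros)
    qed (use st that in auto)
    then show ?thesis by simp
  qed
  let ?S = "{min s t..max s t}"
  let ?g = "\<lambda>r. exp (- (l * r)) + l * exp (- (l * t)) * r"
  have "norm (?g s - ?g t) \<le> (l\<^sup>2 * \<bar>s - t\<bar>) * norm (s - t)"
  proof (rule field_differentiable_bound[of ?S ?g "\<lambda>r. - l * exp (- (l * r)) + l * exp (- (l * t))"])
    fix z assume z: "z \<in> ?S"
    have "- l * exp (- (l * z)) + l * exp (- (l * t)) = - (l * (exp (- (l * z)) - exp (- (l * t))))"
      by (simp add: algebra_simps)
    then have "\<bar>- l * exp (- (l * z)) + l * exp (- (l * t))\<bar> = l * \<bar>exp (- (l * z)) - exp (- (l * t))\<bar>"
      using l by (simp only: abs_minus_cancel abs_mult abs_of_nonneg)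
    also have "\<dots> \<le> l * (l * \<bar>z - t\<bar>)" using z st l by (intro mult_left_mono lip) auto
    also have "\<dots> \<le> l * (l * \<bar>s - t\<bar>)" using z l by (intro mult_left_mono) auto
    finally show "norm (- l * exp (- (l * z)) + l * exp (- (l * t))) \<le> l\<^sup>2 * \<bar>s - t\<bar>"
      by (simp add: power2_eq_square mult.assoc)
    show "(?g has_field_derivative - l * exp (- (l * z)) + l * exp (- (l * t))) (at z within ?S)"
      by (auto intro!: derivative_eq_intros)
  qed auto
  then show ?thesis by (simp add: power2_eq_square algebra_simps)
qed

text \<open>The weight \<open>(1 + l i)^2\<close> dominates 1, \<open>l i\<close> and
  \<open>(l i)^2\<close>, which occur in the series, in its termwise derivative and in the
  second-order remainder. Restriction to nonnegative times yields the one-sided derivative at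
  0.\<close>

lemma has_derivative_exp_infsum:
  fixes l c :: "'i \<Rightarrow> real"
  assumes l: "\<And>i. l i \<ge> 0" and W: "W summable_on UNIV" "\<And>i. (1 + l i)\<^sup>2 * \<bar>c i\<bar> \<le> W i" and t: "t \<ge> 0"
  shows "((\<lambda>s. \<Sum>\<^sub>\<infinity>i. exp (- (l i * s)) * c i) has_real_derivative (\<Sum>\<^sub>\<infinity>i. exp (- (l i * t)) * (- l i * c i))) (at t within {0..})"
proof -
  let ?F = "\<lambda>s. \<Sum>\<^sub>\<infinity>i. exp (- (l i * s)) * c i" and ?G = "\<Sum>\<^sub>\<infinity>i. exp (- (l i * t)) * (- l i * c i)"
  have l2: "1 \<le> (1 + l i)\<^sup>2" "l i \<le> (1 + l i)\<^sup>2" "(l i)\<^sup>2 \<le> (1 + l i)\<^sup>2" for i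
    using l[of i] by (auto simp: power2_eq_square algebra_simps)
  have b: "k * \<bar>c i\<bar> \<le> W i" if "k \<le> (1 + l i)\<^sup>2" for k i
    using W(2)[of i] that by (meson abs_ge_zero mult_right_mono order_trans)
  have e1: "exp (- (l i * s)) \<le> 1" if "s \<ge> 0" for s i using l[of i] that by simp
  have sF: "(\<lambda>i. exp (- (l i * s)) * c i) summable_on UNIV" if "s \<ge> 0" for s
  proof (rule abs_summable_bounded[OF _ W(1)])
    fix i show "\<bar>exp (- (l i * s)) * c i\<bar> \<le> W i"
      using b[of 1 i] l2[of i] mult_right_mono[OF e1[OF that, of i], of "\<bar>c i\<bar>"] by (simp add: abs_mult)
  qed
  have sG: "(\<lambda>i. exp (- (l i * t)) * (- l i * c i)) summable_on UNIV"
  proof (rule abs_summable_bounded[OF _ W(1)])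
    fix i show "\<bar>exp (- (l i * t)) * (- l i * c i)\<bar> \<le> W i"
      using b[of "l i" i] l2[of i] mult_right_mono[OF e1[OF t, of i], of "l i * \<bar>c i\<bar>"] l[of i] by (simp add: abs_mult)
  qed
  have quad: "\<bar>?F s - ?F t - ?G * (s - t)\<bar> \<le> infsum W UNIV * (s - t)\<^sup>2" if s: "s \<ge> 0" for s
  proof -
    have hs: "((\<lambda>i. exp (- (l i * s)) * c i - exp (- (l i * t)) * c i - exp (- (l i * t)) * (- l i * c i) * (s - t))
        has_sum (?F s - ?F t - ?G * (s - t))) UNIV"
      by (intro has_sum_diff has_sum_infsum sF s t has_sum_cmult_left sG)
    have bd: "\<bar>exp (- (l i * s)) * c i - exp (- (l i * t)) * c i - exp (- (l i * t)) * (- l i * c i) * (s - t)\<bar> \<le> W i * (s - t)\<^sup>2" for i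
    proof -
      have "exp (- (l i * s)) * c i - exp (- (l i * t)) * c i - exp (- (l i * t)) * (- l i * c i) * (s - t) =
          (exp (- (l i * s)) - exp (- (l i * t)) - (- l i * exp (- (l i * t))) * (s - t)) * c i"
        by (simp add: algebra_simps)
      also have "\<bar>\<dots>\<bar> \<le> ((l i)\<^sup>2 * (s - t)\<^sup>2) * \<bar>c i\<bar>"
        unfolding abs_mult by (intro mult_right_mono exp_second_order l s t) simp
      also have "\<dots> = (l i)\<^sup>2 * \<bar>c i\<bar> * (s - t)\<^sup>2" by simp
      also have "\<dots> \<le> W i * (s - t)\<^sup>2" using b[OF l2(3)] by (intro mult_right_mono) auto
      finally show ?thesis .
    qed
    have "(\<lambda>i. W i * (s - t)\<^sup>2) summable_on UNIV" by (intro summable_on_cmult_left W)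
    from infsum_tail_le[OF bd this _ hs, of "{}"] show ?thesis
      by (simp add: infsum_cmult_left[OF W(1)])
  qed
  have "((\<lambda>s. (?F s - ?F t) / (s - t)) \<longlongrightarrow> ?G) (at t within {0..})"
  proof (rule Lim_transform2[OF tendsto_const])
    show "((\<lambda>s. ?G - (?F s - ?F t) / (s - t)) \<longlongrightarrow> 0) (at t within {0..})"
    proof (rule Lim_null_comparison)
      show "\<forall>\<^sub>F s in at t within {0..}. norm (?G - (?F s - ?F t) / (s - t)) \<le> infsum W UNIV * \<bar>s - t\<bar>"
        unfolding eventually_at_filter
      proof (rule always_eventually, intro allI impI)
        fix s assume "s \<noteq> t" "s \<in> {0..}"
        then have "\<bar>?G - (?F s - ?F t) / (s - t)\<bar> = \<bar>?F s - ?F t - ?G * (s - t)\<bar> / \<bar>s - t\<bar>"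
          by (subst abs_divide[symmetric]) (simp add: diff_divide_distrib abs_minus_commute)
        also have "\<dots> \<le> (infsum W UNIV * (s - t)\<^sup>2) / \<bar>s - t\<bar>"
          using \<open>s \<in> {0..}\<close> by (intro divide_right_mono quad) auto
        also have "\<dots> = infsum W UNIV * \<bar>s - t\<bar>"
        proof -
          have "(s - t)\<^sup>2 = \<bar>s - t\<bar> * \<bar>s - t\<bar>" by (simp add: power2_eq_square)
          moreover have "w * (b * b) / b = w * b" if "b \<noteq> 0" for w b :: real using that by simp
          ultimately show ?thesis using \<open>s \<noteq> t\<close> by (simp only: abs_eq_0 right_minus_eq not_False_eq_True)
        qed
        finally show "norm (?G - (?F s - ?F t) / (s - t)) \<le> infsum W UNIV * \<bar>s - t\<bar>" by simp
      qed
      have "((\<lambda>s. infsum W UNIV * \<bar>s - t\<bar>) \<longlongrightarrow> infsum W UNIV * \<bar>t - t\<bar>) (at t within {0..})"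
        by (intro tendsto_intros)
      then show "((\<lambda>s. infsum W UNIV * \<bar>s - t\<bar>) \<longlongrightarrow> 0) (at t within {0..})" by simp
    qed
  qed
  then show ?thesis by (simp add: has_field_derivative_iff)
qed

text \<open>Four extra orders of decay pay for the weight of the termwise differentiation in time,
  since \<open>(1 + x^2)^2 \<le> (1 + x)^4\<close> for nonnegative \<open>x\<close>.\<close>

lemma distributions_fterm_summable:
  fixes u :: "(real ^ 'n::finite \<Rightarrow> real) \<Rightarrow> real"
  assumes u: "u \<in> distributions" and f: "f \<in> test_functions"
  shows "\<exists>W. W summable_on UNIV \<and> (\<forall>p. (1 + (norm (frequency p))\<^sup>2)\<^sup>2 * \<bar>u (fterm f p)\<bar> \<le> W p)"
proof -
  let ?M = "2 * CARD('n) + 0"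
  obtain K N where K: "K \<ge> 0" "\<And>f B p. f \<in> test_functions \<Longrightarrow>
    (\<And>bs x. set bs \<subseteq> Basis \<Longrightarrow> length bs \<le> (?M + 4) + N \<Longrightarrow> \<bar>iterated_deriv bs f x\<bar> \<le> B) \<Longrightarrow>
    \<bar>u (fterm f p)\<bar> \<le> K * B * decay (?M + 4) p"
    using distributions_fterm_bound[OF u, of "?M + 4"] by blast
  obtain B where B: "\<And>bs x. set bs \<subseteq> Basis \<Longrightarrow> length bs \<le> (?M + 4) + N \<Longrightarrow> \<bar>iterated_deriv bs f x\<bar> \<le> B"
    using test_functions_deriv_bound[OF f, of "(?M + 4) + N"] by blast
  have B0: "B \<ge> 0" using B[of "[]" 0] by simp
  show ?thesis
  proof (intro exI conjI allI)
    show "(\<lambda>p :: int ^ 'n. K * B * decay ?M p) summable_on UNIV" by (intro summable_on_cmult_right decay_summable)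
    fix p :: "int ^ 'n"
    have "(1 + (norm (frequency p))\<^sup>2)\<^sup>2 \<le> ((1 + norm (frequency p))\<^sup>2)\<^sup>2"
      by (intro power_mono) (auto simp: power2_eq_square algebra_simps)
    then have le: "(1 + (norm (frequency p))\<^sup>2)\<^sup>2 \<le> (1 + norm (frequency p)) ^ 4" by (simp flip: power_mult)
    have "(1 + (norm (frequency p))\<^sup>2)\<^sup>2 * \<bar>u (fterm f p)\<bar> \<le> (1 + norm (frequency p)) ^ 4 * (K * B * decay (?M + 4) p)"
      using K(2)[OF f B] by (intro mult_mono le) auto
    also have "\<dots> = K * B * (decay (?M + 4) p * (1 + norm (frequency p)) ^ 4)" by (simp add: mult_ac)
    finally show "(1 + (norm (frequency p))\<^sup>2)\<^sup>2 * \<bar>u (fterm f p)\<bar> \<le> K * B * decay ?M p" unfolding decay_mult .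
  qed
qed

lemma heat_flow_summable:
  fixes u :: "(real ^ 'n::finite \<Rightarrow> real) \<Rightarrow> real"
  assumes u: "u \<in> distributions" and f: "f \<in> test_functions" and t: "\<tau> \<ge> 0"
  shows "(\<lambda>p. exp (- ((norm (frequency p))\<^sup>2 * \<tau>)) * u (fterm f p)) summable_on UNIV"
proof -
  obtain W where W: "W summable_on UNIV" "\<And>p. (1 + (norm (frequency p))\<^sup>2)\<^sup>2 * \<bar>u (fterm f p)\<bar> \<le> W p"
    using distributions_fterm_summable[OF u f] by blast
  show ?thesis
  proof (rule abs_summable_bounded[OF _ W(1)])
    fix p :: "int ^ 'n"
    have "exp (- ((norm (frequency p))\<^sup>2 * \<tau>)) \<le> 1 ^ 2" using t by simp
    also have "(1::real) ^ 2 \<le> (1 + (norm (frequency p))\<^sup>2)\<^sup>2" by (intro power_mono) auto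
    finally show "\<bar>exp (- ((norm (frequency p))\<^sup>2 * \<tau>)) * u (fterm f p)\<bar> \<le> W p"
      using mult_right_mono[of "exp (- ((norm (frequency p))\<^sup>2 * \<tau>))" _ "\<bar>u (fterm f p)\<bar>"] W(2)[of p]
      by (simp add: abs_mult) (meson order_trans abs_ge_zero)
  qed
qed

lemma heat_flow_distributions:
  fixes u :: "(real ^ 'n::finite \<Rightarrow> real) \<Rightarrow> real"
  assumes u: "u \<in> distributions" and t: "\<tau> \<ge> 0"
  shows "heat_flow u \<tau> \<in> distributions"
proof -
  let ?M = "2 * CARD('n) + 0"
  obtain K N where K: "K \<ge> 0" "\<And>f B p. f \<in> test_functions \<Longrightarrow>
    (\<And>bs x. set bs \<subseteq> Basis \<Longrightarrow> length bs \<le> ?M + N \<Longrightarrow> \<bar>iterated_deriv bs f x\<bar> \<le> B) \<Longrightarrow>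
    \<bar>u (fterm f p)\<bar> \<le> K * B * decay ?M p"
    using distributions_fterm_bound[OF u, of ?M] by blast
  let ?e = "\<lambda>p :: int ^ 'n. exp (- ((norm (frequency p))\<^sup>2 * \<tau>))"
  have sD: "decay ?M summable_on (UNIV :: (int ^ 'n) set)" by (rule decay_summable)
  show ?thesis unfolding distributions_def mem_Collect_eq
  proof (intro conjI ballI allI)
    show "heat_flow u \<tau> \<in> extensional test_functions" by (simp add: heat_flow_def)
    fix f g :: "real ^ 'n \<Rightarrow> real" and a b assume f: "f \<in> test_functions" and g: "g \<in> test_functions"
    have eq: "?e p * u (fterm (\<lambda>x. a * f x + b * g x) p) = a * (?e p * u (fterm f p)) + b * (?e p * u (fterm g p))" for p
      unfolding fterm_linear[OF f g]
      by (subst distributions_linear[OF u]) (auto intro: fterm_test test_continuous f g simp: algebra_simps)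
    have "(\<Sum>\<^sub>\<infinity>p. ?e p * u (fterm (\<lambda>x. a * f x + b * g x) p)) =
        a * (\<Sum>\<^sub>\<infinity>p. ?e p * u (fterm f p)) + b * (\<Sum>\<^sub>\<infinity>p. ?e p * u (fterm g p))"
      unfolding eq
      by (rule infsumI) (intro has_sum_add has_sum_cmult_right has_sum_infsum heat_flow_summable u f g t)
    then show "heat_flow u \<tau> (\<lambda>x. a * f x + b * g x) = a * heat_flow u \<tau> f + b * heat_flow u \<tau> g"
      by (simp add: heat_flow_def f g test_functions_linear_combination)
  next
    show "\<exists>C N. \<forall>f\<in>test_functions. \<forall>B. (\<forall>bs x. set bs \<subseteq> Basis \<longrightarrow> length bs \<le> N \<longrightarrow> \<bar>iterated_deriv bs f x\<bar> \<le> B) \<longrightarrow>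
        \<bar>heat_flow u \<tau> f\<bar> \<le> C * B"
    proof (rule exI[of _ "K * infsum (decay ?M) (UNIV :: (int ^ 'n) set)"], rule exI[of _ "?M + N"], intro ballI allI impI)
      fix f :: "real ^ 'n \<Rightarrow> real" and B
      assume f: "f \<in> test_functions" and "\<forall>bs x. set bs \<subseteq> Basis \<longrightarrow> length bs \<le> ?M + N \<longrightarrow> \<bar>iterated_deriv bs f x\<bar> \<le> B"
      then have B: "\<And>bs x. set bs \<subseteq> Basis \<Longrightarrow> length bs \<le> ?M + N \<Longrightarrow> \<bar>iterated_deriv bs f x\<bar> \<le> B" by blast
      have bd: "\<bar>?e p * u (fterm f p)\<bar> \<le> K * B * decay ?M p" for p
        using K(2)[OF f B, of p] mult_right_mono[of "?e p" 1 "\<bar>u (fterm f p)\<bar>"] t by (simp add: abs_mult)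
      have eq: "(\<Sum>\<^sub>\<infinity>p :: int ^ 'n. K * B * decay ?M p) = K * B * infsum (decay ?M) (UNIV :: (int ^ 'n) set)"
        by (rule infsum_cmult_right[OF sD])
      from infsum_tail_le[OF bd summable_on_cmult_right[OF sD] _ has_sum_infsum[OF heat_flow_summable[OF u f t]], of "{}"]
      show "\<bar>heat_flow u \<tau> f\<bar> \<le> K * infsum (decay ?M) (UNIV :: (int ^ 'n) set) * B"
        unfolding eq by (simp add: heat_flow_def f mult_ac)
    qed
  qed
qed

text \<open>The initial condition is the Fourier expansion of \<open>u\<close>; off the test
  functions it holds because both sides are extensional. The equation is differentiation term by
  term.\<close>

theorem heat_solution_heat_flow:
  fixes u :: "(real ^ 'n::finite \<Rightarrow> real) \<Rightarrow> real"
  assumes u: "u \<in> distributions"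
  shows "heat_solution u (heat_flow u)"
  unfolding heat_solution_def
proof (intro conjI allI impI ballI)
  show "heat_flow u 0 = u"
  proof
    fix f show "heat_flow u 0 f = u f"
    proof (cases "f \<in> test_functions")
      case True
      then show ?thesis using infsumI[OF distributions_expansion[OF u True]] by (simp add: heat_flow_def)
    next
      case False
      then show ?thesis using u by (simp add: heat_flow_def distributions_def extensional_def)
    qed
  qed
  show "heat_flow u \<tau> \<in> distributions" if "\<tau> \<ge> 0" for \<tau> by (rule heat_flow_distributions[OF u that])
  fix f :: "real ^ 'n \<Rightarrow> real" and \<tau> :: real assume f: "f \<in> test_functions" and t: "\<tau> \<ge> 0"
  obtain W where W: "W summable_on UNIV" "\<And>p. (1 + (norm (frequency p))\<^sup>2)\<^sup>2 * \<bar>u (fterm f p)\<bar> \<le> W p"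
    using distributions_fterm_summable[OF u f] by blast
  have "u (fterm (laplacian f) p) = - (norm (frequency p))\<^sup>2 * u (fterm f p)" for p
    unfolding fterm_laplacian[OF f] by (rule distributions_cmult[OF u fterm_test[OF test_continuous[OF f]]])
  then show "((\<lambda>\<tau>'. heat_flow u \<tau>' f) has_real_derivative heat_flow u \<tau> (laplacian f)) (at \<tau> within {0..})"
    using has_derivative_exp_infsum[OF _ W(1) W(2) t] f
    by (simp add: heat_flow_def laplacian_test_functions)
qed

text \<open>Tested against a character, the heat equation is a linear ordinary differential
  equation, and the integrating factor makes the product constant. This applies to every solution
  and is the source of uniqueness.\<close>

lemma heat_solution_trig:
  assumes u: "u \<in> distributions" and v: "heat_solution u v"
  shows "v 1 (trig p a) = exp (- (norm (frequency p))\<^sup>2) * u (trig p a)"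
proof -
  let ?l = "(norm (frequency p))\<^sup>2"
  have vD: "v \<tau> \<in> distributions" if "\<tau> \<ge> 0" for \<tau> using v that by (simp add: heat_solution_def)
  have d: "((\<lambda>\<tau>. exp (?l * \<tau>) * v \<tau> (trig p a)) has_real_derivative 0) (at \<tau> within {0..})" if t: "\<tau> \<in> {0..}" for \<tau>
  proof -
    have "((\<lambda>\<tau>. v \<tau> (trig p a)) has_real_derivative v \<tau> (laplacian (trig p a))) (at \<tau> within {0..})"
      using v t trig_test unfolding heat_solution_def by (metis atLeast_iff)
    moreover have "v \<tau> (laplacian (trig p a)) = - ?l * v \<tau> (trig p a)"
      unfolding laplacian_trig by (rule distributions_cmult[OF vD trig_test]) (use t in simp)
    ultimately show ?thesis by (auto intro!: derivative_eq_intros)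
  qed
  obtain c where c: "\<And>\<tau>. \<tau> \<in> {0..} \<Longrightarrow> exp (?l * \<tau>) * v \<tau> (trig p a) = c"
    using has_field_derivative_zero_constant[of "{0..}", OF _ d] by auto
  have "exp ?l * v 1 (trig p a) = u (trig p a)"
    using c[of 1] c[of 0] v by (simp add: heat_solution_def)
  then show ?thesis by (simp add: exp_minus field_simps)
qed

definition heat_series :: "((real ^ 'n::finite \<Rightarrow> real) \<Rightarrow> real) \<Rightarrow> real ^ 'n \<Rightarrow> real" where
  "heat_series u x = (\<Sum>\<^sub>\<infinity>p. exp (- (norm (frequency p))\<^sup>2) *
     (u (trig p 0) * trig p 0 x + u (trig p (- pi / 2)) * trig p (- pi / 2) x))"

text \<open>The Gaussian beats any polynomial: the limit at infinity settles large arguments and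
  compactness the others.\<close>

lemma exp_decay_bound:
  fixes M N :: nat
  obtains K where "K \<ge> 0" "\<And>p :: int ^ 'n::finite. exp (- (norm (frequency p))\<^sup>2) * (1 + norm (frequency p)) ^ N \<le> K * decay M p"
proof -
  have "((\<lambda>x::real. (1 + x) ^ (N + M) * exp (- x\<^sup>2)) \<longlongrightarrow> 0) at_top" by real_asymp
  then have "eventually (\<lambda>x::real. (1 + x) ^ (N + M) * exp (- x\<^sup>2) < 1) at_top"
    by (rule order_tendstoD) simp
  then obtain R where R: "\<And>x::real. x \<ge> R \<Longrightarrow> (1 + x) ^ (N + M) * exp (- x\<^sup>2) < 1"
    unfolding eventually_at_top_linorder by blast
  have "compact ((\<lambda>x::real. (1 + x) ^ (N + M) * exp (- x\<^sup>2)) ` {0..R})"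
    by (intro compact_continuous_image continuous_intros) auto
  from compact_imp_bounded[OF this] obtain K
    where "\<forall>y\<in>(\<lambda>x::real. (1 + x) ^ (N + M) * exp (- x\<^sup>2)) ` {0..R}. norm y \<le> K"
    unfolding bounded_iff by blast
  then have K: "\<bar>(1 + x) ^ (N + M) * exp (- x\<^sup>2)\<bar> \<le> K" if "x \<in> {0..R}" for x
    using that by auto
  have b: "(1 + x) ^ (N + M) * exp (- x\<^sup>2) \<le> max K 1" if "x \<ge> 0" for x
    using R[of x] K[of x] that by (cases "x \<ge> R") auto
  show ?thesis
  proof (rule that[of "max K 1"])
    fix p :: "int ^ 'n"
    have pos: "0 < (1 + norm (frequency p)) ^ M" by (simp add: add_pos_nonneg)
    show "exp (- (norm (frequency p))\<^sup>2) * (1 + norm (frequency p)) ^ N \<le> max K 1 * decay M p"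
      using b[of "norm (frequency p)"] pos unfolding decay_def by (simp add: pos_le_divide_eq power_add mult_ac)
  qed simp
qed

lemma heat_series_term_bound:
  fixes u :: "(real ^ 'n::finite \<Rightarrow> real) \<Rightarrow> real"
  assumes u: "u \<in> distributions"
  obtains W where "W summable_on UNIV"
    "\<And>p x. \<bar>exp (- (norm (frequency p))\<^sup>2) * (u (trig p 0) * trig p 0 x + u (trig p (- pi / 2)) * trig p (- pi / 2) x)\<bar> \<le> W p"
proof -
  obtain C N where C: "C \<ge> 0" "\<And>p a. \<bar>u (trig p a)\<bar> \<le> C * (1 + norm (frequency p)) ^ N"
    using distributions_trig_bound[OF u] by blast
  obtain K where K: "K \<ge> 0" "\<And>p :: int ^ 'n. exp (- (norm (frequency p))\<^sup>2) * (1 + norm (frequency p)) ^ N \<le> K * decay (2 * CARD('n) + 0) p"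
    using exp_decay_bound[where 'n='n, of N "2 * CARD('n) + 0"] by blast
  show ?thesis
  proof (rule that[of "\<lambda>p. 2 * C * K * decay (2 * CARD('n) + 0) p"])
    show "(\<lambda>p :: int ^ 'n. 2 * C * K * decay (2 * CARD('n) + 0) p) summable_on UNIV"
      by (intro summable_on_cmult_right decay_summable)
    fix p and x :: "real ^ 'n"
    have *: "\<bar>u (trig p a) * trig p a x\<bar> \<le> C * (1 + norm (frequency p)) ^ N * 1" for a
      unfolding abs_mult using C(1) by (intro mult_mono C abs_trig_le) auto
    have "\<bar>u (trig p 0) * trig p 0 x + u (trig p (- pi / 2)) * trig p (- pi / 2) x\<bar> \<le> 2 * C * (1 + norm (frequency p)) ^ N"
      using *[of 0] *[of "- pi / 2"] by linarith
    then have "\<bar>exp (- (norm (frequency p))\<^sup>2) * (u (trig p 0) * trig p 0 x + u (trig p (- pi / 2)) * trig p (- pi / 2) x)\<bar>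
        \<le> exp (- (norm (frequency p))\<^sup>2) * (2 * C * (1 + norm (frequency p)) ^ N)"
      unfolding abs_mult by (intro mult_mono) auto
    also have "\<dots> = 2 * C * (exp (- (norm (frequency p))\<^sup>2) * (1 + norm (frequency p)) ^ N)" by simp
    also have "\<dots> \<le> 2 * C * (K * decay (2 * CARD('n) + 0) p)" using C(1) by (intro mult_left_mono K) auto
    finally show "\<bar>exp (- (norm (frequency p))\<^sup>2) * (u (trig p 0) * trig p 0 x + u (trig p (- pi / 2)) * trig p (- pi / 2) x)\<bar>
        \<le> 2 * C * K * decay (2 * CARD('n) + 0) p" by simp
  qed
qed

text \<open>Any solution has at time 1 the damped coefficients of \<open>u\<close>, and a continuous
  periodic function is determined by its coefficients. So the description in \<open>heat_map\<close>
  denotes, namely the sum of the damped series.\<close>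

theorem heat_map_eq:
  fixes u :: "(real ^ 'n::finite \<Rightarrow> real) \<Rightarrow> real"
  assumes u: "u \<in> distributions"
  shows "heat_map u = heat_series u"
proof -
  let ?f = "\<lambda>p x. exp (- (norm (frequency p))\<^sup>2) * (u (trig p 0) * trig p 0 x + u (trig p (- pi / 2)) * trig p (- pi / 2) x)"
  obtain W where W: "W summable_on UNIV" "\<And>p x. \<bar>?f p x\<bar> \<le> W p" using heat_series_term_bound[OF u] by blast
  have fc: "continuous_on UNIV (?f p)" for p by (intro continuous_intros)
  have c: "continuous_on UNIV (heat_series u)"
    unfolding heat_series_def[abs_def] by (rule continuous_on_infsum[OF fc W(2,1)])
  have per: "periodic (heat_series u)" by (simp add: periodic_def heat_series_def)
  have "pairing (heat_series u) f = heat_flow u 1 f" if f: "f \<in> test_functions" for f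
  proof -
    have "((\<lambda>p. pairing (?f p) f) has_sum pairing (heat_series u) f) UNIV"
      unfolding heat_series_def[abs_def] by (rule has_sum_pairing[OF fc W(2,1) test_continuous[OF f]])
    moreover have "pairing (?f p) f = exp (- ((norm (frequency p))\<^sup>2 * 1)) * u (fterm f p)" for p
    proof -
      have "pairing (\<lambda>x. u (trig p 0) * trig p 0 x + u (trig p (- pi / 2)) * trig p (- pi / 2) x) f =
          u (trig p 0) * pairing (trig p 0) f + u (trig p (- pi / 2)) * pairing (trig p (- pi / 2)) f"
        by (rule pairing_linear_left) (intro continuous_trig test_continuous f)+
      moreover have "pairing (\<lambda>x. c * g x) f = c * pairing g f" for c g by (simp add: pairing_def mult.assoc)
      ultimately show ?thesis by (simp add: distributions_fterm[OF u f] pairing_commute[of f] mult_ac)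
    qed
    ultimately show ?thesis by (simp add: heat_flow_def f infsumI)
  qed
  then have reg: "heat_flow u 1 = regular_distribution (heat_series u)"
    unfolding regular_distribution_def by (intro ext) (auto simp: restrict_def heat_flow_def)
  show ?thesis unfolding heat_map_def
  proof (rule the_equality)
    show "continuous_on UNIV (heat_series u) \<and> periodic (heat_series u) \<and> (\<exists>v. heat_solution u v \<and> v 1 = regular_distribution (heat_series u))"
      using c per reg heat_solution_heat_flow[OF u] by blast
    fix g assume "continuous_on UNIV g \<and> periodic g \<and> (\<exists>v. heat_solution u v \<and> v 1 = regular_distribution g)"
    then obtain v where g: "continuous_on UNIV g" "periodic g" "heat_solution u v" "v 1 = regular_distribution g" by blast
    have "(\<lambda>x. g x - heat_series u x) = (\<lambda>_. 0)"
    proof (rule fourier_uniqueness)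
      show "continuous_on UNIV (\<lambda>x. g x - heat_series u x)" by (intro continuous_intros g c)
      show "periodic (\<lambda>x. g x - heat_series u x)" using g per by (simp add: periodic_def)
      fix p a
      have "pairing g (trig p a) = pairing (heat_series u) (trig p a)"
        using heat_solution_trig[OF u g(3), of p a] heat_solution_trig[OF u heat_solution_heat_flow[OF u], of p a]
        unfolding g(4) reg regular_distribution_def by (simp add: trig_test)
      then show "pairing (\<lambda>x. g x - heat_series u x) (trig p a) = 0"
        using pairing_linear_left[OF g(1) c continuous_trig, of 1 "- 1" p a] by simp
    qed
    then show "g = heat_series u" by (metis eq_iff_diff_eq_0 ext)
  qed
qed

section \<open>Measurability of the observations and of the Besov spaces\<close>

lemma space_distribution_space[simp]: "space distribution_space = distributions"
  unfolding distribution_space_def by (rule space_measure_of) auto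

lemma measurable_evaluation:
  assumes "f \<in> test_functions"
  shows "(\<lambda>T. T f) \<in> borel_measurable distribution_space"
proof (rule measurableI)
  fix A :: "real set" assume "A \<in> sets borel"
  then have "{T \<in> distributions. T f \<in> A} \<in> sigma_sets distributions
      {{T \<in> distributions. T f \<in> A} | f A. f \<in> test_functions \<and> A \<in> sets borel}"
    using assms by (intro sigma_sets.Basic) blast
  moreover have "(\<lambda>T. T f) -` A \<inter> space distribution_space = {T \<in> distributions. T f \<in> A}" by auto
  ultimately show "(\<lambda>T. T f) -` A \<inter> space distribution_space \<in> sets distribution_space"
    unfolding distribution_space_def by (subst sets_measure_of) auto
qed simp

lemma measurable_evaluation_trig: "(\<lambda>T. T (trig p a)) \<in> borel_measurable distribution_space"
  by (rule measurable_evaluation[OF trig_test])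

lemma borel_measurable_infsum_lattice:
  fixes f :: "int ^ 'n::finite \<Rightarrow> 'a \<Rightarrow> real"
  assumes f: "\<And>p. f p \<in> borel_measurable M" and s: "\<And>x. x \<in> space M \<Longrightarrow> (\<lambda>p. f p x) summable_on UNIV"
  shows "(\<lambda>x. \<Sum>\<^sub>\<infinity>p. f p x) \<in> borel_measurable M"
proof -
  obtain e :: "nat \<Rightarrow> int ^ 'n" where e: "bij e" using lattice_enumeration by blast
  show ?thesis
  proof (rule borel_measurable_LIMSEQ_real)
    fix x assume x: "x \<in> space M"
    have "((\<lambda>k. f (e k) x) has_sum (\<Sum>\<^sub>\<infinity>p. f p x)) UNIV"
      using has_sum_reindex_bij_betw[OF e, of "\<lambda>p. f p x"] has_sum_infsum[OF s[OF x]] by simp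
    from has_sum_imp_sums[OF this] show "(\<lambda>n. \<Sum>k<n. f (e k) x) \<longlonglongrightarrow> (\<Sum>\<^sub>\<infinity>p. f p x)"
      by (simp add: sums_def)
  qed (intro borel_measurable_sum f)
qed

text \<open>The Fourier expansion writes every evaluation as a countable sum of evaluations at
  characters. \<open>M\<close> is left general in order to apply this to a sigma-algebra generated
  by characters only.\<close>

lemma measurable_evaluation_of_trig:
  fixes M :: "((real ^ 'n::finite \<Rightarrow> real) \<Rightarrow> real) measure"
  assumes M: "space M = distributions"
    and t: "\<And>p a. a \<in> {0, - pi / 2} \<Longrightarrow> (\<lambda>T. T (trig p a)) \<in> borel_measurable M"
    and f: "f \<in> test_functions"
  shows "(\<lambda>T. T f) \<in> borel_measurable M"
proof -
  let ?g = "\<lambda>p T. pairing f (trig p 0) * T (trig p 0) + pairing f (trig p (- pi / 2)) * T (trig p (- pi / 2))"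
  have hs: "((\<lambda>p. ?g p T) has_sum T f) UNIV" if "T \<in> distributions" for T
    using distributions_expansion[OF that f] by (simp add: distributions_fterm[OF that f])
  have "(\<lambda>T. \<Sum>\<^sub>\<infinity>p. ?g p T) \<in> borel_measurable M"
  proof (rule borel_measurable_infsum_lattice)
    show "?g p \<in> borel_measurable M" for p
      by (intro borel_measurable_add borel_measurable_times borel_measurable_const t) auto
    show "(\<lambda>p. ?g p T) summable_on UNIV" if "T \<in> space M" for T
      using hs[of T] that M by (auto simp: summable_on_def)
  qed
  moreover have "(\<Sum>\<^sub>\<infinity>p. ?g p T) = T f" if "T \<in> space M" for T
    using infsumI[OF hs[of T]] that M by simp
  ultimately show ?thesis by (rule measurable_cong[THEN iffD1, rotated])
qed

text \<open>Countably many characters and a countable base of the line generate the sigma-algebra of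
  all evaluations. Closing under finite intersections makes the generator stable, as the uniqueness
  of conditional distributions requires.\<close>

lemma distribution_space_generator:
  "\<exists>C. countable C \<and> Int_stable C \<and> C \<subseteq> Pow (space (distribution_space :: ((real ^ 'n::finite \<Rightarrow> real) \<Rightarrow> real) measure)) \<and>
    space (distribution_space :: ((real ^ 'n \<Rightarrow> real) \<Rightarrow> real) measure) \<in> C \<and>
    sets (distribution_space :: ((real ^ 'n \<Rightarrow> real) \<Rightarrow> real) measure) = sigma_sets (space distribution_space) C"
proof -
  let ?D = "distributions :: ((real ^ 'n \<Rightarrow> real) \<Rightarrow> real) set"
  obtain B :: "real set set" where B: "countable B" "topological_basis B" using ex_countable_basis by blast
  define G where "G = (\<lambda>(p :: int ^ 'n, a, b). {T \<in> ?D. T (trig p a) \<in> b}) ` (UNIV \<times> {0, - pi / 2} \<times> B)"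
  \<comment> \<open>The intersection with \<open>?D\<close> gives the empty family the value
    \<open>?D\<close> rather than the set of all functionals.\<close>
  define C where "C = (\<lambda>F. ?D \<inter> \<Inter>F) ` {F. finite F \<and> F \<subseteq> G}"
  have G: "countable G" unfolding G_def using B by (intro countable_image countable_SIGMA) auto
  have C: "countable C" unfolding C_def by (intro countable_image countable_Collect_finite_subset G)
  have Gs: "g \<in> sets distribution_space" if gG: "g \<in> G" for g
  proof -
    obtain p a b where g: "g = {T \<in> ?D. T (trig p a) \<in> b}" "b \<in> B" using gG unfolding G_def by (elim imageE) (auto simp del: insert_iff)
    have "b \<in> sets borel" using g(2) B(2) by (simp add: topological_basis_open)
    from measurable_sets[OF measurable_evaluation_trig this, of p a]
    have "(\<lambda>T. T (trig p a)) -` b \<inter> ?D \<in> sets distribution_space" by simp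
    moreover have "(\<lambda>T. T (trig p a)) -` b \<inter> ?D = g" by (auto simp: g)
    ultimately show ?thesis by simp
  qed
  have GD: "g \<subseteq> ?D" if "g \<in> G" for g using that by (auto simp: G_def)
  have CP: "C \<subseteq> Pow ?D" by (auto simp: C_def)
  have "?D \<in> C" unfolding C_def by (rule image_eqI[of _ _ "{}"]) auto
  have int: "Int_stable C"
  proof (rule Int_stableI)
    fix a b assume "a \<in> C" "b \<in> C"
    then obtain F F' where "finite F" "F \<subseteq> G" "a = ?D \<inter> \<Inter>F" "finite F'" "F' \<subseteq> G" "b = ?D \<inter> \<Inter>F'"
      by (auto simp: C_def)
    then show "a \<inter> b \<in> C" unfolding C_def by (intro image_eqI[of _ _ "F \<union> F'"]) auto
  qed
  have "C \<subseteq> sets distribution_space"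
  proof
    fix c assume "c \<in> C"
    then obtain F where F: "finite F" "F \<subseteq> G" "c = ?D \<inter> \<Inter>F" by (auto simp: C_def)
    have "?D \<inter> \<Inter>F \<in> sets distribution_space" using F(1,2)
    proof (induction F)
      case empty then show ?case using sets.top[of "distribution_space :: ((real ^ 'n \<Rightarrow> real) \<Rightarrow> real) measure"] by simp
    next
      case (insert g F)
      have "?D \<inter> \<Inter>(insert g F) = g \<inter> (?D \<inter> \<Inter>F)" by auto
      then show ?case using insert Gs by auto
    qed
    then show "c \<in> sets distribution_space" using F by simp
  qed
  then have sub: "sigma_sets ?D C \<subseteq> sets distribution_space"
    using sets.sigma_sets_subset[of C "distribution_space :: ((real ^ 'n \<Rightarrow> real) \<Rightarrow> real) measure"] by simp
  let ?M = "sigma ?D C"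
  have M: "space ?M = ?D" "sets ?M = sigma_sets ?D C" using CP by (simp_all add: space_measure_of sets_measure_of)
  have tr: "(\<lambda>T. T (trig p a)) \<in> borel_measurable ?M" if a: "a \<in> {0, - pi / 2}" for p a
    unfolding borel_eq_countable_basis[OF B]
  proof (rule measurable_measure_of)
    fix b assume b: "b \<in> B"
    have "{T \<in> ?D. T (trig p a) \<in> b} \<in> G" unfolding G_def using a b by (intro image_eqI[of _ _ "(p, a, b)"]) auto
    then have "?D \<inter> \<Inter>{{T \<in> ?D. T (trig p a) \<in> b}} \<in> C" unfolding C_def by blast
    moreover have "(\<lambda>T. T (trig p a)) -` b \<inter> space ?M = ?D \<inter> \<Inter>{{T \<in> ?D. T (trig p a) \<in> b}}" by (auto simp: M)
    ultimately show "(\<lambda>T. T (trig p a)) -` b \<inter> space ?M \<in> sets ?M" unfolding M by (simp add: sigma_sets.Basic)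
  qed auto
  have "sets distribution_space \<subseteq> sigma_sets ?D C"
  proof -
    have "{T \<in> ?D. T f \<in> A} \<in> sets ?M" if "f \<in> test_functions" "A \<in> sets borel" for f A
    proof -
      have "(\<lambda>T. T f) -` A \<inter> space ?M \<in> sets ?M"
        by (rule measurable_sets[OF measurable_evaluation_of_trig[OF M(1) tr that(1)] that(2)])
      moreover have "(\<lambda>T. T f) -` A \<inter> space ?M = {T \<in> ?D. T f \<in> A}" unfolding M by auto
      ultimately show ?thesis by simp
    qed
    then have "{{T \<in> ?D. T f \<in> A} | f A. f \<in> test_functions \<and> A \<in> sets borel} \<subseteq> sets ?M" by auto
    from sets.sigma_sets_subset[OF this]
    have "sigma_sets ?D {{T \<in> ?D. T f \<in> A} | f A. f \<in> test_functions \<and> A \<in> sets borel} \<subseteq> sigma_sets ?D C"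
      by (simp only: M)
    moreover have "sets distribution_space = sigma_sets ?D {{T \<in> ?D. T f \<in> A} | f A. f \<in> test_functions \<and> A \<in> sets borel}"
      unfolding distribution_space_def by (rule sets_measure_of) auto
    ultimately show ?thesis by simp
  qed
  then show ?thesis using C int CP \<open>?D \<in> C\<close> sub by (intro exI[of _ C]) auto
qed

lemma measurable_heat_map: "(\<lambda>u. heat_map u x) \<in> borel_measurable distribution_space"
proof -
  note [measurable] = measurable_evaluation_trig
  have "(\<lambda>u. heat_series u x) \<in> borel_measurable distribution_space"
    unfolding heat_series_def
  proof (rule borel_measurable_infsum_lattice)
    fix u :: "(real ^ 'a \<Rightarrow> real) \<Rightarrow> real" assume "u \<in> space distribution_space"
    then have u: "u \<in> distributions" by simp
    obtain W where W: "W summable_on UNIV"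
      "\<And>p x. \<bar>exp (- (norm (frequency p))\<^sup>2) * (u (trig p 0) * trig p 0 x + u (trig p (- pi / 2)) * trig p (- pi / 2) x)\<bar> \<le> W p"
      using heat_series_term_bound[OF u] by blast
    show "(\<lambda>p. exp (- (norm (frequency p))\<^sup>2) * (u (trig p 0) * trig p 0 x + u (trig p (- pi / 2)) * trig p (- pi / 2) x)) summable_on UNIV"
      by (rule abs_summable_bounded[OF W(2,1)])
  qed measurable
  then show ?thesis by (rule measurable_cong[THEN iffD1, rotated]) (simp add: heat_map_eq)
qed

lemma measurable_observation: "(\<lambda>u. observation x (heat_map u)) \<in> borel_measurable distribution_space"
  by (rule borel_measurable_vecI) (simp add: observation_def measurable_heat_map)


section \<open>Measurability of Besov membership\<close>

lemma fourier_coeff_trig: "fourier_coeff T p = Complex (T (trig p 0)) (- T (trig p (- pi / 2)))"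
proof -
  have "trig p 0 = (\<lambda>x. cos (frequency p \<bullet> x))" "trig p (- pi / 2) = (\<lambda>x. sin (frequency p \<bullet> x))"
    by (auto simp: trig_def cos_diff)
  then show ?thesis by (simp add: fourier_coeff_def)
qed

lemma dyadic_resolution_support:
  assumes "dyadic_resolution \<theta>" "\<theta> k z \<noteq> 0"
  shows "norm z \<le> 2 ^ (k + 1)" "k \<ge> 1 \<Longrightarrow> 2 ^ (k - 1) \<le> norm z"
proof -
  have "norm z \<le> 2 ^ (k + 1) \<and> (k \<ge> 1 \<longrightarrow> 2 ^ (k - 1) \<le> norm z)"
  proof (cases "k = 0")
    case True
    then show ?thesis using assms unfolding dyadic_resolution_def by (auto simp: not_less[symmetric])
  next
    case False
    then have "k \<ge> 1" by simp
    then show ?thesis using assms unfolding dyadic_resolution_def by (meson not_less)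
  qed
  then show "norm z \<le> 2 ^ (k + 1)" "k \<ge> 1 \<Longrightarrow> 2 ^ (k - 1) \<le> norm z" by auto
qed

lemma finite_frequencies: "finite {p :: int ^ 'n::finite. norm (frequency p) \<le> R}"
proof (rule finite_subset[OF _ finite_vec_set])
  show "{p :: int ^ 'n. norm (frequency p) \<le> R} \<subseteq> {p. \<forall>r. p $ r \<in> {- \<lceil>R\<rceil>..\<lceil>R\<rceil>}}"
  proof (clarify)
    fix p :: "int ^ 'n" and r assume "norm (frequency p) \<le> R"
    then have "\<bar>of_int (p $ r)\<bar> \<le> R" using abs_frequency_nth_le[of p r] by linarith
    then show "p $ r \<in> {- \<lceil>R\<rceil>..\<lceil>R\<rceil>}" by (auto simp: abs_le_iff) linarith+
  qed
qed simp

lemma dyadic_block_eq_sum: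
  assumes "dyadic_resolution \<theta>"
  shows "dyadic_block \<theta> k T x = (\<Sum>p | norm (frequency p) \<le> 2 ^ (k + 1).
     complex_of_real (\<theta> k (frequency p)) * fourier_coeff T p * cis (frequency p \<bullet> x))"
proof -
  have "dyadic_block \<theta> k T x = (\<Sum>\<^sub>\<infinity>p\<in>{p. norm (frequency p) \<le> 2 ^ (k + 1)}.
     complex_of_real (\<theta> k (frequency p)) * fourier_coeff T p * cis (frequency p \<bullet> x))"
    unfolding dyadic_block_def
    by (rule infsum_cong_neutral) (use dyadic_resolution_support(1)[OF assms] in auto)
  then show ?thesis by (simp only: infsum_finite[OF finite_frequencies])
qed

lemma measurable_dyadic_block:
  fixes M :: "'a measure"
  assumes \<theta>: "dyadic_resolution \<theta>" and [measurable]: "f \<in> measurable M distribution_space" "g \<in> borel_measurable M"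
  shows "(\<lambda>z. dyadic_block \<theta> k (f z) (g z)) \<in> borel_measurable M"
proof -
  have fc: "fourier_coeff T p = of_real (T (trig p 0)) - \<i> * of_real (T (trig p (- pi / 2)))" for T and p :: "int ^ 'b"
    by (simp add: fourier_coeff_trig Complex_eq)
  have c: "cis y = of_real (cos y) + \<i> * of_real (sin y)" for y
    by (simp add: cis.code Complex_eq)
  have ev[measurable]: "(\<lambda>z. f z (trig p a)) \<in> borel_measurable M" for p a
    by (rule measurable_compose[OF assms(2) measurable_evaluation_trig])
  have [measurable]: "(\<lambda>z. frequency p \<bullet> g z) \<in> borel_measurable M" for p
    by (intro borel_measurable_inner borel_measurable_const assms)
  show ?thesis unfolding dyadic_block_eq_sum[OF \<theta>] fc c by measurable
qed

lemma measurable_ennreal_powr[measurable (raw)]: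
  assumes [measurable]: "f \<in> borel_measurable M" "r \<in> borel_measurable M"
  shows "(\<lambda>x. ennreal_powr (f x) (r x)) \<in> borel_measurable M"
  unfolding ennreal_powr_def by measurable

lemma ennreal_powr_mono:
  assumes "a \<le> b" "r \<ge> 0"
  shows "ennreal_powr a r \<le> ennreal_powr b r"
proof (cases "b = \<infinity>")
  case False
  then have "a \<noteq> \<infinity>" "enn2real a \<le> enn2real b" using assms by (auto simp: enn2real_mono top.not_eq_extremum)
  then show ?thesis using False assms by (auto simp: ennreal_powr_def intro!: ennreal_leI powr_mono2)
qed (simp add: ennreal_powr_def)

text \<open>The modular decreases in \<open>c\<close>, so the real parameter may be rounded up to an
  integer. This makes finiteness of the norm a countable union of conditions and hence
  measurable.\<close>

lemma variable_Lq_norm_finite_iff: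
  assumes q: "\<And>x. 1 \<le> q x"
  shows "variable_Lq_norm q f < \<infinity> \<longleftrightarrow>
    (\<exists>c::nat. 0 < c \<and> (\<integral>\<^sup>+ x. ennreal_powr (f x / ennreal (real c)) (q x) \<partial>torus) \<le> 1)"
proof
  assume "variable_Lq_norm q f < \<infinity>"
  then obtain c where c: "0 < c" "(\<integral>\<^sup>+ x. ennreal_powr (f x / ennreal c) (q x) \<partial>torus) \<le> 1"
    unfolding variable_Lq_norm_def by (auto simp: Inf_less_iff)
  obtain n :: nat where n: "c \<le> real n" using real_arch_simple by blast
  have "(\<integral>\<^sup>+ x. ennreal_powr (f x / ennreal (real n)) (q x) \<partial>torus) \<le> (\<integral>\<^sup>+ x. ennreal_powr (f x / ennreal c) (q x) \<partial>torus)"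
  proof (intro nn_integral_mono ennreal_powr_mono)
    fix x
    show "f x / ennreal (real n) \<le> f x / ennreal c"
      unfolding divide_ennreal_def using n c
      by (intro mult_left_mono) (auto simp: inverse_ennreal intro!: ennreal_leI le_imp_inverse_le)
    show "0 \<le> q x" using q[of x] by simp
  qed
  then show "\<exists>c::nat. 0 < c \<and> (\<integral>\<^sup>+ x. ennreal_powr (f x / ennreal (real c)) (q x) \<partial>torus) \<le> 1"
    using c n by (intro exI[of _ n]) auto
next
  assume "\<exists>c::nat. 0 < c \<and> (\<integral>\<^sup>+ x. ennreal_powr (f x / ennreal (real c)) (q x) \<partial>torus) \<le> 1"
  then obtain c :: nat where c: "0 < c" "(\<integral>\<^sup>+ x. ennreal_powr (f x / ennreal (real c)) (q x) \<partial>torus) \<le> 1" by blast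
  then have "variable_Lq_norm q f \<le> ennreal (real c)"
    unfolding variable_Lq_norm_def by (intro Inf_lower) auto
  then show "variable_Lq_norm q f < \<infinity>" by (simp add: le_less_trans[OF _ ennreal_less_top])
qed

text \<open>Blocks are finite sums and so jointly measurable in the distribution and the point;
  Tonelli gives measurability of the modular, for countably many \<open>c\<close>.\<close>

lemma besov_space_sets:
  fixes t q :: "real ^ 'n::finite \<Rightarrow> real"
  assumes \<theta>: "dyadic_resolution \<theta>" and [measurable]: "t \<in> borel_measurable borel" "q \<in> borel_measurable borel"
    and q: "\<And>x. 1 \<le> q x"
  shows "besov_space \<theta> t q \<in> sets distribution_space"
proof -
  let ?F = "\<lambda>T x. ennreal_powr (\<Sum>k. ennreal ((2 powr (real k * t x) * cmod (dyadic_block \<theta> k T x)) powr q x)) (1 / q x)"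
  let ?D = "distribution_space :: ((real ^ 'n \<Rightarrow> real) \<Rightarrow> real) measure"
  have tm[measurable]: "t \<in> borel_measurable torus" "q \<in> borel_measurable torus" by (auto intro: measurable_torus)
  have snd: "snd \<in> borel_measurable (?D \<Otimes>\<^sub>M torus)"
    by (rule measurable_compose[OF measurable_snd]) (rule measurable_torus, simp)
  have [measurable]: "(\<lambda>z. dyadic_block \<theta> k (fst z) (snd z)) \<in> borel_measurable (?D \<Otimes>\<^sub>M torus)" for k
    by (rule measurable_dyadic_block[OF \<theta> measurable_fst snd])
  define H where "H c T x = ennreal_powr (?F T x / ennreal (real c)) (q x)" for c :: nat and T x
  have "(\<lambda>z. H c (fst z) (snd z)) \<in> borel_measurable (?D \<Otimes>\<^sub>M torus)" for c
    unfolding H_def by measurable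
  then have "case_prod (H c) \<in> borel_measurable (?D \<Otimes>\<^sub>M torus)" for c
    by (simp only: split_beta')
  then have [measurable]: "(\<lambda>T. \<integral>\<^sup>+ x. H c T x \<partial>torus) \<in> borel_measurable ?D" for c
    by (rule torus.borel_measurable_nn_integral)
  have "besov_space \<theta> t q = {T \<in> space ?D. \<exists>c::nat. 0 < c \<and> (\<integral>\<^sup>+ x. H c T x \<partial>torus) \<le> 1}"
    unfolding besov_space_def besov_norm_def variable_Lq_norm_finite_iff[OF q] H_def by simp
  also have "\<dots> \<in> sets ?D" by measurable
  finally show ?thesis .
qed

text \<open>A pointwise geometric bound on the weighted blocks suffices, because the exponents are
  bounded almost everywhere and the torus has mass 1.\<close>

lemma besov_spaceI:
  fixes t q :: "real ^ 'n::finite \<Rightarrow> real"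
  assumes T: "T \<in> distributions" and q: "\<And>x. 1 \<le> q x" and Q: "AE x in torus. q x \<le> Q"
    and r: "0 < r" "r < 1"
    and b: "\<And>k x. x \<in> unit_cube \<Longrightarrow> 2 powr (real k * t x) * cmod (dyadic_block \<theta> k T x) \<le> D * r ^ k"
  shows "T \<in> besov_space \<theta> t q"
proof -
  define D' where "D' = max 1 D"
  \<comment> \<open>Powers of \<open>D' \<ge> 1\<close> increase with the exponent, and
    \<open>(r ^ k) powr q x \<le> r ^ k\<close> because \<open>q x \<ge> 1\<close>; so
    \<open>E\<close> bounds the inner sum. As \<open>E \<ge> 1\<close>, its power with exponent
    \<open>1 / q x\<close> is at most \<open>E\<close> again.\<close>
  define E where "E = D' powr \<bar>Q\<bar> / (1 - r)"
  have D': "D' \<ge> 1" "D \<le> D'" by (auto simp: D'_def)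
  have E1: "E \<ge> 1"
  proof -
    have "1 \<le> D' powr \<bar>Q\<bar>" using D' by (simp add: ge_one_powr_ge_zero)
    then show ?thesis using r unfolding E_def by (simp add: le_divide_eq)
  qed
  let ?F = "\<lambda>x. ennreal_powr (\<Sum>k. ennreal ((2 powr (real k * t x) * cmod (dyadic_block \<theta> k T x)) powr q x)) (1 / q x)"
  have F: "?F x \<le> ennreal E" if x: "x \<in> unit_cube" "q x \<le> Q" for x
  proof -
    have term_le: "(2 powr (real k * t x) * cmod (dyadic_block \<theta> k T x)) powr q x \<le> D' powr \<bar>Q\<bar> * r ^ k" for k
    proof -
      have "2 powr (real k * t x) * cmod (dyadic_block \<theta> k T x) \<le> D' * r ^ k"
        using b[OF x(1), of k] D'(2) r by (meson mult_right_mono order_trans zero_le_power less_imp_le)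
      then have "(2 powr (real k * t x) * cmod (dyadic_block \<theta> k T x)) powr q x \<le> (D' * r ^ k) powr q x"
        using q[of x] by (intro powr_mono2) auto
      also have "\<dots> = D' powr q x * (r ^ k) powr q x" using D' r by (simp add: powr_mult)
      also have "\<dots> \<le> D' powr \<bar>Q\<bar> * (r ^ k) powr 1"
        using D' r x q[of x] by (intro mult_mono powr_mono powr_mono') (auto simp: power_le_one)
      also have "\<dots> = D' powr \<bar>Q\<bar> * r ^ k" using r by simp
      finally show ?thesis .
    qed
    have "(\<Sum>k. ennreal ((2 powr (real k * t x) * cmod (dyadic_block \<theta> k T x)) powr q x)) \<le> (\<Sum>k. ennreal (D' powr \<bar>Q\<bar> * r ^ k))"
      by (intro suminf_le ennreal_leI term_le) auto
    also have "\<dots> = ennreal (\<Sum>k. D' powr \<bar>Q\<bar> * r ^ k)"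
      using r by (intro suminf_ennreal2) (auto intro!: summable_mult summable_geometric)
    also have "(\<Sum>k. D' powr \<bar>Q\<bar> * r ^ k) = E" using r by (simp add: suminf_mult suminf_geometric E_def)
    finally have "?F x \<le> ennreal_powr (ennreal E) (1 / q x)"
      using q[of x] by (intro ennreal_powr_mono) auto
    also have "\<dots> = ennreal (E powr (1 / q x))" using E1 by (simp add: ennreal_powr_def)
    also have "\<dots> \<le> ennreal (E powr 1)" using E1 q[of x] by (intro ennreal_leI powr_mono) auto
    finally show ?thesis using E1 by simp
  qed
  have "(\<integral>\<^sup>+ x. ennreal_powr (?F x / ennreal E) (q x) \<partial>torus) \<le> (\<integral>\<^sup>+ x. 1 \<partial>(torus :: (real ^ 'n) measure))"
  proof (rule nn_integral_mono_AE)
    have "AE x in torus. x \<in> (unit_cube :: (real ^ 'n) set)" by (rule AE_I2) simp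
    with Q show "AE x in torus. ennreal_powr (?F x / ennreal E) (q x) \<le> 1"
    proof eventually_elim
      case (elim x)
      have "?F x / ennreal E \<le> ennreal E / ennreal E"
        by (rule divide_right_mono_ennreal) (rule F[OF elim(2,1)])
      also have "\<dots> = 1" using E1 by (simp add: divide_ennreal)
      finally have "ennreal_powr (?F x / ennreal E) (q x) \<le> ennreal_powr 1 (q x)"
        using q[of x] by (intro ennreal_powr_mono) auto
      then show ?case by (simp add: ennreal_powr_def)
    qed
  qed
  also have "\<dots> = 1" by simp
  finally have "besov_norm \<theta> t q T \<le> ennreal E"
    unfolding besov_norm_def variable_Lq_norm_def using E1 by (intro Inf_lower) auto
  then show ?thesis using T by (simp add: besov_space_def le_less_trans[OF _ ennreal_less_top])
qed

section \<open>Decay and smoothness of the wavelets\<close>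

text \<open>What the Meyer and Daubechies functions have in common: decay of order \<open>L\<close>,
  and smoothness of order \<open>M\<close> expressed by differences, which carries over to
  periodizations by linearity.\<close>

definition wavelet_like :: "nat \<Rightarrow> nat \<Rightarrow> (real \<Rightarrow> real) \<Rightarrow> bool" where
  "wavelet_like L M \<phi> \<longleftrightarrow> continuous_on UNIV \<phi> \<and> (\<exists>C. \<forall>x. \<bar>\<phi> x\<bar> * (1 + \<bar>x\<bar>) ^ L \<le> C) \<and>
     (\<exists>C. \<forall>h x. \<bar>fd h M \<phi> x\<bar> \<le> C * \<bar>h\<bar> ^ M)"

lemma fd_affine:
  fixes f :: "real \<Rightarrow> real"
  shows "fd h M (\<lambda>x. f (c * x + b)) x = fd (c * h) M f (c * x + b)"
  by (induction M arbitrary: x) (simp_all add: algebra_simps)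

lemma fd_cmult: "fd h M (\<lambda>x. c * f x) x = c * fd h M f x" for f :: "_ \<Rightarrow> real"
  by (induction M arbitrary: x) (simp_all add: algebra_simps)

lemma fd_add: "fd h M (\<lambda>x. f x + g x) x = fd h M f x + fd h M g x" for f :: "_ \<Rightarrow> real"
  by (induction M arbitrary: x) (simp_all add: algebra_simps)

text \<open>The triangle inequality in multiplicative form for the weight
  \<open>1 + \<bar>x\<bar>\<close>; it transports polynomial decay under translations.\<close>

lemma one_plus_abs_le_mult:
  fixes a b x :: real
  assumes "\<bar>x\<bar> \<le> a + b" "0 \<le> a" "0 \<le> b"
  shows "1 + \<bar>x\<bar> \<le> (1 + a) * (1 + b)"
  using assms(1) mult_nonneg_nonneg[OF assms(2,3)] by (simp add: algebra_simps)

lemma wavelet_like_affine: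
  assumes "wavelet_like L M f"
  shows "wavelet_like L M (\<lambda>x. f (2 * x + b))"
proof -
  obtain C D where f: "continuous_on UNIV f" and C: "\<And>x. \<bar>f x\<bar> * (1 + \<bar>x\<bar>) ^ L \<le> C"
    and D: "\<And>h x. \<bar>fd h M f x\<bar> \<le> D * \<bar>h\<bar> ^ M"
    using assms unfolding wavelet_like_def by blast
  have "continuous_on UNIV (\<lambda>x. f (2 * x + b))"
    by (rule continuous_on_compose2[OF f]) (auto intro!: continuous_intros)
  moreover have "\<bar>f (2 * x + b)\<bar> * (1 + \<bar>x\<bar>) ^ L \<le> C * (1 + \<bar>b\<bar>) ^ L" for x
  proof -
    have "1 + \<bar>x\<bar> \<le> (1 + \<bar>2 * x + b\<bar>) * (1 + \<bar>b\<bar>)"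
      by (rule one_plus_abs_le_mult) auto
    then have "\<bar>f (2 * x + b)\<bar> * (1 + \<bar>x\<bar>) ^ L \<le> \<bar>f (2 * x + b)\<bar> * ((1 + \<bar>2 * x + b\<bar>) * (1 + \<bar>b\<bar>)) ^ L"
      by (intro mult_left_mono power_mono) auto
    also have "\<dots> = (\<bar>f (2 * x + b)\<bar> * (1 + \<bar>2 * x + b\<bar>) ^ L) * (1 + \<bar>b\<bar>) ^ L" by (simp add: power_mult_distrib)
    also have "\<dots> \<le> C * (1 + \<bar>b\<bar>) ^ L" by (intro mult_right_mono C) simp
    finally show ?thesis .
  qed
  moreover have "\<bar>fd h M (\<lambda>x. f (2 * x + b)) x\<bar> \<le> (D * 2 ^ M) * \<bar>h\<bar> ^ M" for h x
    unfolding fd_affine using D[of "2 * h" "2 * x + b"] by (simp add: abs_mult power_mult_distrib mult_ac)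
  ultimately show ?thesis unfolding wavelet_like_def by blast
qed

lemma wavelet_like_cmult:
  assumes "wavelet_like L M f"
  shows "wavelet_like L M (\<lambda>x. c * f x)"
proof -
  obtain C D where f: "continuous_on UNIV f" and C: "\<And>x. \<bar>f x\<bar> * (1 + \<bar>x\<bar>) ^ L \<le> C"
    and D: "\<And>h x. \<bar>fd h M f x\<bar> \<le> D * \<bar>h\<bar> ^ M"
    using assms unfolding wavelet_like_def by blast
  have "continuous_on UNIV (\<lambda>x. c * f x)" by (intro continuous_intros f)
  moreover have "\<bar>c * f x\<bar> * (1 + \<bar>x\<bar>) ^ L \<le> \<bar>c\<bar> * C" for x
    using mult_left_mono[OF C[of x], of "\<bar>c\<bar>"] by (simp add: abs_mult mult_ac)
  moreover have "\<bar>fd h M (\<lambda>x. c * f x) x\<bar> \<le> (\<bar>c\<bar> * D) * \<bar>h\<bar> ^ M" for h x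
    unfolding fd_cmult using mult_left_mono[OF D[of h x], of "\<bar>c\<bar>"] by (simp add: abs_mult mult_ac)
  ultimately show ?thesis unfolding wavelet_like_def by blast
qed

lemma wavelet_like_add:
  assumes "wavelet_like L M f" "wavelet_like L M g"
  shows "wavelet_like L M (\<lambda>x. f x + g x)"
proof -
  obtain C D where f: "continuous_on UNIV f" and C: "\<And>x. \<bar>f x\<bar> * (1 + \<bar>x\<bar>) ^ L \<le> C"
    and D: "\<And>h x. \<bar>fd h M f x\<bar> \<le> D * \<bar>h\<bar> ^ M"
    using assms(1) unfolding wavelet_like_def by blast
  obtain C' D' where g: "continuous_on UNIV g" and C': "\<And>x. \<bar>g x\<bar> * (1 + \<bar>x\<bar>) ^ L \<le> C'"
    and D': "\<And>h x. \<bar>fd h M g x\<bar> \<le> D' * \<bar>h\<bar> ^ M"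
    using assms(2) unfolding wavelet_like_def by blast
  have "continuous_on UNIV (\<lambda>x. f x + g x)" by (intro continuous_intros f g)
  moreover have "\<bar>f x + g x\<bar> * (1 + \<bar>x\<bar>) ^ L \<le> C + C'" for x
  proof -
    have "\<bar>f x + g x\<bar> * (1 + \<bar>x\<bar>) ^ L \<le> (\<bar>f x\<bar> + \<bar>g x\<bar>) * (1 + \<bar>x\<bar>) ^ L" by (intro mult_right_mono) auto
    then show ?thesis using C[of x] C'[of x] by (simp add: distrib_right)
  qed
  moreover have "\<bar>fd h M (\<lambda>x. f x + g x) x\<bar> \<le> (D + D') * \<bar>h\<bar> ^ M" for h x
    unfolding fd_add using D[of h x] D'[of h x] by (simp add: distrib_right)
  ultimately show ?thesis unfolding wavelet_like_def by blast
qed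

lemma wavelet_like_zero: "wavelet_like L M (\<lambda>x. 0)"
proof -
  have "fd h M (\<lambda>x. 0) x = (0::real)" for h x :: real using fd_cmult[of h M 0 "\<lambda>_. 0" x] by simp
  then show ?thesis unfolding wavelet_like_def by (auto intro!: exI[of _ 0])
qed

lemma wavelet_like_sum:
  assumes "\<And>k. k \<in> K \<Longrightarrow> wavelet_like L M (f k)"
  shows "wavelet_like L M (\<lambda>x. \<Sum>k\<in>K. c k * f k x)"
  using assms
proof (induction K rule: infinite_finite_induct)
  case (insert k K)
  have "wavelet_like L M (\<lambda>x. c k * f k x + (\<Sum>k\<in>K. c k * f k x))"
    using insert by (intro wavelet_like_add[OF wavelet_like_cmult]) auto
  then show ?case using insert by simp
qed (simp_all add: wavelet_like_zero)


section \<open>Calculus and Fourier integrals on the line\<close>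

lemma Ck_SucI:
  fixes f :: "real \<Rightarrow> real"
  assumes "\<And>x. (f has_real_derivative f' x) (at x)" "Ck k f'"
  shows "Ck (Suc k) f"
proof -
  have "partial_deriv 1 f = f'"
  proof
    fix x show "partial_deriv 1 f x = f' x"
      using partial_deriv_eq[OF assms(1)[of x, unfolded has_field_derivative_def], of 1] by simp
  qed
  then show ?thesis using assms by (auto simp: real_differentiable_def)
qed

lemma Ck_SucE:
  fixes f :: "real \<Rightarrow> real"
  assumes "Ck (Suc k) f"
  obtains f' where "\<And>x. (f has_real_derivative f' x) (at x)" "Ck k f'"
proof
  show "Ck k (partial_deriv 1 f)" using assms by simp
  fix x
  have "f differentiable (at x)" using assms by simp
  from partial_deriv_directional[OF this, of 1]
  have "((\<lambda>h. f (h + x)) has_real_derivative partial_deriv 1 f x) (at 0)" by (simp add: add.commute)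
  then show "(f has_real_derivative partial_deriv 1 f x) (at x)"
    using DERIV_shift[of f "partial_deriv 1 f x" 0 x] by simp
qed

lemma Ck_add: "Ck k f \<Longrightarrow> Ck k g \<Longrightarrow> Ck k (\<lambda>x. f x + g x :: real)"
  using Ck_linear_combination[of k f g 1 1] by simp

lemma Ck_mult:
  fixes f g :: "real \<Rightarrow> real"
  shows "Ck k f \<Longrightarrow> Ck k g \<Longrightarrow> Ck k (\<lambda>x. f x * g x)"
proof (induction k arbitrary: f g)
  case 0 then show ?case by (auto intro!: continuous_intros)
next
  case (Suc k)
  obtain f' where f': "\<And>x. (f has_real_derivative f' x) (at x)" "Ck k f'" using Ck_SucE[OF Suc.prems(1)] by blast
  obtain g' where g': "\<And>x. (g has_real_derivative g' x) (at x)" "Ck k g'" using Ck_SucE[OF Suc.prems(2)] by blast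
  show ?case
  proof (rule Ck_SucI)
    show "((\<lambda>x. f x * g x) has_real_derivative f' x * g x + f x * g' x) (at x)" for x
      using f'(1)[of x] g'(1)[of x] by (auto intro!: derivative_eq_intros)
    show "Ck k (\<lambda>x. f' x * g x + f x * g' x)"
      by (intro Ck_add Suc.IH f'(2) g'(2) Ck_Suc_D[OF Suc.prems(1)] Ck_Suc_D[OF Suc.prems(2)])
  qed
qed

lemma Ck_compose:
  fixes f g :: "real \<Rightarrow> real"
  shows "Ck k f \<Longrightarrow> Ck k g \<Longrightarrow> Ck k (\<lambda>x. f (g x))"
proof (induction k arbitrary: f g)
  case 0
  then show ?case using continuous_on_compose2[of UNIV f UNIV g] by simp
next
  case (Suc k)
  obtain f' where f': "\<And>x. (f has_real_derivative f' x) (at x)" "Ck k f'" using Ck_SucE[OF Suc.prems(1)] by blast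
  obtain g' where g': "\<And>x. (g has_real_derivative g' x) (at x)" "Ck k g'" using Ck_SucE[OF Suc.prems(2)] by blast
  show ?case
  proof (rule Ck_SucI)
    show "((\<lambda>x. f (g x)) has_real_derivative f' (g x) * g' x) (at x)" for x
      by (rule DERIV_chain2[OF f'(1) g'(1)])
    show "Ck k (\<lambda>x. f' (g x) * g' x)"
      by (rule Ck_mult[OF Suc.IH[OF f'(2) Ck_Suc_D[OF Suc.prems(2)]] g'(2)])
  qed
qed

lemma Ck_affine: "Ck k (\<lambda>x::real. c * x + d)"
proof (cases k)
  case 0 then show ?thesis by (auto intro!: continuous_intros)
next
  case (Suc m)
  show ?thesis unfolding Suc
    by (rule Ck_SucI[where f'="\<lambda>_. c"]) (auto intro!: derivative_eq_intros Ck_const)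
qed

lemma Ck_cos_shift: "Ck k (\<lambda>x::real. cos (x + a))"
proof (induction k arbitrary: a)
  case (Suc k)
  show ?case
  proof (rule Ck_SucI[OF _ Suc[of "a + pi / 2"]])
    fix x
    have "((\<lambda>x. cos (x + a)) has_real_derivative - sin (x + a)) (at x)" by (auto intro!: derivative_eq_intros)
    also have "- sin (x + a) = cos (x + (a + pi / 2))" by (simp add: add.assoc[symmetric] cos_add)
    finally show "((\<lambda>x. cos (x + a)) has_real_derivative cos (x + (a + pi / 2))) (at x)" .
  qed
qed (auto intro!: continuous_intros)

lemma partial_deriv_zero_outside:
  fixes f :: "real \<Rightarrow> real"
  assumes "\<And>z. \<bar>z\<bar> > A \<Longrightarrow> f z = 0" "\<bar>z\<bar> > A"
  shows "partial_deriv b f z = 0"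
proof -
  have o: "open {z::real. \<bar>z\<bar> > A}" by (intro open_Collect_less continuous_intros)
  have "((\<lambda>_. 0) has_derivative (\<lambda>_. 0)) (at z)" by simp
  then have "(f has_derivative (\<lambda>_. 0)) (at z)"
    by (rule has_derivative_transform_within_open[OF _ o]) (use assms in auto)
  then show ?thesis by (simp add: partial_deriv_eq)
qed

lemma iterated_deriv_zero_outside:
  fixes f :: "real \<Rightarrow> real"
  assumes "\<And>z. \<bar>z\<bar> > A \<Longrightarrow> f z = 0" "\<bar>z\<bar> > A"
  shows "iterated_deriv bs f z = 0"
  using assms(2) by (induction bs arbitrary: z) (auto simp: assms(1) intro: partial_deriv_zero_outside)

lemma bounded_compact_support:
  fixes f :: "real \<Rightarrow> real"
  assumes "continuous_on UNIV f" "\<And>z. \<bar>z\<bar> > A \<Longrightarrow> f z = 0"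
  obtains B where "B \<ge> 0" "\<And>z. \<bar>f z\<bar> \<le> B"
proof -
  have "compact (f ` {-A..A})" by (intro compact_continuous_image continuous_on_subset[OF assms(1)]) auto
  from compact_imp_bounded[OF this] obtain B where B: "\<forall>y\<in>f ` {-A..A}. norm y \<le> B" unfolding bounded_iff by blast
  show ?thesis
  proof (rule that[of "max B 0"])
    fix z show "\<bar>f z\<bar> \<le> max B 0"
    proof (cases "\<bar>z\<bar> > A")
      case False
      then have "z \<in> {-A..A}" by auto
      then have "norm (f z) \<le> B" using B by blast
      then show ?thesis by simp
    qed (simp add: assms(2))
  qed simp
qed

lemma Ck_iterated_deriv_replicate:
  fixes f :: "real \<Rightarrow> real"
  shows "Ck (M + k) f \<Longrightarrow> Ck k (iterated_deriv (replicate M 1) f)"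
proof (induction M arbitrary: k)
  case (Suc M)
  then have "Ck (Suc k) (iterated_deriv (replicate M 1) f)" by (simp del: Ck.simps)
  then show ?case by simp
qed simp

lemma fd_bound_compact_support:
  fixes f :: "real \<Rightarrow> real"
  assumes f: "Ck M f" "\<And>z. \<bar>z\<bar> > A \<Longrightarrow> f z = 0"
  obtains B where "B \<ge> 0" "\<And>h x. \<bar>fd h M f x\<bar> \<le> B * \<bar>h\<bar> ^ M"
proof -
  have "continuous_on UNIV (iterated_deriv (replicate M 1) f)"
    using Ck_iterated_deriv_replicate[of M 0 f] f(1) by simp
  then obtain B where B: "B \<ge> 0" "\<And>z. \<bar>iterated_deriv (replicate M 1) f z\<bar> \<le> B"
    using bounded_compact_support[of _ A] iterated_deriv_zero_outside[of A f, OF f(2)] by metis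
  show ?thesis
  proof (rule that[OF B(1)])
    fix h x show "\<bar>fd h M f x\<bar> \<le> B * \<bar>h\<bar> ^ M"
      using abs_fd_le_iterated_deriv[OF f(1) _ B(2), of h x] by (simp add: mult.commute)
  qed
qed

lemma wavelet_like_compact_support:
  fixes f :: "real \<Rightarrow> real"
  assumes f: "Ck M f" "\<And>z. \<bar>z\<bar> > A \<Longrightarrow> f z = 0"
  shows "wavelet_like L M f"
proof -
  have c: "continuous_on UNIV f" by (rule Ck_imp_continuous[OF f(1)])
  obtain B where B: "B \<ge> 0" "\<And>z. \<bar>f z\<bar> \<le> B" using bounded_compact_support[OF c f(2)] by blast
  obtain D where D: "\<And>h x. \<bar>fd h M f x\<bar> \<le> D * \<bar>h\<bar> ^ M" using fd_bound_compact_support[OF f] by blast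
  have "\<bar>f x\<bar> * (1 + \<bar>x\<bar>) ^ L \<le> B * (1 + \<bar>A\<bar>) ^ L" for x
  proof (cases "\<bar>x\<bar> > A")
    case True then show ?thesis using B(1) by (simp add: f(2))
  next
    case False
    then show ?thesis using B by (intro mult_mono power_mono) auto
  qed
  then show ?thesis using c D unfolding wavelet_like_def by blast
qed

lemma integral_compact_support:
  fixes f :: "real \<Rightarrow> real"
  assumes f: "continuous_on UNIV f" "\<And>z. \<bar>z\<bar> > A \<Longrightarrow> f z = 0" and B: "\<And>z. \<bar>f z\<bar> \<le> B" and A: "A \<ge> 0"
  shows "integrable lborel f" "\<bar>\<integral>z. f z \<partial>lborel\<bar> \<le> 2 * A * B"
proof -
  have "integrable lborel (\<lambda>x. indicator {-A..A} x *\<^sub>R f x)"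
    by (rule borel_integrable_compact) (auto intro: continuous_on_subset[OF f(1)])
  also have "(\<lambda>x. indicator {-A..A} x *\<^sub>R f x) = f"
  proof
    fix z show "indicator {-A..A} z *\<^sub>R f z = f z"
      using f(2)[of z] by (cases "z \<in> {-A..A}") auto
  qed
  finally show i: "integrable lborel f" .
  have "\<bar>\<integral>z. f z \<partial>lborel\<bar> \<le> (\<integral>z. \<bar>f z\<bar> \<partial>lborel)" by (rule integral_abs_bound)
  also have "\<dots> \<le> (\<integral>z. B * indicator {-A..A} z \<partial>lborel)"
  proof (rule integral_mono)
    show "\<bar>f z\<bar> \<le> B * indicator {-A..A} z" for z
      using B[of z] f(2)[of z] by (auto simp: indicator_def)
    show "integrable lborel (\<lambda>z. B * indicator {-A..A} z)"
      by (intro integrable_mult_right integrable_real_indicator) (simp_all add: emeasure_lborel_Icc_eq)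
  qed (use i in auto)
  also have "\<dots> = 2 * A * B" using A by simp
  finally show "\<bar>\<integral>z. f z \<partial>lborel\<bar> \<le> 2 * A * B" .
qed

text \<open>Translating by half a period of the cosine turns decay of the Fourier integral into bounds for
  the finite differences of \<open>h\<close>.\<close>

lemma cos_integral_fd:
  fixes h :: "real \<Rightarrow> real"
  assumes h: "continuous_on UNIV h" "\<And>z. \<bar>z\<bar> > A \<Longrightarrow> h z = 0" and A: "A \<ge> 0" and y: "y \<noteq> 0"
  shows "(\<integral>z. cos (y * z) * h z \<partial>lborel) = (- (1 / 2)) ^ L * (\<integral>z. cos (y * z) * fd (pi / y) L h z \<partial>lborel)"
    "\<And>z. \<bar>z\<bar> > A + real L * \<bar>pi / y\<bar> \<Longrightarrow> fd (pi / y) L h z = 0"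
proof -
  show supp: "fd (pi / y) L h z = 0" if "\<bar>z\<bar> > A + real L * \<bar>pi / y\<bar>" for z L
    using that
  proof (induction L arbitrary: z)
    case (Suc L)
    have "\<bar>z + pi / y\<bar> \<ge> \<bar>z\<bar> - \<bar>pi / y\<bar>" by linarith
    moreover have "real (Suc L) * \<bar>pi / y\<bar> = real L * \<bar>pi / y\<bar> + \<bar>pi / y\<bar>"
      by (simp only: of_nat_Suc distrib_right mult_1 add.commute)
    ultimately have "A + real L * \<bar>pi / y\<bar> < \<bar>z + pi / y\<bar>" "A + real L * \<bar>pi / y\<bar> < \<bar>z\<bar>"
      using Suc.prems abs_ge_zero[of "pi / y"] by linarith+
    then show ?case using Suc.IH by simp
  qed (simp add: h(2))
  show "(\<integral>z. cos (y * z) * h z \<partial>lborel) = (- (1 / 2)) ^ L * (\<integral>z. cos (y * z) * fd (pi / y) L h z \<partial>lborel)"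
  proof (induction L)
    case (Suc L)
    let ?g = "fd (pi / y) L h"
    let ?A = "A + real L * \<bar>pi / y\<bar>" and ?A' = "A + real L * \<bar>pi / y\<bar> + \<bar>pi / y\<bar>"
    have gc: "continuous_on UNIV ?g" by (rule continuous_fd[OF h(1)])
    obtain B where B: "\<And>z. \<bar>?g z\<bar> \<le> B" using bounded_compact_support[OF gc supp] by blast
    have gc': "continuous_on UNIV (\<lambda>z. ?g (z + pi / y))"
      by (rule continuous_on_compose2[OF gc]) (auto intro!: continuous_intros)
    have bd: "\<bar>cos (y * z) * w\<bar> \<le> B" if "\<bar>w\<bar> \<le> B" for z w
      using mult_mono[OF abs_cos_le_one[of "y * z"] that] by (simp add: abs_mult)
    have i1: "integrable lborel (\<lambda>z. cos (y * z) * ?g z)"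
      by (rule integral_compact_support(1)[of _ ?A B]) (use A supp B bd in \<open>auto intro!: continuous_intros gc\<close>)
    have i2: "integrable lborel (\<lambda>z. cos (y * z) * ?g (z + pi / y))"
    proof (rule integral_compact_support(1)[of _ ?A' B])
      fix z assume "?A' < \<bar>z\<bar>"
      then have "?A < \<bar>z + pi / y\<bar>" by linarith
      then show "cos (y * z) * ?g (z + pi / y) = 0" by (simp add: supp)
    qed (use A B bd in \<open>auto intro!: continuous_intros gc'\<close>)
    have "(\<integral>z. cos (y * z) * ?g z \<partial>lborel) = (\<integral>z. cos (y * (pi / y + 1 * z)) * ?g (pi / y + 1 * z) \<partial>lborel)"
      using lborel_integral_real_affine[of 1 "\<lambda>z. cos (y * z) * ?g z" "pi / y"] by simp
    also have "(\<lambda>z. cos (y * (pi / y + 1 * z)) * ?g (pi / y + 1 * z)) = (\<lambda>z. - (cos (y * z) * ?g (z + pi / y)))"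
      using y by (simp add: distrib_left cos_add add.commute)
    also have "(\<integral>z. - (cos (y * z) * ?g (z + pi / y)) \<partial>lborel) = - (\<integral>z. cos (y * z) * ?g (z + pi / y) \<partial>lborel)" by simp
    finally have "(\<integral>z. cos (y * z) * ?g (z + pi / y) \<partial>lborel) = - (\<integral>z. cos (y * z) * ?g z \<partial>lborel)" by simp
    then have "(\<integral>z. cos (y * z) * fd (pi / y) (Suc L) h z \<partial>lborel) = - 2 * (\<integral>z. cos (y * z) * ?g z \<partial>lborel)"
      using i1 i2 by (simp add: right_diff_distrib)
    then show ?case using Suc by simp
  qed simp
qed

lemma fd_cos_integral:
  fixes h :: "real \<Rightarrow> real"
  assumes h: "continuous_on UNIV h" "\<And>z. \<bar>z\<bar> > A \<Longrightarrow> h z = 0" and A: "A \<ge> 0"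
  shows "fd \<eta> M (\<lambda>x. \<integral>z. cos ((x + c) * z) * h z \<partial>lborel) x = (\<integral>z. fd \<eta> M (\<lambda>x. cos ((x + c) * z)) x * h z \<partial>lborel)"
proof -
  have cont: "continuous_on UNIV (\<lambda>z. fd \<eta> M (\<lambda>x. cos ((x + c) * z)) x)" for M x
    by (induction M arbitrary: x) (auto intro!: continuous_intros)
  have int: "integrable lborel (\<lambda>z. fd \<eta> M (\<lambda>x. cos ((x + c) * z)) x * h z)" for M x
  proof -
    have c: "continuous_on UNIV (\<lambda>z. fd \<eta> M (\<lambda>x. cos ((x + c) * z)) x * h z)" by (intro continuous_intros cont h)
    have s: "\<And>z. \<bar>z\<bar> > A \<Longrightarrow> fd \<eta> M (\<lambda>x. cos ((x + c) * z)) x * h z = 0" using h(2) by simp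
    obtain B where B: "\<And>z. \<bar>fd \<eta> M (\<lambda>x. cos ((x + c) * z)) x * h z\<bar> \<le> B" using bounded_compact_support[OF c s] by blast
    show ?thesis by (rule integral_compact_support(1)[OF c s B A])
  qed
  show "fd \<eta> M (\<lambda>x. \<integral>z. cos ((x + c) * z) * h z \<partial>lborel) x = (\<integral>z. fd \<eta> M (\<lambda>x. cos ((x + c) * z)) x * h z \<partial>lborel)"
    by (induction M arbitrary: x) (use int in \<open>simp_all add: left_diff_distrib\<close>)
qed

text \<open>A derivative in \<open>x\<close> multiplies by \<open>z\<close> and advances the phase
  by \<open>pi / 2\<close>, so all derivatives are explicit.\<close>

lemma fd_cos_bound: "\<bar>fd \<eta> M (\<lambda>x. cos ((x + c) * z)) x\<bar> \<le> \<bar>\<eta>\<bar> ^ M * \<bar>z\<bar> ^ M" for x z \<eta> :: real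
proof -
  let ?F = "\<lambda>a x. z ^ a * cos ((x + c) * z + real a * (pi / 2))"
  have "\<bar>fd (\<eta> *\<^sub>R 1) M (?F 0) x\<bar> \<le> \<bar>\<eta>\<bar> ^ M * \<bar>z\<bar> ^ M"
  proof (rule abs_fd_le_derivative)
    fix a x
    have s: "- sin ((x + c) * z + real a * (pi / 2)) = cos ((x + c) * z + real (Suc a) * (pi / 2))"
    proof -
      have "(x + c) * z + real (Suc a) * (pi / 2) = ((x + c) * z + real a * (pi / 2)) + pi / 2" by (simp only: of_nat_Suc distrib_right mult_1 add_ac)
      moreover have "cos (y + pi / 2) = - sin y" for y :: real by (simp add: cos_add)
      ultimately show ?thesis by (simp only:)
    qed
    have "((\<lambda>s. ?F a (x + s *\<^sub>R 1)) has_real_derivative z ^ a * (- sin ((x + c) * z + real a * (pi / 2)) * z)) (at 0)"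
      by (auto intro!: derivative_eq_intros)
    then show "((\<lambda>s. ?F a (x + s *\<^sub>R 1)) has_real_derivative ?F (Suc a) x) (at 0)"
      unfolding s by (simp add: mult_ac)
  next
    fix x show "\<bar>?F M x\<bar> \<le> \<bar>z\<bar> ^ M" by (simp add: abs_mult power_abs mult_left_le)
  qed
  then show ?thesis by simp
qed

text \<open>The duality of the Fourier transform: compact support of \<open>h\<close> bounds the
  differences of the integral in \<open>x\<close>, and smoothness of \<open>h\<close> gives its
  decay, by differences in \<open>z\<close> with step \<open>pi / (x + c)\<close>.\<close>

lemma wavelet_like_cos_integral:
  fixes h :: "real \<Rightarrow> real"
  assumes h: "\<And>k. Ck k h" "\<And>z. \<bar>z\<bar> > A \<Longrightarrow> h z = 0" and A: "A \<ge> 0"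
  shows "wavelet_like L M (\<lambda>x. K * (\<integral>z. cos ((x + c) * z) * h z \<partial>lborel))"
proof (rule wavelet_like_cmult)
  let ?I = "\<lambda>x. \<integral>z. cos ((x + c) * z) * h z \<partial>lborel"
  have hc: "continuous_on UNIV h" by (rule Ck_imp_continuous[OF h(1)])
  obtain B where B: "B \<ge> 0" "\<And>z. \<bar>h z\<bar> \<le> B" using bounded_compact_support[OF hc h(2)] by blast
  have fdI: "\<bar>fd \<eta> M ?I x\<bar> \<le> (2 * A * (A ^ M * B)) * \<bar>\<eta>\<bar> ^ M" for \<eta> x M
  proof -
    let ?g = "\<lambda>z. fd \<eta> M (\<lambda>x. cos ((x + c) * z)) x * h z"
    have "\<bar>\<integral>z. ?g z \<partial>lborel\<bar> \<le> 2 * A * (\<bar>\<eta>\<bar> ^ M * A ^ M * B)"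
    proof (rule integral_compact_support(2)[OF _ _ _ A])
      have "continuous_on UNIV (\<lambda>z. fd \<eta> M (\<lambda>x. cos ((x + c) * z)) x)"
        by (induction M arbitrary: x) (auto intro!: continuous_intros)
      then show "continuous_on UNIV ?g" by (intro continuous_intros hc)
      show "?g z = 0" if "\<bar>z\<bar> > A" for z using h(2)[OF that] by simp
      show "\<bar>?g z\<bar> \<le> \<bar>\<eta>\<bar> ^ M * A ^ M * B" for z
      proof (cases "\<bar>z\<bar> > A")
        case True then show ?thesis using h(2) A B by simp
      next
        case False
        have "\<bar>fd \<eta> M (\<lambda>x. cos ((x + c) * z)) x\<bar> \<le> \<bar>\<eta>\<bar> ^ M * A ^ M"
          using False by (intro order_trans[OF fd_cos_bound] mult_left_mono power_mono) auto
        then show ?thesis unfolding abs_mult using B A by (intro mult_mono) auto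
      qed
    qed
    moreover have "fd \<eta> M ?I x = (\<integral>z. ?g z \<partial>lborel)" by (rule fd_cos_integral[OF hc h(2) A])
    moreover have "2 * A * (\<bar>\<eta>\<bar> ^ M * A ^ M * B) = (2 * A * (A ^ M * B)) * \<bar>\<eta>\<bar> ^ M" by simp
    ultimately show ?thesis by (simp only:)
  qed
  have c: "continuous_on UNIV ?I"
  proof (rule lipschitz_on_continuous_on[OF lipschitz_onI])
    fix x y :: real
    have "\<bar>?I (y + (x - y)) - ?I y\<bar> \<le> (2 * A * (A * B)) * \<bar>x - y\<bar>" using fdI[of "x - y" 1 y] by simp
    then show "dist (?I x) (?I y) \<le> (2 * A * (A * B)) * dist x y" by (simp add: dist_real_def)
  qed (use A B in auto)
  obtain D where D: "D \<ge> 0" "\<And>\<eta> x. \<bar>fd \<eta> L h x\<bar> \<le> D * \<bar>\<eta>\<bar> ^ L" using fd_bound_compact_support[OF h(1) h(2)] by blast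
  \<comment> \<open>The maximum covers \<open>\<bar>x + c\<bar> < 1\<close>, where the size of the
    integral suffices, and \<open>\<bar>x + c\<bar> \<ge> 1\<close>, where the differences act. The
    factor \<open>2 ^ L\<close> comes from \<open>1 + y \<le> 2 * max 1 y\<close>.\<close>
  define E where "E = max (2 * A * B) (2 * (A + real L * pi) * (D * pi ^ L)) * 2 ^ L"
  have I0: "\<bar>?I x\<bar> \<le> 2 * A * B" for x using fdI[of 0 0 x] by simp
  have E0: "E \<ge> 0" unfolding E_def using A B by (simp add: le_max_iff_disj)
  have bE: "\<bar>?I x\<bar> * (1 + \<bar>x + c\<bar>) ^ L \<le> E" for x
  proof (cases "\<bar>x + c\<bar> \<ge> 1")
    case False
    then have "\<bar>?I x\<bar> * (1 + \<bar>x + c\<bar>) ^ L \<le> (2 * A * B) * 2 ^ L"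
      using I0[of x] A B by (intro mult_mono power_mono) auto
    also have "\<dots> \<le> E" unfolding E_def by (intro mult_right_mono) auto
    finally show ?thesis .
  next
    case True
    let ?y = "x + c"
    have y: "?y \<noteq> 0" using True by auto
    \<comment> \<open>The step is at most \<open>pi\<close>, so the supports of the
      \<open>L\<close>-th differences stay in one fixed interval.\<close>
    have py: "\<bar>pi / ?y\<bar> \<le> pi" using True pi_gt_zero by (simp add: abs_mult divide_le_eq mult_le_cancel_left1)
    let ?A = "A + real L * pi"
    have "\<bar>\<integral>z. cos (?y * z) * fd (pi / ?y) L h z \<partial>lborel\<bar> \<le> 2 * ?A * (D * \<bar>pi / ?y\<bar> ^ L)"
    proof (rule integral_compact_support(2))
      show "continuous_on UNIV (\<lambda>z. cos (?y * z) * fd (pi / ?y) L h z)" by (intro continuous_intros continuous_fd hc)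
      fix z
      show "\<bar>cos (?y * z) * fd (pi / ?y) L h z\<bar> \<le> D * \<bar>pi / ?y\<bar> ^ L"
        using mult_mono[OF abs_cos_le_one[of "?y * z"] D(2)[of "pi / ?y" z]] by (simp add: abs_mult)
      have "real L * \<bar>pi / ?y\<bar> \<le> real L * pi" by (intro mult_left_mono py) simp
      then show "cos (?y * z) * fd (pi / ?y) L h z = 0" if "?A < \<bar>z\<bar>"
        using cos_integral_fd(2)[OF hc h(2) A y, where L=L and z=z] that by simp
    qed (use A in simp)
    then have "(1 / 2) ^ L * \<bar>\<integral>z. cos (?y * z) * fd (pi / ?y) L h z \<partial>lborel\<bar> \<le> (1 / 2) ^ L * (2 * ?A * (D * \<bar>pi / ?y\<bar> ^ L))"
      by (rule mult_left_mono) simp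
    moreover have "?I x = (- (1 / 2)) ^ L * (\<integral>z. cos (?y * z) * fd (pi / ?y) L h z \<partial>lborel)"
      by (rule cos_integral_fd(1)[OF hc h(2) A y])
    moreover have "\<bar>(- (1 / 2)) ^ L\<bar> = (1 / 2 :: real) ^ L" by (simp add: power_abs)
    ultimately have "\<bar>?I x\<bar> \<le> (1 / 2) ^ L * (2 * ?A * (D * \<bar>pi / ?y\<bar> ^ L))"
      by (simp only: abs_mult)
    also have "\<dots> \<le> 1 * (2 * ?A * (D * \<bar>pi / ?y\<bar> ^ L))"
      using A D(1) by (intro mult_right_mono power_le_one) auto
    finally have "\<bar>?I x\<bar> * (1 + \<bar>?y\<bar>) ^ L \<le> (2 * ?A * (D * \<bar>pi / ?y\<bar> ^ L)) * (2 * \<bar>?y\<bar>) ^ L"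
      using True A D(1) by (intro mult_mono power_mono) auto
    also have "\<dots> = (2 * ?A * (D * pi ^ L)) * 2 ^ L"
      using y by (simp add: power_mult_distrib power_divide abs_divide)
    also have "\<dots> \<le> E" unfolding E_def by (intro mult_right_mono) auto
    finally show ?thesis .
  qed
  have "\<bar>?I x\<bar> * (1 + \<bar>x\<bar>) ^ L \<le> E * (1 + \<bar>c\<bar>) ^ L" for x
  proof -
    have "1 + \<bar>x\<bar> \<le> (1 + \<bar>x + c\<bar>) * (1 + \<bar>c\<bar>)"
      by (rule one_plus_abs_le_mult) auto
    then have "\<bar>?I x\<bar> * (1 + \<bar>x\<bar>) ^ L \<le> \<bar>?I x\<bar> * ((1 + \<bar>x + c\<bar>) * (1 + \<bar>c\<bar>)) ^ L"
      by (intro mult_left_mono power_mono) auto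
    also have "\<dots> = (\<bar>?I x\<bar> * (1 + \<bar>x + c\<bar>) ^ L) * (1 + \<bar>c\<bar>) ^ L" by (simp add: power_mult_distrib)
    also have "\<dots> \<le> E * (1 + \<bar>c\<bar>) ^ L" by (intro mult_right_mono bE) simp
    finally show ?thesis .
  qed
  then show "wavelet_like L M ?I" using c fdI unfolding wavelet_like_def by blast
qed

section \<open>The Meyer and Daubechies families\<close>

lemma meyer_wavelet_like:
  assumes "meyer_system \<psi>F \<psi>M"
  shows "wavelet_like L M \<psi>F" "wavelet_like L M \<psi>M"
proof -
  obtain \<nu> :: "real \<Rightarrow> real" and p :: int where \<nu>: "smooth \<nu>" "\<And>z. z \<le> 0 \<Longrightarrow> \<nu> z = 0" "\<And>z. z \<ge> 1 \<Longrightarrow> \<nu> z = 1"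
    and F: "\<And>x. \<psi>F x = 1 / (2 * pi) * (\<integral>z. cos (x * z) * cos (pi / 2 * \<nu> (3 * \<bar>z\<bar> / (2 * pi) - 1)) \<partial>lborel)"
    and W: "\<And>x. \<psi>M x = 1 / (2 * pi) * (\<integral>z. cos ((x + of_int p + 1 / 2) * z) *
          (sin (pi / 2 * \<nu> (3 * \<bar>z\<bar> / (2 * pi) - 1)) * cos (pi / 2 * \<nu> (3 * \<bar>z\<bar> / (4 * pi) - 1))) \<partial>lborel)"
    using assms unfolding meyer_system_def by blast
  have \<nu>C: "Ck k \<nu>" for k using \<nu>(1) by (simp add: smooth_def)
  \<comment> \<open>The absolute value is not smooth at 0. But \<open>\<nu>\<close> vanishes on
    negative arguments, so the composition is a sum of two smooth functions, one for each
    half-line.\<close>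
  have eq: "\<nu> (a * \<bar>z\<bar> - 1) = \<nu> (a * z + (- 1)) + \<nu> (- a * z + (- 1))" if "a > 0" for a z
  proof (cases "z \<ge> 0")
    case True
    then have "0 \<le> a * z" using that by simp
    then show ?thesis using True by (simp add: \<nu>(2))
  next
    case False
    then have "a * z \<le> 0" using that by (simp add: mult_le_0_iff)
    then show ?thesis using False by (simp add: \<nu>(2))
  qed
  have C1: "Ck k (\<lambda>z. \<nu> (a * \<bar>z\<bar> - 1))" if "a > 0" for k a
    unfolding eq[OF that] by (intro Ck_add Ck_compose[OF \<nu>C] Ck_affine)
  have C2: "Ck k (\<lambda>z. cos (pi / 2 * \<nu> (a * \<bar>z\<bar> - 1) + b))" if "a > 0" for k a b
    using Ck_compose[OF Ck_cos_shift Ck_cmult[OF C1[OF that]]] .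
  have sin_cos: "sin y = cos (y + (- pi / 2))" for y :: real by (simp add: cos_diff)
  have arg: "3 * \<bar>z\<bar> / (2 * pi) - 1 = (3 / (2 * pi)) * \<bar>z\<bar> - 1" "3 * \<bar>z\<bar> / (4 * pi) - 1 = (3 / (4 * pi)) * \<bar>z\<bar> - 1" for z :: real
    by simp_all
  let ?h = "\<lambda>z. cos (pi / 2 * \<nu> ((3 / (2 * pi)) * \<bar>z\<bar> - 1) + 0)"
  let ?g = "\<lambda>z. cos (pi / 2 * \<nu> ((3 / (2 * pi)) * \<bar>z\<bar> - 1) + (- pi / 2)) * cos (pi / 2 * \<nu> ((3 / (4 * pi)) * \<bar>z\<bar> - 1) + 0)"
  have "wavelet_like L M (\<lambda>x. 1 / (2 * pi) * (\<integral>z. cos ((x + 0) * z) * ?h z \<partial>lborel))"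
  proof (rule wavelet_like_cos_integral[of ?h "4 * pi / 3"])
    show "Ck k ?h" for k by (rule C2) simp
    show "?h z = 0" if "\<bar>z\<bar> > 4 * pi / 3" for z
    proof -
      have "(3 / (2 * pi)) * \<bar>z\<bar> - 1 \<ge> 1" using that by (simp add: field_simps)
      then show ?thesis by (simp add: \<nu>(3))
    qed
  qed simp
  then show "wavelet_like L M \<psi>F" unfolding F[abs_def] arg by simp
  have "wavelet_like L M (\<lambda>x. 1 / (2 * pi) * (\<integral>z. cos ((x + (of_int p + 1 / 2)) * z) * ?g z \<partial>lborel))"
  proof (rule wavelet_like_cos_integral[of ?g "8 * pi / 3"])
    show "Ck k ?g" for k by (intro Ck_mult C2) simp_all
    show "?g z = 0" if "\<bar>z\<bar> > 8 * pi / 3" for z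
    proof -
      have "(3 / (4 * pi)) * \<bar>z\<bar> - 1 \<ge> 1" using that by (simp add: field_simps)
      then show ?thesis by (simp add: \<nu>(3))
    qed
  qed simp
  then show "wavelet_like L M \<psi>M" unfolding W[abs_def] arg sin_cos by (simp add: add.assoc)
qed

text \<open>The scaling function is smooth with compact support, and the wavelet is a finite
  combination of its dilated translates.\<close>

lemma daubechies_wavelet_like:
  assumes d: "daubechies_system N \<psi>F \<psi>M" and C: "Ck M \<psi>F"
  shows "wavelet_like L M \<psi>F" "wavelet_like L M \<psi>M"
proof -
  obtain h :: "int \<Rightarrow> real" and a p :: int and \<sigma> :: real where
    supp: "\<And>x. x < of_int a \<or> of_int a + 2 * real N - 1 < x \<Longrightarrow> \<psi>F x = 0"
    and M: "\<And>x. \<psi>M x = \<sigma> * sqrt 2 * (\<Sum>k\<in>{a..<a + 2 * int N}. (- 1) powi k * h k * \<psi>F (2 * x + of_int k - of_int p))"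
    using d unfolding daubechies_system_def by blast
  show F: "wavelet_like L M \<psi>F"
  proof (rule wavelet_like_compact_support[OF C])
    fix z :: real assume "\<bar>z\<bar> > \<bar>of_int a\<bar> + 2 * real N"
    then show "\<psi>F z = 0" by (intro supp) linarith
  qed
  have "wavelet_like L M (\<lambda>x. (\<sigma> * sqrt 2) * (\<Sum>k\<in>{a..<a + 2 * int N}. ((- 1) powi k * h k) * \<psi>F (2 * x + (of_int k - of_int p))))"
    by (intro wavelet_like_cmult wavelet_like_sum wavelet_like_affine F)
  then show "wavelet_like L M \<psi>M" unfolding M[abs_def] by (simp add: add_diff_eq)
qed

section \<open>Growth of the random coefficients\<close>

lemma exponents_log_AE_le:
  assumes "q \<in> exponents_log"
  shows "AE x in torus. q x \<le> q_plus q"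
proof -
  have "ess_sup q < \<infinity>" "1 \<le> ess_sup q" using assms unfolding exponents_log_def by auto
  then obtain r where r: "ess_sup q = ereal r" by (cases "ess_sup q") auto
  have "AE x in torus. ereal (q x) \<le> ess_sup q" unfolding ess_sup_def by (rule esssup_AE)
  then show ?thesis by (simp add: r)
qed

lemma nn_integral_exp_abs: "(\<integral>\<^sup>+x. ennreal (exp (- \<bar>x :: real\<bar> / 4)) \<partial>lborel) \<le> 8"
proof -
  define G where "G x = ennreal (exp (- x)) * indicator {0..} x" for x :: real
  have [measurable]: "G \<in> borel_measurable borel" unfolding G_def by measurable
  have G1: "(\<integral>\<^sup>+x. G x \<partial>lborel) = 1"
    using nn_intergal_power_times_exp_Ici[of 0] by (simp add: G_def)
  have a: "(\<integral>\<^sup>+x. G (x / 4) \<partial>lborel) = 4"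
    using nn_integral_real_affine[of "\<lambda>x. G (x / 4)" 4 0] by (simp add: G1)
  have b: "(\<integral>\<^sup>+x. G (- x / 4) \<partial>lborel) = 4"
    using nn_integral_real_affine[of "\<lambda>x. G (- x / 4)" "- 4" 0] by (simp add: G1)
  have "(\<integral>\<^sup>+x. ennreal (exp (- \<bar>x :: real\<bar> / 4)) \<partial>lborel) \<le> (\<integral>\<^sup>+x. G (x / 4) + G (- x / 4) \<partial>lborel)"
    by (intro nn_integral_mono) (auto simp: G_def indicator_def abs_if)
  also have "\<dots> = (\<integral>\<^sup>+x. G (x / 4) \<partial>lborel) + (\<integral>\<^sup>+x. G (- x / 4) \<partial>lborel)"
    by (rule nn_integral_add) measurable
  finally show ?thesis unfolding a b by simp
qed

text \<open>Exponents at least 1 give \<open>\<bar>x\<bar> powr q y \<ge> \<bar>x\<bar>\<close> for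
  \<open>\<bar>x\<bar> \<ge> 1\<close>, hence an exponential tail of rate \<open>1 / 2\<close>; the
  factor \<open>exp (1 / 2)\<close> covers smaller \<open>x\<close>.\<close>

lemma coefficient_weight:
  fixes q :: "real ^ 'n::finite \<Rightarrow> real"
  assumes q: "q \<in> exponents_log"
  defines "w \<equiv> \<lambda>x. exp (- 1 / 2 * (\<integral>y. \<bar>x\<bar> powr q y \<partial>torus))"
  shows "w \<in> borel_measurable borel" "\<And>x. w x \<le> exp (1 / 2) * exp (- \<bar>x\<bar> / 2)"
proof -
  have qm: "q \<in> borel_measurable borel" "\<And>x. 1 \<le> q x"
    using q by (auto simp: exponents_log_def exponents_def)
  note qt[measurable] = measurable_torus[OF qm(1)]
  have Q: "AE x in torus. q x \<le> q_plus q" by (rule exponents_log_AE_le[OF q])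
  have "(\<lambda>x. \<integral>y. \<bar>x\<bar> powr q y \<partial>torus) \<in> borel_measurable borel"
    by (rule torus.borel_measurable_lebesgue_integral) measurable
  then show "w \<in> borel_measurable borel" unfolding w_def by measurable
  fix x :: real
  have nn: "0 \<le> (\<integral>y. \<bar>x\<bar> powr q y \<partial>torus)" by (rule integral_nonneg_AE) simp
  show "w x \<le> exp (1 / 2) * exp (- \<bar>x\<bar> / 2)"
  proof (cases "\<bar>x\<bar> \<ge> 1")
    case True
    \<comment> \<open>The almost sure bound on \<open>q\<close> excludes the default value 0 of the
      integral of a nonintegrable function.\<close>
    have int: "integrable torus (\<lambda>y. \<bar>x\<bar> powr q y)"
    proof (rule torus.integrable_const_bound[where B="\<bar>x\<bar> powr q_plus q"])
      show "AE y in torus. norm (\<bar>x\<bar> powr q y) \<le> \<bar>x\<bar> powr q_plus q"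
        using Q by eventually_elim (use True in \<open>simp add: powr_mono\<close>)
    qed measurable
    have "(\<integral>y. \<bar>x\<bar> \<partial>(torus :: (real ^ 'n) measure)) \<le> (\<integral>y. \<bar>x\<bar> powr q y \<partial>torus)"
    proof (rule integral_mono[OF _ int])
      fix y show "\<bar>x\<bar> \<le> \<bar>x\<bar> powr q y" using powr_mono[OF qm(2)[of y] True] True by simp
    qed simp
    then have "\<bar>x\<bar> \<le> (\<integral>y. \<bar>x\<bar> powr q y \<partial>torus)" by simp
    then show ?thesis by (simp add: w_def exp_add[symmetric])
  next
    case False
    have "w x \<le> exp 0" unfolding w_def using nn by (subst exp_le_cancel_iff) simp
    also have "\<dots> \<le> exp (1 / 2 - \<bar>x\<bar> / 2)" using False by (subst exp_le_cancel_iff) simp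
    also have "exp (1 / 2 - \<bar>x\<bar> / 2) = exp (1 / 2) * exp (- \<bar>x\<bar> / 2)" unfolding mult_exp_exp by simp
    finally show ?thesis .
  qed
qed

text \<open>The moment of rate \<open>1 / 4\<close> is finite because the weight decays at rate
  \<open>1 / 2\<close>, which leaves an integrable factor of rate \<open>1 / 4\<close>.\<close>

lemma coefficient_law:
  fixes q :: "real ^ 'n::finite \<Rightarrow> real"
  assumes q: "q \<in> exponents_log"
  defines "\<nu> \<equiv> density lborel (\<lambda>x. ennreal (coefficient_density q x))"
  shows "prob_space \<nu>" "\<exists>K. (\<integral>\<^sup>+x. ennreal (exp (\<bar>x\<bar> / 4)) \<partial>\<nu>) \<le> ennreal K"
proof -
  define w where "w x = exp (- 1 / 2 * (\<integral>y. \<bar>x\<bar> powr q y \<partial>torus))" for x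
  have w[measurable]: "w \<in> borel_measurable borel" and wle: "\<And>x. w x \<le> exp (1 / 2) * exp (- \<bar>x\<bar> / 2)"
    using coefficient_weight[OF q] unfolding w_def by auto
  have wpos: "w x > 0" for x by (simp add: w_def)
  have wle4: "exp (\<bar>x\<bar> / 4) * w x \<le> exp (1 / 2) * exp (- \<bar>x\<bar> / 4)" for x
  proof -
    have "exp (\<bar>x\<bar> / 4) * w x \<le> exp (\<bar>x\<bar> / 4) * (exp (1 / 2) * exp (- \<bar>x\<bar> / 2))"
      by (intro mult_left_mono wle) simp
    also have "\<dots> = exp (1 / 2) * exp (- \<bar>x\<bar> / 4)" by (simp add: exp_add[symmetric])
    finally show ?thesis .
  qed
  have bound: "(\<integral>\<^sup>+x. ennreal (exp (\<bar>x\<bar> / 4) * w x) \<partial>lborel) \<le> ennreal (exp (1 / 2)) * 8"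
  proof -
    have "(\<integral>\<^sup>+x. ennreal (exp (\<bar>x\<bar> / 4) * w x) \<partial>lborel) \<le> (\<integral>\<^sup>+x. ennreal (exp (1 / 2)) * ennreal (exp (- \<bar>x\<bar> / 4)) \<partial>lborel)"
      unfolding ennreal_mult[OF exp_ge_zero exp_ge_zero, symmetric]
      by (intro nn_integral_mono ennreal_leI wle4)
    also have "\<dots> = ennreal (exp (1 / 2)) * (\<integral>\<^sup>+x. ennreal (exp (- \<bar>x\<bar> / 4)) \<partial>lborel)"
      by (rule nn_integral_cmult) measurable
    also have "\<dots> \<le> ennreal (exp (1 / 2)) * 8" by (intro mult_left_mono nn_integral_exp_abs) simp
    finally show ?thesis .
  qed
  have "(\<integral>\<^sup>+x. ennreal (w x) \<partial>lborel) \<le> (\<integral>\<^sup>+x. ennreal (exp (\<bar>x\<bar> / 4) * w x) \<partial>lborel)"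
  proof (intro nn_integral_mono ennreal_leI)
    fix x
    have "1 * w x \<le> exp (\<bar>x\<bar> / 4) * w x" by (rule mult_right_mono) (use less_imp_le[OF wpos] in simp_all)
    then show "w x \<le> exp (\<bar>x\<bar> / 4) * w x" by simp
  qed
  also note bound
  finally have wfin: "(\<integral>\<^sup>+x. ennreal (w x) \<partial>lborel) < \<infinity>"
    by (rule le_less_trans) (simp add: ennreal_mult_less_top)
  then have wint: "integrable lborel w"
    using wpos by (intro integrableI_nonneg) (auto simp: less_imp_le)
  define Z where "Z = (\<integral>x. w x \<partial>lborel)"
  have wZ: "(\<integral>\<^sup>+x. ennreal (w x) \<partial>lborel) = ennreal Z"
    unfolding Z_def using wpos by (intro nn_integral_eq_integral wint) (auto simp: less_imp_le)
  have Z: "Z > 0"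
  proof -
    have "Z \<noteq> 0"
    proof
      assume "Z = 0"
      then have "emeasure lborel {x \<in> space lborel. ennreal (w x) \<noteq> 0} = 0"
        using wZ by (subst nn_integral_0_iff[symmetric]) auto
      moreover have "{x \<in> space lborel. ennreal (w x) \<noteq> 0} = UNIV"
        using wpos by (auto simp: ennreal_eq_0_iff not_le)
      ultimately show False by simp
    qed
    moreover have "Z \<ge> 0" unfolding Z_def using wpos by (intro integral_nonneg_AE) (auto simp: less_imp_le)
    ultimately show ?thesis by simp
  qed
  have dens: "coefficient_density q x = w x / Z" for x
    by (simp add: coefficient_density_def w_def Z_def)
  have dm[measurable]: "(\<lambda>x. ennreal (coefficient_density q x)) \<in> borel_measurable lborel"
    unfolding dens by measurable
  have scale: "(\<integral>\<^sup>+x. ennreal (v x * (w x / Z)) \<partial>lborel) = ennreal (1 / Z) * (\<integral>\<^sup>+x. ennreal (v x * w x) \<partial>lborel)"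
    if [measurable]: "v \<in> borel_measurable borel" and "\<And>x. v x \<ge> 0" for v
  proof -
    have "(\<integral>\<^sup>+x. ennreal (v x * (w x / Z)) \<partial>lborel) = (\<integral>\<^sup>+x. ennreal (1 / Z) * ennreal (v x * w x) \<partial>lborel)"
      using Z wpos that(2) by (intro nn_integral_cong) (simp add: ennreal_mult[symmetric] less_imp_le)
    then show ?thesis by (simp add: nn_integral_cmult)
  qed
  show "prob_space \<nu>"
  proof
    have "emeasure \<nu> (space \<nu>) = (\<integral>\<^sup>+x. ennreal (1 * (w x / Z)) \<partial>lborel)"
      unfolding \<nu>_def by (simp add: emeasure_density dens)
    also have "\<dots> = ennreal (1 / Z) * ennreal Z" using scale[of "\<lambda>_. 1"] by (simp add: wZ)
    also have "\<dots> = 1" using Z by (simp add: ennreal_mult[symmetric])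
    finally show "emeasure \<nu> (space \<nu>) = 1" .
  qed
  have "(\<integral>\<^sup>+x. ennreal (exp (\<bar>x\<bar> / 4)) \<partial>\<nu>) = (\<integral>\<^sup>+x. ennreal (exp (\<bar>x\<bar> / 4) * (w x / Z)) \<partial>lborel)"
    unfolding \<nu>_def using Z wpos
    by (subst nn_integral_density) (auto simp: dens ennreal_mult[symmetric] mult.commute less_imp_le intro!: nn_integral_cong)
  also have "\<dots> = ennreal (1 / Z) * (\<integral>\<^sup>+x. ennreal (exp (\<bar>x\<bar> / 4) * w x) \<partial>lborel)"
    by (rule scale) auto
  also have "\<dots> \<le> ennreal (1 / Z) * (ennreal (exp (1 / 2)) * 8)" by (intro mult_left_mono bound) simp
  also have "\<dots> = ennreal (1 / Z * (exp (1 / 2) * 8))"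
  proof -
    have "ennreal (1 / Z * (exp (1 / 2) * 8)) = ennreal (1 / Z) * ennreal (exp (1 / 2) * 8)"
      using Z by (intro ennreal_mult) auto
    moreover have "ennreal (exp (1 / 2) * 8) = ennreal (exp (1 / 2)) * ennreal 8"
      by (intro ennreal_mult) auto
    ultimately show ?thesis by simp
  qed
  finally show "\<exists>K. (\<integral>\<^sup>+x. ennreal (exp (\<bar>x\<bar> / 4)) \<partial>\<nu>) \<le> ennreal K" by blast
qed

lemma card_vec_set:
  assumes "finite A"
  shows "card {m :: 'a ^ 'n::finite. \<forall>r. m $ r \<in> A} = card A ^ CARD('n)"
proof -
  have "(\<Sum>m\<in>{m :: 'a ^ 'n. \<forall>r. m $ r \<in> A}. \<Prod>r\<in>(UNIV::'n set). (1::nat)) = (\<Prod>r\<in>(UNIV::'n set). \<Sum>a\<in>A. 1)"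
    using sum_vec_prod[OF assms, of "\<lambda>(_ :: 'n) _. 1::nat"] .
  then show ?thesis by (simp only: prod.neutral_const sum_constant prod_constant of_nat_id mult_1_right)
qed

lemma wavelet_positions_eq: "wavelet_positions j = {m. \<forall>r. m $ r \<in> {..<2 ^ j}}"
  by (simp add: wavelet_positions_def)

lemma finite_wavelet_positions: "finite (wavelet_positions j)"
  unfolding wavelet_positions_eq by (rule finite_vec_set) simp

lemma card_wavelet_positions: "card (wavelet_positions j :: (nat ^ 'n::finite) set) = 2 ^ (j * CARD('n))"
  unfolding wavelet_positions_eq by (subst card_vec_set) (simp_all add: power_mult)

text \<open>The series of the expectations of \<open>2 ^ (- j (n + 1)) exp (|\<xi>| / 4)\<close> converges, hence so does
  the series itself almost surely.\<close>

lemma coefficients_grow_linearly: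
  fixes q :: "real ^ 'n::finite \<Rightarrow> real"
  assumes q: "q \<in> exponents_log"
  shows "AE \<xi> in coefficient_space q. \<exists>C. \<forall>j. \<forall>G\<in>wavelet_types j. \<forall>m\<in>wavelet_positions j. \<bar>\<xi> (j, G, m)\<bar> \<le> C * (1 + real j)"
proof -
  define \<nu> where "\<nu> = density lborel (\<lambda>x. ennreal (coefficient_density q x))"
  have \<nu>: "prob_space \<nu>" using coefficient_law[OF q] by (simp add: \<nu>_def)
  obtain K where K: "(\<integral>\<^sup>+x. ennreal (exp (\<bar>x\<bar> / 4)) \<partial>\<nu>) \<le> ennreal K"
    using coefficient_law(2)[OF q] unfolding \<nu>_def by blast
  define I where "I = (SIGMA j:UNIV. (wavelet_types j :: (wavelet_kind ^ 'n) set) \<times> (wavelet_positions j :: (nat ^ 'n) set))"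
  have sp: "coefficient_space q = PiM I (\<lambda>_. \<nu>)" by (simp add: coefficient_space_def I_def \<nu>_def)
  have sets\<nu>: "sets \<nu> = sets borel" by (simp add: \<nu>_def)
  have comp: "(\<lambda>\<xi>. \<xi> i) \<in> measurable (coefficient_space q) \<nu>" if "i \<in> I" for i
    unfolding sp by (rule measurable_component_singleton[OF that])
  have e\<nu>: "(\<lambda>x. ennreal (exp (\<bar>x\<bar> / 4))) \<in> borel_measurable \<nu>"
    unfolding measurable_cong_sets[OF sets\<nu> refl] by measurable
  have em: "(\<lambda>\<xi>. ennreal (exp (\<bar>\<xi> i\<bar> / 4))) \<in> borel_measurable (coefficient_space q)" if "i \<in> I" for i
    by (rule measurable_compose[OF comp[OF that] e\<nu>])
  have exp_i: "(\<integral>\<^sup>+\<xi>. ennreal (exp (\<bar>\<xi> i\<bar> / 4)) \<partial>coefficient_space q) \<le> ennreal K" if i: "i \<in> I" for i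
  proof -
    have "distr (coefficient_space q) \<nu> (\<lambda>\<xi>. \<xi> i) = \<nu>" unfolding sp using \<nu> i by (intro distr_PiM_component)
    then have "(\<integral>\<^sup>+x. ennreal (exp (\<bar>x\<bar> / 4)) \<partial>\<nu>) = (\<integral>\<^sup>+x. ennreal (exp (\<bar>x\<bar> / 4)) \<partial>distr (coefficient_space q) \<nu> (\<lambda>\<xi>. \<xi> i))" by simp
    also have "\<dots> = (\<integral>\<^sup>+\<xi>. ennreal (exp (\<bar>\<xi> i\<bar> / 4)) \<partial>coefficient_space q)"
      by (rule nn_integral_distr[OF comp[OF i]]) (simp add: e\<nu>)
    finally show ?thesis using K by simp
  qed
  define J where "J j = (wavelet_types j :: (wavelet_kind ^ 'n) set) \<times> (wavelet_positions j :: (nat ^ 'n) set)" for j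
  define g where "g = CARD(wavelet_kind ^ 'n)"
  have J: "finite (J j)" "card (J j) \<le> g * 2 ^ (j * CARD('n))" for j
  proof -
    show "finite (J j)" unfolding J_def by (intro finite_cartesian_product finite_wavelet_positions) simp
    have "card (wavelet_types j :: (wavelet_kind ^ 'n) set) \<le> g" unfolding g_def by (intro card_mono) auto
    then show "card (J j) \<le> g * 2 ^ (j * CARD('n))"
      unfolding J_def card_cartesian_product card_wavelet_positions by simp
  qed
  have JI: "(j, i) \<in> I" if "i \<in> J j" for j i using that by (auto simp: I_def J_def)
  \<comment> \<open>Of the exponent \<open>n + 1\<close> per level, \<open>n\<close> cancels the
    number of positions and 1 makes the expectations summable.\<close>
  define b where "b j = (1 / 2 :: real) ^ (j * (CARD('n) + 1))" for j :: nat
  have b: "b j > 0" for j by (simp add: b_def)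
  define S where "S \<xi> = (\<Sum>j. ennreal (b j) * (\<Sum>i\<in>J j. ennreal (exp (\<bar>\<xi> (j, i)\<bar> / 4))))" for \<xi> :: "nat \<times> (wavelet_kind ^ 'n) \<times> (nat ^ 'n) \<Rightarrow> real"
  have Sm: "(\<lambda>\<xi>. \<Sum>i\<in>J j. ennreal (exp (\<bar>\<xi> (j, i)\<bar> / 4))) \<in> borel_measurable (coefficient_space q)" for j
    by (intro borel_measurable_sum em JI)
  have Sm': "(\<lambda>\<xi>. ennreal (b j) * (\<Sum>i\<in>J j. ennreal (exp (\<bar>\<xi> (j, i)\<bar> / 4)))) \<in> borel_measurable (coefficient_space q)" for j
    by (intro borel_measurable_times_ennreal Sm borel_measurable_const)
  \<comment> \<open>\<open>K\<close> might be negative; \<open>ennreal\<close> truncates it, and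
    real arithmetic needs the truncated value.\<close>
  have K0: "ennreal K = ennreal (max K 0)" by (simp add: max_def ennreal_neg)
  have "(\<integral>\<^sup>+\<xi>. S \<xi> \<partial>coefficient_space q) = (\<Sum>j. \<integral>\<^sup>+\<xi>. ennreal (b j) * (\<Sum>i\<in>J j. ennreal (exp (\<bar>\<xi> (j, i)\<bar> / 4))) \<partial>coefficient_space q)"
    unfolding S_def by (rule nn_integral_suminf[OF Sm'])
  also have "\<dots> = (\<Sum>j. ennreal (b j) * (\<Sum>i\<in>J j. \<integral>\<^sup>+\<xi>. ennreal (exp (\<bar>\<xi> (j, i)\<bar> / 4)) \<partial>coefficient_space q))"
  proof (rule suminf_cong)
    fix j
    have "(\<integral>\<^sup>+\<xi>. (\<Sum>i\<in>J j. ennreal (exp (\<bar>\<xi> (j, i)\<bar> / 4))) \<partial>coefficient_space q) =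
        (\<Sum>i\<in>J j. \<integral>\<^sup>+\<xi>. ennreal (exp (\<bar>\<xi> (j, i)\<bar> / 4)) \<partial>coefficient_space q)"
      by (rule nn_integral_sum) (rule em[OF JI])
    then show "(\<integral>\<^sup>+\<xi>. ennreal (b j) * (\<Sum>i\<in>J j. ennreal (exp (\<bar>\<xi> (j, i)\<bar> / 4))) \<partial>coefficient_space q) =
        ennreal (b j) * (\<Sum>i\<in>J j. \<integral>\<^sup>+\<xi>. ennreal (exp (\<bar>\<xi> (j, i)\<bar> / 4)) \<partial>coefficient_space q)"
      by (simp only: nn_integral_cmult[OF Sm])
  qed
  also have "\<dots> \<le> (\<Sum>j. ennreal (real g * max K 0 * (1 / 2) ^ j))"
  proof (intro suminf_le allI)
    fix j
    have "(\<Sum>i\<in>J j. \<integral>\<^sup>+\<xi>. ennreal (exp (\<bar>\<xi> (j, i)\<bar> / 4)) \<partial>coefficient_space q) \<le> (\<Sum>i\<in>J j. ennreal (max K 0))"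
      unfolding K0[symmetric] by (rule sum_mono) (rule exp_i[OF JI])
    also have "\<dots> = ennreal (real (card (J j)) * max K 0)" by (simp add: ennreal_mult ennreal_of_nat_eq_real_of_nat)
    also have "\<dots> \<le> ennreal (real (g * 2 ^ (j * CARD('n))) * max K 0)"
      by (intro ennreal_leI mult_right_mono) (use J(2)[of j] in \<open>auto simp only: of_nat_le_iff max.cobounded2\<close>)
    finally have "ennreal (b j) * (\<Sum>i\<in>J j. \<integral>\<^sup>+\<xi>. ennreal (exp (\<bar>\<xi> (j, i)\<bar> / 4)) \<partial>coefficient_space q)
        \<le> ennreal (b j) * ennreal (real (g * 2 ^ (j * CARD('n))) * max K 0)" by (rule mult_left_mono) simp
    also have "\<dots> = ennreal (b j * (real (g * 2 ^ (j * CARD('n))) * max K 0))"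
      using b[of j] by (intro ennreal_mult[symmetric]) auto
    also have "b j * (real (g * 2 ^ (j * CARD('n))) * max K 0) = real g * max K 0 * (1 / 2) ^ j"
    proof -
      have "b j * 2 ^ (j * CARD('n)) = (1 / 2) ^ j"
        by (simp add: b_def power_add power_divide)
      then show ?thesis by (simp add: mult_ac)
    qed
    finally show "ennreal (b j) * (\<Sum>i\<in>J j. \<integral>\<^sup>+\<xi>. ennreal (exp (\<bar>\<xi> (j, i)\<bar> / 4)) \<partial>coefficient_space q)
        \<le> ennreal (real g * max K 0 * (1 / 2) ^ j)" .
  qed auto
  also have "\<dots> = ennreal (\<Sum>j. real g * max K 0 * (1 / 2) ^ j)"
    by (intro suminf_ennreal2) (auto intro!: summable_mult summable_geometric)
  finally have "(\<integral>\<^sup>+\<xi>. S \<xi> \<partial>coefficient_space q) < \<infinity>"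
    unfolding infinity_ennreal_def by (rule le_less_trans) (rule ennreal_less_top)
  then have "(\<integral>\<^sup>+\<xi>. S \<xi> \<partial>coefficient_space q) \<noteq> \<infinity>" by simp
  moreover have "S \<in> borel_measurable (coefficient_space q)"
    unfolding S_def by (rule borel_measurable_suminf_order[OF Sm'])
  ultimately have "AE \<xi> in coefficient_space q. S \<xi> \<noteq> \<infinity>" by (intro nn_integral_PInf_AE)
  then show ?thesis
  proof eventually_elim
    case (elim \<xi>)
    then obtain s where s: "S \<xi> = ennreal s" "s \<ge> 0" by (cases "S \<xi>") auto
    \<comment> \<open>Taking logarithms, \<open>\<bar>\<xi>\<bar> / 4\<close> is at most
      \<open>ln (s + 1)\<close> plus \<open>j * (n + 1) * ln 2\<close>, and
      \<open>ln 2 < 1\<close>.\<close>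
    define C where "C = 4 * (\<bar>ln (s + 1)\<bar> + real (CARD('n) + 1))"
    show ?case
    proof (rule exI[of _ C], intro allI ballI)
      fix j and G :: "wavelet_kind ^ 'n" and m :: "nat ^ 'n" assume "G \<in> wavelet_types j" "m \<in> wavelet_positions j"
      then have i: "(G, m) \<in> J j" by (simp add: J_def)
      have "ennreal (exp (\<bar>\<xi> (j, (G, m))\<bar> / 4)) \<le> (\<Sum>i\<in>J j. ennreal (exp (\<bar>\<xi> (j, i)\<bar> / 4)))"
        by (rule member_le_sum[OF i _ J(1)]) simp
      then have "ennreal (b j) * ennreal (exp (\<bar>\<xi> (j, (G, m))\<bar> / 4)) \<le> ennreal (b j) * (\<Sum>i\<in>J j. ennreal (exp (\<bar>\<xi> (j, i)\<bar> / 4)))"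
        by (rule mult_left_mono) simp
      also have "\<dots> \<le> S \<xi>" unfolding S_def
        using sum_le_suminf[of "\<lambda>j. ennreal (b j) * (\<Sum>i\<in>J j. ennreal (exp (\<bar>\<xi> (j, i)\<bar> / 4)))" "{j}"] by simp
      finally have "ennreal (b j * exp (\<bar>\<xi> (j, (G, m))\<bar> / 4)) \<le> ennreal s"
        using b[of j] by (simp add: s(1) ennreal_mult[symmetric])
      then have "b j * exp (\<bar>\<xi> (j, (G, m))\<bar> / 4) \<le> s" using s(2) by simp
      also have "s < s + 1" by simp
      finally have lt: "b j * exp (\<bar>\<xi> (j, (G, m))\<bar> / 4) < s + 1" .
      have "ln (b j) + \<bar>\<xi> (j, (G, m))\<bar> / 4 = ln (b j * exp (\<bar>\<xi> (j, (G, m))\<bar> / 4))"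
        using b[of j] by (simp add: ln_mult)
      also have "\<dots> \<le> ln (s + 1)" using lt b[of j] s(2) by (subst ln_le_cancel_iff) auto
      finally have 1: "ln (b j) + \<bar>\<xi> (j, (G, m))\<bar> / 4 \<le> \<bar>ln (s + 1)\<bar>" by linarith
      have "ln (b j) = - (real j * real (CARD('n) + 1) * ln 2)"
        unfolding b_def by (subst ln_realpow) (simp_all add: ln_div algebra_simps)
      moreover have "real j * real (CARD('n) + 1) * ln 2 \<le> real j * real (CARD('n) + 1) * 1"
        using ln_2_less_1 by (intro mult_left_mono) auto
      moreover have "x \<le> 4 * (w + v)" if "b' = - a" "a \<le> v * 1" "b' + x / 4 \<le> w" for x w v b' a :: real
        using that by simp
      ultimately have "\<bar>\<xi> (j, (G, m))\<bar> \<le> 4 * (\<bar>ln (s + 1)\<bar> + real j * real (CARD('n) + 1))" using 1 by blast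
      also have "\<dots> \<le> C * (1 + real j)"
      proof -
        have "0 \<le> \<bar>ln (s + 1)\<bar> * real j" "0 \<le> real (CARD('n) + 1)" by auto
        then show ?thesis unfolding C_def by (simp only: distrib_left distrib_right mult_1_right) (simp add: algebra_simps)
      qed
      finally show "\<bar>\<xi> (j, G, m)\<bar> \<le> C * (1 + real j)" .
    qed
  qed
qed

section \<open>Periodized wavelets\<close>

definition bump :: "real \<Rightarrow> real" where
  "bump x = 1 / (1 + \<bar>x\<bar>)\<^sup>2"

text \<open>The factor 4 pays for rounding the offset of a shifted integer lattice down to an
  integer.\<close>

definition bump_const :: real where
  "bump_const = 4 * (\<Sum>\<^sub>\<infinity>i::int. bump (of_int i))"

lemma bump_pos: "bump x > 0"
  by (simp add: bump_def add_pos_nonneg)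

lemma bump_nonneg[simp]: "bump x \<ge> 0"
  using bump_pos[of x] by simp

lemma bump_summable_int: "(\<lambda>i::int. bump (of_int i)) summable_on UNIV"
  using summable_inverse_square_int by (simp add: bump_def)

lemma bump_const_nonneg: "bump_const \<ge> 0"
  unfolding bump_const_def by (simp add: infsum_nonneg)

lemma bump_translate_le: "bump (z + of_int i) \<le> 4 * bump (of_int (i + \<lfloor>z\<rfloor>))"
proof -
  have "1 + \<bar>of_int (i + \<lfloor>z\<rfloor>)\<bar> \<le> 2 * (1 + \<bar>z + of_int i\<bar>)"
  proof -
    have "real_of_int (i + \<lfloor>z\<rfloor>) = (z + of_int i) - (z - of_int \<lfloor>z\<rfloor>)" by simp
    moreover have "\<bar>z - of_int \<lfloor>z\<rfloor>\<bar> \<le> 1" by linarith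
    ultimately have "\<bar>real_of_int (i + \<lfloor>z\<rfloor>)\<bar> \<le> \<bar>z + of_int i\<bar> + 1" by linarith
    moreover have "1 + a \<le> 2 * (1 + b)" if "a \<le> b + 1" "0 \<le> b" for a b :: real using that by simp
    ultimately show ?thesis by (simp only: abs_ge_zero)
  qed
  then have "(1 + \<bar>of_int (i + \<lfloor>z\<rfloor>)\<bar>)\<^sup>2 \<le> (2 * (1 + \<bar>z + of_int i\<bar>))\<^sup>2"
    by (intro power_mono) auto
  then have "(1 + \<bar>real_of_int (i + \<lfloor>z\<rfloor>)\<bar>)\<^sup>2 \<le> 4 * (1 + \<bar>z + of_int i\<bar>)\<^sup>2"
    unfolding power_mult_distrib by (rule order_trans) simp
  moreover have "0 < (1 + \<bar>real_of_int (i + \<lfloor>z\<rfloor>)\<bar>)\<^sup>2" "0 < (1 + \<bar>z + of_int i\<bar>)\<^sup>2"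
    by (auto simp: add_pos_nonneg)
  ultimately show ?thesis unfolding bump_def by (simp add: divide_le_eq le_divide_eq mult.commute)
qed

lemma bump_summable: "(\<lambda>i::int. bump (z + of_int i)) summable_on A"
  and bump_infsum_le: "infsum (\<lambda>i::int. bump (z + of_int i)) A \<le> bump_const"
proof -
  have b: "bij (\<lambda>i::int. i + \<lfloor>z\<rfloor>)" by (rule bij_plus_right)
  have s: "(\<lambda>i::int. bump (of_int (i + \<lfloor>z\<rfloor>))) summable_on UNIV"
    using summable_on_reindex_bij_betw[OF b, of "\<lambda>i. bump (of_int i)"] bump_summable_int by simp
  have i: "(\<Sum>\<^sub>\<infinity>i::int. bump (of_int (i + \<lfloor>z\<rfloor>))) = (\<Sum>\<^sub>\<infinity>i::int. bump (of_int i))"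
    using infsum_reindex_bij_betw[OF b, of "\<lambda>i. bump (of_int i)"] by simp
  have s4: "(\<lambda>i::int. 4 * bump (of_int (i + \<lfloor>z\<rfloor>))) summable_on UNIV" by (rule summable_on_cmult_right[OF s])
  have u: "(\<lambda>i::int. bump (z + of_int i)) summable_on UNIV"
    by (rule summable_on_comparison_test[OF s4]) (use bump_translate_le in auto)
  then show sA: "(\<lambda>i::int. bump (z + of_int i)) summable_on A"
    by (rule summable_on_subset_banach) simp
  have "infsum (\<lambda>i::int. bump (z + of_int i)) A \<le> (\<Sum>\<^sub>\<infinity>i::int. bump (z + of_int i))"
    by (rule infsum_mono_neutral[OF sA u]) auto
  also have "\<dots> \<le> (\<Sum>\<^sub>\<infinity>i::int. 4 * bump (of_int (i + \<lfloor>z\<rfloor>)))"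
    by (rule infsum_mono[OF u s4]) (rule bump_translate_le)
  also have "\<dots> = bump_const" by (simp only: infsum_cmult_right[OF s] i bump_const_def)
  finally show "infsum (\<lambda>i::int. bump (z + of_int i)) A \<le> bump_const" .
qed

text \<open>The points \<open>2 ^ j * (y + l) - m\<close> lie in the shifted integer lattice
  \<open>2 ^ j * y + i\<close>, along a residue class modulo \<open>2 ^ j\<close>. So a periodized
  sum is part of one sum over the integers.\<close>

lemma dilate_eq: "2 ^ j * (y + of_int l) - real m = 2 ^ j * y + of_int (2 ^ j * l - int m)"
  by (simp add: algebra_simps)

lemma inj_dilate: "inj (\<lambda>l::int. 2 ^ j * l - int m)"
  by (simp add: inj_def)

lemma bump_dilate_infsum:
  "(\<Sum>\<^sub>\<infinity>l::int. bump (2 ^ j * (y + of_int l) - real m)) = infsum (\<lambda>i::int. bump (2 ^ j * y + of_int i)) (range (\<lambda>l. 2 ^ j * l - int m))"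
  unfolding dilate_eq using infsum_reindex[OF inj_dilate, of "\<lambda>i. bump (2 ^ j * y + of_int i)" j m] by (simp add: o_def)

lemma bump_dilate_summable: "(\<lambda>l::int. bump (2 ^ j * (y + of_int l) - real m)) summable_on UNIV"
  unfolding dilate_eq using summable_on_reindex[OF inj_dilate, of "\<lambda>i. bump (2 ^ j * y + of_int i)" j m]
  by (simp add: o_def bump_summable)

lemma infsum_finite_UN_disjoint:
  fixes f :: "'a \<Rightarrow> real"
  assumes "finite M" "\<And>A. f summable_on A" "\<And>m m'. m \<in> M \<Longrightarrow> m' \<in> M \<Longrightarrow> m \<noteq> m' \<Longrightarrow> A m \<inter> A m' = {}"
  shows "(\<Sum>m\<in>M. infsum f (A m)) = infsum f (\<Union>m\<in>M. A m)"
  using assms(1,3)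
proof (induction M)
  case (insert m M)
  have "infsum f (A m \<union> (\<Union>m\<in>M. A m)) = infsum f (A m) + infsum f (\<Union>m\<in>M. A m)"
    using insert by (intro infsum_Un_disjoint assms(2)) auto
  then show ?case using insert by simp
qed simp

text \<open>Distinct positions below \<open>2 ^ j\<close> occupy distinct residue classes, so the
  sum over all of them is still part of one sum over the integers, with a bound independent of the
  level.\<close>

lemma bump_dilate_sum_le:
  "(\<Sum>m<2 ^ j. \<Sum>\<^sub>\<infinity>l::int. bump (2 ^ j * (y + of_int l) - real m)) \<le> bump_const"
proof -
  have "range (\<lambda>l. 2 ^ j * l - int m) \<inter> range (\<lambda>l. 2 ^ j * l - int m') = {}"
    if "m \<in> {..<2 ^ j}" "m' \<in> {..<2 ^ j}" "m \<noteq> m'" for m m' :: nat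
  proof (rule ccontr)
    assume "range (\<lambda>l. 2 ^ j * l - int m) \<inter> range (\<lambda>l. 2 ^ j * l - int m') \<noteq> {}"
    then obtain l l' where "2 ^ j * l - int m = 2 ^ j * l' - int m'" by auto
    then have "int m - int m' = 2 ^ j * (l - l')" by (simp add: algebra_simps)
    then have "(2 ^ j :: int) dvd int m - int m'" by simp
    then have "int m mod 2 ^ j = int m' mod 2 ^ j" by (simp add: mod_eq_dvd_iff)
    moreover have "int m < 2 ^ j" "int m' < 2 ^ j" using that by (simp_all add: nat_less_real_le flip: of_nat_less_iff[where 'a=int])
    ultimately show False using that by simp
  qed
  then have "(\<Sum>m<2 ^ j. \<Sum>\<^sub>\<infinity>l::int. bump (2 ^ j * (y + of_int l) - real m)) =
      infsum (\<lambda>i::int. bump (2 ^ j * y + of_int i)) (\<Union>m<2 ^ j. range (\<lambda>l. 2 ^ j * l - int m))"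
    unfolding bump_dilate_infsum by (intro infsum_finite_UN_disjoint bump_summable) auto
  then show ?thesis by (simp add: bump_infsum_le)
qed

text \<open>Each difference adds a second term, whose weight is moved from \<open>x + \<eta>\<close>
  to \<open>x\<close> at the cost of \<open>(1 + \<bar>\<eta>\<bar>) ^ L\<close>.\<close>

lemma fd_decay:
  fixes f :: "real \<Rightarrow> real"
  assumes f: "\<And>x. \<bar>f x\<bar> * (1 + \<bar>x\<bar>) ^ L \<le> C"
  shows "\<bar>fd \<eta> M f x\<bar> * (1 + \<bar>x\<bar>) ^ L \<le> C * (2 * (1 + \<bar>\<eta>\<bar>) ^ L) ^ M"
proof (induction M arbitrary: x)
  case (Suc M)
  let ?K = "(1 + \<bar>\<eta>\<bar>) ^ L"
  have C0: "C \<ge> 0" using f[of 0] by (simp add: order_trans[OF abs_ge_zero])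
  have K1: "?K \<ge> 1" by (rule one_le_power) simp
  have x: "(1 + \<bar>x\<bar>) ^ L \<le> (1 + \<bar>x + \<eta>\<bar>) ^ L * ?K"
    unfolding power_mult_distrib[symmetric] by (intro power_mono one_plus_abs_le_mult) auto
  have "\<bar>fd \<eta> (Suc M) f x\<bar> * (1 + \<bar>x\<bar>) ^ L \<le> \<bar>fd \<eta> M f (x + \<eta>)\<bar> * (1 + \<bar>x\<bar>) ^ L + \<bar>fd \<eta> M f x\<bar> * (1 + \<bar>x\<bar>) ^ L"
    unfolding distrib_right[symmetric] by (intro mult_right_mono) auto
  also have "\<bar>fd \<eta> M f (x + \<eta>)\<bar> * (1 + \<bar>x\<bar>) ^ L \<le> \<bar>fd \<eta> M f (x + \<eta>)\<bar> * ((1 + \<bar>x + \<eta>\<bar>) ^ L * ?K)"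
    by (intro mult_left_mono x) simp
  also have "\<dots> \<le> C * (2 * ?K) ^ M * ?K"
    using mult_right_mono[OF Suc[of "x + \<eta>"], of ?K] by (simp add: mult_ac)
  also have "\<bar>fd \<eta> M f x\<bar> * (1 + \<bar>x\<bar>) ^ L \<le> C * (2 * ?K) ^ M * ?K"
    using mult_mono[OF Suc[of x] K1] C0 K1 by (simp add: mult_nonneg_nonneg)
  finally show ?case by (simp add: algebra_simps)
qed (use f in simp)

text \<open>The geometric mean of two bounds: one of order \<open>2 * K\<close> in the step without
  decay, the other with decay of order 4 without smallness. Half of each survives, which is enough
  to sum over translates.\<close>

lemma fd_interpolated:
  fixes f :: "real \<Rightarrow> real"
  assumes f: "\<And>x. \<bar>f x\<bar> * (1 + \<bar>x\<bar>) ^ 4 \<le> C" and d: "\<And>h x. \<bar>fd h (2 * K) f x\<bar> \<le> D * \<bar>h\<bar> ^ (2 * K)"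
    and \<eta>: "\<bar>\<eta>\<bar> \<le> A"
  shows "\<bar>fd \<eta> (2 * K) f x\<bar> \<le> sqrt (D * (C * (2 * (1 + A) ^ 4) ^ (2 * K))) * \<bar>\<eta>\<bar> ^ K * bump x"
proof -
  let ?E = "C * (2 * (1 + A) ^ 4) ^ (2 * K)"
  have C0: "C \<ge> 0" using f[of 0] by (simp add: order_trans[OF abs_ge_zero])
  have A0: "A \<ge> 0" using \<eta> by linarith
  have D0: "D \<ge> 0" using d[of 1 0] by (simp add: order_trans[OF abs_ge_zero])
  have E0: "?E \<ge> 0" using C0 A0 by simp
  let ?a = "\<bar>fd \<eta> (2 * K) f x\<bar>"
  have "?a * (1 + \<bar>x\<bar>) ^ 4 \<le> C * (2 * (1 + \<bar>\<eta>\<bar>) ^ 4) ^ (2 * K)" by (rule fd_decay[OF f])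
  also have "\<dots> \<le> ?E" using C0 \<eta> by (intro mult_left_mono power_mono) auto
  finally have a1: "?a * (1 + \<bar>x\<bar>) ^ 4 \<le> ?E" .
  have "(?a * (1 + \<bar>x\<bar>)\<^sup>2)\<^sup>2 = ?a * (?a * (1 + \<bar>x\<bar>) ^ 4)"
    by (simp add: power2_eq_square power4_eq_xxxx)
  also have "\<dots> \<le> (D * \<bar>\<eta>\<bar> ^ (2 * K)) * ?E"
    by (rule mult_mono[OF d a1]) (use D0 in simp_all)
  also have "\<dots> = (sqrt (D * ?E) * \<bar>\<eta>\<bar> ^ K)\<^sup>2"
  proof -
    have "(sqrt (D * ?E) * \<bar>\<eta>\<bar> ^ K)\<^sup>2 = (sqrt (D * ?E))\<^sup>2 * (\<bar>\<eta>\<bar> ^ K)\<^sup>2" by (rule power_mult_distrib)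
    also have "(sqrt (D * ?E))\<^sup>2 = D * ?E" by (rule real_sqrt_pow2) (rule mult_nonneg_nonneg[OF D0 E0])
    also have "(\<bar>\<eta>\<bar> ^ K)\<^sup>2 = \<bar>\<eta>\<bar> ^ (2 * K)" by (rule power_even_eq[symmetric])
    finally show ?thesis by (simp only: mult_ac)
  qed
  finally have "?a * (1 + \<bar>x\<bar>)\<^sup>2 \<le> sqrt (D * ?E) * \<bar>\<eta>\<bar> ^ K"
    by (rule power2_le_imp_le) (use D0 E0 in simp)
  moreover have "(1 + \<bar>x\<bar>)\<^sup>2 > 0" by (simp add: add_pos_nonneg)
  ultimately show ?thesis unfolding bump_def by (simp add: le_divide_eq)
qed

lemma fd_infsum:
  fixes F :: "'i \<Rightarrow> 'a::ab_semigroup_add \<Rightarrow> real"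
  assumes "\<And>y. (\<lambda>l. F l y) summable_on UNIV"
  shows "(\<lambda>l. fd h M (F l) y) summable_on UNIV \<and> fd h M (\<lambda>y. \<Sum>\<^sub>\<infinity>l. F l y) y = (\<Sum>\<^sub>\<infinity>l. fd h M (F l) y)"
proof (induction M arbitrary: y)
  case (Suc M)
  have h: "((\<lambda>l. fd h M (F l) y) has_sum fd h M (\<lambda>y. \<Sum>\<^sub>\<infinity>l. F l y) y) UNIV" for y
    using has_sum_infsum[OF Suc[of y, THEN conjunct1]] Suc[of y] by simp
  have "((\<lambda>l. fd h (Suc M) (F l) y) has_sum fd h (Suc M) (\<lambda>y. \<Sum>\<^sub>\<infinity>l. F l y) y) UNIV"
    unfolding fd.simps by (rule has_sum_diff[OF h h])
  then show ?case by (auto simp: summable_on_def infsumI simp del: fd.simps)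
qed (simp add: assms)

text \<open>The majorant may depend on the bounded range considered, as it does for sums of
  translates.\<close>

lemma continuous_on_infsum_locally:
  fixes f :: "'i \<Rightarrow> real \<Rightarrow> real"
  assumes c: "\<And>i. continuous_on UNIV (f i)" and b: "\<And>R. \<exists>M. M summable_on UNIV \<and> (\<forall>i x. \<bar>x\<bar> \<le> R \<longrightarrow> \<bar>f i x\<bar> \<le> M i)"
  shows "continuous_on UNIV (\<lambda>x. \<Sum>\<^sub>\<infinity>i. f i x)"
proof (rule continuous_at_imp_continuous_on, rule ballI)
  fix x :: real
  define R where "R = \<bar>x\<bar> + 1"
  obtain M where M: "M summable_on UNIV" "\<And>i x. \<bar>x\<bar> \<le> R \<Longrightarrow> \<bar>f i x\<bar> \<le> M i" using b[of R] by blast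
  have "continuous_on {-R..R} (\<lambda>x. \<Sum>\<^sub>\<infinity>i. f i x)"
  proof (rule uniform_limit_theorem)
    show "uniform_limit {-R..R} (\<lambda>P x. \<Sum>i\<in>P. f i x) (\<lambda>x. \<Sum>\<^sub>\<infinity>i. f i x) (finite_subsets_at_top UNIV)"
      by (rule Weierstrass_m_test_general[OF _ M(1)]) (use M(2) in \<open>auto simp: abs_le_iff\<close>)
  qed (auto intro!: always_eventually continuous_on_sum continuous_on_subset[OF c])
  moreover have "x \<in> interior {-R..R}" by (simp add: R_def) linarith
  ultimately show "isCont (\<lambda>x. \<Sum>\<^sub>\<infinity>i. f i x) x" by (rule continuous_on_interior)
qed

section \<open>Periodized functions of one variable\<close>

definition periodize :: "(real \<Rightarrow> real) \<Rightarrow> nat \<Rightarrow> nat \<Rightarrow> real \<Rightarrow> real" where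
  "periodize \<phi> j m y = (\<Sum>\<^sub>\<infinity>l::int. 2 powr (real j / 2) * \<phi> (2 ^ j * (y + of_int l) - real m))"

text \<open>The factor \<open>2 powr (j / 2)\<close> is left out, so that all bounds are independent
  of the level.\<close>

definition periodize_abs :: "(real \<Rightarrow> real) \<Rightarrow> nat \<Rightarrow> nat \<Rightarrow> real \<Rightarrow> real" where
  "periodize_abs \<phi> j m y = (\<Sum>\<^sub>\<infinity>l::int. \<bar>\<phi> (2 ^ j * (y + of_int l) - real m)\<bar>)"

text \<open>Constants for both functions of a wavelet system; the exponent \<open>L + 4\<close> leaves a factor \<open>L\<close>
  of decay after summation, and \<open>2 * K\<close> differences give the factor \<open>K\<close> after interpolation with the
  decay.\<close>

locale wavelet_pair =
  fixes \<psi> :: "wavelet_kind \<Rightarrow> real \<Rightarrow> real" and L K :: nat and C D :: real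
  assumes continuous: "continuous_on UNIV (\<psi> k)"
    and decay: "\<bar>\<psi> k x\<bar> * (1 + \<bar>x\<bar>) ^ (L + 4) \<le> C"
    and differences: "\<bar>fd h (2 * K) (\<psi> k) x\<bar> \<le> D * \<bar>h\<bar> ^ (2 * K)"
begin

lemma C_nonneg: "C \<ge> 0"
  using decay[of Scaling 0] by (simp add: order_trans[OF abs_ge_zero])

lemma D_nonneg: "D \<ge> 0"
  using differences[of 1 Scaling 0] by (simp add: order_trans[OF abs_ge_zero])

lemma abs_far_le:
  assumes "0 \<le> R" "R \<le> \<bar>x\<bar>"
  shows "\<bar>\<psi> k x\<bar> \<le> C / (1 + R) ^ L * bump x"
proof -
  have "\<bar>\<psi> k x\<bar> * ((1 + R) ^ L * (1 + \<bar>x\<bar>)\<^sup>2) \<le> \<bar>\<psi> k x\<bar> * (1 + \<bar>x\<bar>) ^ (L + 4)"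
  proof (rule mult_left_mono)
    have "(1 + R) ^ L * (1 + \<bar>x\<bar>)\<^sup>2 \<le> (1 + \<bar>x\<bar>) ^ L * (1 + \<bar>x\<bar>) ^ 4"
      using assms by (intro mult_mono power_mono power_increasing) auto
    then show "(1 + R) ^ L * (1 + \<bar>x\<bar>)\<^sup>2 \<le> (1 + \<bar>x\<bar>) ^ (L + 4)" by (simp add: power_add)
  qed simp
  also have "\<dots> \<le> C" by (rule decay)
  finally have "\<bar>\<psi> k x\<bar> * ((1 + R) ^ L * (1 + \<bar>x\<bar>)\<^sup>2) \<le> C" .
  moreover have "0 < (1 + R) ^ L * (1 + \<bar>x\<bar>)\<^sup>2" using assms by (simp add: add_pos_nonneg)
  ultimately have "\<bar>\<psi> k x\<bar> \<le> C / ((1 + R) ^ L * (1 + \<bar>x\<bar>)\<^sup>2)" by (simp add: pos_le_divide_eq)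
  then show ?thesis by (simp add: bump_def)
qed

lemma abs_le_bump: "\<bar>\<psi> k x\<bar> \<le> C * bump x"
  using abs_far_le[of 0 x k] by simp

lemma abs_dilate_summable: "(\<lambda>l::int. \<bar>\<psi> k (2 ^ j * (y + of_int l) - real m)\<bar>) summable_on UNIV"
  by (rule abs_summable_bounded[OF _ summable_on_cmult_right[OF bump_dilate_summable, of C j y m]])
    (use abs_le_bump in simp)

lemma dilate_summable: "(\<lambda>l::int. 2 powr (real j / 2) * \<psi> k (2 ^ j * (y + of_int l) - real m)) summable_on UNIV"
  by (rule summable_on_cmult_right,
      rule abs_summable_bounded[OF _ summable_on_cmult_right[OF bump_dilate_summable, of C j y m]])
    (use abs_le_bump in simp)

lemma periodize_abs_nonneg: "periodize_abs (\<psi> k) j m y \<ge> 0"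
  unfolding periodize_abs_def by (rule infsum_nonneg) simp

lemma periodize_abs_far_le:
  assumes R: "R \<ge> 0" "\<And>l::int. R \<le> \<bar>2 ^ j * (y + of_int l) - real m\<bar>"
  shows "periodize_abs (\<psi> k) j m y \<le> C / (1 + R) ^ L * bump_const"
proof -
  have "periodize_abs (\<psi> k) j m y \<le> (\<Sum>\<^sub>\<infinity>l::int. C / (1 + R) ^ L * bump (2 ^ j * (y + of_int l) - real m))"
    unfolding periodize_abs_def
    by (intro infsum_mono abs_dilate_summable summable_on_cmult_right bump_dilate_summable abs_far_le R)
  also have "\<dots> = C / (1 + R) ^ L * (\<Sum>\<^sub>\<infinity>l::int. bump (2 ^ j * (y + of_int l) - real m))"
    by (rule infsum_cmult_right) (rule bump_dilate_summable)
  also have "\<dots> \<le> C / (1 + R) ^ L * bump_const"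
    unfolding bump_dilate_infsum using C_nonneg R(1) by (intro mult_left_mono bump_infsum_le) simp
  finally show ?thesis .
qed

lemma periodize_abs_le: "periodize_abs (\<psi> k) j m y \<le> C * bump_const"
  using periodize_abs_far_le[of 0 j y m k] by simp

lemma periodize_abs_sum_le: "(\<Sum>m<2 ^ j. periodize_abs (\<psi> k) j m y) \<le> C * bump_const"
proof -
  have "(\<Sum>m<2 ^ j. periodize_abs (\<psi> k) j m y) \<le> (\<Sum>m<2 ^ j. C * (\<Sum>\<^sub>\<infinity>l::int. bump (2 ^ j * (y + of_int l) - real m)))"
  proof (rule sum_mono)
    fix m
    have "periodize_abs (\<psi> k) j m y \<le> (\<Sum>\<^sub>\<infinity>l::int. C * bump (2 ^ j * (y + of_int l) - real m))"
      unfolding periodize_abs_def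
      by (intro infsum_mono abs_dilate_summable summable_on_cmult_right bump_dilate_summable abs_le_bump)
    also have "\<dots> = C * (\<Sum>\<^sub>\<infinity>l::int. bump (2 ^ j * (y + of_int l) - real m))"
      by (rule infsum_cmult_right) (rule bump_dilate_summable)
    finally show "periodize_abs (\<psi> k) j m y \<le> C * (\<Sum>\<^sub>\<infinity>l::int. bump (2 ^ j * (y + of_int l) - real m))" .
  qed
  also have "\<dots> \<le> C * bump_const"
    unfolding sum_distrib_left[symmetric] by (intro mult_left_mono bump_dilate_sum_le C_nonneg)
  finally show ?thesis .
qed

lemma abs_periodize_le: "\<bar>periodize (\<psi> k) j m y\<bar> \<le> 2 powr (real j / 2) * periodize_abs (\<psi> k) j m y"
proof -
  have "norm (\<Sum>\<^sub>\<infinity>l::int. 2 powr (real j / 2) * \<psi> k (2 ^ j * (y + of_int l) - real m)) \<le>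
      (\<Sum>\<^sub>\<infinity>l::int. 2 powr (real j / 2) * \<bar>\<psi> k (2 ^ j * (y + of_int l) - real m)\<bar>)"
    by (rule norm_infsum_le[OF has_sum_infsum[OF dilate_summable] has_sum_infsum[OF summable_on_cmult_right[OF abs_dilate_summable]]])
      (simp add: abs_mult)
  also have "\<dots> = 2 powr (real j / 2) * periodize_abs (\<psi> k) j m y"
    unfolding periodize_abs_def by (rule infsum_cmult_right) (rule abs_dilate_summable)
  finally show ?thesis by (simp add: periodize_def)
qed

lemma periodize_periodic: "periodize (\<psi> k) j m (y + 1) = periodize (\<psi> k) j m y"
proof -
  have b: "bij (\<lambda>l::int. l + 1)" by (rule bij_plus_right)
  show ?thesis unfolding periodize_def
    using infsum_reindex_bij_betw[OF b, of "\<lambda>l. 2 powr (real j / 2) * \<psi> k (2 ^ j * (y + of_int l) - real m)"]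
    by (simp add: add_ac)
qed

lemma continuous_periodize: "continuous_on UNIV (periodize (\<psi> k) j m)"
  unfolding periodize_def[abs_def]
proof (rule continuous_on_infsum_locally)
  show "continuous_on UNIV (\<lambda>y. 2 powr (real j / 2) * \<psi> k (2 ^ j * (y + of_int l) - real m))" for l
    by (intro continuous_intros continuous_on_compose2[OF continuous]) auto
  fix R :: real
  \<comment> \<open>For \<open>\<bar>y\<bar> \<le> R\<close>, the translate index exceeds the
    argument of the function by at most \<open>S\<close> in absolute value, so the profile at the
    argument is at most \<open>(1 + S)^2\<close> times the profile at the index.\<close>
  define S where "S = 2 ^ j * \<bar>R\<bar> + real m"
  have S: "S \<ge> 0" by (simp add: S_def)
  have "\<bar>2 powr (real j / 2) * \<psi> k (2 ^ j * (y + of_int l) - real m)\<bar> \<le> 2 powr (real j / 2) * (C * (1 + S)\<^sup>2) * bump (of_int l)"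
    if y: "\<bar>y\<bar> \<le> R" for l :: int and y
  proof -
    let ?z = "2 ^ j * (y + of_int l) - real m"
    have "\<bar>of_int l\<bar> \<le> \<bar>?z\<bar> + S"
    proof -
      have "\<bar>real_of_int l\<bar> * 1 \<le> \<bar>of_int l\<bar> * 2 ^ j" by (intro mult_left_mono) auto
      also have "\<dots> = \<bar>2 ^ j * of_int l\<bar>" by (simp add: abs_mult)
      also have "2 ^ j * of_int l = ?z - 2 ^ j * y + real m" by (simp add: algebra_simps)
      also have "\<bar>\<dots>\<bar> \<le> \<bar>?z\<bar> + \<bar>2 ^ j * y\<bar> + real m" by linarith
      also have "\<bar>2 ^ j * y\<bar> \<le> 2 ^ j * \<bar>R\<bar>" using y by (simp add: abs_mult)
      finally show ?thesis by (simp add: S_def)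
    qed
    then have "1 + \<bar>real_of_int l\<bar> \<le> (1 + \<bar>?z\<bar>) * (1 + S)" by (rule one_plus_abs_le_mult) (use S in auto)
    then have "(1 + \<bar>real_of_int l\<bar>)\<^sup>2 \<le> ((1 + \<bar>?z\<bar>) * (1 + S))\<^sup>2" by (rule power_mono) simp
    then have "bump ?z \<le> (1 + S)\<^sup>2 * bump (of_int l)"
      unfolding bump_def power_mult_distrib
      by (simp add: add_pos_nonneg pos_divide_le_eq pos_le_divide_eq mult_ac)
    then have "C * bump ?z \<le> C * ((1 + S)\<^sup>2 * bump (of_int l))" by (rule mult_left_mono) (rule C_nonneg)
    then have "\<bar>\<psi> k ?z\<bar> \<le> C * (1 + S)\<^sup>2 * bump (of_int l)" using abs_le_bump[of k ?z] by (simp add: mult_ac)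
    then have "2 powr (real j / 2) * \<bar>\<psi> k ?z\<bar> \<le> 2 powr (real j / 2) * (C * (1 + S)\<^sup>2 * bump (of_int l))"
      by (rule mult_left_mono) simp
    then show ?thesis by (simp add: abs_mult mult_ac)
  qed
  then show "\<exists>M. M summable_on UNIV \<and> (\<forall>l y. \<bar>y\<bar> \<le> R \<longrightarrow>
      \<bar>2 powr (real j / 2) * \<psi> k (2 ^ j * (y + of_int l) - real m)\<bar> \<le> M l)"
    by (intro exI[of _ "\<lambda>l. 2 powr (real j / 2) * (C * (1 + S)\<^sup>2) * bump (of_int l)"] conjI
        summable_on_cmult_right bump_summable_int) blast
qed

text \<open>The constant of \<open>fd_interpolated\<close> for steps bounded by
  \<open>A\<close>.\<close>

definition fd_const :: "real \<Rightarrow> real" where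
  "fd_const A = sqrt (D * (C * (2 * (1 + A) ^ 4) ^ (2 * K)))"

lemma fd_const_nonneg: "A \<ge> 0 \<Longrightarrow> fd_const A \<ge> 0"
  using C_nonneg D_nonneg by (simp add: fd_const_def)

lemma fd_periodize_le:
  assumes A: "\<bar>2 ^ j * h\<bar> \<le> A"
  shows "\<bar>fd h (2 * K) (periodize (\<psi> k) j m) y\<bar> \<le> 2 powr (real j / 2) * (fd_const A * \<bar>2 ^ j * h\<bar> ^ K * bump_const)"
proof -
  let ?F = "\<lambda>(l::int) y. 2 powr (real j / 2) * \<psi> k (2 ^ j * (y + of_int l) - real m)"
  have A0: "A \<ge> 0" using A by linarith
  have d4: "\<bar>\<psi> k x\<bar> * (1 + \<bar>x\<bar>) ^ 4 \<le> C" for x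
  proof -
    have "\<bar>\<psi> k x\<bar> * (1 + \<bar>x\<bar>) ^ 4 \<le> \<bar>\<psi> k x\<bar> * (1 + \<bar>x\<bar>) ^ (L + 4)"
      by (intro mult_left_mono power_increasing) auto
    then show ?thesis using decay[of k x] by linarith
  qed
  have F: "fd h (2 * K) (?F l) y = 2 powr (real j / 2) * fd (2 ^ j * h) (2 * K) (\<psi> k) (2 ^ j * (y + of_int l) - real m)" for l
  proof -
    have "?F l = (\<lambda>y. 2 powr (real j / 2) * (\<lambda>y. \<psi> k (2 ^ j * y + (2 ^ j * of_int l - real m))) y)"
      by (simp add: algebra_simps)
    then have "fd h (2 * K) (?F l) y = 2 powr (real j / 2) * fd (2 ^ j * h) (2 * K) (\<psi> k) (2 ^ j * y + (2 ^ j * of_int l - real m))"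
      by (simp only: fd_cmult fd_affine)
    then show ?thesis by (simp add: algebra_simps)
  qed
  let ?c = "2 powr (real j / 2) * (fd_const A * \<bar>2 ^ j * h\<bar> ^ K)"
  have bd: "\<bar>fd h (2 * K) (?F l) y\<bar> \<le> ?c * bump (2 ^ j * (y + of_int l) - real m)" for l
  proof -
    have "\<bar>fd (2 ^ j * h) (2 * K) (\<psi> k) (2 ^ j * (y + of_int l) - real m)\<bar> \<le> fd_const A * \<bar>2 ^ j * h\<bar> ^ K * bump (2 ^ j * (y + of_int l) - real m)"
      unfolding fd_const_def by (rule fd_interpolated[OF d4 differences A])
    from mult_left_mono[OF this, of "2 powr (real j / 2)"] show ?thesis unfolding F by (simp add: abs_mult mult_ac)
  qed
  have e1: "fd h (2 * K) (periodize (\<psi> k) j m) y = (\<Sum>\<^sub>\<infinity>l. fd h (2 * K) (?F l) y)"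
    unfolding periodize_def[abs_def] using fd_infsum[of ?F h "2 * K" y, OF dilate_summable] by simp
  have "norm (\<Sum>\<^sub>\<infinity>l. fd h (2 * K) (?F l) y) \<le> (\<Sum>\<^sub>\<infinity>l::int. ?c * bump (2 ^ j * (y + of_int l) - real m))"
    by (rule norm_infsum_le[OF has_sum_infsum[OF fd_infsum[of ?F h "2 * K" y, OF dilate_summable, THEN conjunct1]]
          has_sum_infsum[OF summable_on_cmult_right[OF bump_dilate_summable]]]) (use bd in simp)
  moreover have "(\<Sum>\<^sub>\<infinity>l::int. ?c * bump (2 ^ j * (y + of_int l) - real m)) =
      ?c * (\<Sum>\<^sub>\<infinity>l::int. bump (2 ^ j * (y + of_int l) - real m))"
    by (rule infsum_cmult_right[OF bump_dilate_summable])
  moreover have "?c * (\<Sum>\<^sub>\<infinity>l::int. bump (2 ^ j * (y + of_int l) - real m)) \<le> ?c * bump_const"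
    unfolding bump_dilate_infsum
    by (rule mult_left_mono[OF bump_infsum_le]) (use fd_const_nonneg[OF A0] in simp)
  ultimately have "norm (\<Sum>\<^sub>\<infinity>l. fd h (2 * K) (?F l) y) \<le> ?c * bump_const" by (simp only:)
  then show ?thesis unfolding e1 by (simp only: real_norm_def mult_ac)
qed

section \<open>Tensor-product wavelets\<close>

definition wavelet :: "nat \<Rightarrow> wavelet_kind ^ 'n::finite \<Rightarrow> nat ^ 'n \<Rightarrow> real ^ 'n \<Rightarrow> real" where
  "wavelet j G m x = (\<Prod>r\<in>UNIV. periodize (\<psi> (G $ r)) j (m $ r) (x $ r))"

lemma continuous_wavelet: "continuous_on UNIV (wavelet j G m)"
  unfolding wavelet_def[abs_def]
  by (intro continuous_on_prod continuous_on_compose2[OF continuous_periodize] continuous_intros) auto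

lemma periodic_wavelet: "periodic (wavelet j G m)"
  unfolding periodic_def wavelet_def
proof (intro allI prod.cong refl)
  fix x :: "real ^ 'a" and i r
  show "periodize (\<psi> (G $ r)) j (m $ r) ((x + axis i 1) $ r) = periodize (\<psi> (G $ r)) j (m $ r) (x $ r)"
    by (cases "r = i") (simp_all add: periodize_periodic axis_def)
qed

lemma abs_wavelet_le:
  fixes G :: "wavelet_kind ^ 'n::finite"
  shows "\<bar>wavelet j G m x\<bar> \<le> 2 powr (real j * real CARD('n) / 2) * (\<Prod>r\<in>UNIV. periodize_abs (\<psi> (G $ r)) j (m $ r) (x $ r))"
proof -
  have "\<bar>wavelet j G m x\<bar> \<le> (\<Prod>r\<in>(UNIV::'n set). 2 powr (real j / 2) * periodize_abs (\<psi> (G $ r)) j (m $ r) (x $ r))"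
    unfolding wavelet_def abs_prod by (intro prod_mono) (auto intro: abs_periodize_le)
  also have "\<dots> = (2 powr (real j / 2)) ^ CARD('n) * (\<Prod>r\<in>UNIV. periodize_abs (\<psi> (G $ r)) j (m $ r) (x $ r))"
    by (simp add: prod.distrib)
  also have "(2 powr (real j / 2)) ^ CARD('n) = 2 powr (real j * real CARD('n) / 2)"
    by (simp add: powr_power mult_ac)
  finally show ?thesis .
qed

text \<open>Differences along axis \<open>i\<close> act on the factor with index \<open>i\<close>
  only; the other factors are bounded.\<close>

lemma fd_wavelet_le:
  fixes G :: "wavelet_kind ^ 'n::finite"
  assumes A: "\<bar>2 ^ j * h\<bar> \<le> A"
  shows "\<bar>fd (h *\<^sub>R axis i 1) (2 * K) (wavelet j G m) x\<bar> \<le>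
    2 powr (real j * real CARD('n) / 2) * ((C * bump_const) ^ (CARD('n) - 1) * (fd_const A * bump_const)) * \<bar>2 ^ j * h\<bar> ^ K"
proof -
  let ?P = "\<lambda>x. \<Prod>r\<in>UNIV - {i}. periodize (\<psi> (G $ r)) j (m $ r) (x $ r)"
  let ?g = "periodize (\<psi> (G $ i)) j (m $ i)"
  have A0: "A \<ge> 0" using A by linarith
  have split: "wavelet j G m x = ?P x * ?g (x $ i)" for x
    unfolding wavelet_def by (subst prod.remove[of _ i]) (auto simp: mult.commute)
  have "fd (h *\<^sub>R axis i 1) M (wavelet j G m) x = ?P x * fd h M ?g (x $ i)" for M x
  proof (induction M arbitrary: x)
    case (Suc M)
    have "?P (x + h *\<^sub>R axis i 1) = ?P x" by (intro prod.cong) (auto simp: axis_def)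
    moreover have "(x + h *\<^sub>R axis i 1) $ i = x $ i + h" by (simp add: axis_def)
    ultimately show ?case by (simp only: fd.simps Suc right_diff_distrib)
  qed (simp add: split)
  then have eq: "\<bar>fd (h *\<^sub>R axis i 1) (2 * K) (wavelet j G m) x\<bar> = \<bar>?P x\<bar> * \<bar>fd h (2 * K) ?g (x $ i)\<bar>"
    by (simp only: abs_mult)
  have "\<bar>?P x\<bar> \<le> (\<Prod>r\<in>UNIV - {i}. 2 powr (real j / 2) * (C * bump_const))"
    unfolding abs_prod
  proof (intro prod_mono conjI)
    fix r
    show "\<bar>periodize (\<psi> (G $ r)) j (m $ r) (x $ r)\<bar> \<le> 2 powr (real j / 2) * (C * bump_const)"
      by (rule order_trans[OF abs_periodize_le]) (intro mult_left_mono periodize_abs_le, simp)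
  qed simp
  also have "\<dots> = (2 powr (real j / 2) * (C * bump_const)) ^ (CARD('n) - 1)" by (simp add: card_Diff_singleton)
  finally have P: "\<bar>?P x\<bar> \<le> (2 powr (real j / 2) * (C * bump_const)) ^ (CARD('n) - 1)" .
  have "\<bar>fd (h *\<^sub>R axis i 1) (2 * K) (wavelet j G m) x\<bar> \<le>
      (2 powr (real j / 2) * (C * bump_const)) ^ (CARD('n) - 1) * (2 powr (real j / 2) * (fd_const A * \<bar>2 ^ j * h\<bar> ^ K * bump_const))"
    unfolding eq using C_nonneg bump_const_nonneg
    by (intro mult_mono[OF P fd_periodize_le[OF A]] zero_le_power mult_nonneg_nonneg) simp_all
  also have "\<dots> = (2 powr (real j / 2)) ^ (CARD('n) - 1) * 2 powr (real j / 2) *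
      ((C * bump_const) ^ (CARD('n) - 1) * (fd_const A * bump_const)) * \<bar>2 ^ j * h\<bar> ^ K"
    by (simp add: power_mult_distrib mult_ac)
  also have "(2 powr (real j / 2)) ^ (CARD('n) - 1) * 2 powr (real j / 2) = (2 powr (real j / 2)) ^ CARD('n)"
    by (subst power_Suc2[symmetric]) simp
  also have "\<dots> = 2 powr (real j * real CARD('n) / 2)" by (simp add: powr_power mult_ac)
  finally show ?thesis .
qed

text \<open>The step \<open>1 / (2 * p $ i)\<close> along the largest component of \<open>p\<close>
  is of order \<open>2 powr (- k)\<close>, small against the width \<open>2 powr (- j)\<close> of
  the wavelet; each of the \<open>K\<close> usable differences gains the ratio of the two
  scales.\<close>

lemma pairing_wavelet_trig_le:
  shows "\<exists>B\<ge>0. \<forall>j k (G :: wavelet_kind ^ 'n::finite) m p a. j \<le> k \<longrightarrow> 1 \<le> k \<longrightarrow> 2 ^ (k - 1) \<le> norm (frequency p) \<longrightarrow>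
    \<bar>pairing (wavelet j G m) (trig p a)\<bar> \<le> B * 2 powr (real j * real CARD('n) / 2) * (2 ^ j / 2 ^ k) ^ K"
proof -
  define A where "A = 2 * pi * real CARD('n)"
  have A: "A > 0" by (simp add: A_def)
  define E where "E = (C * bump_const) ^ (CARD('n) - 1) * (fd_const A * bump_const)"
  have E0: "E \<ge> 0" unfolding E_def using C_nonneg bump_const_nonneg fd_const_nonneg A by (intro mult_nonneg_nonneg zero_le_power) auto
  show ?thesis
  proof (intro exI[of _ "E * A ^ K"] conjI allI impI)
    show "0 \<le> E * A ^ K" using E0 A by simp
    fix j k and G :: "wavelet_kind ^ 'n" and m p a
    assume jk: "j \<le> k" "1 \<le> k" and p: "2 ^ (k - 1) \<le> norm (frequency (p :: int ^ 'n))"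
    obtain i where i: "norm (frequency p) \<le> A * \<bar>of_int (p $ i)\<bar>"
      using max_coordinate[of p] unfolding A_def by blast
    have "0 < norm (frequency p)" using p by (rule less_le_trans[rotated]) simp
    then have pi: "p $ i \<noteq> 0" using i by auto
    let ?h = "1 / (2 * real_of_int (p $ i))"
    have ge: "2 ^ k \<le> A * (2 * \<bar>real_of_int (p $ i)\<bar>)"
    proof -
      have "(2::real) ^ k = 2 * 2 ^ (k - 1)" using jk by (simp flip: power_Suc)
      then show ?thesis using p i by simp
    qed
    have h: "\<bar>2 ^ j * ?h\<bar> \<le> A * (2 ^ j / 2 ^ k)"
    proof -
      have "\<bar>2 ^ j * ?h\<bar> = 2 ^ j * (1 / (2 * \<bar>real_of_int (p $ i)\<bar>))" by (simp add: abs_mult)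
      also have "1 / (2 * \<bar>real_of_int (p $ i)\<bar>) \<le> A / 2 ^ k"
        using ge pi by (simp add: divide_le_eq le_divide_eq mult_ac)
      finally show ?thesis by (simp add: mult_ac)
    qed
    have hA: "\<bar>2 ^ j * ?h\<bar> \<le> A"
    proof -
      have "(2::real) ^ j / 2 ^ k \<le> 1" using jk by (simp add: power_increasing)
      then have "A * (2 ^ j / 2 ^ k) \<le> A * 1" using A by (intro mult_left_mono) auto
      then show ?thesis using h by linarith
    qed
    have "\<bar>pairing (wavelet j G m) (trig p a)\<bar> \<le> (2 powr (real j * real CARD('n) / 2) * E * \<bar>2 ^ j * ?h\<bar> ^ K) / 2 ^ (2 * K)"
      by (rule abs_pairing_trig_le[OF continuous_wavelet periodic_wavelet pi])
        (use fd_wavelet_le[OF hA] in \<open>simp add: E_def\<close>)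
    also have "\<dots> \<le> (2 powr (real j * real CARD('n) / 2) * E * \<bar>2 ^ j * ?h\<bar> ^ K) / 1"
      using E0 by (intro divide_left_mono) auto
    also have "\<dots> \<le> 2 powr (real j * real CARD('n) / 2) * E * (A * (2 ^ j / 2 ^ k)) ^ K"
      using E0 h by (simp only: div_by_1) (intro mult_left_mono power_mono, auto)
    also have "\<dots> = E * A ^ K * 2 powr (real j * real CARD('n) / 2) * (2 ^ j / 2 ^ k) ^ K"
      by (simp only: power_mult_distrib mult_ac)
    finally show "\<bar>pairing (wavelet j G m) (trig p a)\<bar> \<le> E * A ^ K * 2 powr (real j * real CARD('n) / 2) * (2 ^ j / 2 ^ k) ^ K" .
  qed
qed

end

lemma wavelet_pair_exists:
  assumes "wavelet_like (L + 4) (2 * K) \<psi>F" "wavelet_like (L + 4) (2 * K) \<psi>M"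
  shows "\<exists>C D. wavelet_pair (\<lambda>k. case k of Scaling \<Rightarrow> \<psi>F | Wavelet \<Rightarrow> \<psi>M) L K C D"
proof -
  obtain C D where F: "continuous_on UNIV \<psi>F" "\<And>x. \<bar>\<psi>F x\<bar> * (1 + \<bar>x\<bar>) ^ (L + 4) \<le> C"
    "\<And>h x. \<bar>fd h (2 * K) \<psi>F x\<bar> \<le> D * \<bar>h\<bar> ^ (2 * K)"
    using assms(1) unfolding wavelet_like_def by blast
  obtain C' D' where M: "continuous_on UNIV \<psi>M" "\<And>x. \<bar>\<psi>M x\<bar> * (1 + \<bar>x\<bar>) ^ (L + 4) \<le> C'"
    "\<And>h x. \<bar>fd h (2 * K) \<psi>M x\<bar> \<le> D' * \<bar>h\<bar> ^ (2 * K)"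
    using assms(2) unfolding wavelet_like_def by blast
  have d: "D * \<bar>h\<bar> ^ (2 * K) \<le> max D D' * \<bar>h\<bar> ^ (2 * K)" "D' * \<bar>h\<bar> ^ (2 * K) \<le> max D D' * \<bar>h\<bar> ^ (2 * K)" for h
    by (rule mult_right_mono, simp, simp)+
  have "wavelet_pair (\<lambda>k. case k of Scaling \<Rightarrow> \<psi>F | Wavelet \<Rightarrow> \<psi>M) L K (max C C') (max D D')"
  proof
    fix k x h
    show "continuous_on UNIV (case k of Scaling \<Rightarrow> \<psi>F | Wavelet \<Rightarrow> \<psi>M)" using F(1) M(1) by (cases k) auto
    show "\<bar>(case k of Scaling \<Rightarrow> \<psi>F | Wavelet \<Rightarrow> \<psi>M) x\<bar> * (1 + \<bar>x\<bar>) ^ (L + 4) \<le> max C C'"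
      using F(2)[of x] M(2)[of x] by (cases k) (simp_all add: le_max_iff_disj)
    show "\<bar>fd h (2 * K) (case k of Scaling \<Rightarrow> \<psi>F | Wavelet \<Rightarrow> \<psi>M) x\<bar> \<le> max D D' * \<bar>h\<bar> ^ (2 * K)"
      using order_trans[OF F(3)[of h x] d(1)] order_trans[OF M(3)[of h x] d(2)] by (cases k) simp_all
  qed
  then show ?thesis by blast
qed

section \<open>Littlewood--Paley kernels\<close>

text \<open>The convolution kernel of the dyadic block: the block at \<open>x\<close> is obtained by
  applying the distribution to the kernel at \<open>x - y\<close> as a function of
  \<open>y\<close>.\<close>

definition kernel :: "(nat \<Rightarrow> real ^ 'n::finite \<Rightarrow> real) \<Rightarrow> nat \<Rightarrow> real ^ 'n \<Rightarrow> complex" where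
  "kernel \<theta> k z = (\<Sum>p | norm (frequency p) \<le> 2 ^ (k + 1). of_real (\<theta> k (frequency p)) * cis (frequency p \<bullet> z))"

lemma frequency_axis_inner: "frequency (axis i 1) \<bullet> z = 2 * pi * z $ i"
  by (simp add: frequency_def inner_vec_def axis_def if_distrib if_distribR cong: if_cong)

text \<open>Summation by parts: multiplication by \<open>cis (2 * pi * z $ i)\<close> shifts the
  coefficients by one lattice unit along axis \<open>i\<close>.\<close>

lemma cis_infsum_shift:
  fixes a :: "int ^ 'n::finite \<Rightarrow> real"
  assumes a: "finite {p. a p \<noteq> 0}"
  shows "(\<Sum>\<^sub>\<infinity>p. of_real (a p) * cis (frequency p \<bullet> z)) * (cis (2 * pi * z $ i) - 1) =
    (\<Sum>\<^sub>\<infinity>p. of_real (a (p + - axis i 1) - a p) * cis (frequency p \<bullet> z))"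
proof -
  let ?F = "\<lambda>p. of_real (a p) * cis (frequency p \<bullet> z)"
  have sF: "?F summable_on UNIV"
    by (rule finite_nonzero_values_imp_summable_on) (rule finite_subset[OF _ a], auto)
  have hF: "(?F has_sum (\<Sum>\<^sub>\<infinity>p. ?F p)) UNIV" by (rule has_sum_infsum[OF sF])
  have b: "bij (\<lambda>p::int ^ 'n. p + axis i 1)" by (rule bij_plus_right)
  have "((\<lambda>p. ?F p * cis (2 * pi * z $ i)) has_sum ((\<Sum>\<^sub>\<infinity>p. ?F p) * cis (2 * pi * z $ i))) UNIV"
    by (rule has_sum_cmult_left[OF hF])
  moreover have "?F p * cis (2 * pi * z $ i) = of_real (a ((p + axis i 1) + - axis i 1)) * cis (frequency (p + axis i 1) \<bullet> z)" for p
    by (simp add: frequency_add inner_add_left frequency_axis_inner cis_mult[symmetric])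
  ultimately have "((\<lambda>p. of_real (a (p + - axis i 1)) * cis (frequency p \<bullet> z)) has_sum ((\<Sum>\<^sub>\<infinity>p. ?F p) * cis (2 * pi * z $ i))) UNIV"
    using has_sum_reindex_bij_betw[OF b, of "\<lambda>p. of_real (a (p + - axis i 1)) * cis (frequency p \<bullet> z)"] by simp
  from has_sum_add[OF this has_sum_uminusI[OF hF]]
  have "((\<lambda>p. of_real (a (p + - axis i 1) - a p) * cis (frequency p \<bullet> z)) has_sum
      ((\<Sum>\<^sub>\<infinity>p. ?F p) * cis (2 * pi * z $ i) + - (\<Sum>\<^sub>\<infinity>p. ?F p))) UNIV"
    by (simp add: left_diff_distrib)
  from infsumI[OF this] show ?thesis by (simp add: right_diff_distrib)
qed

lemma fd_support:
  fixes a :: "int ^ 'n::finite \<Rightarrow> real"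
  assumes "\<And>p r. a p \<noteq> 0 \<Longrightarrow> \<bar>p $ r\<bar> \<le> N" "fd (- axis i 1) L a p \<noteq> 0"
  shows "\<bar>p $ r\<bar> \<le> N + int L"
  using assms(2)
proof (induction L arbitrary: p)
  case (Suc L)
  then have "fd (- axis i 1) L a (p + - axis i 1) \<noteq> 0 \<or> fd (- axis i 1) L a p \<noteq> 0" by auto
  then have "\<bar>(p + - axis i 1) $ r\<bar> \<le> N + int L \<or> \<bar>p $ r\<bar> \<le> N + int L" using Suc.IH by blast
  then show ?case by (auto simp: axis_def split: if_splits)
qed (use assms(1) in auto)

lemma finite_support_box:
  fixes a :: "int ^ 'n::finite \<Rightarrow> real"
  assumes "\<And>p r. a p \<noteq> 0 \<Longrightarrow> \<bar>p $ r\<bar> \<le> N"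
  shows "finite {p. a p \<noteq> 0}"
proof (rule finite_subset[OF _ finite_vec_set[of "{-N..N}"]])
  show "{p. a p \<noteq> 0} \<subseteq> {p. \<forall>r. p $ r \<in> {- N..N}}"
  proof clarify
    fix p :: "int ^ 'n" and r assume "a p \<noteq> 0"
    then have "\<bar>p $ r\<bar> \<le> N" by (rule assms)
    then show "p $ r \<in> {- N..N}" unfolding atLeastAtMost_iff by linarith
  qed
qed simp

lemma cis_infsum_fd:
  fixes a :: "int ^ 'n::finite \<Rightarrow> real"
  assumes a: "\<And>p r. a p \<noteq> 0 \<Longrightarrow> \<bar>p $ r\<bar> \<le> N"
  shows "(\<Sum>\<^sub>\<infinity>p. of_real (a p) * cis (frequency p \<bullet> z)) * (cis (2 * pi * z $ i) - 1) ^ L =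
    (\<Sum>\<^sub>\<infinity>p. of_real (fd (- axis i 1) L a p) * cis (frequency p \<bullet> z))"
proof (induction L)
  case (Suc L)
  have f: "finite {p. fd (- axis i 1) L a p \<noteq> 0}"
    by (rule finite_support_box[where N="N + int L"]) (rule fd_support[OF a])
  have "(\<Sum>\<^sub>\<infinity>p. of_real (a p) * cis (frequency p \<bullet> z)) * (cis (2 * pi * z $ i) - 1) ^ Suc L =
      (\<Sum>\<^sub>\<infinity>p. of_real (fd (- axis i 1) L a p) * cis (frequency p \<bullet> z)) * (cis (2 * pi * z $ i) - 1)"
    unfolding Suc[symmetric] by (simp only: power_Suc2 mult.assoc)
  also have "\<dots> = (\<Sum>\<^sub>\<infinity>p. of_real (fd (- axis i 1) (Suc L) a p) * cis (frequency p \<bullet> z))"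
    unfolding cis_infsum_shift[OF f] by simp
  finally show ?case .
qed simp

lemma norm_cis_infsum_le:
  fixes a :: "int ^ 'n::finite \<Rightarrow> real"
  assumes a: "\<And>p r. a p \<noteq> 0 \<Longrightarrow> \<bar>p $ r\<bar> \<le> N" and N: "N \<ge> 0" and B: "\<And>p. \<bar>a p\<bar> \<le> B"
  shows "norm (\<Sum>\<^sub>\<infinity>p. of_real (a p) * cis (frequency p \<bullet> z)) \<le> real_of_int (2 * N + 1) ^ CARD('n) * B"
proof -
  let ?S = "{p :: int ^ 'n. \<forall>r. p $ r \<in> {-N..N}}"
  have f: "finite ?S" by (rule finite_vec_set) simp
  have "(\<Sum>\<^sub>\<infinity>p. of_real (a p) * cis (frequency p \<bullet> z)) = (\<Sum>\<^sub>\<infinity>p\<in>?S. of_real (a p) * cis (frequency p \<bullet> z))"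
  proof (rule infsum_cong_neutral)
    fix p assume "p \<in> UNIV - ?S"
    then obtain r where "p $ r \<notin> {-N..N}" by auto
    then have "\<not> \<bar>p $ r\<bar> \<le> N" by (auto simp: abs_le_iff)
    then show "of_real (a p) * cis (frequency p \<bullet> z) = 0" using a[of p r] by auto
  qed auto
  also have "\<dots> = (\<Sum>p\<in>?S. of_real (a p) * cis (frequency p \<bullet> z))" by (rule infsum_finite[OF f])
  also have "norm \<dots> \<le> (\<Sum>p\<in>?S. B)"
    by (rule order_trans[OF norm_sum], rule sum_mono) (simp add: norm_mult B)
  also have "\<dots> = real (card ?S) * B" by simp
  also have "real (card ?S) = real_of_int (2 * N + 1) ^ CARD('n)"
  proof -
    have "card ?S = card {-N..N} ^ CARD('n)"
    proof -
      have "(\<Sum>p\<in>?S. \<Prod>r\<in>(UNIV::'n set). (1::nat)) = (\<Prod>r\<in>(UNIV::'n set). \<Sum>a\<in>{-N..N}. 1)"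
        using sum_vec_prod[of "{-N..N}" "\<lambda>(_ :: 'n) _. 1::nat"] by simp
      then show ?thesis by (simp only: prod.neutral_const sum_constant prod_constant of_nat_id mult_1_right)
    qed
    moreover have "real (card {-N..N}) = real_of_int (2 * N + 1)" using N by simp
    ultimately show ?thesis by (simp only: of_nat_power)
  qed
  finally show ?thesis .
qed

lemma kernel_eq_infsum:
  assumes "dyadic_resolution \<theta>"
  shows "kernel \<theta> k z = (\<Sum>\<^sub>\<infinity>p. of_real (\<theta> k (frequency p)) * cis (frequency p \<bullet> z))"
proof -
  have "(\<Sum>\<^sub>\<infinity>p. of_real (\<theta> k (frequency p)) * cis (frequency p \<bullet> z)) =
      (\<Sum>\<^sub>\<infinity>p\<in>{p. norm (frequency p) \<le> 2 ^ (k + 1)}. of_real (\<theta> k (frequency p)) * cis (frequency p \<bullet> z))"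
    by (rule infsum_cong_neutral) (use dyadic_resolution_support(1)[OF assms] in auto)
  then show ?thesis by (simp only: infsum_finite[OF finite_frequencies] kernel_def)
qed

text \<open>A unit step of the lattice is a step \<open>2 * pi\<close> in frequency, so derivative
  bounds on \<open>\<theta>\<close> apply to the lattice differences.\<close>

lemma fd_frequency:
  "fd (- axis i 1) L (\<lambda>p. f (frequency p)) p = fd ((- (2 * pi)) *\<^sub>R axis i 1) L f (frequency p)"
proof (induction L arbitrary: p)
  case (Suc L)
  have "frequency (p + - axis i 1) = frequency p + (- (2 * pi)) *\<^sub>R axis i 1"
    by (simp add: frequency_def vec_eq_iff axis_def algebra_simps)
  then show ?case by (simp only: fd.simps Suc)
qed simp

lemma dyadic_resolution_deriv_bound:
  fixes \<theta> :: "nat \<Rightarrow> real ^ 'n::finite \<Rightarrow> real"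
  assumes \<theta>: "dyadic_resolution \<theta>"
  shows "\<exists>c\<ge>0. \<forall>k z i. \<bar>iterated_deriv (replicate L (axis i 1)) (\<theta> k) z\<bar> \<le> c / 2 ^ (k * L)"
proof -
  have "\<exists>c. \<forall>k z. 2 ^ (k * length (replicate L (axis i 1 :: real ^ 'n))) * \<bar>iterated_deriv (replicate L (axis i 1)) (\<theta> k) z\<bar> \<le> c" for i
  proof -
    have "set (replicate L (axis i 1 :: real ^ 'n)) \<subseteq> Basis" by (cases L) (auto simp: axis_in_Basis_iff)
    then show ?thesis using \<theta> unfolding dyadic_resolution_def by blast
  qed
  then have "\<exists>c. \<forall>i k z. 2 ^ (k * L) * \<bar>iterated_deriv (replicate L (axis i 1 :: real ^ 'n)) (\<theta> k) z\<bar> \<le> c i"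
    unfolding length_replicate by (intro choice) blast
  then obtain c where c: "\<And>i k z. 2 ^ (k * L) * \<bar>iterated_deriv (replicate L (axis i 1 :: real ^ 'n)) (\<theta> k) z\<bar> \<le> c i" by blast
  show ?thesis
  proof (intro exI[of _ "\<Sum>i\<in>UNIV. \<bar>c i\<bar>"] conjI allI sum_nonneg)
    fix k z i
    have "2 ^ (k * L) * \<bar>iterated_deriv (replicate L (axis i 1 :: real ^ 'n)) (\<theta> k) z\<bar> \<le> \<bar>c i\<bar>" using c[of k i z] by linarith
    also have "\<dots> \<le> (\<Sum>i\<in>UNIV. \<bar>c i\<bar>)" by (rule member_le_sum) auto
    finally show "\<bar>iterated_deriv (replicate L (axis i 1)) (\<theta> k) z\<bar> \<le> (\<Sum>i\<in>UNIV. \<bar>c i\<bar>) / 2 ^ (k * L)"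
      by (simp add: pos_le_divide_eq mult.commute)
  qed simp
qed

text \<open>Each of the \<open>L\<close> differences of the cutoff gains
  \<open>2 powr (- k)\<close>, and about \<open>(2 ^ k) ^ CARD('n)\<close> frequencies
  contribute.\<close>

lemma kernel_times_power_le:
  fixes \<theta> :: "nat \<Rightarrow> real ^ 'n::finite \<Rightarrow> real"
  assumes \<theta>: "dyadic_resolution \<theta>"
  shows "\<exists>C\<ge>0. \<forall>k z i. norm (kernel \<theta> k z) * norm (cis (2 * pi * z $ i) - 1) ^ L \<le> C * (2 ^ k) ^ CARD('n) / (2 ^ k) ^ L"
proof -
  obtain c where c: "c \<ge> 0" "\<And>k z i. \<bar>iterated_deriv (replicate L (axis i 1)) (\<theta> k) z\<bar> \<le> c / 2 ^ (k * L)"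
    using dyadic_resolution_deriv_bound[OF \<theta>, of L] by blast
  \<comment> \<open>\<open>5 + 2 * L\<close> comes from
    \<open>2 * (2 ^ (k + 1) + L) + 1 \<le> (5 + 2 * L) * 2 ^ k\<close>, the side of the box of
    frequencies after \<open>L\<close> differences.\<close>
  let ?C = "real (5 + 2 * L) ^ CARD('n) * ((2 * pi) ^ L * c)"
  show ?thesis
  proof (intro exI[of _ ?C] conjI allI)
    show "0 \<le> ?C" using c(1) by simp
    fix k i and z :: "real ^ 'n"
    let ?a = "\<lambda>p. \<theta> k (frequency p)" and ?N = "2 ^ (k + 1) :: int"
    have sup: "\<bar>p $ r\<bar> \<le> ?N" if "?a p \<noteq> 0" for p r
    proof -
      have "\<bar>real_of_int (p $ r)\<bar> \<le> 2 ^ (k + 1)"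
        using abs_frequency_nth_le[of p r] dyadic_resolution_support(1)[OF \<theta> that] by linarith
      also have "(2::real) ^ (k + 1) = real_of_int ?N" by simp
      finally show ?thesis unfolding of_int_abs[symmetric] of_int_le_iff .
    qed
    have fdb: "\<bar>fd (- axis i 1) L ?a p\<bar> \<le> (2 * pi) ^ L * (c / 2 ^ (k * L))" for p
    proof -
      have "\<bar>fd ((- (2 * pi)) *\<^sub>R axis i 1) L (\<theta> k) (frequency p)\<bar> \<le> \<bar>- (2 * pi)\<bar> ^ L * (c / 2 ^ (k * L))"
        by (rule abs_fd_le_iterated_deriv[OF _ _ c(2)])
          (use \<theta> in \<open>auto simp: dyadic_resolution_def smooth_def axis_in_Basis_iff\<close>)
      then show ?thesis unfolding fd_frequency by simp
    qed
    have "norm (kernel \<theta> k z) * norm (cis (2 * pi * z $ i) - 1) ^ L = norm (kernel \<theta> k z * (cis (2 * pi * z $ i) - 1) ^ L)"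
      by (simp add: norm_mult norm_power)
    also have "kernel \<theta> k z * (cis (2 * pi * z $ i) - 1) ^ L = (\<Sum>\<^sub>\<infinity>p. of_real (fd (- axis i 1) L ?a p) * cis (frequency p \<bullet> z))"
      unfolding kernel_eq_infsum[OF \<theta>] by (rule cis_infsum_fd[OF sup])
    also have "norm \<dots> \<le> real_of_int (2 * (?N + int L) + 1) ^ CARD('n) * ((2 * pi) ^ L * (c / 2 ^ (k * L)))"
      by (rule norm_cis_infsum_le[OF fd_support[OF sup] _ fdb]) auto
    also have "\<dots> \<le> (real (5 + 2 * L) * 2 ^ k) ^ CARD('n) * ((2 * pi) ^ L * (c / 2 ^ (k * L)))"
    proof (intro mult_right_mono power_mono)
      have "(2 * real L + 1) * 1 \<le> (2 * real L + 1) * 2 ^ k" by (intro mult_left_mono) auto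
      then show "real_of_int (2 * (?N + int L) + 1) \<le> real (5 + 2 * L) * 2 ^ k" by (simp add: algebra_simps)
    qed (use c(1) in auto)
    also have "\<dots> = ?C * (2 ^ k) ^ CARD('n) / (2 ^ k) ^ L"
      by (simp add: power_mult_distrib power_mult)
    finally show "norm (kernel \<theta> k z) * norm (cis (2 * pi * z $ i) - 1) ^ L \<le> ?C * (2 ^ k) ^ CARD('n) / (2 ^ k) ^ L" .
  qed
qed

lemma sin_ge_quarter:
  fixes x :: real
  assumes "0 \<le> x" "x \<le> pi / 2"
  shows "x / 4 \<le> sin x"
proof (cases "x \<le> pi / 3")
  case True
  have "\<exists>z. z > 0 \<and> z < x \<and> sin x - sin 0 = (x - 0) * cos z" if "x > 0"
    by (rule MVT2[OF that]) (auto intro!: derivative_eq_intros)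
  moreover have c: "cos z \<ge> 1 / 2" if "0 < z" "z < x" for z
    using cos_monotone_0_pi_le[of z "pi / 3"] that True by (simp add: cos_60)
  ultimately have m: "\<exists>z. sin x = x * cos z \<and> 1 / 2 \<le> cos z" if "x > 0" using that by auto
  show ?thesis
  proof (cases "x = 0")
    case False
    then have "x > 0" using assms(1) by simp
    from m[OF this] obtain z where z: "sin x = x * cos z" "1 / 2 \<le> cos z" by blast
    have "x * (1 / 2) \<le> x * cos z" using z(2) assms(1) by (rule mult_left_mono)
    then show ?thesis using z(1) assms(1) by linarith
  qed simp
next
  case False
  have "sin (pi / 3) \<le> sin x" using False assms by (intro sin_monotone_2pi_le) auto
  moreover have "1 / 2 \<le> sqrt 3 / 2" by simp
  ultimately have "1 / 2 \<le> sin x" unfolding sin_60 by linarith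
  then show ?thesis using assms(2) pi_half_less_two by simp
qed

text \<open>The chord has length \<open>2 * \<bar>sin (pi * u)\<bar>\<close> with \<open>u\<close>
  the signed distance from \<open>t\<close> to a nearest integer; the linear bound for the sine and
  \<open>pi \<ge> 2\<close> give at least \<open>\<bar>u\<bar>\<close>.\<close>

lemma norm_cis_minus_one_ge:
  assumes "0 \<le> \<rho>" and r: "\<And>l::int. \<rho> \<le> \<bar>t + of_int l\<bar>"
  shows "\<rho> \<le> norm (cis (2 * pi * t) - 1)"
proof -
  define u where "u = t - of_int (round t)"
  have u: "\<bar>u\<bar> \<le> 1 / 2" "\<rho> \<le> \<bar>u\<bar>"
    using of_int_round_abs_le[of t] r[of "- round t"] by (auto simp: u_def abs_minus_commute)
  have "cis (2 * pi * t) = cis (2 * pi * u) * cis (2 * pi * of_int (round t))"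
    unfolding cis_mult by (simp add: u_def algebra_simps)
  also have "cis (2 * pi * of_int (round t)) = 1" by (rule cis_multiple_2pi) simp
  finally have "norm (cis (2 * pi * t) - 1) = norm (exp (\<i> * complex_of_real (2 * pi * u)) - 1)"
    by (simp add: cis_conv_exp)
  also have "\<dots> = 2 * \<bar>sin (2 * pi * u / 2)\<bar>" by (rule dist_exp_i_1)
  also have "\<bar>sin (2 * pi * u / 2)\<bar> = \<bar>sin (pi * \<bar>u\<bar>)\<bar>" by (cases "u \<ge> 0") auto
  finally have n: "norm (cis (2 * pi * t) - 1) = 2 * \<bar>sin (pi * \<bar>u\<bar>)\<bar>" .
  have "pi * \<bar>u\<bar> / 4 \<le> sin (pi * \<bar>u\<bar>)" using u by (intro sin_ge_quarter) auto
  moreover have "2 * \<bar>u\<bar> \<le> pi * \<bar>u\<bar>" using pi_ge_two by (intro mult_right_mono) auto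
  ultimately show ?thesis using u n by linarith
qed

text \<open>The summation by parts with 0 and with \<open>L\<close> differences: the size
  everywhere, and the decay away from the lattice.\<close>

lemma kernel_bound:
  fixes \<theta> :: "nat \<Rightarrow> real ^ 'n::finite \<Rightarrow> real"
  assumes \<theta>: "dyadic_resolution \<theta>"
  shows "\<exists>C\<ge>0. (\<forall>k z. norm (kernel \<theta> k z) \<le> C * (2 ^ k) ^ CARD('n)) \<and>
    (\<forall>k z \<rho> i. 0 < \<rho> \<longrightarrow> (\<forall>l::int. \<rho> \<le> \<bar>z $ i + of_int l\<bar>) \<longrightarrow> norm (kernel \<theta> k z) \<le> C * (2 ^ k) ^ CARD('n) / (2 ^ k * \<rho>) ^ L)"
proof -
  obtain C0 where C0: "C0 \<ge> 0" "\<And>k z i. norm (kernel \<theta> k z) * norm (cis (2 * pi * z $ i) - 1) ^ 0 \<le> C0 * (2 ^ k) ^ CARD('n) / (2 ^ k) ^ 0"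
    using kernel_times_power_le[OF \<theta>, of 0] by blast
  obtain C1 where C1: "C1 \<ge> 0" "\<And>k z i. norm (kernel \<theta> k z) * norm (cis (2 * pi * z $ i) - 1) ^ L \<le> C1 * (2 ^ k) ^ CARD('n) / (2 ^ k) ^ L"
    using kernel_times_power_le[OF \<theta>, of L] by blast
  show ?thesis
  proof (intro exI[of _ "C0 + C1"] conjI allI impI)
    show "0 \<le> C0 + C1" using C0 C1 by simp
    fix k and z :: "real ^ 'n"
    \<comment> \<open>With exponent 0 the coordinate is immaterial, so \<open>undefined\<close>
      serves.\<close>
    have "norm (kernel \<theta> k z) \<le> C0 * (2 ^ k) ^ CARD('n)" using C0(2)[of k z undefined] by simp
    also have "\<dots> \<le> (C0 + C1) * (2 ^ k) ^ CARD('n)" using C1(1) by (intro mult_right_mono) auto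
    finally show "norm (kernel \<theta> k z) \<le> (C0 + C1) * (2 ^ k) ^ CARD('n)" .
  next
    fix k i and z :: "real ^ 'n" and \<rho> :: real assume \<rho>: "0 < \<rho>" and far: "\<forall>l::int. \<rho> \<le> \<bar>z $ i + of_int l\<bar>"
    have "norm (kernel \<theta> k z) * \<rho> ^ L \<le> norm (kernel \<theta> k z) * norm (cis (2 * pi * z $ i) - 1) ^ L"
      using \<rho> far by (intro mult_left_mono power_mono norm_cis_minus_one_ge) auto
    also have "\<dots> \<le> C1 * (2 ^ k) ^ CARD('n) / (2 ^ k) ^ L" by (rule C1(2))
    also have "\<dots> \<le> (C0 + C1) * (2 ^ k) ^ CARD('n) / (2 ^ k) ^ L"
      using C0(1) by (intro divide_right_mono mult_right_mono) auto
    finally show "norm (kernel \<theta> k z) \<le> (C0 + C1) * (2 ^ k) ^ CARD('n) / (2 ^ k * \<rho>) ^ L"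
      using \<rho> by (simp add: power_mult_distrib pos_le_divide_eq mult_ac)
  qed
qed

section \<open>Dyadic blocks as values at test functions\<close>

text \<open>For \<open>b = 0\<close> and \<open>b = pi / 2\<close> the value of a distribution at
  this function is the real and the imaginary part of its dyadic block at \<open>x\<close>.\<close>

definition block_function :: "(nat \<Rightarrow> real ^ 'n::finite \<Rightarrow> real) \<Rightarrow> nat \<Rightarrow> real ^ 'n \<Rightarrow> real \<Rightarrow> real ^ 'n \<Rightarrow> real" where
  "block_function \<theta> k x b y = (\<Sum>p | norm (frequency p) \<le> 2 ^ (k + 1). \<theta> k (frequency p) * trig p (b - frequency p \<bullet> x) y)"

lemma block_function_test: "block_function \<theta> k x b \<in> test_functions"
  unfolding block_function_def[abs_def] by (rule test_functions_sum) (rule trig_test)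

lemma block_function_kernel:
  "block_function \<theta> k x 0 y = Re (kernel \<theta> k (x - y))" "block_function \<theta> k x (pi / 2) y = Im (kernel \<theta> k (x - y))"
proof -
  have a: "trig p (0 - frequency p \<bullet> x) y = cos (frequency p \<bullet> (x - y))" for p
    using cos_minus[of "frequency p \<bullet> y - frequency p \<bullet> x"] by (simp add: trig_def inner_diff_right)
  have b: "trig p (pi / 2 - frequency p \<bullet> x) y = sin (frequency p \<bullet> (x - y))" for p
  proof -
    have "frequency p \<bullet> y + (pi / 2 - frequency p \<bullet> x) = pi / 2 - frequency p \<bullet> (x - y)" by (simp add: inner_diff_right)
    then show ?thesis unfolding trig_def by (simp only: cos_diff) simp
  qed
  show "block_function \<theta> k x 0 y = Re (kernel \<theta> k (x - y))"
    unfolding block_function_def kernel_def a by (simp add: Re_sum)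
  show "block_function \<theta> k x (pi / 2) y = Im (kernel \<theta> k (x - y))"
    unfolding block_function_def kernel_def b by (simp add: Im_sum)
qed

lemma abs_block_function_le: "b \<in> {0, pi / 2} \<Longrightarrow> \<bar>block_function \<theta> k x b y\<bar> \<le> norm (kernel \<theta> k (x - y))"
  by (elim insertE emptyE; hypsubst) (simp_all only: block_function_kernel abs_Re_le_cmod abs_Im_le_cmod)

lemma norm_dyadic_block_le:
  assumes \<theta>: "dyadic_resolution \<theta>" and T: "T \<in> distributions"
  shows "cmod (dyadic_block \<theta> k T x) \<le> \<bar>T (block_function \<theta> k x 0)\<bar> + \<bar>T (block_function \<theta> k x (pi / 2))\<bar>"
proof -
  have tr: "T (trig p a) = cos a * T (trig p 0) - sin a * T (trig p (- pi / 2))" for p a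
  proof -
    have "trig p a = (\<lambda>x. cos a * trig p 0 x + (- sin a) * trig p (- pi / 2) x)" by (rule ext) (simp add: trig_expand[of p a])
    then have "T (trig p a) = T (\<lambda>x. cos a * trig p 0 x + (- sin a) * trig p (- pi / 2) x)" by (rule arg_cong)
    also have "\<dots> = cos a * T (trig p 0) + (- sin a) * T (trig p (- pi / 2))"
      by (rule distributions_linear[OF T trig_test trig_test])
    finally show ?thesis by simp
  qed
  have bl: "T (block_function \<theta> k x b) = (\<Sum>p | norm (frequency p) \<le> 2 ^ (k + 1). \<theta> k (frequency p) * T (trig p (b - frequency p \<bullet> x)))" for b
    unfolding block_function_def[abs_def] by (rule distributions_sum[OF T trig_test])
  have c: "fourier_coeff T p * cis (frequency p \<bullet> x) = Complex (T (trig p (0 - frequency p \<bullet> x))) (T (trig p (pi / 2 - frequency p \<bullet> x)))" for p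
    unfolding fourier_coeff_trig tr[of p "0 - frequency p \<bullet> x"] tr[of p "pi / 2 - frequency p \<bullet> x"]
    by (simp add: complex_eq_iff cos_diff sin_diff algebra_simps)
  have "dyadic_block \<theta> k T x = (\<Sum>p | norm (frequency p) \<le> 2 ^ (k + 1). complex_of_real (\<theta> k (frequency p)) *
      Complex (T (trig p (0 - frequency p \<bullet> x))) (T (trig p (pi / 2 - frequency p \<bullet> x))))"
    unfolding dyadic_block_eq_sum[OF \<theta>] mult.assoc c ..
  then have "Re (dyadic_block \<theta> k T x) = T (block_function \<theta> k x 0)" "Im (dyadic_block \<theta> k T x) = T (block_function \<theta> k x (pi / 2))"
    unfolding bl by (simp_all add: Re_sum Im_sum)
  then show ?thesis using cmod_le[of "dyadic_block \<theta> k T x"] by simp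
qed

text \<open>The near set is covered by \<open>3 ^ CARD('n)\<close> cubes of side
  \<open>2 * \<rho>\<close> around translates of \<open>x\<close>, hence of measure at most
  \<open>(6 * \<rho>) ^ CARD('n)\<close>; the far bound is integrated over mass 1.\<close>

lemma abs_integral_torus_near_far:
  fixes f :: "real ^ 'n::finite \<Rightarrow> real"
  assumes f: "continuous_on UNIV f" and x: "x \<in> unit_cube" and \<rho>: "0 \<le> \<rho>" "\<rho> < 1" and XY: "X \<ge> 0" "Y \<ge> 0"
    and near: "\<And>y. y \<in> unit_cube \<Longrightarrow> \<forall>r. \<exists>l::int. \<bar>(x - y) $ r + of_int l\<bar> \<le> \<rho> \<Longrightarrow> \<bar>f y\<bar> \<le> X"
    and far: "\<And>y i. y \<in> unit_cube \<Longrightarrow> \<forall>l::int. \<rho> \<le> \<bar>(x - y) $ i + of_int l\<bar> \<Longrightarrow> \<bar>f y\<bar> \<le> Y"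
  shows "\<bar>\<integral>y. f y \<partial>torus\<bar> \<le> X * (6 * \<rho>) ^ CARD('n) + Y"
proof -
  let ?Q = "{q :: int ^ 'n. \<forall>r. q $ r \<in> {-1, 0, 1}}"
  let ?v = "(\<chi> r. \<rho>) :: real ^ 'n"
  let ?b = "\<lambda>q. cbox (x + lattice_point q - ?v) (x + lattice_point q + ?v)"
  define N where "N = (\<Union>q\<in>?Q. ?b q)"
  have fQ: "finite ?Q" by (rule finite_vec_set) simp
  have cQ: "card ?Q = 3 ^ CARD('n)"
  proof -
    have "(\<Sum>p\<in>?Q. \<Prod>r\<in>(UNIV::'n set). (1::nat)) = (\<Prod>r\<in>(UNIV::'n set). \<Sum>a\<in>{-1, 0, 1::int}. 1)"
      using sum_vec_prod[of "{-1, 0, 1::int}" "\<lambda>(_ :: 'n) _. 1::nat"] by simp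
    moreover have "card {-1, 0, 1::int} = 3" by simp
    ultimately show ?thesis by (simp only: prod.neutral_const sum_constant prod_constant of_nat_id mult_1_right)
  qed
  have Nb: "N \<in> sets borel" unfolding N_def using fQ by (intro sets.finite_UN) auto
  have box: "emeasure lborel (?b q) = ennreal ((2 * \<rho>) ^ CARD('n))" for q
  proof -
    have v: "?v \<bullet> b = \<rho>" "(2 * ?v) \<bullet> b = 2 * \<rho>" if "b \<in> Basis" for b using that by (auto simp: Basis_vec_def inner_axis)
    have "emeasure lborel (?b q) = (\<Prod>b\<in>Basis. ((x + lattice_point q + ?v) - (x + lattice_point q - ?v)) \<bullet> b)"
      using \<rho> by (subst emeasure_lborel_cbox_eq) (auto simp: inner_add_left inner_diff_left v)
    also have "(\<Prod>b\<in>(Basis :: (real ^ 'n) set). ((x + lattice_point q + ?v) - (x + lattice_point q - ?v)) \<bullet> b) = (\<Prod>b\<in>(Basis :: (real ^ 'n) set). 2 * \<rho>)"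
      by (intro prod.cong refl) (simp add: inner_add_left inner_diff_left v)
    also have "\<dots> = (2 * \<rho>) ^ CARD('n)" by simp
    finally show ?thesis .
  qed
  have "emeasure lborel N \<le> (\<Sum>q\<in>?Q. emeasure lborel (?b q))"
    unfolding N_def by (rule emeasure_subadditive_finite[OF fQ]) auto
  also have "\<dots> = ennreal (real (3 ^ CARD('n))) * ennreal ((2 * \<rho>) ^ CARD('n))"
    by (simp only: box sum_constant cQ ennreal_of_nat_eq_real_of_nat)
  also have "\<dots> = ennreal (3 ^ CARD('n) * (2 * \<rho>) ^ CARD('n))"
    using \<rho> by (subst ennreal_mult[symmetric]) simp_all
  also have "3 ^ CARD('n) * (2 * \<rho>) ^ CARD('n) = (6 * \<rho>) ^ CARD('n)" unfolding power_mult_distrib[symmetric] by simp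
  finally have eN: "emeasure lborel N \<le> ennreal ((6 * \<rho>) ^ CARD('n))" .
  have Nt: "N \<inter> unit_cube \<in> sets torus" using Nb by (auto simp: sets_torus)
  have "emeasure torus (N \<inter> unit_cube) \<le> emeasure lborel N"
    unfolding emeasure_torus[OF Nt] by (rule emeasure_mono) (use Nb in auto)
  also note eN
  finally have mN: "measure torus (N \<inter> unit_cube) \<le> (6 * \<rho>) ^ CARD('n)"
    using \<rho> by (simp add: torus.emeasure_eq_measure)
  have pt: "\<bar>f y\<bar> \<le> X * indicator (N \<inter> unit_cube) y + Y" if y: "y \<in> unit_cube" for y
  proof (cases "\<forall>r. \<exists>l::int. \<bar>(x - y) $ r + of_int l\<bar> \<le> \<rho>")
    case True
    then have "\<exists>l. \<forall>r. \<bar>(x - y) $ r + of_int (l r)\<bar> \<le> \<rho>" by (intro choice) blast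
    then obtain l :: "'n \<Rightarrow> int" where l: "\<And>r. \<bar>(x - y) $ r + of_int (l r)\<bar> \<le> \<rho>" by blast
    \<comment> \<open>Coordinates in the cube differ by less than 1 and \<open>\<rho> < 1\<close>,
      so only neighbouring translates of \<open>x\<close> can be near \<open>y\<close>.\<close>
    have l1: "l r \<in> {-1, 0, 1}" for r
    proof -
      have "0 \<le> x $ r" "x $ r < 1" "0 \<le> y $ r" "y $ r < 1" using x y by (simp_all add: unit_cube_def)
      then have "\<bar>(x - y) $ r\<bar> < 1" unfolding vector_minus_component by linarith
      then have "\<bar>real_of_int (l r)\<bar> < 2" using l[of r] \<rho> by linarith
      then show ?thesis by auto
    qed
    have "y \<in> ?b (\<chi> r. l r)"
      unfolding mem_box_cart
    proof (intro allI conjI)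
      fix r
      have "\<bar>x $ r - y $ r + of_int (l r)\<bar> \<le> \<rho>" using l[of r] by simp
      then show "(x + lattice_point (\<chi> r. l r) - ?v) $ r \<le> y $ r" "y $ r \<le> (x + lattice_point (\<chi> r. l r) + ?v) $ r"
        by (auto simp: lattice_point_def abs_le_iff)
    qed
    moreover have "(\<chi> r. l r) \<in> ?Q" using l1 by simp
    ultimately have "y \<in> N" unfolding N_def by (rule UN_I[rotated])
    then have "y \<in> N \<inter> unit_cube" using y by simp
    then show ?thesis using near[OF y True] XY by simp
  next
    case False
    then obtain i where "\<forall>l::int. \<rho> \<le> \<bar>(x - y) $ i + of_int l\<bar>" using linear by (metis (no_types))
    then have "\<bar>f y\<bar> \<le> Y" by (rule far[OF y])
    then show ?thesis using XY by (simp add: add_increasing)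
  qed
  have i1: "integrable torus (\<lambda>y. X * indicator (N \<inter> unit_cube) y + Y)"
    using Nt by (intro Bochner_Integration.integrable_add integrable_mult_right integrable_real_indicator)
      (auto simp: torus.emeasure_eq_measure)
  have "\<bar>\<integral>y. f y \<partial>torus\<bar> \<le> (\<integral>y. \<bar>f y\<bar> \<partial>torus)" by (rule integral_abs_bound)
  also have "\<dots> \<le> (\<integral>y. X * indicator (N \<inter> unit_cube) y + Y \<partial>torus)"
    by (rule integral_mono[OF _ i1]) (use integrable_torus_continuous[OF f] pt in auto)
  also have "\<dots> = X * measure torus (N \<inter> unit_cube) + Y"
  proof -
    have "integrable torus (\<lambda>y. X * indicator (N \<inter> unit_cube) y)"
      using Nt by (intro integrable_mult_right integrable_real_indicator) (auto simp: torus.emeasure_eq_measure)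
    then have "(\<integral>y. X * indicator (N \<inter> unit_cube) y + Y \<partial>torus) = (\<integral>y. X * indicator (N \<inter> unit_cube) y \<partial>torus) + (\<integral>y. Y \<partial>(torus :: (real ^ 'n) measure))"
      by (rule Bochner_Integration.integral_add) simp
    moreover have "N \<inter> unit_cube \<inter> unit_cube = N \<inter> unit_cube" by blast
    ultimately show ?thesis using Nt by simp
  qed
  also have "\<dots> \<le> X * (6 * \<rho>) ^ CARD('n) + Y" using mN XY(1) by (intro add_mono mult_left_mono) auto
  finally show ?thesis .
qed

section \<open>Besov regularity of wavelet series\<close>

lemma card_frequencies_le:
  "real (card {p :: int ^ 'n::finite. norm (frequency p) \<le> 2 ^ (k + 1)}) \<le> (5 * 2 ^ k) ^ CARD('n)"
proof -
  let ?N = "2 ^ (k + 1) :: int"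
  let ?S = "{p :: int ^ 'n. \<forall>r. p $ r \<in> {-?N..?N}}"
  have "{p :: int ^ 'n. norm (frequency p) \<le> 2 ^ (k + 1)} \<subseteq> ?S"
  proof clarify
    fix p :: "int ^ 'n" and r assume "norm (frequency p) \<le> 2 ^ (k + 1)"
    then have "\<bar>real_of_int (p $ r)\<bar> \<le> 2 ^ (k + 1)" using abs_frequency_nth_le[of p r] by linarith
    also have "(2::real) ^ (k + 1) = real_of_int ?N" by simp
    finally have "\<bar>p $ r\<bar> \<le> ?N" unfolding of_int_abs[symmetric] of_int_le_iff .
    then show "p $ r \<in> {-?N..?N}" unfolding atLeastAtMost_iff by linarith
  qed
  then have "real (card {p :: int ^ 'n. norm (frequency p) \<le> 2 ^ (k + 1)}) \<le> real (card ?S)"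
    by (intro of_nat_mono card_mono finite_vec_set) auto
  also have "\<dots> = real (card {-?N..?N} ^ CARD('n))" by (simp only: card_vec_set finite_atLeastAtMost_int)
  also have "\<dots> = real (card {-?N..?N}) ^ CARD('n)" by (simp only: of_nat_power)
  also have "\<dots> \<le> (5 * 2 ^ k) ^ CARD('n)"
  proof (rule power_mono)
    have "real (card {-?N..?N}) = 4 * 2 ^ k + 1" by (simp add: nat_add_distrib nat_mult_distrib nat_power_eq)
    also have "\<dots> \<le> 4 * 2 ^ k + 2 ^ k" by simp
    finally show "real (card {-?N..?N}) \<le> 5 * 2 ^ k" by simp
  qed simp
  finally show ?thesis .
qed

lemma pairing_sum_left:
  assumes "\<And>i. i \<in> I \<Longrightarrow> continuous_on UNIV (f i)" "continuous_on UNIV h"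
  shows "pairing (\<lambda>x. \<Sum>i\<in>I. a i * f i x) h = (\<Sum>i\<in>I. a i * pairing (f i) h)"
  unfolding pairing_def sum_distrib_right
  by (subst Bochner_Integration.integral_sum)
    (auto simp: mult.assoc intro!: integrable_torus_continuous continuous_intros assms)

text \<open>Coordinatewise closeness \<open>d / n\<close> to a lattice translate gives distance at
  most \<open>d\<close> in the l1 norm, and periodicity removes the translation.\<close>

lemma near_lattice_translate:
  fixes s :: "real ^ 'n::finite \<Rightarrow> real"
  assumes s: "periodic s" and close: "\<And>x y. norm (x - y) \<le> d \<Longrightarrow> \<bar>s x - s y\<bar> \<le> e"
    and near: "\<forall>r. \<exists>l::int. \<bar>(x - y) $ r + of_int l\<bar> \<le> d / real CARD('n)"
  shows "\<bar>s x - s y\<bar> \<le> e"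
proof -
  have "\<exists>l. \<forall>r. \<bar>(x - y) $ r + of_int (l r)\<bar> \<le> d / real CARD('n)" using near by (intro choice)
  then obtain l :: "'n \<Rightarrow> int" where l: "\<And>r. \<bar>(x - y) $ r + of_int (l r)\<bar> \<le> d / real CARD('n)" by blast
  let ?x = "x + lattice_point (\<chi> r. l r)"
  have "norm (?x - y) \<le> (\<Sum>r\<in>UNIV. \<bar>(?x - y) $ r\<bar>)" by (rule norm_le_l1_cart)
  also have "\<dots> \<le> (\<Sum>r\<in>(UNIV::'n set). d / real CARD('n))"
    using l by (intro sum_mono) (simp add: lattice_point_def algebra_simps)
  also have "\<dots> = d" by simp
  finally have "\<bar>s ?x - s y\<bar> \<le> e" by (rule close)
  then show ?thesis by (simp only: periodic_lattice_point[OF s])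
qed

lemma two_powr_nat: "2 powr (real a * real b) = (2 ^ a) ^ b"
  by (simp add: powr_realpow[symmetric] powr_powr)

text \<open>A deterministic series with exponent \<open>s\<close>, meant for one realization of the
  prior with the shift of the exponent and the growth of the coefficients already absorbed in
  \<open>s\<close> and \<open>A\<close>. The summand \<open>n / 2\<close> in \<open>c_le\<close>
  cancels the normalization of the wavelets; \<open>L_large\<close> lets the wavelet tails beat both
  the size of the level and the number of positions.\<close>

locale wavelet_series = wavelet_pair \<psi> L K C D for \<psi> L K C D +
  fixes c :: "nat \<Rightarrow> wavelet_kind ^ 'n::finite \<Rightarrow> nat ^ 'n \<Rightarrow> real"
    and s :: "real ^ 'n \<Rightarrow> real" and A S e d :: real
  assumes s_periodic: "periodic s" and s_lower: "3 * e \<le> s x" and s_upper: "s x \<le> S"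
    and e_pos: "0 < e" and e_le: "e \<le> 1" and d_pos: "0 < d"
    and s_close: "norm (x - y) \<le> d \<Longrightarrow> \<bar>s x - s y\<bar> \<le> e"
    and L_large: "real CARD('n) + S \<le> real L" and A_nonneg: "0 \<le> A"
    and c_le: "G \<in> wavelet_types j \<Longrightarrow> m \<in> wavelet_positions j \<Longrightarrow>
      \<bar>c j G m\<bar> \<le> A * 2 powr (- real j * (s (\<chi> r. real (m $ r) / 2 ^ j) + real CARD('n) / 2))"
begin

definition level :: "nat \<Rightarrow> real ^ 'n \<Rightarrow> real" where
  "level j y = (\<Sum>G\<in>wavelet_types j. \<Sum>m\<in>wavelet_positions j. c j G m * wavelet j G m y)"

lemma continuous_level: "continuous_on UNIV (level j)"
  unfolding level_def[abs_def] by (intro continuous_intros continuous_wavelet)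

lemma pairing_level:
  assumes "continuous_on UNIV f"
  shows "pairing (level j) f = (\<Sum>G\<in>wavelet_types j. \<Sum>m\<in>wavelet_positions j. c j G m * pairing (wavelet j G m) f)"
proof -
  let ?I = "wavelet_types j \<times> wavelet_positions j :: ((wavelet_kind ^ 'n) \<times> (nat ^ 'n)) set"
  have "level j = (\<lambda>y. \<Sum>i\<in>?I. c j (fst i) (snd i) * wavelet j (fst i) (snd i) y)"
    by (rule ext) (simp add: level_def sum.cartesian_product split_beta)
  then have "pairing (level j) f = (\<Sum>i\<in>?I. c j (fst i) (snd i) * pairing (wavelet j (fst i) (snd i)) f)"
    by (simp only: pairing_sum_left[OF continuous_wavelet assms])
  then show ?thesis by (simp add: sum.cartesian_product split_beta)
qed

lemma sum_level_le:
  fixes f :: "wavelet_kind ^ 'n \<Rightarrow> nat ^ 'n \<Rightarrow> real"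
  assumes "0 \<le> b" "\<And>G m. G \<in> wavelet_types j \<Longrightarrow> m \<in> wavelet_positions j \<Longrightarrow> f G m \<le> b"
  shows "(\<Sum>G\<in>wavelet_types j. \<Sum>m\<in>(wavelet_positions j :: (nat ^ 'n) set). f G m) \<le>
    real CARD(wavelet_kind ^ 'n) * ((2 ^ j) ^ CARD('n) * b)"
proof -
  have "(\<Sum>G\<in>wavelet_types j. \<Sum>m\<in>(wavelet_positions j :: (nat ^ 'n) set). f G m) \<le>
      (\<Sum>G\<in>(wavelet_types j :: (wavelet_kind ^ 'n) set). \<Sum>m\<in>(wavelet_positions j :: (nat ^ 'n) set). b)"
    by (rule sum_mono, rule sum_mono, rule assms(2))
  also have "\<dots> = real (card (wavelet_types j :: (wavelet_kind ^ 'n) set)) * ((2 ^ j) ^ CARD('n) * b)"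
    by (simp add: card_wavelet_positions power_mult)
  also have "\<dots> \<le> real CARD(wavelet_kind ^ 'n) * ((2 ^ j) ^ CARD('n) * b)"
    using assms(1) by (intro mult_right_mono of_nat_mono card_mono) auto
  finally show ?thesis .
qed

lemma exponents_combine:
  "\<bar>c j G m\<bar> * 2 powr (real j * real CARD('n) / 2) \<le> A * 2 powr (- real j * s (\<chi> r. real (m $ r) / 2 ^ j))"
  if "G \<in> wavelet_types j" "m \<in> wavelet_positions j"
proof -
  have "\<bar>c j G m\<bar> * 2 powr (real j * real CARD('n) / 2) \<le>
      A * 2 powr (- real j * (s (\<chi> r. real (m $ r) / 2 ^ j) + real CARD('n) / 2)) * 2 powr (real j * real CARD('n) / 2)"
    by (intro mult_right_mono c_le that) simp
  also have "\<dots> = A * 2 powr (- real j * s (\<chi> r. real (m $ r) / 2 ^ j))"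
    unfolding mult.assoc powr_add[symmetric] by (simp add: algebra_simps)
  finally show ?thesis .
qed

text \<open>Near the position of the wavelet the exponent differs from \<open>s y\<close> by at most
  \<open>e\<close>. Otherwise one factor is far from its centre, and its decay of order
  \<open>L\<close> makes up for the missing comparison of exponents.\<close>

lemma level_term_le:
  fixes y :: "real ^ 'n"
  assumes Gm: "G \<in> wavelet_types j" "m \<in> wavelet_positions j"
  shows "\<bar>c j G m * wavelet j G m y\<bar> \<le> A * 2 powr (- real j * (s y - e)) *
    ((\<Prod>r\<in>UNIV. periodize_abs (\<psi> (G $ r)) j (m $ r) (y $ r)) +
     (C * bump_const) ^ CARD('n) / (d / real CARD('n)) ^ L * (1 / (2 ^ j) ^ CARD('n)))"
proof -
  let ?n = "real CARD('n)" and ?P = "\<Prod>r\<in>UNIV. periodize_abs (\<psi> (G $ r)) j (m $ r) (y $ r)"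
  let ?z = "\<chi> r. real (m $ r) / 2 ^ j :: real ^ 'n"
  let ?E = "(C * bump_const) ^ CARD('n) / (d / ?n) ^ L * (1 / (2 ^ j) ^ CARD('n))"
  have n: "?n > 0" by simp
  have P0: "?P \<ge> 0" by (intro prod_nonneg) (simp add: periodize_abs_nonneg)
  have Cb: "0 \<le> C * bump_const" using C_nonneg bump_const_nonneg by simp
  have E0: "?E \<ge> 0" using C_nonneg bump_const_nonneg d_pos n by (intro mult_nonneg_nonneg divide_nonneg_nonneg zero_le_power) auto
  have "\<bar>c j G m * wavelet j G m y\<bar> \<le> \<bar>c j G m\<bar> * (2 powr (real j * ?n / 2) * ?P)"
    unfolding abs_mult by (intro mult_left_mono abs_wavelet_le) simp
  also have "\<dots> = (\<bar>c j G m\<bar> * 2 powr (real j * ?n / 2)) * ?P" by simp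
  also have "\<dots> \<le> (A * 2 powr (- real j * s ?z)) * ?P"
    by (intro mult_right_mono exponents_combine Gm P0)
  also have "\<dots> \<le> A * 2 powr (- real j * (s y - e)) * (?P + ?E)"
  proof (cases "\<forall>r. \<exists>l::int. \<bar>(y - ?z) $ r + of_int l\<bar> \<le> d / ?n")
    case True
    have "\<bar>s y - s ?z\<bar> \<le> e" by (rule near_lattice_translate[OF s_periodic s_close True])
    then have "real j * (s y - e) \<le> real j * s ?z" by (intro mult_left_mono) auto
    then have "2 powr (- real j * s ?z) \<le> 2 powr (- real j * (s y - e))" by simp
    then show ?thesis using A_nonneg P0 E0 by (intro mult_mono mult_left_mono) auto
  next
    case False
    then obtain r where r: "\<forall>l::int. d / ?n \<le> \<bar>(y - ?z) $ r + of_int l\<bar>" using linear by (metis (no_types))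
    have far: "2 ^ j * (d / ?n) \<le> \<bar>2 ^ j * (y $ r + of_int l) - real (m $ r)\<bar>" for l :: int
    proof -
      have "2 ^ j * (d / ?n) \<le> 2 ^ j * \<bar>(y - ?z) $ r + of_int l\<bar>" using r by (intro mult_left_mono) auto
      also have "\<dots> = \<bar>2 ^ j * ((y - ?z) $ r + of_int l)\<bar>" by (simp add: abs_mult)
      also have "2 ^ j * ((y - ?z) $ r + of_int l) = 2 ^ j * (y $ r + of_int l) - real (m $ r)" by (simp add: field_simps)
      finally show ?thesis .
    qed
    have "periodize_abs (\<psi> (G $ r)) j (m $ r) (y $ r) \<le> C / (1 + 2 ^ j * (d / ?n)) ^ L * bump_const"
      using d_pos by (intro periodize_abs_far_le far) simp
    also have "\<dots> \<le> C / (2 ^ j * (d / ?n)) ^ L * bump_const"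
      using d_pos C_nonneg bump_const_nonneg by (intro mult_right_mono divide_left_mono power_mono mult_pos_pos zero_less_power) (auto intro: add_pos_pos)
    finally have far': "periodize_abs (\<psi> (G $ r)) j (m $ r) (y $ r) \<le> C * bump_const / (2 ^ j * (d / ?n)) ^ L" by simp
    have "?P = periodize_abs (\<psi> (G $ r)) j (m $ r) (y $ r) * (\<Prod>i\<in>UNIV - {r}. periodize_abs (\<psi> (G $ i)) j (m $ i) (y $ i))"
      by (rule prod.remove) auto
    also have "\<dots> \<le> C * bump_const / (2 ^ j * (d / ?n)) ^ L * (\<Prod>i\<in>UNIV - {r}. C * bump_const)"
      using far' Cb d_pos by (intro mult_mono prod_mono conjI periodize_abs_le periodize_abs_nonneg prod_nonneg) auto
    also have "\<dots> = (C * bump_const) ^ Suc (CARD('n) - 1) / (2 ^ j * (d / ?n)) ^ L"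
    proof -
      have "card (UNIV - {r}) = CARD('n) - 1" by (simp add: card_Diff_singleton)
      then show ?thesis by (simp only: prod_constant power_Suc times_divide_eq_left)
    qed
    also have "Suc (CARD('n) - 1) = CARD('n)" by simp
    also have "(C * bump_const) ^ CARD('n) / (2 ^ j * (d / ?n)) ^ L = (C * bump_const) ^ CARD('n) / (d / ?n) ^ L * (1 / (2 ^ j) ^ L)"
      unfolding power_mult_distrib by simp
    finally have P1: "?P \<le> (C * bump_const) ^ CARD('n) / (d / ?n) ^ L * (1 / (2 ^ j) ^ L)" .
    \<comment> \<open>By \<open>L_large\<close> the decay leaves a spare
      \<open>1 / (2 ^ j) ^ CARD('n)\<close>, which cancels the number of positions on
      summation.\<close>
    have q: "1 / (2 ^ j) ^ L \<le> 2 powr (- real j * (s y - e)) * (1 / (2 ^ j) ^ CARD('n))"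
    proof -
      have "1 / (2 ^ j) ^ L = 2 powr (- (real j * real L))" unfolding powr_minus two_powr_nat by (simp add: field_simps)
      also have "\<dots> \<le> 2 powr (- real j * (s y - e) + - (real j * ?n))"
      proof -
        have "real j * (s y - e + ?n) \<le> real j * real L" using s_upper[of y] e_pos L_large by (intro mult_left_mono) auto
        then show ?thesis by (simp add: algebra_simps)
      qed
      also have "\<dots> = 2 powr (- real j * (s y - e)) * (1 / (2 ^ j) ^ CARD('n))"
        unfolding powr_add powr_minus two_powr_nat by (simp add: field_simps)
      finally show ?thesis .
    qed
    have "?P \<le> (C * bump_const) ^ CARD('n) / (d / ?n) ^ L * (2 powr (- real j * (s y - e)) * (1 / (2 ^ j) ^ CARD('n)))"
      using Cb d_pos by (intro order_trans[OF P1] mult_left_mono q) auto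
    also have "\<dots> = 2 powr (- real j * (s y - e)) * ?E" by simp
    finally have P2: "?P \<le> 2 powr (- real j * (s y - e)) * ?E" .
    have "2 powr (- real j * s ?z) \<le> 2 powr 0"
      using s_lower[of ?z] e_pos by (intro powr_mono) (auto intro!: mult_nonneg_nonneg)
    then have "(A * 2 powr (- real j * s ?z)) * ?P \<le> (A * 1) * ?P"
      using A_nonneg P0 by (intro mult_right_mono mult_left_mono) auto
    also have "\<dots> \<le> A * (2 powr (- real j * (s y - e)) * ?E)" unfolding mult_1_right by (rule mult_left_mono[OF P2 A_nonneg])
    also have "\<dots> \<le> A * 2 powr (- real j * (s y - e)) * (?P + ?E)"
      using A_nonneg P0 unfolding mult.assoc by (intro mult_left_mono) auto
    finally show ?thesis .
  qed
  finally show ?thesis .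
qed

text \<open>The sum over positions of the tensor profiles factors into one-dimensional sums bounded
  uniformly in \<open>j\<close>; the far terms add up to a constant.\<close>

lemma abs_level_le: "\<exists>B\<ge>0. \<forall>j y. \<bar>level j y\<bar> \<le> B * 2 powr (- real j * (s y - e))"
proof -
  let ?E = "(C * bump_const) ^ CARD('n) / (d / real CARD('n)) ^ L"
  let ?W = "real CARD(wavelet_kind ^ 'n)"
  let ?B = "?W * (A * ((C * bump_const) ^ CARD('n) + ?E))"
  have Cb: "0 \<le> C * bump_const" using C_nonneg bump_const_nonneg by simp
  have E0: "?E \<ge> 0" using Cb d_pos by (intro divide_nonneg_nonneg zero_le_power) auto
  have AE: "0 \<le> A * ((C * bump_const) ^ CARD('n) + ?E)" using C_nonneg bump_const_nonneg E0 A_nonneg by (intro mult_nonneg_nonneg add_nonneg_nonneg zero_le_power) auto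
  show ?thesis
  proof (intro exI[of _ ?B] conjI allI)
    show "0 \<le> ?B" using AE by simp
    fix j and y :: "real ^ 'n"
    let ?p = "2 powr (- real j * (s y - e))"
    have m: "(\<Sum>m\<in>wavelet_positions j. \<bar>c j G m * wavelet j G m y\<bar>) \<le> A * ((C * bump_const) ^ CARD('n) + ?E) * ?p"
      if G: "G \<in> wavelet_types j" for G
    proof -
      have "(\<Sum>m\<in>wavelet_positions j. \<bar>c j G m * wavelet j G m y\<bar>) \<le> (\<Sum>m\<in>wavelet_positions j. A * ?p *
          ((\<Prod>r\<in>UNIV. periodize_abs (\<psi> (G $ r)) j (m $ r) (y $ r)) + ?E * (1 / (2 ^ j) ^ CARD('n))))"
        by (intro sum_mono level_term_le G)
      also have "\<dots> = A * ?p * ((\<Sum>m\<in>wavelet_positions j. \<Prod>r\<in>UNIV. periodize_abs (\<psi> (G $ r)) j (m $ r) (y $ r)) +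
          real (card (wavelet_positions j :: (nat ^ 'n) set)) * (?E * (1 / (2 ^ j) ^ CARD('n))))"
        by (simp only: sum_distrib_left[symmetric] sum.distrib sum_constant) (simp only: mult_ac)
      also have "real (card (wavelet_positions j :: (nat ^ 'n) set)) * (?E * (1 / (2 ^ j) ^ CARD('n))) = ?E"
        by (simp add: card_wavelet_positions power_mult)
      also have "(\<Sum>m\<in>wavelet_positions j. \<Prod>r\<in>UNIV. periodize_abs (\<psi> (G $ r)) j (m $ r) (y $ r)) =
          (\<Prod>r\<in>UNIV. \<Sum>a<2 ^ j. periodize_abs (\<psi> (G $ r)) j a (y $ r))"
        using sum_vec_prod[of "{..<2 ^ j :: nat}" "\<lambda>r a. periodize_abs (\<psi> (G $ r)) j a (y $ r)"]
        by (simp add: wavelet_positions_def)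
      also have "A * ?p * (\<dots> + ?E) \<le> A * ?p * ((C * bump_const) ^ CARD('n) + ?E)"
      proof -
        have "(\<Prod>r\<in>UNIV. \<Sum>a<2 ^ j. periodize_abs (\<psi> (G $ r)) j a (y $ r)) \<le> (\<Prod>r\<in>(UNIV::'n set). C * bump_const)"
          by (intro prod_mono conjI sum_nonneg periodize_abs_nonneg periodize_abs_sum_le)
        then show ?thesis using A_nonneg by (intro mult_left_mono add_right_mono) auto
      qed
      finally show ?thesis by (simp only: mult_ac)
    qed
    have "\<bar>level j y\<bar> \<le> (\<Sum>G\<in>wavelet_types j. \<Sum>m\<in>wavelet_positions j. \<bar>c j G m * wavelet j G m y\<bar>)"
      unfolding level_def by (rule order_trans[OF sum_abs sum_mono]) (rule sum_abs)
    also have "\<dots> \<le> (\<Sum>G\<in>(wavelet_types j :: (wavelet_kind ^ 'n) set). A * ((C * bump_const) ^ CARD('n) + ?E) * ?p)"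
      by (intro sum_mono m)
    also have "\<dots> = real (card (wavelet_types j :: (wavelet_kind ^ 'n) set)) * (A * ((C * bump_const) ^ CARD('n) + ?E) * ?p)" by simp
    also have "\<dots> \<le> ?W * (A * ((C * bump_const) ^ CARD('n) + ?E) * ?p)"
      using AE by (intro mult_right_mono of_nat_mono card_mono mult_nonneg_nonneg[OF AE]) auto
    finally show "\<bar>level j y\<bar> \<le> ?B * ?p" by (simp only: mult.assoc)
  qed
qed

text \<open>The triangle inequality over all positions and frequencies costs the two powers with
  exponent \<open>CARD('n)\<close>; the gain is one scale ratio per usable difference.\<close>

lemma pairing_level_low:
  assumes \<theta>: "dyadic_resolution \<theta>"
  shows "\<exists>B\<ge>0. \<forall>j k x b. j \<le> k \<longrightarrow> 1 \<le> k \<longrightarrow>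
    \<bar>pairing (level j) (block_function \<theta> k x b)\<bar> \<le> B * ((2 ^ j) ^ CARD('n) * (2 ^ k) ^ CARD('n) * (2 ^ j / 2 ^ k) ^ K)"
proof -
  obtain B where B: "B \<ge> 0" "\<And>j k (G :: wavelet_kind ^ 'n) m p a. j \<le> k \<Longrightarrow> 1 \<le> k \<Longrightarrow> 2 ^ (k - 1) \<le> norm (frequency p) \<Longrightarrow>
      \<bar>pairing (wavelet j G m) (trig p a)\<bar> \<le> B * 2 powr (real j * real CARD('n) / 2) * (2 ^ j / 2 ^ k) ^ K"
    using pairing_wavelet_trig_le by blast
  obtain b0 where "b0 \<ge> 0" "\<And>k z (i::'n). \<bar>iterated_deriv (replicate 0 (axis i 1)) (\<theta> k) z\<bar> \<le> b0 / 2 ^ (k * 0)"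
    using dyadic_resolution_deriv_bound[OF \<theta>, of 0] by blast
  then have b0: "b0 \<ge> 0" "\<And>k z. \<bar>\<theta> k z\<bar> \<le> b0" by auto
  let ?W = "real CARD(wavelet_kind ^ 'n)"
  let ?B = "?W * (A * (5 ^ CARD('n) * (b0 * B)))"
  show ?thesis
  proof (intro exI[of _ ?B] conjI allI impI)
    show "0 \<le> ?B" using A_nonneg b0 B by simp
    fix j k :: nat and b and x :: "real ^ 'n" assume jk: "j \<le> k" "1 \<le> k"
    let ?h = "2 powr (real j * real CARD('n) / 2)" and ?r = "(2 ^ j / 2 ^ k) ^ K :: real"
    let ?F = "{p :: int ^ 'n. norm (frequency p) \<le> 2 ^ (k + 1)}"
    have w: "\<bar>pairing (wavelet j G m) (block_function \<theta> k x b)\<bar> \<le> (5 * 2 ^ k) ^ CARD('n) * (b0 * (B * ?h * ?r))" for G :: "wavelet_kind ^ 'n" and m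
    proof -
      have "pairing (wavelet j G m) (block_function \<theta> k x b) =
          (\<Sum>p\<in>?F. \<theta> k (frequency p) * pairing (trig p (b - frequency p \<bullet> x)) (wavelet j G m))"
        unfolding pairing_commute[of "wavelet j G m"] block_function_def[abs_def]
        by (rule pairing_sum_left[OF test_continuous[OF trig_test] continuous_wavelet])
      also have "\<bar>\<dots>\<bar> \<le> (\<Sum>p\<in>?F. b0 * (B * ?h * ?r))"
      proof (rule order_trans[OF sum_abs sum_mono])
        fix p assume "p \<in> ?F"
        show "\<bar>\<theta> k (frequency p) * pairing (trig p (b - frequency p \<bullet> x)) (wavelet j G m)\<bar> \<le> b0 * (B * ?h * ?r)"
        proof (cases "\<theta> k (frequency p) = 0")
          case True
          then show ?thesis using b0 B by simp
        next
          case False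
          then have "\<bar>pairing (wavelet j G m) (trig p (b - frequency p \<bullet> x))\<bar> \<le> B * ?h * ?r"
            by (intro B(2) jk dyadic_resolution_support(2)[OF \<theta>])
          then show ?thesis unfolding abs_mult pairing_commute[of "trig p _"] using b0 by (intro mult_mono) auto
        qed
      qed
      also have "\<dots> = real (card ?F) * (b0 * (B * ?h * ?r))" by simp
      also have "\<dots> \<le> (5 * 2 ^ k) ^ CARD('n) * (b0 * (B * ?h * ?r))"
        using card_frequencies_le b0 B by (intro mult_right_mono) auto
      finally show ?thesis .
    qed
    have t: "\<bar>c j G m * pairing (wavelet j G m) (block_function \<theta> k x b)\<bar> \<le> A * ((5 * 2 ^ k) ^ CARD('n) * (b0 * (B * ?r)))"
      if Gm: "G \<in> wavelet_types j" "m \<in> wavelet_positions j" for G m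
    proof -
      have "\<bar>c j G m * pairing (wavelet j G m) (block_function \<theta> k x b)\<bar> \<le> \<bar>c j G m\<bar> * ((5 * 2 ^ k) ^ CARD('n) * (b0 * (B * ?h * ?r)))"
        unfolding abs_mult by (intro mult_left_mono w) simp
      also have "\<dots> = (\<bar>c j G m\<bar> * ?h) * ((5 * 2 ^ k) ^ CARD('n) * (b0 * (B * ?r)))" by (simp only: mult_ac)
      also have "\<dots> \<le> A * ((5 * 2 ^ k) ^ CARD('n) * (b0 * (B * ?r)))"
      proof (rule mult_right_mono)
        let ?z = "\<chi> r. real (m $ r) / 2 ^ j :: real ^ 'n"
        have "2 powr (- real j * s ?z) \<le> 2 powr 0"
          using s_lower[of ?z] e_pos by (intro powr_mono) (auto intro!: mult_nonneg_nonneg)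
        then have "A * 2 powr (- real j * s ?z) \<le> A * 1" using A_nonneg by (intro mult_left_mono) auto
        with exponents_combine[OF Gm] show "\<bar>c j G m\<bar> * ?h \<le> A" by simp
      qed (use b0 B in simp)
      finally show ?thesis .
    qed
    have "\<bar>pairing (level j) (block_function \<theta> k x b)\<bar> \<le>
        (\<Sum>G\<in>wavelet_types j. \<Sum>m\<in>wavelet_positions j. \<bar>c j G m * pairing (wavelet j G m) (block_function \<theta> k x b)\<bar>)"
      unfolding pairing_level[OF test_continuous[OF block_function_test]]
      by (rule order_trans[OF sum_abs sum_mono]) (rule sum_abs)
    also have "\<dots> \<le> ?W * ((2 ^ j) ^ CARD('n) * (A * ((5 * 2 ^ k) ^ CARD('n) * (b0 * (B * ?r)))))"
      using A_nonneg b0 B by (intro sum_level_le t) auto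
    also have "\<dots> = ?B * ((2 ^ j) ^ CARD('n) * (2 ^ k) ^ CARD('n) * ?r)"
      unfolding power_mult_distrib[of 5] by (simp only: mult_ac)
    finally show "\<bar>pairing (level j) (block_function \<theta> k x b)\<bar> \<le> ?B * ((2 ^ j) ^ CARD('n) * (2 ^ k) ^ CARD('n) * ?r)" .
  qed
qed


text \<open>At levels \<open>j \<le> (1 - \<kappa>) * k\<close> the scale ratio is at most
  \<open>2 powr (- \<kappa> * k)\<close>, so a large \<open>K\<close> beats the counting
  factors.\<close>

lemma two_powr_kappa:
  assumes "0 \<le> \<kappa>" "real j \<le> (1 - \<kappa>) * real k"
  shows "(2 ^ j) ^ CARD('n) * (2 ^ k) ^ CARD('n) * (2 ^ j / 2 ^ k) ^ K \<le> 2 powr (real k * (2 * real CARD('n) - \<kappa> * real K))"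
proof -
  have "2 ^ j / (2::real) ^ k = 2 powr (real j - real k)" by (simp add: powr_diff powr_realpow)
  then have "(2 ^ j / (2::real) ^ k) ^ K = 2 powr ((real j - real k) * real K)" by (simp add: powr_realpow[symmetric] powr_powr)
  then have "(2 ^ j) ^ CARD('n) * (2 ^ k) ^ CARD('n) * (2 ^ j / 2 ^ k) ^ K =
      2 powr (real j * real CARD('n) + real k * real CARD('n) + (real j - real k) * real K)"
    by (simp only: powr_add two_powr_nat)
  also have "\<dots> \<le> 2 powr (real k * (2 * real CARD('n) - \<kappa> * real K))"
  proof (rule powr_mono)
    have 1: "real j - real k \<le> - (\<kappa> * real k)" using assms(2) by (simp add: algebra_simps)
    moreover have "0 \<le> \<kappa> * real k" using assms(1) by simp
    ultimately have "real j \<le> real k" by linarith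
    then have "real j * real CARD('n) \<le> real k * real CARD('n)" by (rule mult_right_mono) simp
    moreover have "(real j - real k) * real K \<le> - (\<kappa> * real k) * real K" using 1 by (rule mult_right_mono) simp
    moreover have "real k * (2 * real CARD('n) - \<kappa> * real K) = real k * real CARD('n) + real k * real CARD('n) + - (\<kappa> * real k) * real K"
      by (simp add: algebra_simps)
    ultimately show "real j * real CARD('n) + real k * real CARD('n) + (real j - real k) * real K \<le> real k * (2 * real CARD('n) - \<kappa> * real K)"
      by (simp only: add.commute add_mono)
  qed simp
  finally show ?thesis .
qed

text \<open>The integral is split at a distance of order
  \<open>2 powr (- (1 - \<kappa>) * k)\<close>. Near \<open>x\<close>, volume times kernel size is
  of order \<open>2 powr (\<kappa> * n * k)\<close>, which \<open>\<kappa>\<close> makes cheap;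
  beyond, the kernel gains \<open>2 powr (- \<kappa> * N * k)\<close>, which beats any exponent up
  to \<open>M\<close>.\<close>

lemma pairing_level_high:
  assumes \<theta>: "dyadic_resolution \<theta>" and \<kappa>: "0 < \<kappa>" "\<kappa> < 1" "\<kappa> * (S + real CARD('n)) \<le> e"
    and N: "\<kappa> * real N \<ge> M + real CARD('n) + 1"
  shows "\<exists>B\<ge>0. \<forall>j k x b \<tau>. (1 - \<kappa>) * real k \<le> real j \<longrightarrow> x \<in> unit_cube \<longrightarrow> b \<in> {0, pi / 2} \<longrightarrow>
    \<tau> \<le> M \<longrightarrow> \<tau> \<le> s x - 5 * e \<longrightarrow>
    \<bar>pairing (level j) (block_function \<theta> k x b)\<bar> \<le> B * (2 powr (- real j * e) * 2 powr (- real k * (\<tau> + e)))"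
proof -
  obtain B where B: "B \<ge> 0" "\<And>j y. \<bar>level j y\<bar> \<le> B * 2 powr (- real j * (s y - e))" using abs_level_le by blast
  obtain Q where Q: "Q \<ge> 0" "\<And>k z. norm (kernel \<theta> k (z :: real ^ 'n)) \<le> Q * (2 ^ k) ^ CARD('n)"
      "\<And>k z \<rho> i. 0 < \<rho> \<Longrightarrow> (\<forall>l::int. \<rho> \<le> \<bar>z $ i + of_int l\<bar>) \<Longrightarrow> norm (kernel \<theta> k (z :: real ^ 'n)) \<le> Q * (2 ^ k) ^ CARD('n) / (2 ^ k * \<rho>) ^ N"
    using kernel_bound[OF \<theta>, of N] by blast
  \<comment> \<open>The first bound keeps the near set where \<open>s\<close> varies by at most
    \<open>e\<close>, the second keeps the radius below 1.\<close>
  define a where "a = min (d / real CARD('n)) (1 / 2)"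
  have a: "0 < a" "a \<le> d / real CARD('n)" "a \<le> 1 / 2" using d_pos unfolding a_def by (simp, intro min.cobounded1, intro min.cobounded2)
  let ?Z = "B * Q * (6 ^ CARD('n) + 1 / a ^ N)"
  show ?thesis
  proof (intro exI[of _ ?Z] conjI allI impI)
    show "0 \<le> ?Z" using B Q a by simp
    fix j k b \<tau> and x :: "real ^ 'n"
    assume jk: "(1 - \<kappa>) * real k \<le> real j" and x: "x \<in> unit_cube" and b: "b \<in> {0, pi / 2}" and \<tau>: "\<tau> \<le> M" "\<tau> \<le> s x - 5 * e"
    define \<rho> where "\<rho> = a * 2 powr (- (1 - \<kappa>) * real k)"
    have "2 powr (- (1 - \<kappa>) * real k) \<le> 2 powr 0" using \<kappa> by (intro powr_mono) (auto intro!: mult_nonpos_nonneg)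
    then have p1: "2 powr (- (1 - \<kappa>) * real k) \<le> 1" by simp
    have \<rho>: "0 < \<rho>" "\<rho> \<le> a" unfolding \<rho>_def using a(1) p1 by (auto intro: mult_left_le)
    let ?X = "B * 2 powr (- real j * (s x - 2 * e)) * (Q * (2 ^ k) ^ CARD('n))"
    let ?Y = "B * 2 powr (- real j * (2 * e)) * (Q * (2 ^ k) ^ CARD('n) / (2 ^ k * \<rho>) ^ N)"
    let ?R = "2 powr (- real j * e) * 2 powr (- real k * (\<tau> + e))"
    have "\<bar>\<integral>y. level j y * block_function \<theta> k x b y \<partial>torus\<bar> \<le> ?X * (6 * \<rho>) ^ CARD('n) + ?Y"
    proof (rule abs_integral_torus_near_far[OF _ x])
      show "continuous_on UNIV (\<lambda>y. level j y * block_function \<theta> k x b y)"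
        by (intro continuous_intros continuous_level test_continuous[OF block_function_test])
      show "0 \<le> \<rho>" "\<rho> < 1" "0 \<le> ?X" "0 \<le> ?Y" using \<rho> a B Q by simp_all
      fix y :: "real ^ 'n"
      { assume near: "\<forall>r. \<exists>l::int. \<bar>(x - y) $ r + of_int l\<bar> \<le> \<rho>"
        have "\<bar>s x - s y\<bar> \<le> e"
        proof (rule near_lattice_translate[OF s_periodic s_close])
          show "\<forall>r. \<exists>l::int. \<bar>(x - y) $ r + of_int l\<bar> \<le> d / real CARD('n)"
            using near \<rho>(2) a(2) by (meson order_trans)
        qed
        then have "real j * (s x - 2 * e) \<le> real j * (s y - e)" by (intro mult_left_mono) auto
        then have "2 powr (- real j * (s y - e)) \<le> 2 powr (- real j * (s x - 2 * e))" by (intro powr_mono) auto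
        then have "\<bar>level j y\<bar> \<le> B * 2 powr (- real j * (s x - 2 * e))"
          by (intro order_trans[OF B(2)] mult_left_mono B(1))
        moreover have "\<bar>block_function \<theta> k x b y\<bar> \<le> Q * (2 ^ k) ^ CARD('n)"
          by (rule order_trans[OF abs_block_function_le[OF b] Q(2)])
        ultimately show "\<bar>level j y * block_function \<theta> k x b y\<bar> \<le> ?X"
          unfolding abs_mult using B(1) by (intro mult_mono) auto }
      { fix i assume far: "\<forall>l::int. \<rho> \<le> \<bar>(x - y) $ i + of_int l\<bar>"
        \<comment> \<open>Away from \<open>x\<close> the exponent \<open>s y\<close> is not
          comparable with \<open>s x\<close>; the lower bound \<open>3 * e\<close> leaves
          \<open>2 * e\<close>, of which one \<open>e\<close> serves the summation over
          levels.\<close>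
        have "real j * (2 * e) \<le> real j * (s y - e)" using s_lower[of y] by (intro mult_left_mono) auto
        then have "2 powr (- real j * (s y - e)) \<le> 2 powr (- real j * (2 * e))" by (intro powr_mono) auto
        then have "\<bar>level j y\<bar> \<le> B * 2 powr (- real j * (2 * e))"
          by (intro order_trans[OF B(2)] mult_left_mono B(1))
        moreover have "\<bar>block_function \<theta> k x b y\<bar> \<le> Q * (2 ^ k) ^ CARD('n) / (2 ^ k * \<rho>) ^ N"
          by (rule order_trans[OF abs_block_function_le[OF b] Q(3)[OF \<rho>(1) far]])
        ultimately show "\<bar>level j y * block_function \<theta> k x b y\<bar> \<le> ?Y"
          unfolding abs_mult using B(1) by (intro mult_mono) auto }
    qed
    also have "?X * (6 * \<rho>) ^ CARD('n) \<le> B * Q * 6 ^ CARD('n) * ?R"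
    proof -
      have "(6 * \<rho>) ^ CARD('n) \<le> (6 * 2 powr (- (1 - \<kappa>) * real k)) ^ CARD('n)"
        using a \<rho>(1) unfolding \<rho>_def by (intro power_mono mult_left_mono mult_left_le_one_le) auto
      also have "\<dots> = 6 ^ CARD('n) * 2 powr (- (1 - \<kappa>) * real k * real CARD('n))"
        by (simp add: power_mult_distrib powr_realpow[symmetric] powr_powr)
      finally have r: "(6 * \<rho>) ^ CARD('n) \<le> 6 ^ CARD('n) * 2 powr (- (1 - \<kappa>) * real k * real CARD('n))" .
      have "?X * (6 * \<rho>) ^ CARD('n) \<le> ?X * (6 ^ CARD('n) * 2 powr (- (1 - \<kappa>) * real k * real CARD('n)))"
        using B Q by (intro mult_left_mono r) auto
      also have "\<dots> = B * Q * 6 ^ CARD('n) *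
          2 powr (- real j * (s x - 2 * e) + real k * real CARD('n) + - (1 - \<kappa>) * real k * real CARD('n))"
        unfolding powr_add two_powr_nat by (simp only: mult_ac)
      also have "\<dots> \<le> B * Q * 6 ^ CARD('n) * 2 powr (- real j * e + - real k * (\<tau> + e))"
      proof (intro mult_left_mono powr_mono)
        \<comment> \<open>The five losses: \<open>e\<close> in the bound of a level,
          \<open>e\<close> for the variation of \<open>s\<close> near \<open>x\<close>,
          \<open>e\<close> for summing over \<open>j\<close>, \<open>e\<close> for the volume and
          for replacing \<open>j\<close> by \<open>(1 - \<kappa>) * k\<close>, and \<open>e\<close>
          for the decay in \<open>k\<close>. Nonnegativity of \<open>s x - 3 * e\<close> permits
          that replacement.\<close>
        have s3: "0 \<le> s x - 3 * e" using s_lower[of x] by simp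
        have "(1 - \<kappa>) * real k * (s x - 3 * e) \<le> real j * (s x - 3 * e)" using jk s3 by (rule mult_right_mono)
        moreover have "real k * (\<kappa> * (S + real CARD('n))) \<le> real k * e" using \<kappa>(3) by (intro mult_left_mono) auto
        moreover have "\<kappa> * real k * (s x - 3 * e) \<le> \<kappa> * real k * S" using \<kappa>(1) s_upper[of x] e_pos by (intro mult_left_mono) auto
        moreover have "real k * \<tau> \<le> real k * (s x - 5 * e)" using \<tau>(2) by (intro mult_left_mono) auto
        ultimately show "- real j * (s x - 2 * e) + real k * real CARD('n) + - (1 - \<kappa>) * real k * real CARD('n)
            \<le> - real j * e + - real k * (\<tau> + e)"
          by (simp add: algebra_simps)
      qed (use B Q in auto)
      finally show ?thesis unfolding powr_add .
    qed
    also have "?Y \<le> B * Q * (1 / a ^ N) * ?R"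
    proof -
      have "2 ^ k * \<rho> = a * 2 powr (real k + - (1 - \<kappa>) * real k)"
        unfolding \<rho>_def powr_add by (simp add: powr_realpow)
      also have "real k + - (1 - \<kappa>) * real k = \<kappa> * real k" by (simp add: algebra_simps)
      finally have "(2 ^ k * \<rho>) ^ N = a ^ N * 2 powr (\<kappa> * real k * real N)"
        by (simp add: power_mult_distrib powr_realpow[symmetric] powr_powr)
      then have "?Y = B * 2 powr (- real j * (2 * e)) * (Q * 2 powr (real k * real CARD('n)) / (a ^ N * 2 powr (\<kappa> * real k * real N)))"
        by (simp only: two_powr_nat)
      also have "\<dots> = B * Q * (1 / a ^ N) * 2 powr (- real j * (2 * e) + (real k * real CARD('n) - \<kappa> * real k * real N))"
        unfolding powr_add powr_diff by simp
      also have "\<dots> \<le> B * Q * (1 / a ^ N) * 2 powr (- real j * e + - real k * (\<tau> + e))"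
      proof (intro mult_left_mono powr_mono)
        have "real k * (M + real CARD('n) + 1) \<le> real k * (\<kappa> * real N)" using N by (intro mult_left_mono) auto
        moreover have "real k * (\<tau> + e) \<le> real k * (M + 1)" using \<tau>(1) e_le by (intro mult_left_mono) auto
        moreover have "0 \<le> real j * e" using e_pos by simp
        ultimately show "- real j * (2 * e) + (real k * real CARD('n) - \<kappa> * real k * real N) \<le> - real j * e + - real k * (\<tau> + e)"
          by (simp add: algebra_simps)
      qed (use B Q a in auto)
      finally show ?thesis unfolding powr_add .
    qed
    finally show "\<bar>pairing (level j) (block_function \<theta> k x b)\<bar> \<le> ?Z * ?R"
      unfolding pairing_def by (simp add: distrib_left distrib_right)
  qed
qed

lemma pairing_level_le:
  assumes \<theta>: "dyadic_resolution \<theta>" and \<kappa>: "0 < \<kappa>" "\<kappa> < 1" "\<kappa> * (S + real CARD('n)) \<le> e"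
    and K: "\<kappa> * real K \<ge> M + 2 * real CARD('n) + 2"
  shows "\<exists>B\<ge>0. \<forall>j k x b \<tau>. x \<in> unit_cube \<longrightarrow> b \<in> {0, pi / 2} \<longrightarrow> \<tau> \<le> M \<longrightarrow> \<tau> \<le> s x - 5 * e \<longrightarrow>
    2 powr (real k * \<tau>) * \<bar>pairing (level j) (block_function \<theta> k x b)\<bar> \<le> B * (2 powr (- real j * e) * 2 powr (- real k * e))"
proof -
  obtain B1 where B1: "B1 \<ge> 0" "\<And>j k x b. j \<le> k \<Longrightarrow> 1 \<le> k \<Longrightarrow>
      \<bar>pairing (level j) (block_function \<theta> k x b)\<bar> \<le> B1 * ((2 ^ j) ^ CARD('n) * (2 ^ k) ^ CARD('n) * (2 ^ j / 2 ^ k) ^ K)"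
    using pairing_level_low[OF \<theta>] by blast
  obtain N :: nat where "(M + real CARD('n) + 1) / \<kappa> < real N" using reals_Archimedean2 by blast
  then have N: "\<kappa> * real N \<ge> M + real CARD('n) + 1" using \<kappa>(1) by (simp add: field_simps)
  obtain B2 where B2: "B2 \<ge> 0" "\<And>j k x b \<tau>. (1 - \<kappa>) * real k \<le> real j \<Longrightarrow> x \<in> unit_cube \<Longrightarrow> b \<in> {0, pi / 2} \<Longrightarrow>
      \<tau> \<le> M \<Longrightarrow> \<tau> \<le> s x - 5 * e \<Longrightarrow>
      \<bar>pairing (level j) (block_function \<theta> k x b)\<bar> \<le> B2 * (2 powr (- real j * e) * 2 powr (- real k * (\<tau> + e)))"
    using pairing_level_high[OF \<theta> \<kappa> N] by blast
  show ?thesis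
  proof (intro exI[of _ "B1 + B2"] conjI allI impI)
    show "0 \<le> B1 + B2" using B1 B2 by simp
    fix j k b \<tau> and x :: "real ^ 'n"
    assume x: "x \<in> unit_cube" and b: "b \<in> {0, pi / 2}" and \<tau>: "\<tau> \<le> M" "\<tau> \<le> s x - 5 * e"
    let ?R = "2 powr (- real j * e) * 2 powr (- real k * e)"
    have "\<exists>B\<in>{B1, B2}. 2 powr (real k * \<tau>) * \<bar>pairing (level j) (block_function \<theta> k x b)\<bar> \<le> B * ?R"
    proof (cases "(1 - \<kappa>) * real k \<le> real j")
      case True
      have "2 powr (real k * \<tau>) * \<bar>pairing (level j) (block_function \<theta> k x b)\<bar> \<le>
          2 powr (real k * \<tau>) * (B2 * (2 powr (- real j * e) * 2 powr (- real k * (\<tau> + e))))"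
        by (intro mult_left_mono B2(2) True x b \<tau>) simp
      also have "\<dots> = B2 * (2 powr (- real j * e) * 2 powr (real k * \<tau> + - real k * (\<tau> + e)))"
        unfolding powr_add by (simp only: mult_ac)
      also have "real k * \<tau> + - real k * (\<tau> + e) = - real k * e" by (simp add: algebra_simps)
      finally show ?thesis by blast
    next
      case False
      then have jk: "real j \<le> (1 - \<kappa>) * real k" by simp
      have "0 \<le> \<kappa> * real k" using \<kappa>(1) by simp
      then have jk': "j \<le> k" using jk by (simp add: algebra_simps)
      have k1: "1 \<le> k" using False by (cases k) auto
      have "2 powr (real k * \<tau>) * \<bar>pairing (level j) (block_function \<theta> k x b)\<bar> \<le>
          2 powr (real k * \<tau>) * (B1 * 2 powr (real k * (2 * real CARD('n) - \<kappa> * real K)))"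
        using \<kappa>(1) by (intro mult_left_mono order_trans[OF B1(2)[OF jk' k1] mult_left_mono[OF two_powr_kappa]] B1(1) jk) auto
      also have "\<dots> = B1 * 2 powr (real k * \<tau> + real k * (2 * real CARD('n) - \<kappa> * real K))"
        unfolding powr_add by (simp only: mult_ac)
      also have "\<dots> \<le> B1 * 2 powr (- real j * e + - real k * e)"
      proof (intro mult_left_mono powr_mono)
        \<comment> \<open>The budget \<open>M + 2 * n + 2\<close>: \<open>M\<close> for the weight,
          \<open>2 * n\<close> for the counting factors, and 2 for the decay in \<open>j\<close> and
          in \<open>k\<close>, as \<open>j \<le> k\<close> and \<open>e \<le> 1\<close>.\<close>
        have "real k * (M + 2 * real CARD('n) + 2) \<le> real k * (\<kappa> * real K)" using K by (intro mult_left_mono) auto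
        moreover have "real k * \<tau> \<le> real k * M" using \<tau>(1) by (intro mult_left_mono) auto
        moreover have "real j * e \<le> real k * 1" using jk' e_le e_pos by (intro mult_mono) auto
        moreover have "real k * e \<le> real k * 1" using e_le by (intro mult_left_mono) auto
        ultimately show "real k * \<tau> + real k * (2 * real CARD('n) - \<kappa> * real K) \<le> - real j * e + - real k * e"
          by (simp add: algebra_simps)
      qed (use B1 in auto)
      finally show ?thesis unfolding powr_add by blast
    qed
    then show "2 powr (real k * \<tau>) * \<bar>pairing (level j) (block_function \<theta> k x b)\<bar> \<le> (B1 + B2) * ?R"
    proof
      fix B assume "B \<in> {B1, B2}" and le: "2 powr (real k * \<tau>) * \<bar>pairing (level j) (block_function \<theta> k x b)\<bar> \<le> B * ?R"
      then have "B * ?R \<le> (B1 + B2) * ?R" using B1(1) B2(1) by (intro mult_right_mono) auto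
      with le show ?thesis by (rule order_trans)
    qed
  qed
qed

text \<open>The block is the value of \<open>T\<close> at two test functions, so the assumed weak
  convergence suffices. The factors \<open>2 powr (- j * e)\<close> sum geometrically over the
  levels and \<open>2 powr (- k * e)\<close> remains.\<close>

lemma dyadic_block_decay:
  assumes \<theta>: "dyadic_resolution \<theta>" and \<kappa>: "0 < \<kappa>" "\<kappa> < 1" "\<kappa> * (S + real CARD('n)) \<le> e"
    and K: "\<kappa> * real K \<ge> M + 2 * real CARD('n) + 2"
    and T: "T \<in> distributions"
    and sums: "\<And>f. f \<in> test_functions \<Longrightarrow>
      (\<lambda>j. \<Sum>G\<in>wavelet_types j. \<Sum>m\<in>wavelet_positions j. c j G m * pairing (wavelet j G m) f) sums T f"
  shows "\<exists>B. \<forall>k x \<tau>. x \<in> unit_cube \<longrightarrow> \<tau> \<le> M \<longrightarrow> \<tau> \<le> s x - 5 * e \<longrightarrow>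
    2 powr (real k * \<tau>) * cmod (dyadic_block \<theta> k T x) \<le> B * (2 powr (- e)) ^ k"
proof -
  obtain B where B: "B \<ge> 0" "\<And>j k x b \<tau>. x \<in> unit_cube \<Longrightarrow> b \<in> {0, pi / 2} \<Longrightarrow> \<tau> \<le> M \<Longrightarrow> \<tau> \<le> s x - 5 * e \<Longrightarrow>
      2 powr (real k * \<tau>) * \<bar>pairing (level j) (block_function \<theta> k x b)\<bar> \<le> B * (2 powr (- real j * e) * 2 powr (- real k * e))"
    using pairing_level_le[OF \<theta> \<kappa> K] by blast
  define g where "g = 2 powr (- e)"
  have "2 powr (- e) < 2 powr 0" using e_pos by (intro powr_less_mono) auto
  then have g: "0 < g" "g < 1" by (auto simp: g_def)
  have gp: "2 powr (- real j * e) = g ^ j" for j unfolding g_def by (simp add: powr_realpow[symmetric] powr_powr mult.commute)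
  have half: "2 powr (real k * \<tau>) * \<bar>T (block_function \<theta> k x b)\<bar> \<le> B * (1 / (1 - g)) * g ^ k"
    if x: "x \<in> unit_cube" "\<tau> \<le> M" "\<tau> \<le> s x - 5 * e" and b: "b \<in> {0, pi / 2}" for k x \<tau> b
  proof -
    let ?a = "\<lambda>j. 2 powr (real k * \<tau>) * pairing (level j) (block_function \<theta> k x b)"
    have "(\<lambda>j. pairing (level j) (block_function \<theta> k x b)) sums T (block_function \<theta> k x b)"
      unfolding pairing_level[OF test_continuous[OF block_function_test]] by (rule sums[OF block_function_test])
    then have s: "?a sums (2 powr (real k * \<tau>) * T (block_function \<theta> k x b))" by (rule sums_mult)
    have le: "norm (?a j) \<le> B * g ^ k * g ^ j" for j
    proof -
      have "norm (?a j) = 2 powr (real k * \<tau>) * \<bar>pairing (level j) (block_function \<theta> k x b)\<bar>" by (simp add: abs_mult)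
      also have "\<dots> \<le> B * (g ^ j * g ^ k)" using B(2)[OF x(1) b x(2,3), of k j] unfolding gp .
      finally show ?thesis by (simp only: mult_ac)
    qed
    have sm: "summable (\<lambda>j. B * g ^ k * g ^ j)" using g by (intro summable_mult summable_geometric) simp
    have "norm (\<Sum>j. ?a j) \<le> (\<Sum>j. B * g ^ k * g ^ j)" by (rule norm_suminf_le[OF le sm])
    also have "\<dots> = B * g ^ k * (1 / (1 - g))" using g by (simp add: suminf_mult suminf_geometric)
    finally show ?thesis unfolding sums_unique[OF s, symmetric] by (simp add: abs_mult mult_ac)
  qed
  show ?thesis
  proof (intro exI[of _ "2 * (B * (1 / (1 - g)))"] allI impI)
    fix k \<tau> and x :: "real ^ 'n" assume x: "x \<in> unit_cube" "\<tau> \<le> M" "\<tau> \<le> s x - 5 * e"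
    have "2 powr (real k * \<tau>) * cmod (dyadic_block \<theta> k T x) \<le>
        2 powr (real k * \<tau>) * (\<bar>T (block_function \<theta> k x 0)\<bar> + \<bar>T (block_function \<theta> k x (pi / 2))\<bar>)"
      by (intro mult_left_mono norm_dyadic_block_le \<theta> T) simp
    also have "\<dots> \<le> 2 * (B * (1 / (1 - g))) * g ^ k"
      using half[OF x, of 0 k] half[OF x, of "pi / 2" k] by (simp add: distrib_left)
    finally show "2 powr (real k * \<tau>) * cmod (dyadic_block \<theta> k T x) \<le> 2 * (B * (1 / (1 - g))) * (2 powr (- e)) ^ k"
      unfolding g_def .
  qed
qed

end

section \<open>The posterior measure\<close>

text \<open>The logarithm in the modulus is at least 1, so the oscillation is at most
  \<open>c\<close>; at coinciding points division by zero yields 0 and the logarithm is 1.\<close>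

lemma C_log_loc_bounded:
  fixes g :: "real ^ 'n::finite \<Rightarrow> real"
  assumes "g \<in> C_log_loc"
  shows "\<exists>B\<ge>0. \<forall>x. \<bar>g x\<bar> \<le> B"
proof -
  obtain c where c: "c > 0" "\<And>x y. \<bar>g x - g y\<bar> \<le> c / ln (exp 1 + 1 / norm (x - y))"
    using assms unfolding C_log_loc_def by blast
  have le: "\<bar>g x - g 0\<bar> \<le> c" for x
  proof -
    have "ln (exp 1) \<le> ln (exp 1 + 1 / norm (x - 0))" by (rule ln_mono) auto
    then have "c / ln (exp 1 + 1 / norm (x - 0)) \<le> c / 1" using c(1) by (intro divide_left_mono) auto
    then show ?thesis using c(2)[of x 0] by simp
  qed
  have "\<bar>g x\<bar> \<le> \<bar>g 0\<bar> + c" for x using le[of x] by linarith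
  then show ?thesis using c(1) by (intro exI[of _ "\<bar>g 0\<bar> + c"]) auto
qed

text \<open>The radius \<open>exp (- (c / e))\<close> inverts the logarithmic modulus: it makes the
  logarithm at least \<open>c / e\<close>.\<close>

lemma C_log_loc_uniformly_continuous:
  fixes g :: "real ^ 'n::finite \<Rightarrow> real"
  assumes "g \<in> C_log_loc" "e > 0"
  shows "\<exists>d>0. \<forall>x y. norm (x - y) \<le> d \<longrightarrow> \<bar>g x - g y\<bar> \<le> e"
proof -
  obtain c where c: "c > 0" "\<And>x y. \<bar>g x - g y\<bar> \<le> c / ln (exp 1 + 1 / norm (x - y))"
    using assms(1) unfolding C_log_loc_def by blast
  show ?thesis
  proof (intro exI[of _ "exp (- (c / e))"] conjI allI impI)
    fix x y :: "real ^ 'n" assume d: "norm (x - y) \<le> exp (- (c / e))"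
    show "\<bar>g x - g y\<bar> \<le> e"
    proof (cases "x = y")
      case False
      then have n: "norm (x - y) > 0" by simp
      have "exp (c / e) = 1 / exp (- (c / e))" by (simp add: exp_minus field_simps)
      also have "\<dots> \<le> 1 / norm (x - y)" using d n by (intro divide_left_mono) auto
      also have "\<dots> \<le> exp 1 + 1 / norm (x - y)" by simp
      finally have "ln (exp (c / e)) \<le> ln (exp 1 + 1 / norm (x - y))" by (intro ln_mono) auto
      moreover have "c / e > 0" using c(1) assms(2) by simp
      ultimately have "c / ln (exp 1 + 1 / norm (x - y)) \<le> c / (c / e)"
        using c(1) by (intro divide_left_mono mult_pos_pos) auto
      also have "\<dots> = e" using c(1) by simp
      finally show ?thesis using c(2)[of x y] by linarith
    qed (use assms(2) in simp)
  qed simp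
qed

text \<open>Turns the linear growth of the random coefficients into a loss of \<open>e\<close> in
  the exponent.\<close>

lemma linear_le_powr:
  assumes "0 < e"
  shows "1 + real j \<le> (1 + 1 / (e * ln 2)) * 2 powr (real j * e)"
proof -
  have l: "0 < e * ln 2" using assms by simp
  have p: "1 + real j * (e * ln 2) \<le> 2 powr (real j * e)"
    using exp_ge_add_one_self[of "real j * e * ln 2"] by (simp add: powr_def mult.assoc)
  have "1 * 1 \<le> 1 * 2 powr (real j * e)" using assms by (intro mult_left_mono ge_one_powr_ge_zero) auto
  moreover have "real j = 1 / (e * ln 2) * (real j * (e * ln 2))" using assms by simp
  moreover have "1 / (e * ln 2) * (real j * (e * ln 2)) \<le> 1 / (e * ln 2) * 2 powr (real j * e)"
    using p l by (intro mult_left_mono) auto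
  ultimately show ?thesis unfolding distrib_right by linarith
qed

lemma (in wavelet_pair) wavelet_eq_periodic_wavelet:
  assumes "\<psi> = (\<lambda>k. case k of Scaling \<Rightarrow> \<psi>F | Wavelet \<Rightarrow> \<psi>M)"
  shows "wavelet = periodic_wavelet \<psi>F \<psi>M"
proof (intro ext)
  fix j G m x
  show "wavelet j G m x = periodic_wavelet \<psi>F \<psi>M j G m x"
    unfolding wavelet_def periodize_def periodic_wavelet_def unfolding assms ..
qed

text \<open>\<open>R = 2 * K\<close> depends on \<open>s\<close>, \<open>q\<close> and
  \<open>t\<close> only: \<open>e\<close> is read off from the two strict inequalities,
  \<open>\<kappa>\<close> from \<open>e\<close>, and \<open>K\<close> from \<open>\<kappa>\<close>.
  The decay exponent \<open>L\<close> adds no condition on the wavelets, as both families decay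
  faster than any power.\<close>

lemma besov_prior_concentrated:
  fixes s q t :: "real ^ 'n::finite \<Rightarrow> real"
  assumes s: "s \<in> C_log_loc" and q: "q \<in> exponents_log" and t: "t \<in> C_log_loc" "t \<in> L_infinity"
    and inf: "(INF x. s x) > real CARD('n) / q_plus q"
    and sup: "(SUP x. t x - s x + real CARD('n) / q_plus q) < 0"
  shows "\<exists>R :: nat. \<forall>\<psi>F \<psi>M \<theta> \<delta> \<mu>.
    meyer_system \<psi>F \<psi>M \<or> (\<exists>N\<ge>R. daubechies_system N \<psi>F \<psi>M \<and> Ck R \<psi>F) \<longrightarrow>
    dyadic_resolution \<theta> \<longrightarrow> besov_measure \<delta> s q \<psi>F \<psi>M \<mu> \<longrightarrow> (AE w in \<mu>. w \<in> besov_space \<theta> t q)"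
proof -
  let ?n = "real CARD('n)" and ?a = "real CARD('n) / q_plus q"
  obtain Bs where Bs: "Bs \<ge> 0" "\<And>x. \<bar>s x\<bar> \<le> Bs" using C_log_loc_bounded[OF s] by blast
  obtain M where M: "M \<ge> 0" "\<And>x. \<bar>t x\<bar> \<le> M" using C_log_loc_bounded[OF t(1)] by blast
  define \<sigma> where "\<sigma> = (INF x. s x) - ?a"
  define \<epsilon> where "\<epsilon> = - (SUP x. t x - s x + ?a)"
  have sl: "\<sigma> + ?a \<le> s x" for x
  proof -
    have "bdd_below (range s)" using Bs(2) by (intro bdd_belowI2[of _ "- Bs"]) (simp add: abs_le_iff minus_le_iff)
    then show ?thesis unfolding \<sigma>_def by (simp add: cINF_lower)
  qed
  have tl: "t x \<le> s x - ?a - \<epsilon>" for x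
  proof -
    have "bdd_above (range (\<lambda>x. t x - s x + ?a))"
    proof (rule bdd_aboveI2)
      fix x show "t x - s x + ?a \<le> M + Bs + ?a" using M(2)[of x] Bs(2)[of x] by linarith
    qed
    then have "t x - s x + ?a \<le> (SUP x. t x - s x + ?a)" by (intro cSUP_upper) auto
    then show ?thesis unfolding \<epsilon>_def by linarith
  qed
  have pos: "\<sigma> > 0" "\<epsilon> > 0" using inf sup by (simp_all add: \<sigma>_def \<epsilon>_def)
  \<comment> \<open>\<open>4 * e \<le> \<sigma>\<close>: one \<open>e\<close> goes into
    \<open>s1\<close>, three remain as its lower bound. \<open>6 * e \<le> \<epsilon>\<close>: again
    one goes into \<open>s1\<close>, and five are lost in the estimate of the blocks.\<close>
  define e where "e = min 1 (min (\<sigma> / 4) (\<epsilon> / 6))"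
  have e: "0 < e" "e \<le> 1" "4 * e \<le> \<sigma>" "6 * e \<le> \<epsilon>" using pos by (auto simp: e_def min_def)
  \<comment> \<open>The exponent of the realized series: \<open>s\<close> reduced by the shift in
    the weights and by \<open>e\<close> for the growth of the coefficients.\<close>
  define s1 where "s1 x = s x - ?a - e" for x
  define S where "S = Bs + \<bar>?a\<bar>"
  define \<kappa> where "\<kappa> = min (1 / 2) (e / (S + ?n))"
  have Sn: "S + ?n > 0" unfolding S_def using Bs(1) by (intro add_nonneg_pos add_nonneg_nonneg abs_ge_zero) auto
  have \<kappa>: "0 < \<kappa>" "\<kappa> < 1" using e Sn by (auto simp: \<kappa>_def)
  have "\<kappa> * (S + ?n) \<le> e / (S + ?n) * (S + ?n)" using Sn by (intro mult_right_mono) (auto simp: \<kappa>_def)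
  then have \<kappa>e: "\<kappa> * (S + ?n) \<le> e" using Sn by simp
  obtain K :: nat where "(M + 2 * ?n + 2) / \<kappa> < real K" using reals_Archimedean2 by blast
  then have K: "M + 2 * ?n + 2 \<le> \<kappa> * real K" using \<kappa>(1) by (simp add: field_simps)
  obtain L :: nat where L: "?n + S < real L" using reals_Archimedean2 by blast
  have qm: "q \<in> borel_measurable borel" and q1: "1 \<le> q x" for x
    using q by (auto simp: exponents_log_def exponents_def)
  have tm: "t \<in> borel_measurable borel" using t(2) by (simp add: L_infinity_def)
  obtain d where d: "d > 0" "\<And>x y. norm (x - y) \<le> d \<Longrightarrow> \<bar>s x - s y\<bar> \<le> e"
    using C_log_loc_uniformly_continuous[OF s e(1)] by blast
  have sp: "periodic s" using s by (simp add: C_log_loc_def)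
  have "AE w in \<mu>. w \<in> besov_space \<theta> t q"
    if sys: "meyer_system \<psi>F \<psi>M \<or> (\<exists>N\<ge>2 * K. daubechies_system N \<psi>F \<psi>M \<and> Ck (2 * K) \<psi>F)"
      and \<theta>: "dyadic_resolution \<theta>" and \<mu>: "besov_measure \<delta> s q \<psi>F \<psi>M \<mu>" for \<psi>F \<psi>M \<theta> \<delta> \<mu>
  proof -
    obtain u where u: "u \<in> measurable (coefficient_space q) distribution_space"
      "AE \<xi> in coefficient_space q. \<forall>f\<in>test_functions. (\<lambda>j. \<Sum>G\<in>wavelet_types j. \<Sum>m\<in>wavelet_positions j.
         besov_weight \<delta> s q j m * \<xi> (j, G, m) * pairing (periodic_wavelet \<psi>F \<psi>M j G m) f) sums u \<xi> f"
      "\<mu> = distr (coefficient_space q) distribution_space u"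
      using \<mu> unfolding besov_measure_def by blast
    define \<psi> where "\<psi> = (\<lambda>k. case k of Scaling \<Rightarrow> \<psi>F | Wavelet \<Rightarrow> \<psi>M)"
    have "wavelet_like (L + 4) (2 * K) \<psi>F" "wavelet_like (L + 4) (2 * K) \<psi>M"
      using sys meyer_wavelet_like daubechies_wavelet_like by blast+
    then obtain C D where "wavelet_pair \<psi> L K C D" using wavelet_pair_exists unfolding \<psi>_def by blast
    then interpret wavelet_pair \<psi> L K C D .
    have w: "periodic_wavelet \<psi>F \<psi>M = wavelet" by (rule wavelet_eq_periodic_wavelet[OF \<psi>_def, symmetric])
    have member: "u \<xi> \<in> besov_space \<theta> t q"
      if \<xi>: "\<xi> \<in> space (coefficient_space q)"
        and grow: "\<exists>B. \<forall>j. \<forall>G\<in>wavelet_types j. \<forall>m\<in>wavelet_positions j. \<bar>\<xi> (j, G, m)\<bar> \<le> B * (1 + real j)"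
        and sums: "\<forall>f\<in>test_functions. (\<lambda>j. \<Sum>G\<in>wavelet_types j. \<Sum>m\<in>wavelet_positions j.
         besov_weight \<delta> s q j m * \<xi> (j, G, m) * pairing (periodic_wavelet \<psi>F \<psi>M j G m) f) sums u \<xi> f" for \<xi>
    proof -
      have T: "u \<xi> \<in> distributions" using measurable_space[OF u(1) \<xi>] by simp
      obtain B where B: "\<And>j G m. G \<in> wavelet_types j \<Longrightarrow> m \<in> wavelet_positions j \<Longrightarrow> \<bar>\<xi> (j, G, m)\<bar> \<le> B * (1 + real j)"
        using grow by blast
      let ?w = "(1 / \<delta>) powr (1 / q_plus q)"
      define A where "A = ?w * (\<bar>B\<bar> * (1 + 1 / (e * ln 2)))"
      have A: "A \<ge> 0" unfolding A_def using e by simp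
      have c: "\<bar>besov_weight \<delta> s q j m * \<xi> (j, G, m)\<bar> \<le> A * 2 powr (- real j * (s1 (\<chi> r. real (m $ r) / 2 ^ j) + ?n / 2))"
        if Gm: "G \<in> wavelet_types j" "m \<in> wavelet_positions j" for j G m
      proof -
        let ?z = "\<chi> r. real (m $ r) / 2 ^ j :: real ^ 'n"
        have "\<bar>\<xi> (j, G, m)\<bar> \<le> \<bar>B\<bar> * (1 + real j)"
          by (rule order_trans[OF B[OF Gm]]) (auto intro: mult_right_mono)
        also have "\<dots> \<le> \<bar>B\<bar> * ((1 + 1 / (e * ln 2)) * 2 powr (real j * e))"
          by (intro mult_left_mono linear_le_powr e(1)) simp
        finally have x: "\<bar>\<xi> (j, G, m)\<bar> \<le> \<bar>B\<bar> * ((1 + 1 / (e * ln 2)) * 2 powr (real j * e))" .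
        have "\<bar>besov_weight \<delta> s q j m * \<xi> (j, G, m)\<bar> = 2 powr (- real j * (s ?z + ?n / 2 - ?a)) * ?w * \<bar>\<xi> (j, G, m)\<bar>"
          unfolding besov_weight_def by (simp add: abs_mult)
        also have "\<dots> \<le> 2 powr (- real j * (s ?z + ?n / 2 - ?a)) * ?w * (\<bar>B\<bar> * ((1 + 1 / (e * ln 2)) * 2 powr (real j * e)))"
          by (intro mult_left_mono x) simp
        also have "\<dots> = A * 2 powr (- real j * (s ?z + ?n / 2 - ?a) + real j * e)"
          unfolding A_def powr_add by (simp only: mult_ac)
        also have "- real j * (s ?z + ?n / 2 - ?a) + real j * e = - real j * (s1 ?z + ?n / 2)"
          by (simp add: s1_def algebra_simps)
        finally show ?thesis .
      qed
      interpret wavelet_series \<psi> L K C D "\<lambda>j G m. besov_weight \<delta> s q j m * \<xi> (j, G, m)" s1 A S e d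
      proof
        show "periodic s1" using sp by (simp add: periodic_def s1_def)
        show "3 * e \<le> s1 x" "s1 x \<le> S" for x
          using sl[of x] e Bs(2)[of x] unfolding s1_def S_def by linarith+
        show "\<bar>s1 x - s1 y\<bar> \<le> e" if "norm (x - y) \<le> d" for x y using d(2)[OF that] by (simp add: s1_def)
        show "?n + S \<le> real L" using L by simp
      qed (fact e(1) e(2) d(1) A c)+
      obtain E where E: "\<And>k x \<tau>. x \<in> unit_cube \<Longrightarrow> \<tau> \<le> M \<Longrightarrow> \<tau> \<le> s1 x - 5 * e \<Longrightarrow>
          2 powr (real k * \<tau>) * cmod (dyadic_block \<theta> k (u \<xi>) x) \<le> E * (2 powr (- e)) ^ k"
        using dyadic_block_decay[OF \<theta> \<kappa> \<kappa>e K T sums[rule_format, unfolded w]] by blast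
      have "2 powr (- e) < 2 powr 0" using e by (intro powr_less_mono) auto
      then have r: "0 < 2 powr (- e)" "2 powr (- e) < 1" by auto
      show ?thesis
      proof (rule besov_spaceI[OF T q1 exponents_log_AE_le[OF q] r])
        fix k and x :: "real ^ 'n" assume "x \<in> unit_cube"
        then show "2 powr (real k * t x) * cmod (dyadic_block \<theta> k (u \<xi>) x) \<le> E * (2 powr (- e)) ^ k"
        proof (rule E)
          show "t x \<le> M" using M(2)[of x] by linarith
          show "t x \<le> s1 x - 5 * e" using tl[of x] e(4) unfolding s1_def by linarith
        qed
      qed
    qed
    have "AE \<xi> in coefficient_space q. u \<xi> \<in> besov_space \<theta> t q"
      using AE_space coefficients_grow_linearly[OF q] u(2) by eventually_elim (rule member)
    moreover have "{w \<in> space distribution_space. w \<in> besov_space \<theta> t q} = besov_space \<theta> t q"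
      by (auto simp: besov_space_def)
    then have "{w \<in> space distribution_space. w \<in> besov_space \<theta> t q} \<in> sets distribution_space"
      using besov_space_sets[OF \<theta> tm qm q1] by (simp only:)
    ultimately show ?thesis unfolding u(3) by (subst AE_distr_iff[OF u(1)]) auto
  qed
  then show ?thesis by blast
qed

theorem theorem6p1:
  fixes s q t :: "real ^ 'n::finite \<Rightarrow> real"
  assumes "CARD('n) \<le> 3"
    and "s \<in> C_log_loc \<inter> L_infinity"
    and "q \<in> exponents_log"
    and "(INF x. s x) > real CARD('n) / q_plus q"
    and "t \<in> C_log_loc \<inter> L_infinity"
    and "(SUP x. t x - s x + real CARD('n) / q_plus q) < 0"
  shows "\<exists>R :: nat. \<forall>\<psi>F \<psi>M.
    meyer_system \<psi>F \<psi>M \<or> (\<exists>N\<ge>R. daubechies_system N \<psi>F \<psi>M \<and> Ck R \<psi>F) \<longrightarrow>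
    (\<forall>(\<theta> :: nat \<Rightarrow> real ^ 'n \<Rightarrow> real) (\<delta> :: real) \<mu>0
       (\<Gamma> :: real ^ 'k::finite ^ 'k) (x :: 'k \<Rightarrow> real ^ 'n) (P :: 'w measure) u \<eta> Y.
       dyadic_resolution \<theta> \<longrightarrow>
       4 < \<delta> \<longrightarrow>
       besov_measure \<delta> s q \<psi>F \<psi>M \<mu>0 \<longrightarrow>
       positive_definite \<Gamma> \<longrightarrow>
       prob_space P \<longrightarrow>
       u \<in> measurable P distribution_space \<longrightarrow>
       distr P distribution_space u = \<mu>0 \<longrightarrow>
       distributed P lborel \<eta> (\<lambda>z. ennreal (centered_gaussian_density \<Gamma> z)) \<longrightarrow>
       independent_vars P distribution_space u borel \<eta> \<longrightarrow>
       Y = (\<lambda>\<omega>. observation x (heat_map (u \<omega>)) + \<eta> \<omega>) \<longrightarrow>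
       (let obs = (\<lambda>w. observation x (heat_map w));
            Z = normalizer \<Gamma> obs \<mu>0 (besov_space \<theta> t q)
        in \<exists>\<mu> :: real ^ 'k \<Rightarrow> ((real ^ 'n \<Rightarrow> real) \<Rightarrow> real) measure.
          conditional_distribution P distribution_space u borel Y \<mu> \<and>
          (\<forall>\<kappa>. conditional_distribution P distribution_space u borel Y \<kappa> \<longrightarrow>
             (AE y in distr P borel Y. \<kappa> y = \<mu> y)) \<and>
          (\<forall>y. absolutely_continuous \<mu>0 (\<mu> y) \<and>
             (AE w in \<mu>0. RN_deriv \<mu>0 (\<mu> y) w =
                ennreal (1 / Z y * exp (- potential \<Gamma> obs w y)))) \<and>
          (\<forall>r. \<exists>C. \<forall>y y'. max (norm y) (norm y') \<le> r \<longrightarrow>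
             (\<forall>N. reference_measure N (\<mu> y) (\<mu> y') \<longrightarrow>
                hellinger_dist N (\<mu> y) (\<mu> y') \<le> C * norm (y - y')))))"
proof -
  have qm: "q \<in> borel_measurable borel" and q1: "1 \<le> q x" for x
    using assms(3) by (auto simp: exponents_log_def exponents_def)
  have tm: "t \<in> borel_measurable borel" using assms(5) by (simp add: L_infinity_def)
  obtain R :: nat where R: "\<And>\<psi>F \<psi>M \<theta> \<delta> \<mu>.
      meyer_system \<psi>F \<psi>M \<or> (\<exists>N\<ge>R. daubechies_system N \<psi>F \<psi>M \<and> Ck R \<psi>F) \<Longrightarrow>
      dyadic_resolution \<theta> \<Longrightarrow> besov_measure \<delta> s q \<psi>F \<psi>M \<mu> \<Longrightarrow> AE w in \<mu>. w \<in> besov_space \<theta> t q"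
    using besov_prior_concentrated[of s q t] assms by blast
  show ?thesis
  proof (intro exI[of _ R] allI impI)
    fix \<psi>F \<psi>M and \<theta> :: "nat \<Rightarrow> real ^ 'n \<Rightarrow> real" and \<delta> :: real and \<mu>0 and \<Gamma> :: "real ^ 'k ^ 'k"
      and x :: "'k \<Rightarrow> real ^ 'n" and P :: "'w measure" and u \<eta> Y
    assume sys: "meyer_system \<psi>F \<psi>M \<or> (\<exists>N\<ge>R. daubechies_system N \<psi>F \<psi>M \<and> Ck R \<psi>F)"
      and \<theta>: "dyadic_resolution \<theta>" and prior: "besov_measure \<delta> s q \<psi>F \<psi>M \<mu>0" and \<Gamma>: "positive_definite \<Gamma>"
      and P: "prob_space P" and u: "u \<in> measurable P distribution_space" "distr P distribution_space u = \<mu>0"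
      and \<eta>: "distributed P lborel \<eta> (\<lambda>z. ennreal (centered_gaussian_density \<Gamma> z))"
      and ind: "independent_vars P distribution_space u borel \<eta>"
      and Y: "Y = (\<lambda>\<omega>. observation x (heat_map (u \<omega>)) + \<eta> \<omega>)"
    let ?obs = "\<lambda>w. observation x (heat_map w)"
    let ?B = "besov_space \<theta> t q"
    have S: "sets \<mu>0 = sets distribution_space" using u(2) by auto
    interpret gaussian_inverse_problem \<mu>0 ?obs \<Gamma>
    proof (intro gaussian_inverse_problem.intro gaussian_inverse_problem_axioms.intro)
      show "prob_space \<mu>0" unfolding u(2)[symmetric] by (rule prob_space.prob_space_distr[OF P u(1)])
      show "?obs \<in> borel_measurable \<mu>0" using measurable_observation by (simp only: measurable_cong_sets[OF S refl])
    qed (fact \<Gamma>)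
    have B: "?B \<in> sets \<mu>0" unfolding S by (rule besov_space_sets[OF \<theta> tm qm q1])
    \<comment> \<open>The prior gives the Besov space full mass, so integrating over that space only
      does not change the evidence.\<close>
    have Z: "normalizer \<Gamma> ?obs \<mu>0 ?B y = evidence y" for y
    proof -
      have l: "exp (- 1 / 2 * (norm (inverse_sqrt_matrix \<Gamma> *v (y - ?obs w)))\<^sup>2 + 1 / 2 * (norm (inverse_sqrt_matrix \<Gamma> *v y))\<^sup>2) = likelihood y w" for w
        unfolding likelihood_def potential_def by simp
      have [measurable]: "likelihood y \<in> borel_measurable \<mu>0" using likelihood_integrable by (rule borel_measurable_integrable)
      have "(\<integral>w. indicator ?B w *\<^sub>R likelihood y w \<partial>\<mu>0) = (\<integral>w. likelihood y w \<partial>\<mu>0)"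
      proof (rule integral_cong_AE)
        show "AE w in \<mu>0. indicator ?B w *\<^sub>R likelihood y w = likelihood y w"
          using R[OF sys \<theta> prior] by (rule AE_mp) (rule AE_I2, simp)
      qed (use B in measurable)
      then show ?thesis unfolding normalizer_def set_lebesgue_integral_def l evidence_def .
    qed
    have post: "conditional_distribution P distribution_space u borel Y posterior"
      unfolding Y by (rule conditional_distribution_posterior[OF P S[symmetric] u \<eta> ind])
    obtain C where C: "countable C" "Int_stable C" "C \<subseteq> Pow (space (distribution_space :: ((real ^ 'n \<Rightarrow> real) \<Rightarrow> real) measure))"
      "space (distribution_space :: ((real ^ 'n \<Rightarrow> real) \<Rightarrow> real) measure) \<in> C"
      "sets (distribution_space :: ((real ^ 'n \<Rightarrow> real) \<Rightarrow> real) measure) = sigma_sets (space distribution_space) C"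
      using distribution_space_generator by blast
    show "let obs = (\<lambda>w. observation x (heat_map w));
            Z = normalizer \<Gamma> obs \<mu>0 (besov_space \<theta> t q)
        in \<exists>\<mu> :: real ^ 'k \<Rightarrow> ((real ^ 'n \<Rightarrow> real) \<Rightarrow> real) measure.
          conditional_distribution P distribution_space u borel Y \<mu> \<and>
          (\<forall>\<kappa>. conditional_distribution P distribution_space u borel Y \<kappa> \<longrightarrow>
             (AE y in distr P borel Y. \<kappa> y = \<mu> y)) \<and>
          (\<forall>y. absolutely_continuous \<mu>0 (\<mu> y) \<and>
             (AE w in \<mu>0. RN_deriv \<mu>0 (\<mu> y) w =
                ennreal (1 / Z y * exp (- potential \<Gamma> obs w y)))) \<and>
          (\<forall>r. \<exists>C. \<forall>y y'. max (norm y) (norm y') \<le> r \<longrightarrow>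
             (\<forall>N. reference_measure N (\<mu> y) (\<mu> y') \<longrightarrow>
                hellinger_dist N (\<mu> y) (\<mu> y') \<le> C * norm (y - y')))"
      unfolding Let_def Z likelihood_def[symmetric]
    proof (intro exI[of _ posterior] conjI allI impI)
      fix \<kappa> assume "conditional_distribution P distribution_space u borel Y \<kappa>"
      then show "AE y in distr P borel Y. \<kappa> y = posterior y"
        by (rule conditional_distribution_AE_unique[OF P C _ post])
    qed (fact post absolutely_continuous_posterior RN_deriv_posterior posterior_hellinger_Lipschitz)+
  qed
qed

end
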